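(* Let $n\ge 2$ and identify $\overline{LM}_n$ with the closure of the maximal torus of $PGL_n$ in the wonderful compactification $\overline{PGL_n}$. Then the divisors (classes) on $\overline{PGL_n}$ corresponding to $\omega_1,\dots,\omega_{n-1}$ restrict to the divisors (classes) $G_1,\dots,G_{n-1}$ on the Losev--Manin space $\overline{LM}_n$.
   Context: Varieties are over $\mathbb{C}$. Losev--Manin space. For $N=\{1,\dots,n\}$, $\overline{LM}_n=\overline{LM}_N$ is the moduli space of nodal linear chains of $\mathbb{P}^1$'s with points marked by $\{0,\infty\}\sqcup N$, with $0$ on the left tail and $\infty$ on the right tail, such that marked points are never at the nodes, only points marked by $N$ may coincide with each other, and every $\mathbb{P}^1$ has at least three special points. For $\emptyset\neq J\subsetneq N$, $\delta_J$ is the boundary divisor parametrizing (degenerations of) chains of two $\mathbb{P}^1$'s, one with markings $J\cup\{0\}$ and the other with markings $(N\setminus J)\cup\{\infty\}$. $\psi_0$ is the psi-class at $0$, and for $a=1,\dots,n-1$ $$G_a=a\psi_0-\sum_{\emptyset\ne J\subset N,\ |J|\le a-1}(a-|J|)\,\delta_J .$$ $\overline{LM}_n$ is the toric variety of the torus $T=\mathbb{G}_m^n/\mathbb{G}_m$ whose fan in $\mathbb{Z}^n/\langle(1,\dots,1)\rangle$ is the fan of Weyl chambers of type $A_{n-1}$; $\delta_J$ corresponds to the ray spanned by $\sum_{j\in J}e_j$. $T$ is identified with the diagonal maximal torus of $PGL_n$. Wonderful compactification. $\overline{PGL_n}$ is the (minimal) wonderful compactification of $PGL_n$, whose boundary consists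 of $n-1$ divisors $D_1,\dots,D_{n-1}$. $\mathrm{Pic}\,\overline{PGL_n}$ is identified with the weight lattice of the root system $A_{n-1}$ so that $D_i$ corresponds to the simple root $\alpha_i$ (simple roots numbered along the Dynkin diagram, so that $D_i$ is the boundary divisor containing $\delta_{\{1,\dots,i\}}$); $\omega_1,\dots,\omega_{n-1}$ are the fundamental weights dual to the simple (co)roots. The classes $\alpha_i$ span the effective cone and the classes $\omega_i$ span the nef cone of $\overline{PGL_n}$. *)

theory Defs
  imports
    "HOL-Analysis.Abstract_Topology"
    "HOL-Algebra.FiniteProduct"
    "Jordan_Normal_Form.DL_Submatrix"
    "Jordan_Normal_Form.Determinant"
begin

section \<open>Complex varieties as spaces with functions\<close>

text \<open>A variety over the complex numbers is handled classically, as its set of closed points with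
  the Zariski topology and the sheaf of regular functions. Of a function in \<open>vreg X V\<close> only the
  values on \<open>V\<close> matter.\<close>

record 'a variety =
  vtop :: "'a topology"
  vreg :: "'a set \<Rightarrow> ('a \<Rightarrow> complex) set"

abbreviation points :: "('a, 'm) variety_scheme \<Rightarrow> 'a set" where
  "points X \<equiv> topspace (vtop X)"

inductive_set polyfuns :: "(('i \<Rightarrow> complex) \<Rightarrow> complex) set" where
  const: "(\<lambda>_. c) \<in> polyfuns"
| coord: "(\<lambda>z. z i) \<in> polyfuns"
| add: "\<lbrakk>p \<in> polyfuns; q \<in> polyfuns\<rbrakk> \<Longrightarrow> (\<lambda>z. p z + q z) \<in> polyfuns"
| mult: "\<lbrakk>p \<in> polyfuns; q \<in> polyfuns\<rbrakk> \<Longrightarrow> (\<lambda>z. p z * q z) \<in> polyfuns"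

text \<open>Gluing of affine charts. A chart \<open>(U, \<phi>)\<close> is a set \<open>U\<close> of points with an injective
  coordinate map \<open>\<phi>\<close> onto an affine algebraic set. The definition is only used for algebraically
  compatible charts, for which the principal open subsets of the charts are a basis of the glued
  Zariski topology.\<close>

definition glue :: "('a set \<times> ('a \<Rightarrow> 'i \<Rightarrow> complex)) set \<Rightarrow> 'a variety" where
  "glue charts =
    \<lparr>vtop = topology_generated_by
        {{x \<in> U. b (\<phi> x) \<noteq> 0} | U \<phi> b. (U, \<phi>) \<in> charts \<and> b \<in> polyfuns},
     vreg = (\<lambda>V. {f. \<forall>x\<in>V. \<exists>(U, \<phi>)\<in>charts. \<exists>a\<in>polyfuns. \<exists>b\<in>polyfuns.
        x \<in> U \<and> b (\<phi> x) \<noteq> 0 \<and>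
        (\<forall>y\<in>V \<inter> U. b (\<phi> y) \<noteq> 0 \<longrightarrow> f y = a (\<phi> y) / b (\<phi> y))})\<rparr>"

definition subvariety :: "'a variety \<Rightarrow> 'a set \<Rightarrow> 'a variety" where
  "subvariety X Z =
    \<lparr>vtop = subtopology (vtop X) Z,
     vreg = (\<lambda>V. {f. \<forall>x\<in>V. \<exists>U h. openin (vtop X) U \<and> x \<in> U \<and> h \<in> vreg X U \<and>
        (\<forall>y\<in>U \<inter> V. f y = h y)})\<rparr>"

definition morphism :: "'a variety \<Rightarrow> 'b variety \<Rightarrow> ('a \<Rightarrow> 'b) \<Rightarrow> bool" where
  "morphism X Y f \<longleftrightarrow> continuous_map (vtop X) (vtop Y) f \<and>
    (\<forall>V h. openin (vtop Y) V \<and> h \<in> vreg Y V \<longrightarrow> h \<circ> f \<in> vreg X {x \<in> points X. f x \<in> V})"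

definition isomorphism :: "'a variety \<Rightarrow> 'b variety \<Rightarrow> ('a \<Rightarrow> 'b) \<Rightarrow> bool" where
  "isomorphism X Y f \<longleftrightarrow> morphism X Y f \<and>
    (\<exists>g. morphism Y X g \<and> (\<forall>x\<in>points X. g (f x) = x) \<and> (\<forall>y\<in>points Y. f (g y) = y))"

definition irreducible_subset :: "'a topology \<Rightarrow> 'a set \<Rightarrow> bool" where
  "irreducible_subset T Z \<longleftrightarrow> Z \<noteq> {} \<and> Z \<subseteq> topspace T \<and>
    (\<forall>A B. closedin T A \<and> closedin T B \<and> Z \<subseteq> A \<union> B \<longrightarrow> Z \<subseteq> A \<or> Z \<subseteq> B)"

definition irreducible_components :: "'a topology \<Rightarrow> 'a set \<Rightarrow> 'a set set" where
  "irreducible_components T S = {Z. Z \<subseteq> S \<and> irreducible_subset T Z \<and>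
    (\<forall>Z'. Z \<subseteq> Z' \<and> Z' \<subseteq> S \<and> irreducible_subset T Z' \<longrightarrow> Z' = Z)}"


section \<open>Line bundles and the Picard group\<close>

text \<open>A line bundle is given by a cocycle \<open>(U, g)\<close>. The covering is indexed by the points of the
  variety, \<open>U x\<close> being a neighbourhood of \<open>x\<close>; this loses no generality and keeps all line bundles
  in one type. A section is a family of functions \<open>s x\<close> on \<open>U x\<close> such that
  \<open>s x = g x y * s y\<close> on \<open>U x \<inter> U y\<close>.\<close>

type_synonym 'a cocycle = "('a \<Rightarrow> 'a set) \<times> ('a \<Rightarrow> 'a \<Rightarrow> 'a \<Rightarrow> complex)"

definition unit_functions :: "'a variety \<Rightarrow> 'a set \<Rightarrow> ('a \<Rightarrow> complex) set" where
  "unit_functions X V = {f \<in> vreg X V. \<forall>t\<in>V. f t \<noteq> 0}"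

definition line_bundles :: "'a variety \<Rightarrow> 'a cocycle set" where
  "line_bundles X = {(U, g).
    (\<forall>x\<in>points X. openin (vtop X) (U x) \<and> x \<in> U x) \<and>
    (\<forall>x\<in>points X. \<forall>y\<in>points X. g x y \<in> unit_functions X (U x \<inter> U y)) \<and>
    (\<forall>x\<in>points X. \<forall>y\<in>points X. \<forall>z\<in>points X. \<forall>t\<in>U x \<inter> U y \<inter> U z.
        g x y t * g y z t = g x z t)}"

definition bundle_iso :: "'a variety \<Rightarrow> ('a cocycle \<times> 'a cocycle) set" where
  "bundle_iso X = {((U, g), (V, h)). (U, g) \<in> line_bundles X \<and> (V, h) \<in> line_bundles X \<and>
    (\<exists>W a. (\<forall>x\<in>points X. openin (vtop X) (W x) \<and> x \<in> W x \<and> W x \<subseteq> U x \<inter> V x \<and>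
                a x \<in> unit_functions X (W x)) \<and>
           (\<forall>x\<in>points X. \<forall>y\<in>points X. \<forall>t\<in>W x \<inter> W y.
                g x y t * a y t = a x t * h x y t))}"

definition tensor :: "'a cocycle \<Rightarrow> 'a cocycle \<Rightarrow> 'a cocycle" where
  "tensor L M = (\<lambda>x. fst L x \<inter> fst M x, \<lambda>x y t. snd L x y t * snd M x y t)"

definition trivial_bundle :: "'a variety \<Rightarrow> 'a cocycle" where
  "trivial_bundle X = (\<lambda>_. points X, \<lambda>_ _ _. 1)"

definition Pic :: "'a variety \<Rightarrow> 'a cocycle set monoid" where
  "Pic X =
    \<lparr>carrier = line_bundles X // bundle_iso X,
     mult = (\<lambda>A B. \<Union>L\<in>A. \<Union>M\<in>B. bundle_iso X `` {tensor L M}),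
     one = bundle_iso X `` {trivial_bundle X}\<rparr>"

definition pullback_cocycle :: "'a variety \<Rightarrow> ('a \<Rightarrow> 'b) \<Rightarrow> 'b cocycle \<Rightarrow> 'a cocycle" where
  "pullback_cocycle Y f L =
    (\<lambda>y. {t \<in> points Y. f t \<in> fst L (f y)}, \<lambda>y y' t. snd L (f y) (f y') (f t))"

text \<open>Pullback of divisor classes along a morphism \<open>f\<close> from \<open>Y\<close> to another variety.\<close>

definition pullback_class :: "'a variety \<Rightarrow> ('a \<Rightarrow> 'b) \<Rightarrow> 'b cocycle set \<Rightarrow> 'a cocycle set" where
  "pullback_class Y f c = (\<Union>L\<in>c. bundle_iso Y `` {pullback_cocycle Y f L})"

text \<open>The class of \<open>\<O>(D)\<close> for a reduced effective Cartier divisor \<open>D\<close>, given by its support: the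
  line bundles having a section \<open>s\<close> which locally generates the ideal of functions vanishing on \<open>D\<close>.\<close>

definition divisor_class :: "'a variety \<Rightarrow> 'a set \<Rightarrow> 'a cocycle set" where
  "divisor_class X D = {(U, g) \<in> line_bundles X. \<exists>s.
    (\<forall>x\<in>points X. s x \<in> vreg X (U x)) \<and>
    (\<forall>x\<in>points X. \<forall>y\<in>points X. \<forall>t\<in>U x \<inter> U y. s x t = g x y t * s y t) \<and>
    (\<forall>x\<in>points X. \<forall>W. openin (vtop X) W \<and> W \<subseteq> U x \<longrightarrow>
      (\<forall>f\<in>vreg X W. (\<forall>t\<in>W \<inter> D. f t = 0) \<longleftrightarrow> (\<exists>h\<in>vreg X W. \<forall>t\<in>W. f t = s x t * h t)))}"


section \<open>Losev--Manin space\<close>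

text \<open>The markings are \<open>N = {..<n}\<close> (shifted by one from \<open>{1..n}\<close>). In a chain with components
  numbered \<open>0, 1, ..., m - 1\<close> from the left tail to the right tail, every component is a projective
  line with coordinate \<open>z\<close>, where the point \<open>z = \<infinity>\<close> of each component is glued to the point \<open>z = 0\<close>
  of the next one; the marked points \<open>0\<close> and \<open>\<infinity>\<close> are \<open>z = 0\<close> on the first and \<open>z = \<infinity>\<close> on the last
  component. The point marked \<open>i\<close> is \<open>z = pos C i\<close> on component \<open>component C i\<close>. Every component
  carries some \<open>i\<close>, which is stability.\<close>

record marked_chain =
  component :: "nat \<Rightarrow> nat"
  pos :: "nat \<Rightarrow> complex"

definition marked_chains :: "nat \<Rightarrow> marked_chain set" where
  "marked_chains n = {C. (\<exists>m. component C ` {..<n} = {..<m}) \<and> (\<forall>i<n. pos C i \<noteq> 0)}"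

text \<open>An isomorphism of marked chains rescales the coordinate of every component, as it fixes
  \<open>z = 0\<close> and \<open>z = \<infinity>\<close>.\<close>

definition chain_iso :: "nat \<Rightarrow> (marked_chain \<times> marked_chain) set" where
  "chain_iso n = {(C, C'). C \<in> marked_chains n \<and> C' \<in> marked_chains n \<and>
    (\<exists>s. \<forall>i<n. component C' i = component C i \<and>
      s (component C i) \<noteq> 0 \<and> pos C' i = s (component C i) * pos C i)}"

text \<open>The torus-invariant affine chart of a Weyl chamber, i.e. of a permutation \<open>w\<close>: the chains on
  which the points \<open>w 0, ..., w (n - 1)\<close> appear in this order (weakly) from left to right. The
  generators of the dual cone are the characters \<open>pos (w k) / pos (w (k + 1))\<close>, which extend by
  zero to the chains with a node between these two points, and give an isomorphism with affine space
  of dimension \<open>n - 1\<close>.\<close>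

definition chamber_set :: "nat \<Rightarrow> (nat \<Rightarrow> nat) \<Rightarrow> marked_chain set set" where
  "chamber_set n w = {P \<in> marked_chains n // chain_iso n.
    \<forall>C\<in>P. \<forall>k. Suc k < n \<longrightarrow> component C (w k) \<le> component C (w (Suc k))}"

definition chamber_coord :: "nat \<Rightarrow> (nat \<Rightarrow> nat) \<Rightarrow> marked_chain set \<Rightarrow> nat \<Rightarrow> complex" where
  "chamber_coord n w P k = (let C = (SOME C. C \<in> P) in
    if Suc k < n \<and> component C (w k) = component C (w (Suc k))
    then pos C (w k) / pos C (w (Suc k)) else 0)"

definition LM :: "nat \<Rightarrow> marked_chain set variety" where
  "LM n = glue {(chamber_set n w, chamber_coord n w) | w. w permutes {..<n}}"

text \<open>The locus of chains with a node separating \<open>J\<close> and \<open>0\<close> from the other marked points.\<close>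

definition delta :: "nat \<Rightarrow> nat set \<Rightarrow> marked_chain set set" where
  "delta n J = {P \<in> marked_chains n // chain_iso n. \<exists>C\<in>P. \<exists>m. J = {i\<in>{..<n}. component C i < m}}"

text \<open>The space with one more light point, \<open>LM (Suc n)\<close>, with the map forgetting the point marked
  \<open>n\<close>, is the universal curve over \<open>LM n\<close>: a point of the fibre is a position of the additional
  point on the chain, with a new component inserted when it is a node, \<open>0\<close> or \<open>\<infinity>\<close>. The section
  given by the marked point \<open>0\<close> therefore puts the additional point on a new leftmost component.\<close>

definition add_at_zero :: "nat \<Rightarrow> marked_chain \<Rightarrow> marked_chain" where
  "add_at_zero n C =
    \<lparr>component = (\<lambda>i. if i = n then 0 else Suc (component C i)),
     pos = (\<lambda>i. if i = n then 1 else pos C i)\<rparr>"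

definition zero_section :: "nat \<Rightarrow> marked_chain set \<Rightarrow> marked_chain set" where
  "zero_section n P = (\<Union>C\<in>P. chain_iso (Suc n) `` {add_at_zero n C})"

text \<open>The cotangent line bundle of a family of curves \<open>E\<close> over \<open>B\<close> along a section \<open>\<sigma>\<close> in the smooth
  locus is the conormal bundle of the section, i.e. the pullback by \<open>\<sigma>\<close> of \<open>\<O>(-\<sigma>(B))\<close>.\<close>

definition psi_class :: "'b variety \<Rightarrow> 'a variety \<Rightarrow> ('b \<Rightarrow> 'a) \<Rightarrow> 'b cocycle set" where
  "psi_class B E \<sigma> = pullback_class B \<sigma> (inv\<^bsub>Pic E\<^esub> (divisor_class E (\<sigma> ` points B)))"

definition psi_zero :: "nat \<Rightarrow> marked_chain set cocycle set" where
  "psi_zero n = psi_class (LM n) (LM (Suc n)) (zero_section n)"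

definition G_class :: "nat \<Rightarrow> nat \<Rightarrow> marked_chain set cocycle set" where
  "G_class n a =
    psi_zero n [^]\<^bsub>Pic (LM n)\<^esub> a \<otimes>\<^bsub>Pic (LM n)\<^esub>
    inv\<^bsub>Pic (LM n)\<^esub>
      (finprod (Pic (LM n)) (\<lambda>J. divisor_class (LM n) (delta n J) [^]\<^bsub>Pic (LM n)\<^esub> (a - card J))
        {J. J \<noteq> {} \<and> J \<subseteq> {..<n} \<and> card J \<le> a - 1})"


section \<open>Wonderful compactification of the projective linear group\<close>

text \<open>The wonderful compactification is realised as the variety of complete collineations, the
  closure of the image of \<open>PGL\<^sub>n\<close> in the product of the projective spaces of
  \<open>End (\<Lambda>\<^sup>k \<complex>\<^sup>n)\<close>, \<open>1 \<le> k < n\<close>. A point of the product is a multihomogeneous coordinate vector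
  indexed by the pairs \<open>(I, J)\<close> of \<open>k\<close>-subsets of \<open>{..<n}\<close>, up to rescaling for each \<open>k\<close>.\<close>

type_synonym collineation = "nat set \<times> nat set \<Rightarrow> complex"

definition minor_indices :: "nat \<Rightarrow> nat \<Rightarrow> (nat set \<times> nat set) set" where
  "minor_indices n k = {(I, J). I \<subseteq> {..<n} \<and> J \<subseteq> {..<n} \<and> card I = k \<and> card J = k}"

definition hom_vectors :: "nat \<Rightarrow> collineation set" where
  "hom_vectors n = {A. (\<forall>q. q \<notin> (\<Union>k\<in>{1..<n}. minor_indices n k) \<longrightarrow> A q = 0) \<and>
    (\<forall>k\<in>{1..<n}. \<exists>q\<in>minor_indices n k. A q \<noteq> 0)}"

definition hom_equiv :: "nat \<Rightarrow> (collineation \<times> collineation) set" where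
  "hom_equiv n = {(A, B). A \<in> hom_vectors n \<and> B \<in> hom_vectors n \<and>
    (\<exists>s. \<forall>k\<in>{1..<n}. s k \<noteq> 0 \<and> (\<forall>q\<in>minor_indices n k. B q = s k * A q))}"

definition hom_chart_set :: "nat \<Rightarrow> (nat \<Rightarrow> nat set \<times> nat set) \<Rightarrow> collineation set set" where
  "hom_chart_set n \<tau> = {P \<in> hom_vectors n // hom_equiv n. \<forall>A\<in>P. \<forall>k\<in>{1..<n}. A (\<tau> k) \<noteq> 0}"

definition hom_chart_coord ::
  "(nat \<Rightarrow> nat set \<times> nat set) \<Rightarrow> collineation set \<Rightarrow> nat set \<times> nat set \<Rightarrow> complex" where
  "hom_chart_coord \<tau> P q = (let A = (SOME A. A \<in> P) in A q / A (\<tau> (card (fst q))))"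

definition hom_product :: "nat \<Rightarrow> collineation set variety" where
  "hom_product n = glue {(hom_chart_set n \<tau>, hom_chart_coord \<tau>) | \<tau>.
    \<forall>k\<in>{1..<n}. \<tau> k \<in> minor_indices n k}"

definition exterior_powers :: "nat \<Rightarrow> complex mat \<Rightarrow> collineation" where
  "exterior_powers n g = (\<lambda>(I, J).
    if (I, J) \<in> (\<Union>k\<in>{1..<n}. minor_indices n k) then det (submatrix g I J) else 0)"

text \<open>The image in the product of the class of an invertible matrix in \<open>PGL\<^sub>n\<close>.\<close>

definition pgl_point :: "nat \<Rightarrow> complex mat \<Rightarrow> collineation set" where
  "pgl_point n g = hom_equiv n `` {exterior_powers n g}"

definition PGL :: "nat \<Rightarrow> collineation set set" where
  "PGL n = pgl_point n ` {g \<in> carrier_mat n n. invertible_mat g}"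

definition wonderful :: "nat \<Rightarrow> collineation set variety" where
  "wonderful n = subvariety (hom_product n) (vtop (hom_product n) closure_of PGL n)"

definition wonderful_boundary :: "nat \<Rightarrow> collineation set set" where
  "wonderful_boundary n = points (wonderful n) - PGL n"

definition diagonal_torus :: "nat \<Rightarrow> collineation set set" where
  "diagonal_torus n = {pgl_point n (mat_diag n p) | p. \<forall>i<n. p i \<noteq> 0}"

definition torus_closure :: "nat \<Rightarrow> collineation set variety" where
  "torus_closure n = subvariety (wonderful n) (vtop (wonderful n) closure_of diagonal_torus n)"

text \<open>The identification of the Losev--Manin space with the closure of the maximal torus: on the open
  torus, the chain with a single component and points \<open>p 0, ..., p (n - 1)\<close> is sent to
  \<open>diag (p 0, ..., p (n - 1))\<close>.\<close>

definition torus_identification :: "nat \<Rightarrow> (marked_chain set \<Rightarrow> collineation set) \<Rightarrow> bool" where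
  "torus_identification n \<iota> \<longleftrightarrow> isomorphism (LM n) (torus_closure n) \<iota> \<and>
    (\<forall>p. (\<forall>i<n. p i \<noteq> 0) \<longrightarrow>
      \<iota> (chain_iso n `` {\<lparr>component = (\<lambda>_. 0), pos = p\<rparr>}) = pgl_point n (mat_diag n p))"


section \<open>The root system of type A\<close>

text \<open>The root system \<open>A\<close> of rank \<open>n - 1\<close> in the sum-zero hyperplane of \<open>\<real>\<^sup>n\<close>, with coordinates
  indexed by \<open>{..<n}\<close>; the simple roots are numbered by \<open>1, ..., n - 1\<close>.\<close>

definition root_space :: "nat \<Rightarrow> (nat \<Rightarrow> real) set" where
  "root_space n = {v. (\<forall>k\<ge>n. v k = 0) \<and> (\<Sum>k<n. v k) = 0}"

definition simple_root :: "nat \<Rightarrow> nat \<Rightarrow> real" where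
  "simple_root i = (\<lambda>k. if k = i - 1 then 1 else if k = i then -1 else 0)"

definition coroot_pairing :: "nat \<Rightarrow> (nat \<Rightarrow> real) \<Rightarrow> (nat \<Rightarrow> real) \<Rightarrow> real" where
  "coroot_pairing n v \<alpha> = 2 * (\<Sum>k<n. v k * \<alpha> k) / (\<Sum>k<n. \<alpha> k * \<alpha> k)"

definition weight_lattice :: "nat \<Rightarrow> (nat \<Rightarrow> real) monoid" where
  "weight_lattice n =
    \<lparr>carrier = {v \<in> root_space n. \<forall>i\<in>{1..<n}. coroot_pairing n v (simple_root i) \<in> \<int>},
     mult = (\<lambda>v w k. v k + w k),
     one = (\<lambda>_. 0)\<rparr>"

definition fundamental_weight :: "nat \<Rightarrow> nat \<Rightarrow> nat \<Rightarrow> real" where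
  "fundamental_weight n i = (THE v. v \<in> root_space n \<and>
    (\<forall>j\<in>{1..<n}. coroot_pairing n v (simple_root j) = (if j = i then 1 else 0)))"

end

theory Submission
  imports
    Defs
    "HOL-Computational_Algebra.Fundamental_Theorem_Algebra"
begin

text \<open>The point of the torus closure given by a chain is a limit of points of the torus, which shows that
its coordinates of level \<open>k\<close> (in the projective space of \<open>End (\<Lambda>\<^sup>k \<complex>\<^sup>n)\<close>) are the products of positions over
the \<open>k\<close>-subsets of maximal component sum. Hence the bundle \<open>\<O>(1)\<close> of level \<open>n - a\<close> pulls back to the toric
bundle of \<open>G\<^sub>a\<close>, and it remains to identify \<open>\<O>(1)\<close> of level \<open>n - a\<close> with \<open>\<omega>\<^sub>a\<close>. The component \<open>D\<^sub>i\<close> lies in the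
locus where the coordinate matrix of level \<open>n - i\<close> has rank one, and is stable under simultaneous permutations of rows
and columns. So the curve of the diagonal matrices with entries \<open>\<Prod>\<^bsub>j: l \<in> J\<^sub>j\<^esub> (t - j)\<close>, where \<open>J\<^sub>0, \<dots>, J\<^bsub>n-1\<^esub>\<close> are the
cyclic intervals of length \<open>i\<close>, meets the boundary only in \<open>D\<^sub>i\<close>, transversally in \<open>n\<close> points. A weight is determined
by the degrees of its bundle along these curves for all \<open>i\<close>, and \<open>\<O>(1)\<close> of level \<open>k\<close> has degree
\<open>k i - n max(0, k + i - n)\<close>.\<close>


section \<open>Function rings and charts\<close>

text \<open>About the Picard group it is only given that \<Phi> is an isomorphism taking simple
  roots to boundary classes. Surjectivity yields a weight \<open>v\<close> for the level bundle;
  \<open>n\<close> times \<open>v\<close> is an integral combination of simple roots, so degrees of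
  boundary classes determine the partial sums of \<open>v\<close>. Level \<open>n - i\<close>
  belongs to \<open>D i\<close> because, for a chain with one node after \<open>i\<close> points,
  the subset of maximal component sum is unique exactly for the size \<open>n - i\<close> among the
  sizes \<open>1, ..., n - 1\<close>. The hypothesis puts only the divisor of the first
  \<open>i\<close> points into \<open>D i\<close>, while the curve needs all cyclic intervals; hence
  the stability under permutations, proved by moving a component with unipotent one-parameter
  families. Each index lies in exactly \<open>i\<close> of the \<open>n\<close> intervals, so all
  diagonal entries are monic of degree \<open>i\<close> and the curve passes through the identity at
  infinity. Transversality needs no local equation of \<open>D i\<close>: a two by two minor that
  vanishes on \<open>D i\<close> has a simple zero along the curve. Limits are algebraic throughout:
  a polynomial vanishing off the zeros of a nonzero polynomial is zero.\<close>

definition func_ring :: "('y => complex) set => bool" where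
 "func_ring R \<longleftrightarrow> (\<forall>c. (\<lambda>_. c) \<in> R) \<and>
  (\<forall>f\<in>R. \<forall>g\<in>R. (\<lambda>y. f y + g y) \<in> R \<and> (\<lambda>y. f y * g y) \<in> R)"

lemma func_ringD:
 assumes "func_ring R"
 shows func_ring_const: "(\<lambda>_. c) \<in> R"
  and func_ring_add: "f \<in> R ==> g \<in> R ==> (\<lambda>y. f y + g y) \<in> R"
  and func_ring_mult: "f \<in> R ==> g \<in> R ==> (\<lambda>y. f y * g y) \<in> R"
 using assms by (auto simp: func_ring_def)

lemma func_ring_power: "func_ring R ==> f \<in> R ==> (\<lambda>y. f y ^ k) \<in> R"
 by (induction k) (auto intro: func_ring_const func_ring_mult)

lemma func_ring_prod:
 "func_ring R ==> (\<And>i. i \<in> I ==> f i \<in> R) ==> (\<lambda>y. \<Prod>i\<in>I. f i y) \<in> R"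
 by (induction I rule: infinite_finite_induct) (auto intro: func_ring_const func_ring_mult)

lemma func_ring_sum:
 "func_ring R ==> (\<And>i. i \<in> I ==> f i \<in> R) ==> (\<lambda>y. \<Sum>i\<in>I. f i y) \<in> R"
 by (induction I rule: infinite_finite_induct) (auto intro: func_ring_const func_ring_add)

lemma func_ring_polyfuns: "func_ring polyfuns"
 by (auto simp: func_ring_def intro: polyfuns.intros)

lemma func_ring_compose: "func_ring R ==> func_ring {\<lambda>y. p (phi y) | p. p \<in> R}"
 unfolding func_ring_def by (fastforce simp: Bex_def)

lemma func_ring_poly: "func_ring {poly p | p. True}"
 unfolding func_ring_def
 by (auto intro: exI[of _ "[:_:]"] simp: fun_eq_iff simp flip: poly_add poly_mult)

text \<open>Substituting fractions with one common denominator into a polynomial function and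
  clearing denominators. The ring \<open>R\<close> is kept abstract so that the same lemma serves
  changes of charts and curves: it is applied to polynomial functions of chart coordinates and to
  polynomials in one parameter.\<close>

lemma polyfuns_quotient:
 assumes R: "func_ring R" and b: "b \<in> R"
  and psi: "\<And>k. \<exists>a\<in>R. \<forall>y\<in>Y. b y \<noteq> 0 --> psi y k = a y / b y"
  and "p \<in> polyfuns"
 shows "\<exists>a\<in>R. \<exists>N. \<forall>y\<in>Y. b y \<noteq> 0 --> p (psi y) = a y / b y ^ N"
 using \<open>p \<in> polyfuns\<close>
proof induction
 case (const c)
 show ?case by (rule bexI[OF _ func_ring_const[OF R, of c]], rule exI[of _ 0]) auto
next
 case (coord i)
 then show ?case using psi[of i] by (metis power_one_right)
next
 case (add p q)
 then obtain a N a' N' where "a \<in> R" "a' \<in> R"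
  and "\<forall>y\<in>Y. b y \<noteq> 0 --> p (psi y) = a y / b y ^ N"
  and "\<forall>y\<in>Y. b y \<noteq> 0 --> q (psi y) = a' y / b y ^ N'" by blast
 then show ?case
  by (intro bexI[of _ "\<lambda>y. a y * b y ^ N' + a' y * b y ^ N"] exI[of _ "N + N'"])
    (auto simp: field_simps power_add intro!: func_ring_add[OF R] func_ring_mult[OF R]
     func_ring_power[OF R] b)
next
 case (mult p q)
 then obtain a N a' N' where "a \<in> R" "a' \<in> R"
  and "\<forall>y\<in>Y. b y \<noteq> 0 --> p (psi y) = a y / b y ^ N"
  and "\<forall>y\<in>Y. b y \<noteq> 0 --> q (psi y) = a' y / b y ^ N'" by blast
 then show ?case
  by (intro bexI[of _ "\<lambda>y. a y * a' y"] exI[of _ "N + N'"])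
    (auto simp: power_add intro!: func_ring_mult[OF R])
qed

text \<open>The denominator \<open>b\<close> is chosen before the coordinate index \<open>k\<close>,
  so one principal open set around \<open>x\<close> works for all coordinates at once, even for an
  infinite index type.\<close>

definition compatible_charts :: "('a set \<times> ('a => 'i => complex)) set => bool" where
 "compatible_charts C \<longleftrightarrow> (\<forall>U phi V psi x. (U, phi) \<in> C --> (V, psi) \<in> C --> x \<in> U --> x \<in> V -->
   (\<exists>b\<in>polyfuns. b (phi x) \<noteq> 0 \<and>
   (\<forall>y\<in>U. b (phi y) \<noteq> 0 --> y \<in> V) \<and>
   (\<forall>k. \<exists>a\<in>polyfuns. \<forall>y\<in>U. b (phi y) \<noteq> 0 --> psi y k = a (phi y) / b (phi y))))"

lemma compatible_polyfun:
 assumes C: "compatible_charts C" and "(U, phi) \<in> C" "(V, psi) \<in> C" "x \<in> U" "x \<in> V"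
 obtains b where "b \<in> polyfuns" "b (phi x) \<noteq> 0" "\<And>y. y \<in> U ==> b (phi y) \<noteq> 0 ==> y \<in> V"
  "\<And>p. p \<in> polyfuns ==>
   \<exists>a\<in>polyfuns. \<exists>N. \<forall>y\<in>U. b (phi y) \<noteq> 0 --> p (psi y) = a (phi y) / b (phi y) ^ N"
proof -
 obtain b where b: "b \<in> polyfuns" "b (phi x) \<noteq> 0" "\<forall>y\<in>U. b (phi y) \<noteq> 0 --> y \<in> V"
  "\<forall>k. \<exists>a\<in>polyfuns. \<forall>y\<in>U. b (phi y) \<noteq> 0 --> psi y k = a (phi y) / b (phi y)"
  using C[unfolded compatible_charts_def, rule_format, OF assms(2-5)] by auto
 have "\<exists>a\<in>polyfuns. \<exists>N. \<forall>y\<in>U. b (phi y) \<noteq> 0 --> p (psi y) = a (phi y) / b (phi y) ^ N"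
  if "p \<in> polyfuns" for p
 proof -
  let ?R = "{\<lambda>y. p (phi y) | p. p \<in> polyfuns}"
  have "\<exists>a\<in>?R. \<exists>N. \<forall>y\<in>U. b (phi y) \<noteq> 0 --> p (psi y) = a y / b (phi y) ^ N"
  proof (rule polyfuns_quotient[OF func_ring_compose[OF func_ring_polyfuns] _ _ that])
   show "(\<lambda>y. b (phi y)) \<in> ?R" using b by blast
   fix k
   from b(4) obtain a where "a \<in> polyfuns" "\<forall>y\<in>U. b (phi y) \<noteq> 0 --> psi y k = a (phi y) / b (phi y)"
    by blast
   then show "\<exists>a\<in>?R. \<forall>y\<in>U. b (phi y) \<noteq> 0 --> psi y k = a y / b (phi y)"
    by (intro bexI[of _ "\<lambda>y. a (phi y)"]) auto
  qed
  then show ?thesis by blast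
 qed
 with b show thesis using that by blast
qed

lemma points_glue: "points (glue C) = (\<Union>(U, phi)\<in>C. U)"
 by (auto simp: glue_def intro!: exI[of _ "\<lambda>_. 1"] polyfuns.const)
   (metis (mono_tags, lifting) mem_Collect_eq polyfuns.const zero_neq_one)

lemma glue_basic_open:
 assumes "(U, phi) \<in> C" "b \<in> polyfuns"
 shows "openin (vtop (glue C)) {x \<in> U. b (phi x) \<noteq> 0}"
 unfolding glue_def using assms
 by (auto simp: openin_topology_generated_by_iff intro!: generate_topology_on.Basis)

lemma glue_chart_open:
 assumes "(U, phi) \<in> C"
 shows "openin (vtop (glue C)) U"
 using glue_basic_open[OF assms polyfuns.const[of 1]] by simp

text \<open>The topology is generated by the principal open sets of all charts. Compatibility
  rewrites each of them in the given chart, so this chart alone supplies a neighbourhood basis at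
  \<open>x\<close>; the induction follows the generation of open sets.\<close>

lemma glue_open_basis:
 assumes C: "compatible_charts C" and "openin (vtop (glue C)) V"
  and "(U, phi) \<in> C" "x \<in> U" "x \<in> V"
 obtains b where "b \<in> polyfuns" "b (phi x) \<noteq> 0" "\<And>y. y \<in> U ==> b (phi y) \<noteq> 0 ==> y \<in> V"
proof -
 have "generate_topology_on {{x \<in> U. b (phi x) \<noteq> 0} | U phi b. (U, phi) \<in> C \<and> b \<in> polyfuns} V"
  using assms(2) by (simp add: glue_def openin_topology_generated_by_iff)
 then have "x \<in> V ==> \<exists>b\<in>polyfuns. b (phi x) \<noteq> 0 \<and> (\<forall>y\<in>U. b (phi y) \<noteq> 0 --> y \<in> V)"
 proof induction
  case Empty
  then show ?case by simp
 next
  case (Int V V')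
  then obtain b b' where "b \<in> polyfuns" "b (phi x) \<noteq> 0" "\<forall>y\<in>U. b (phi y) \<noteq> 0 --> y \<in> V"
   "b' \<in> polyfuns" "b' (phi x) \<noteq> 0" "\<forall>y\<in>U. b' (phi y) \<noteq> 0 --> y \<in> V'" by auto
  then show ?case
   by (intro bexI[of _ "\<lambda>z. b z * b' z"]) (auto intro: polyfuns.mult)
 next
  case (UN K)
  then show ?case by (meson UnionE UnionI)
 next
  case (Basis s)
  then obtain U' phi' b' where s: "s = {x \<in> U'. b' (phi' x) \<noteq> 0}" "(U', phi') \<in> C" "b' \<in> polyfuns"
   by blast
  with Basis have x: "x \<in> U'" "b' (phi' x) \<noteq> 0" by auto
  from compatible_polyfun[OF C assms(3) s(2) assms(4) x(1)] obtain b where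
   b: "b \<in> polyfuns" "b (phi x) \<noteq> 0" "\<And>y. y \<in> U ==> b (phi y) \<noteq> 0 ==> y \<in> U'"
   "\<And>p. p \<in> polyfuns ==>
    \<exists>a\<in>polyfuns. \<exists>N. \<forall>y\<in>U. b (phi y) \<noteq> 0 --> p (phi' y) = a (phi y) / b (phi y) ^ N" by metis
  from b(4)[OF s(3)] obtain a N where
   "a \<in> polyfuns" "\<forall>y\<in>U. b (phi y) \<noteq> 0 --> b' (phi' y) = a (phi y) / b (phi y) ^ N" by blast
  \<comment> \<open>The factor \<open>b z\<close> forces the point into the other chart, where the
    formula for \<open>b'\<close> is valid.\<close>
  then show ?case using b(1-3) x s assms(4)
   by (intro bexI[of _ "\<lambda>z. a z * b z"]) (auto intro: polyfuns.mult)
 qed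
 then show thesis using assms(5) that by meson
qed

text \<open>The definition of regularity picks some chart around \<open>x\<close>; compatibility
  moves the fraction to any prescribed chart.\<close>

lemma glue_regular_chart:
 assumes C: "compatible_charts C" and "f \<in> vreg (glue C) V" and "x \<in> V"
  and "(U, phi) \<in> C" "x \<in> U"
 obtains a b where "a \<in> polyfuns" "b \<in> polyfuns" "b (phi x) \<noteq> 0"
  "\<And>y. y \<in> V ==> y \<in> U ==> b (phi y) \<noteq> 0 ==> f y = a (phi y) / b (phi y)"
proof -
 have "\<forall>x\<in>V. \<exists>(U, phi)\<in>C. \<exists>a\<in>polyfuns. \<exists>b\<in>polyfuns.
    x \<in> U \<and> b (phi x) \<noteq> 0 \<and> (\<forall>y\<in>V \<inter> U. b (phi y) \<noteq> 0 --> f y = a (phi y) / b (phi y))"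
  using assms(2) by (simp add: glue_def)
 then obtain U' phi' a' b' where f: "(U', phi') \<in> C" "a' \<in> polyfuns" "b' \<in> polyfuns" "x \<in> U'"
  "b' (phi' x) \<noteq> 0" "\<forall>y\<in>V \<inter> U'. b' (phi' y) \<noteq> 0 --> f y = a' (phi' y) / b' (phi' y)"
  using \<open>x \<in> V\<close> by fast
 from compatible_polyfun[OF C assms(4) f(1) assms(5) f(4)] obtain b where
  b: "b \<in> polyfuns" "b (phi x) \<noteq> 0" "\<And>y. y \<in> U ==> b (phi y) \<noteq> 0 ==> y \<in> U'"
  "\<And>p. p \<in> polyfuns ==>
   \<exists>a\<in>polyfuns. \<exists>N. \<forall>y\<in>U. b (phi y) \<noteq> 0 --> p (phi' y) = a (phi y) / b (phi y) ^ N" by metis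
 from b(4)[OF f(2)] b(4)[OF f(3)] obtain alpha N beta M where
  alpha: "alpha \<in> polyfuns" "\<forall>y\<in>U. b (phi y) \<noteq> 0 --> a' (phi' y) = alpha (phi y) / b (phi y) ^ N"
  and beta: "beta \<in> polyfuns" "\<forall>y\<in>U. b (phi y) \<noteq> 0 --> b' (phi' y) = beta (phi y) / b (phi y) ^ M" by blast
 \<comment> \<open>One power of \<open>b\<close> more than clearing denominators requires: then a
   nonzero denominator includes \<open>b (phi y) \<noteq> 0\<close>, under which the rewriting
   holds.\<close>
 show thesis
 proof (rule that[of "\<lambda>z. alpha z * b z ^ (M + 1)" "\<lambda>z. beta z * b z ^ (N + 1)"])
  show "(\<lambda>z. alpha z * b z ^ (M + 1)) \<in> polyfuns" "(\<lambda>z. beta z * b z ^ (N + 1)) \<in> polyfuns"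
   using alpha beta b func_ring_power[OF func_ring_polyfuns] by (auto intro!: polyfuns.mult)
  show "beta (phi x) * b (phi x) ^ (N + 1) \<noteq> 0" using beta b f assms by auto
  fix y assume y: "y \<in> V" "y \<in> U" "beta (phi y) * b (phi y) ^ (N + 1) \<noteq> 0"
  then show "f y = alpha (phi y) * b (phi y) ^ (M + 1) / (beta (phi y) * b (phi y) ^ (N + 1))"
  proof -
   have nz: "b (phi y) \<noteq> 0" "beta (phi y) \<noteq> 0" using y(3) by auto
   have "f y = a' (phi' y) / b' (phi' y)" using f(6) beta(2) b(3) nz y(1,2) by auto
   also have "\<dots> = (alpha (phi y) / b (phi y) ^ N) / (beta (phi y) / b (phi y) ^ M)"
    using alpha(2) beta(2) nz y(2) by simp
   also have "\<dots> = alpha (phi y) * b (phi y) ^ (M + 1) / (beta (phi y) * b (phi y) ^ (N + 1))"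
    using nz by (simp add: divide_simps)
   finally show ?thesis .
  qed
 qed
qed

text \<open>A family of points whose chart coordinates are quotients of functions from a ring \<open>R\<close> of
 functions of the parameter: open conditions and regular functions pull back to conditions and
 quotients in \<open>R\<close>.\<close>

lemma glue_family_open:
 assumes C: "compatible_charts C" and "(U, phi) \<in> C" and R: "func_ring R" and b: "b \<in> R"
  and y0: "y0 \<in> Y" "b y0 \<noteq> 0" and U: "\<And>y. y \<in> Y ==> b y \<noteq> 0 ==> x y \<in> U"
  and co: "\<And>k. \<exists>a\<in>R. \<forall>y\<in>Y. b y \<noteq> 0 --> phi (x y) k = a y / b y"
  and V: "openin (vtop (glue C)) V" "x y0 \<in> V"
 obtains r where "r \<in> R" "r y0 \<noteq> 0" "\<forall>y\<in>Y. r y \<noteq> 0 --> b y \<noteq> 0 \<and> x y \<in> V"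
proof -
 from glue_open_basis[OF C V(1) assms(2) U[OF y0] V(2)] obtain beta where
  beta: "beta \<in> polyfuns" "beta (phi (x y0)) \<noteq> 0" "\<And>y. y \<in> U ==> beta (phi y) \<noteq> 0 ==> y \<in> V" by blast
 from polyfuns_quotient[where psi = "\<lambda>y. phi (x y)", OF R b co beta(1)] obtain a N where
  a: "a \<in> R" "\<forall>y\<in>Y. b y \<noteq> 0 --> beta (phi (x y)) = a y / b y ^ N" by blast
 show thesis
  by (rule that[of "\<lambda>y. a y * b y"])
    (use a b beta y0 U in \<open>auto intro: func_ring_mult[OF R]\<close>)
qed

lemma glue_family_regular:
 assumes C: "compatible_charts C" and "(U, phi) \<in> C" and R: "func_ring R" and b: "b \<in> R"
  and y0: "y0 \<in> Y" "b y0 \<noteq> 0" and U: "\<And>y. y \<in> Y ==> b y \<noteq> 0 ==> x y \<in> U"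
  and co: "\<And>k. \<exists>a\<in>R. \<forall>y\<in>Y. b y \<noteq> 0 --> phi (x y) k = a y / b y"
  and V: "openin (vtop (glue C)) V" "x y0 \<in> V" "h \<in> vreg (glue C) V"
 obtains a r where "a \<in> R" "r \<in> R" "r y0 \<noteq> 0"
  "\<forall>y\<in>Y. r y \<noteq> 0 --> b y \<noteq> 0 \<and> x y \<in> V \<and> h (x y) = a y / r y"
proof -
 obtain r where r: "r \<in> R" "r y0 \<noteq> 0" "\<forall>y\<in>Y. r y \<noteq> 0 --> b y \<noteq> 0 \<and> x y \<in> V"
  by (rule glue_family_open[OF assms(1-8) V(1,2)])
 from glue_regular_chart[OF C V(3,2) assms(2) U[OF y0]] obtain alpha beta where
  alpha: "alpha \<in> polyfuns" and beta: "beta \<in> polyfuns" "beta (phi (x y0)) \<noteq> 0"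
  and h: "\<And>y. y \<in> V ==> y \<in> U ==> beta (phi y) \<noteq> 0 ==> h y = alpha (phi y) / beta (phi y)" by blast
 from polyfuns_quotient[where psi = "\<lambda>y. phi (x y)", OF R b co alpha] obtain a N where
  a: "a \<in> R" "\<forall>y\<in>Y. b y \<noteq> 0 --> alpha (phi (x y)) = a y / b y ^ N" by blast
 from polyfuns_quotient[where psi = "\<lambda>y. phi (x y)", OF R b co beta(1)] obtain c M where
  c: "c \<in> R" "\<forall>y\<in>Y. b y \<noteq> 0 --> beta (phi (x y)) = c y / b y ^ M" by blast
 show thesis
 proof (rule that[of "\<lambda>y. a y * b y ^ M * r y" "\<lambda>y. c y * b y ^ N * r y"])
  show "(\<lambda>y. a y * b y ^ M * r y) \<in> R" "(\<lambda>y. c y * b y ^ N * r y) \<in> R"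
   using a c r b by (auto intro!: func_ring_mult[OF R] func_ring_power[OF R])
  show "c y0 * b y0 ^ N * r y0 \<noteq> 0" using c r beta y0 by auto
  show "\<forall>y\<in>Y. c y * b y ^ N * r y \<noteq> 0 --> b y \<noteq> 0 \<and> x y \<in> V \<and>
   h (x y) = a y * b y ^ M * r y / (c y * b y ^ N * r y)"
  proof (intro ballI impI conjI)
  fix y assume y: "y \<in> Y" "c y * b y ^ N * r y \<noteq> 0"
  then show "b y \<noteq> 0" "x y \<in> V" using r by auto
  with y have "h (x y) = alpha (phi (x y)) / beta (phi (x y))" using h U c by auto
  also have "\<dots> = (a y / b y ^ N) / (c y / b y ^ M)"
   using y \<open>b y \<noteq> 0\<close> a c by simp
  also have "\<dots> = a y * b y ^ M * r y / (c y * b y ^ N * r y)"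
   using y \<open>b y \<noteq> 0\<close> by (simp add: divide_simps)
  finally show "h (x y) = a y * b y ^ M * r y / (c y * b y ^ N * r y)" .
  qed
 qed
qed

section \<open>Varieties and their Picard groups\<close>

text \<open>The Losev-Manin space is glued and the compactification is a closed subset of a glued
  variety. These sheaf properties are the common ground on which cocycles, Picard groups and divisor
  classes are treated for both.\<close>

locale function_variety =
 fixes X :: "'a variety"
 assumes reg_const: "V \<subseteq> points X ==> (\<lambda>_. c) \<in> vreg X V"
  and reg_mult: "f \<in> vreg X V ==> g \<in> vreg X V ==> (\<lambda>t. f t * g t) \<in> vreg X V"
  and reg_inverse: "f \<in> vreg X V ==> (\<And>t. t \<in> V ==> f t \<noteq> 0) ==> (\<lambda>t. inverse (f t)) \<in> vreg X V"
  and reg_subset: "f \<in> vreg X V ==> V' \<subseteq> V ==> f \<in> vreg X V'"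
  and reg_local: "(\<And>x. x \<in> V ==> \<exists>W h. openin (vtop X) W \<and> x \<in> W \<and> h \<in> vreg X (W \<inter> V) \<and>
    (\<forall>y\<in>W \<inter> V. f y = h y)) ==> f \<in> vreg X V"
  and reg_nonzero_open: "openin (vtop X) V ==> f \<in> vreg X V ==>
    openin (vtop X) {x \<in> V. f x \<noteq> 0}"

abbreviation chart_fraction ::
  "('a set \<times> ('a => 'i => complex)) set => 'a set => 'a => ('a => complex) => bool" where
 "chart_fraction C V x f \<equiv> \<exists>U phi a b. (U, phi) \<in> C \<and> a \<in> polyfuns \<and> b \<in> polyfuns \<and> x \<in> U \<and>
  b (phi x) \<noteq> 0 \<and> (\<forall>y\<in>V \<inter> U. b (phi y) \<noteq> 0 --> f y = a (phi y) / b (phi y))"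

lemma glue_regularI:
 assumes "\<And>x. x \<in> V ==> chart_fraction C V x f"
 shows "f \<in> vreg (glue C) V"
proof -
 have "\<exists>(U, phi)\<in>C. \<exists>a\<in>polyfuns. \<exists>b\<in>polyfuns.
    x \<in> U \<and> b (phi x) \<noteq> 0 \<and> (\<forall>y\<in>V \<inter> U. b (phi y) \<noteq> 0 --> f y = a (phi y) / b (phi y))"
  if "x \<in> V" for x
 proof -
  from assms[OF that] obtain U phi a b where "(U, phi) \<in> C \<and> a \<in> polyfuns \<and> b \<in> polyfuns \<and> x \<in> U \<and>
   b (phi x) \<noteq> 0 \<and> (\<forall>y\<in>V \<inter> U. b (phi y) \<noteq> 0 --> f y = a (phi y) / b (phi y))" by (elim exE)
  then show ?thesis by (intro bexI[of _ "(U, phi)"]) auto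
 qed
 then show ?thesis by (simp add: glue_def)
qed

lemma glue_regular_point:
 assumes "f \<in> vreg (glue C) V" "x \<in> V"
 obtains U phi where "(U, phi) \<in> C" "x \<in> U"
 using assms unfolding glue_def by auto

lemma function_variety_glue:
 assumes C: "compatible_charts C"
 shows "function_variety (glue C)"
proof
 fix V :: "'a set" and c :: complex
 assume V: "V \<subseteq> points (glue C)"
 show "(\<lambda>_. c) \<in> vreg (glue C) V"
 proof (rule glue_regularI)
  fix x assume "x \<in> V"
  then obtain U phi where "(U, phi) \<in> C" "x \<in> U" using V by (auto simp: points_glue)
  then show "chart_fraction C V x (\<lambda>y. c)"
   by (intro exI[of _ U] exI[of _ phi] exI[of _ "\<lambda>_. c"] exI[of _ "\<lambda>_. 1"])
     (auto intro: polyfuns.const)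
 qed
next
 fix V f g assume f: "f \<in> vreg (glue C) V" and g: "g \<in> vreg (glue C) V"
 show "(\<lambda>t. f t * g t) \<in> vreg (glue C) V"
 proof (rule glue_regularI)
  fix x assume x: "x \<in> V"
  then obtain U phi where U: "(U, phi) \<in> C" "x \<in> U" using f unfolding glue_def by auto
  from glue_regular_chart[OF C f x U] obtain a b where
   "a \<in> polyfuns" "b \<in> polyfuns" "b (phi x) \<noteq> 0"
   "\<And>y. y \<in> V ==> y \<in> U ==> b (phi y) \<noteq> 0 ==> f y = a (phi y) / b (phi y)" by blast
  moreover from glue_regular_chart[OF C g x U] obtain a' b' where
   "a' \<in> polyfuns" "b' \<in> polyfuns" "b' (phi x) \<noteq> 0"
   "\<And>y. y \<in> V ==> y \<in> U ==> b' (phi y) \<noteq> 0 ==> g y = a' (phi y) / b' (phi y)" by blast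
  ultimately show "chart_fraction C V x (\<lambda>y. f y * g y)" using U
   by (intro exI[of _ U] exI[of _ phi] exI[of _ "\<lambda>z. a z * a' z"] exI[of _ "\<lambda>z. b z * b' z"])
     (auto intro: polyfuns.mult)
 qed
next
 fix V f assume f: "f \<in> vreg (glue C) V" and nz: "\<And>t. t \<in> V ==> f t \<noteq> 0"
 show "(\<lambda>t. inverse (f t)) \<in> vreg (glue C) V"
 proof (rule glue_regularI)
  fix x assume x: "x \<in> V"
  then obtain U phi where U: "(U, phi) \<in> C" "x \<in> U" using f unfolding glue_def by auto
  from glue_regular_chart[OF C f x U] obtain a b where
   "a \<in> polyfuns" "b \<in> polyfuns" "b (phi x) \<noteq> 0"
   "\<And>y. y \<in> V ==> y \<in> U ==> b (phi y) \<noteq> 0 ==> f y = a (phi y) / b (phi y)" by blast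
  then show "chart_fraction C V x (\<lambda>y. inverse (f y))"
   using U nz[OF x] x
   by (intro exI[of _ U] exI[of _ phi] exI[of _ "\<lambda>z. b z * b z"] exI[of _ "\<lambda>z. a z * b z"])
     (auto intro: polyfuns.mult)
 qed
next
 fix V V' f assume "f \<in> vreg (glue C) V" "V' \<subseteq> V"
 then have *: "chart_fraction C V x f" if "x \<in> V'" for x
 proof -
  have "\<exists>(U, phi)\<in>C. \<exists>a\<in>polyfuns. \<exists>b\<in>polyfuns.
    x \<in> U \<and> b (phi x) \<noteq> 0 \<and> (\<forall>y\<in>V \<inter> U. b (phi y) \<noteq> 0 --> f y = a (phi y) / b (phi y))"
   using \<open>f \<in> vreg (glue C) V\<close> \<open>V' \<subseteq> V\<close> that by (simp add: glue_def subset_iff)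
  then show ?thesis by blast
 qed
 show "f \<in> vreg (glue C) V'"
 proof (rule glue_regularI)
  fix x assume "x \<in> V'"
  from *[OF this] show "chart_fraction C V' x f"
   using \<open>V' \<subseteq> V\<close> by (elim ex_forward) auto
 qed
next
 fix V f
 assume *: "\<And>x. x \<in> V ==> \<exists>W h. openin (vtop (glue C)) W \<and> x \<in> W \<and> h \<in> vreg (glue C) (W \<inter> V) \<and>
    (\<forall>y\<in>W \<inter> V. f y = h y)"
 show "f \<in> vreg (glue C) V"
 proof (rule glue_regularI)
  fix x assume x: "x \<in> V"
  from *[OF x] obtain W h where W: "openin (vtop (glue C)) W" "x \<in> W"
   "h \<in> vreg (glue C) (W \<inter> V)" "\<forall>y\<in>W \<inter> V. f y = h y" by blast
  then obtain U phi where U: "(U, phi) \<in> C" "x \<in> U" using x glue_regular_point[OF W(3), of x] by auto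
  from glue_regular_chart[OF C W(3) _ U] W(2) x obtain a b where
   "a \<in> polyfuns" "b \<in> polyfuns" "b (phi x) \<noteq> 0"
   "\<And>y. y \<in> W \<inter> V ==> y \<in> U ==> b (phi y) \<noteq> 0 ==> h y = a (phi y) / b (phi y)" by blast
  moreover from glue_open_basis[OF C W(1) U W(2)] obtain b' where
   "b' \<in> polyfuns" "b' (phi x) \<noteq> 0" "\<And>y. y \<in> U ==> b' (phi y) \<noteq> 0 ==> y \<in> W" by blast
  ultimately show "chart_fraction C V x f" using U W(4)
   by (intro exI[of _ U] exI[of _ phi] exI[of _ "\<lambda>z. a z * b' z"] exI[of _ "\<lambda>z. b z * b' z"])
     (auto intro: polyfuns.mult)
 qed
next
 fix V f assume V: "openin (vtop (glue C)) V" and f: "f \<in> vreg (glue C) V"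
 show "openin (vtop (glue C)) {x \<in> V. f x \<noteq> 0}"
 proof (subst openin_subopen, safe)
  fix x assume x: "x \<in> V" "f x \<noteq> 0"
  then obtain U phi where U: "(U, phi) \<in> C" "x \<in> U" using f unfolding glue_def by auto
  from glue_regular_chart[OF C f x(1) U] obtain a b where ab:
   "a \<in> polyfuns" "b \<in> polyfuns" "b (phi x) \<noteq> 0"
   "\<And>y. y \<in> V ==> y \<in> U ==> b (phi y) \<noteq> 0 ==> f y = a (phi y) / b (phi y)" by blast
  have "openin (vtop (glue C)) (V \<inter> {x \<in> U. (\<lambda>z. a z * b z) (phi x) \<noteq> 0})"
   by (intro openin_Int V glue_basic_open U polyfuns.mult ab)
  then show "\<exists>T. openin (vtop (glue C)) T \<and> x \<in> T \<and> T \<subseteq> {x \<in> V. f x \<noteq> 0}"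
   using x ab U by (intro exI[of _ "V \<inter> {x \<in> U. (\<lambda>z. a z * b z) (phi x) \<noteq> 0}"]) auto
 qed
qed

lemma points_subvariety: "points (subvariety X Z) = points X \<inter> Z"
 by (simp add: subvariety_def)

lemma openin_subvariety:
 "openin (vtop (subvariety X Z)) V \<longleftrightarrow> (\<exists>W. openin (vtop X) W \<and> V = W \<inter> Z)"
 by (auto simp: subvariety_def openin_subtopology)

abbreviation locally_regular :: "'a variety => 'a set => 'a => ('a => complex) => bool" where
 "locally_regular X V x f \<equiv>
  \<exists>U h. openin (vtop X) U \<and> x \<in> U \<and> h \<in> vreg X U \<and> (\<forall>y\<in>U \<inter> V. f y = h y)"

lemma vreg_subvariety: "f \<in> vreg (subvariety X Z) V \<longleftrightarrow> (\<forall>x\<in>V. locally_regular X V x f)"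
 by (simp add: subvariety_def)

lemma vreg_subvarietyE:
 assumes "f \<in> vreg (subvariety X Z) V" "x \<in> V"
 obtains U h where "openin (vtop X) U" "x \<in> U" "h \<in> vreg X U" "\<forall>y\<in>U \<inter> V. f y = h y"
 using assms(1)[unfolded vreg_subvariety, rule_format, OF assms(2)] that by (elim exE conjE) auto

lemma function_variety_subvariety:
 assumes "function_variety X"
 shows "function_variety (subvariety X Z)"
proof -
 interpret function_variety X by fact
 show ?thesis
 proof
  fix V :: "'a set" and c :: complex
  assume "V \<subseteq> points (subvariety X Z)"
  then show "(\<lambda>_. c) \<in> vreg (subvariety X Z) V"
   unfolding vreg_subvariety points_subvariety
   by (intro ballI exI[of _ "points X"] exI[of _ "\<lambda>_. c"]) (auto intro: reg_const)
 next
  fix V f g assume f: "f \<in> vreg (subvariety X Z) V" and g: "g \<in> vreg (subvariety X Z) V"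
  show "(\<lambda>t. f t * g t) \<in> vreg (subvariety X Z) V"
   unfolding vreg_subvariety
  proof
   fix x assume x: "x \<in> V"
   from f x obtain U h where "openin (vtop X) U" "x \<in> U" "h \<in> vreg X U" "\<forall>y\<in>U \<inter> V. f y = h y"
    unfolding vreg_subvariety by blast
   moreover from g x obtain U' h' where "openin (vtop X) U'" "x \<in> U'" "h' \<in> vreg X U'"
    "\<forall>y\<in>U' \<inter> V. g y = h' y" unfolding vreg_subvariety by blast
   ultimately show "locally_regular X V x (\<lambda>y. f y * g y)"
    by (intro exI[of _ "U \<inter> U'"] exI[of _ "\<lambda>t. h t * h' t"])
      (auto intro!: reg_mult intro: reg_subset)
  qed
 next
  fix V f assume f: "f \<in> vreg (subvariety X Z) V" and nz: "\<And>t. t \<in> V ==> f t \<noteq> 0"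
  show "(\<lambda>t. inverse (f t)) \<in> vreg (subvariety X Z) V"
   unfolding vreg_subvariety
  proof
   fix x assume x: "x \<in> V"
   from f x obtain U h where "openin (vtop X) U" "x \<in> U" "h \<in> vreg X U" "\<forall>y\<in>U \<inter> V. f y = h y"
    unfolding vreg_subvariety by blast
   then show "locally_regular X V x (\<lambda>y. inverse (f y))"
    using nz[OF x] x
    by (intro exI[of _ "{x \<in> U. h x \<noteq> 0}"] exI[of _ "\<lambda>t. inverse (h t)"])
      (auto intro!: reg_nonzero_open reg_inverse intro: reg_subset)
  qed
 next
  fix V V' f assume "f \<in> vreg (subvariety X Z) V" "V' \<subseteq> V"
  then have "locally_regular X V x f"
   if "x \<in> V'" for x using that unfolding vreg_subvariety by (simp add: subset_iff)
  then show "f \<in> vreg (subvariety X Z) V'"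
   unfolding vreg_subvariety using \<open>V' \<subseteq> V\<close> by (intro ballI) (fastforce elim!: ex_forward)
 next
  fix V f
  assume *: "\<And>x. x \<in> V ==> \<exists>W h. openin (vtop (subvariety X Z)) W \<and> x \<in> W \<and>
   h \<in> vreg (subvariety X Z) (W \<inter> V) \<and> (\<forall>y\<in>W \<inter> V. f y = h y)"
  show "f \<in> vreg (subvariety X Z) V"
   unfolding vreg_subvariety
  proof
   fix x assume x: "x \<in> V"
   from *[OF x] obtain W h where W: "openin (vtop X) W" "x \<in> W \<inter> Z"
    "h \<in> vreg (subvariety X Z) (W \<inter> Z \<inter> V)" "\<forall>y\<in>W \<inter> Z \<inter> V. f y = h y"
    unfolding openin_subvariety by auto
   have "x \<in> W \<inter> Z \<inter> V" using x W(2) by simp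
   obtain U k where U: "openin (vtop X) U" "x \<in> U"
    "k \<in> vreg X U" "\<forall>y\<in>U \<inter> (W \<inter> Z \<inter> V). h y = k y"
    by (rule vreg_subvarietyE[OF W(3) \<open>x \<in> W \<inter> Z \<inter> V\<close>])
   \<comment> \<open>The local data agree with regular functions only on \<open>Z\<close>, whereas
     \<open>locally_regular\<close> compares on ambient open sets; every point of \<open>V\<close>
     lies in an open set of the subvariety, hence in \<open>Z\<close>.\<close>
   have "V \<subseteq> Z"
   proof
    fix y assume "y \<in> V"
    from *[OF this] obtain W' where "openin (vtop (subvariety X Z)) W'" "y \<in> W'" by (elim exE conjE)
    then show "y \<in> Z" by (auto simp: openin_subvariety)
   qed
   with U W show "locally_regular X V x f"
    by (intro exI[of _ "U \<inter> W"] exI[of _ k]) (auto intro: reg_subset)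
  qed
 next
  fix V f assume V: "openin (vtop (subvariety X Z)) V" and f: "f \<in> vreg (subvariety X Z) V"
  show "openin (vtop (subvariety X Z)) {x \<in> V. f x \<noteq> 0}"
  proof (subst openin_subopen, safe)
   fix x assume x: "x \<in> V" "f x \<noteq> 0"
   with f obtain U h where U: "openin (vtop X) U" "x \<in> U" "h \<in> vreg X U" "\<forall>y\<in>U \<inter> V. f y = h y"
    unfolding vreg_subvariety by blast
   from V obtain W where W: "openin (vtop X) W" "V = W \<inter> Z" unfolding openin_subvariety by blast
   have "openin (vtop (subvariety X Z)) ({x \<in> U. h x \<noteq> 0} \<inter> W \<inter> Z)"
    unfolding openin_subvariety
    by (intro exI[of _ "{x \<in> U. h x \<noteq> 0} \<inter> W"] conjI openin_Int reg_nonzero_open U W refl)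
   then show "\<exists>T. openin (vtop (subvariety X Z)) T \<and> x \<in> T \<and> T \<subseteq> {x \<in> V. f x \<noteq> 0}"
    using x U W by (intro exI[of _ "{x \<in> U. h x \<noteq> 0} \<inter> W \<inter> Z"]) auto
  qed
 qed
qed

section \<open>Cocycles, their tensor products and the group structure on isomorphism
  classes\<close>

lemma line_bundlesI:
 assumes "\<And>x. x \<in> points X ==> openin (vtop X) (fst L x)" "\<And>x. x \<in> points X ==> x \<in> fst L x"
  and "\<And>x y. x \<in> points X ==> y \<in> points X ==> snd L x y \<in> unit_functions X (fst L x \<inter> fst L y)"
  and "\<And>x y z t. x \<in> points X ==> y \<in> points X ==> z \<in> points X ==>
   t \<in> fst L x ==> t \<in> fst L y ==> t \<in> fst L z ==> snd L x y t * snd L y z t = snd L x z t"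
 shows "L \<in> line_bundles X"
 using assms by (simp add: line_bundles_def split_def)

lemma line_bundlesD:
 assumes "L \<in> line_bundles X"
 shows lb_open: "x \<in> points X ==> openin (vtop X) (fst L x)"
  and lb_mem: "x \<in> points X ==> x \<in> fst L x"
  and lb_unit: "x \<in> points X ==> y \<in> points X ==> snd L x y \<in> unit_functions X (fst L x \<inter> fst L y)"
  and lb_cocycle: "x \<in> points X ==> y \<in> points X ==> z \<in> points X ==>
   t \<in> fst L x ==> t \<in> fst L y ==> t \<in> fst L z ==> snd L x y t * snd L y z t = snd L x z t"
 using assms by (simp_all add: line_bundles_def split_def)

lemma lb_nonzero:
 assumes "L \<in> line_bundles X" "x \<in> points X" "y \<in> points X" "t \<in> fst L x" "t \<in> fst L y"
 shows "snd L x y t \<noteq> 0"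
 using lb_unit[OF assms(1-3)] assms(4,5) by (auto simp: unit_functions_def)

lemma lb_subset_points:
 assumes "L \<in> line_bundles X" "x \<in> points X"
 shows "fst L x \<subseteq> points X"
 using lb_open[OF assms] by (rule openin_subset)

lemma bundle_isoI:
 assumes "L \<in> line_bundles X" "M \<in> line_bundles X"
  and "\<And>x. x \<in> points X ==> openin (vtop X) (W x)" "\<And>x. x \<in> points X ==> x \<in> W x"
  and "\<And>x. x \<in> points X ==> W x \<subseteq> fst L x \<inter> fst M x"
  and "\<And>x. x \<in> points X ==> a x \<in> unit_functions X (W x)"
  and "\<And>x y t. x \<in> points X ==> y \<in> points X ==> t \<in> W x ==> t \<in> W y ==>
   snd L x y t * a y t = a x t * snd M x y t"
 shows "(L, M) \<in> bundle_iso X"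
 using assms unfolding bundle_iso_def split_def mem_Collect_eq fst_conv snd_conv
 by (intro conjI exI[of _ W] exI[of _ a] ballI) auto

definition bundle_iso_by ::
 "'a variety => 'a cocycle => 'a cocycle => ('a => 'a set) => ('a => 'a => complex) => bool" where
 "bundle_iso_by X L M W a \<longleftrightarrow>
  (\<forall>x\<in>points X. openin (vtop X) (W x) \<and> x \<in> W x \<and> W x \<subseteq> fst L x \<inter> fst M x \<and>
   a x \<in> unit_functions X (W x)) \<and>
  (\<forall>x\<in>points X. \<forall>y\<in>points X. \<forall>t\<in>W x \<inter> W y. snd L x y t * a y t = a x t * snd M x y t)"

lemma bundle_iso_byD:
 assumes "bundle_iso_by X L M W a"
 shows "\<forall>x\<in>points X. openin (vtop X) (W x) \<and> x \<in> W x \<and> W x \<subseteq> fst L x \<inter> fst M x \<and>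
   a x \<in> unit_functions X (W x)"
  and "\<forall>x\<in>points X. \<forall>y\<in>points X. \<forall>t\<in>W x \<inter> W y. snd L x y t * a y t = a x t * snd M x y t"
 using assms unfolding bundle_iso_by_def by blast+

lemma bundle_isoE:
 assumes "(L, M) \<in> bundle_iso X"
 obtains W a where "bundle_iso_by X L M W a"
 using assms unfolding bundle_iso_def split_def mem_Collect_eq fst_conv snd_conv
 by (elim conjE exE) (rule that[unfolded bundle_iso_by_def, OF conjI])

lemma bundle_iso_line_bundles:
 "(L, M) \<in> bundle_iso X ==> L \<in> line_bundles X" "(L, M) \<in> bundle_iso X ==> M \<in> line_bundles X"
 by (auto simp: bundle_iso_def)

definition dual :: "'a cocycle => 'a cocycle" where
 "dual L = (fst L, \<lambda>x y t. inverse (snd L x y t))"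

lemma fst_dual [simp]: "fst (dual L) = fst L"
 and snd_dual [simp]: "snd (dual L) = (\<lambda>x y t. inverse (snd L x y t))"
 and fst_tensor [simp]: "fst (tensor L M) = (\<lambda>x. fst L x \<inter> fst M x)"
 and snd_tensor [simp]: "snd (tensor L M) = (\<lambda>x y t. snd L x y t * snd M x y t)"
 by (simp_all add: dual_def tensor_def)

lemma fst_trivial_bundle [simp]: "fst (trivial_bundle X) = (\<lambda>_. points X)"
 and snd_trivial_bundle [simp]: "snd (trivial_bundle X) = (\<lambda>_ _ _. 1)"
 by (simp_all add: trivial_bundle_def)

lemma commuting_square_compose:
 fixes p q r :: complex
 assumes "p * a = b * q" "q * c = d * r"
 shows "p * (a * c) = b * d * r"
 using assms by (metis mult.assoc)

lemma commuting_square_mult: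
 fixes p q p' q' :: complex
 assumes "p * a = b * q" "p' * a' = b' * q'"
 shows "p * p' * (a * a') = b * b' * (q * q')"
proof -
 have "p * p' * (a * a') = (p * a) * (p' * a')" by (simp add: mult_ac)
 then show ?thesis unfolding assms by (simp add: mult_ac)
qed

abbreviation bundle_class :: "'a variety => 'a cocycle => 'a cocycle set" where
 "bundle_class X L \<equiv> bundle_iso X `` {L}"

context function_variety
begin

lemma unit_mult:
 "f \<in> unit_functions X V ==> g \<in> unit_functions X V ==> (\<lambda>t. f t * g t) \<in> unit_functions X V"
 by (auto simp: unit_functions_def intro: reg_mult)

lemma unit_inverse:
 "f \<in> unit_functions X V ==> (\<lambda>t. inverse (f t)) \<in> unit_functions X V"
 by (auto simp: unit_functions_def intro: reg_inverse)

lemma unit_subset: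
 "f \<in> unit_functions X V ==> V' \<subseteq> V ==> f \<in> unit_functions X V'"
 by (auto simp: unit_functions_def intro: reg_subset)

lemma unit_one: "V \<subseteq> points X ==> (\<lambda>_. 1) \<in> unit_functions X V"
 by (auto simp: unit_functions_def intro: reg_const)

lemma dual_line_bundle: "L \<in> line_bundles X ==> dual L \<in> line_bundles X"
 by (rule line_bundlesI)
   (simp_all add: lb_open lb_mem unit_inverse lb_unit lb_cocycle flip: inverse_mult_distrib)

lemma tensor_line_bundle:
 assumes "L \<in> line_bundles X" "M \<in> line_bundles X"
 shows "tensor L M \<in> line_bundles X"
proof (rule line_bundlesI)
 fix x y assume "x \<in> points X" "y \<in> points X"
 then show "snd (tensor L M) x y \<in> unit_functions X (fst (tensor L M) x \<inter> fst (tensor L M) y)"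
  by (auto intro!: unit_mult unit_subset[OF lb_unit[OF assms(1)]] unit_subset[OF lb_unit[OF assms(2)]])
next
 fix x y z t
 assume *: "x \<in> points X" "y \<in> points X" "z \<in> points X" "t \<in> fst (tensor L M) x"
  "t \<in> fst (tensor L M) y" "t \<in> fst (tensor L M) z"
 then show "snd (tensor L M) x y t * snd (tensor L M) y z t = snd (tensor L M) x z t"
  using lb_cocycle[OF assms(1), of x y z t] lb_cocycle[OF assms(2), of x y z t]
  by (simp add: mult_ac flip: mult.assoc[of "snd L x z t"])
qed (use assms in \<open>auto simp: lb_open lb_mem\<close>)

lemma trivial_line_bundle: "trivial_bundle X \<in> line_bundles X"
 by (rule line_bundlesI) (auto intro!: unit_one)

lemma equiv_bundle_iso: "equiv (line_bundles X) (bundle_iso X)"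
proof (rule equivI)
 show "bundle_iso X \<subseteq> line_bundles X \<times> line_bundles X"
  by (auto intro: bundle_iso_line_bundles)
 show "refl_on (line_bundles X) (bundle_iso X)"
 proof (rule refl_onI)
  fix L assume L: "L \<in> line_bundles X"
  show "(L, L) \<in> bundle_iso X"
   by (rule bundle_isoI[OF L L, of "fst L" "\<lambda>_ _. 1"])
     (use L lb_subset_points[OF L] in \<open>auto simp: lb_open lb_mem intro!: unit_one\<close>)
 qed
 show "sym (bundle_iso X)"
 proof (rule symI)
  fix L M assume LM: "(L, M) \<in> bundle_iso X"
  obtain W a where "bundle_iso_by X L M W a" by (rule bundle_isoE[OF LM])
  note W = bundle_iso_byD(1)[OF this] and a = bundle_iso_byD(2)[OF this]
  show "(M, L) \<in> bundle_iso X"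
  proof (rule bundle_isoI[of _ _ _ W "\<lambda>x t. inverse (a x t)"])
   fix x y t assume *: "x \<in> points X" "y \<in> points X" "t \<in> W x" "t \<in> W y"
   then have "a x t \<noteq> 0" "a y t \<noteq> 0" using W by (auto simp: unit_functions_def)
   moreover have "snd L x y t * a y t = a x t * snd M x y t" using a * by blast
   ultimately show "snd M x y t * inverse (a y t) = inverse (a x t) * snd L x y t"
    by (simp add: field_simps)
  qed (use W bundle_iso_line_bundles[OF LM] in \<open>auto intro: unit_inverse\<close>)
 qed
 show "trans (bundle_iso X)"
 proof (rule transI)
  fix L M K assume LM: "(L, M) \<in> bundle_iso X" and MK: "(M, K) \<in> bundle_iso X"
  obtain W a where "bundle_iso_by X L M W a" by (rule bundle_isoE[OF LM])
  note W = bundle_iso_byD(1)[OF this] and a = bundle_iso_byD(2)[OF this]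
  obtain V b where "bundle_iso_by X M K V b" by (rule bundle_isoE[OF MK])
  note V = bundle_iso_byD(1)[OF this] and b = bundle_iso_byD(2)[OF this]
  show "(L, K) \<in> bundle_iso X"
  proof (rule bundle_isoI[of _ _ _ "\<lambda>x. W x \<inter> V x" "\<lambda>x t. a x t * b x t"])
   fix x y t assume *: "x \<in> points X" "y \<in> points X" "t \<in> W x \<inter> V x" "t \<in> W y \<inter> V y"
   then have "snd L x y t * a y t = a x t * snd M x y t"
    "snd M x y t * b y t = b x t * snd K x y t" using a b by auto
   then show "snd L x y t * (a y t * b y t) = a x t * b x t * snd K x y t"
    by (rule commuting_square_compose)
  next
   fix x assume "x \<in> points X"
   with W V show "(\<lambda>t. a x t * b x t) \<in> unit_functions X (W x \<inter> V x)"
    by (intro unit_mult) (auto intro: unit_subset)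
  qed (use W V bundle_iso_line_bundles[OF LM] bundle_iso_line_bundles[OF MK] in auto)
 qed
qed

lemma bundle_iso_refl: "L \<in> line_bundles X ==> (L, L) \<in> bundle_iso X"
 using equiv_bundle_iso by (auto elim!: equivE simp: refl_on_def)

lemma bundle_class_eqI: "(L, M) \<in> bundle_iso X ==> bundle_class X L = bundle_class X M"
 by (rule equiv_class_eq[OF equiv_bundle_iso])

lemma tensor_iso:
 assumes LM: "(L, M) \<in> bundle_iso X" and LM': "(L', M') \<in> bundle_iso X"
 shows "(tensor L L', tensor M M') \<in> bundle_iso X"
proof -
 obtain W a where "bundle_iso_by X L M W a" by (rule bundle_isoE[OF LM])
  note W = bundle_iso_byD(1)[OF this] and a = bundle_iso_byD(2)[OF this]
 obtain V b where "bundle_iso_by X L' M' V b" by (rule bundle_isoE[OF LM'])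
  note V = bundle_iso_byD(1)[OF this] and b = bundle_iso_byD(2)[OF this]
 show ?thesis
 proof (rule bundle_isoI[of _ _ _ "\<lambda>x. W x \<inter> V x" "\<lambda>x t. a x t * b x t"])
  fix x y t assume *: "x \<in> points X" "y \<in> points X" "t \<in> W x \<inter> V x" "t \<in> W y \<inter> V y"
  have "snd L x y t * a y t = a x t * snd M x y t" by (rule a[rule_format]) (use * in auto)
  moreover have "snd L' x y t * b y t = b x t * snd M' x y t"
   by (rule b[rule_format]) (use * in auto)
  ultimately show "snd (tensor L L') x y t * (a y t * b y t) = a x t * b x t * snd (tensor M M') x y t"
   unfolding snd_tensor by (rule commuting_square_mult)
 next
  fix x assume "x \<in> points X"
  with W V show "(\<lambda>t. a x t * b x t) \<in> unit_functions X (W x \<inter> V x)"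
   by (intro unit_mult) (auto intro: unit_subset)
 next
  fix x assume "x \<in> points X"
  then show "W x \<inter> V x \<subseteq> fst (tensor L L') x \<inter> fst (tensor M M') x" using W V by auto
 qed (use W V bundle_iso_line_bundles[OF LM] bundle_iso_line_bundles[OF LM']
    in \<open>auto intro: tensor_line_bundle\<close>)
qed

lemma Pic_carrierI: "L \<in> line_bundles X ==> bundle_class X L \<in> carrier (Pic X)"
 by (simp add: Pic_def quotientI)

lemma Pic_carrierE:
 assumes "c \<in> carrier (Pic X)"
 obtains L where "L \<in> line_bundles X" "c = bundle_class X L"
 using assms by (auto simp: Pic_def elim: quotientE)

lemma Pic_mult:
 assumes L: "L \<in> line_bundles X" and M: "M \<in> line_bundles X"
 shows "bundle_class X L \<otimes>\<^bsub>Pic X\<^esub> bundle_class X M = bundle_class X (tensor L M)"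
proof -
 have "bundle_class X (tensor L' M') = bundle_class X (tensor L M)"
  if "(L, L') \<in> bundle_iso X" "(M, M') \<in> bundle_iso X" for L' M'
  using bundle_class_eqI[OF tensor_iso[OF that]] by simp
 then have "(\<Union>L'\<in>bundle_class X L. \<Union>M'\<in>bundle_class X M. bundle_class X (tensor L' M')) =
   (\<Union>L'\<in>bundle_class X L. \<Union>M'\<in>bundle_class X M. bundle_class X (tensor L M))"
  by (intro SUP_cong refl) simp
 also have "L \<in> bundle_class X L" "M \<in> bundle_class X M" using bundle_iso_refl L M by simp_all
 then have "(\<Union>L'\<in>bundle_class X L. \<Union>M'\<in>bundle_class X M. bundle_class X (tensor L M)) =
   bundle_class X (tensor L M)" by blast
 finally show ?thesis by (simp add: Pic_def)
qed

lemma Pic_one: "\<one>\<^bsub>Pic X\<^esub> = bundle_class X (trivial_bundle X)"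
 by (simp add: Pic_def)

text \<open>Isomorphic cocycles over the same open sets; this covers associativity and the other
 identities between tensor products.\<close>

lemma bundle_class_cong:
 assumes "L \<in> line_bundles X" "M \<in> line_bundles X"
  and "\<And>x y t. x \<in> points X ==> y \<in> points X ==> t \<in> fst L x ==> t \<in> fst L y ==>
   t \<in> fst M x ==> t \<in> fst M y ==> snd L x y t = snd M x y t"
 shows "bundle_class X L = bundle_class X M"
proof (rule bundle_class_eqI, rule bundle_isoI[of _ _ _ "\<lambda>x. fst L x \<inter> fst M x" "\<lambda>_ _. 1"])
 fix x assume "x \<in> points X"
 then show "(\<lambda>_. 1) \<in> unit_functions X (fst L x \<inter> fst M x)"
  using lb_subset_points[OF assms(1)] by (intro unit_one) auto
qed (use assms in \<open>auto simp: lb_open lb_mem\<close>)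

lemma Pic_comm_group: "comm_group (Pic X)"
proof (rule comm_groupI)
 fix x y assume "x \<in> carrier (Pic X)" "y \<in> carrier (Pic X)"
 then show "x \<otimes>\<^bsub>Pic X\<^esub> y \<in> carrier (Pic X)"
  by (elim Pic_carrierE) (simp add: Pic_mult Pic_carrierI tensor_line_bundle)
next
 show "\<one>\<^bsub>Pic X\<^esub> \<in> carrier (Pic X)"
  by (simp add: Pic_one Pic_carrierI trivial_line_bundle)
next
 fix x y z assume "x \<in> carrier (Pic X)" "y \<in> carrier (Pic X)" "z \<in> carrier (Pic X)"
 then show "x \<otimes>\<^bsub>Pic X\<^esub> y \<otimes>\<^bsub>Pic X\<^esub> z = x \<otimes>\<^bsub>Pic X\<^esub> (y \<otimes>\<^bsub>Pic X\<^esub> z)"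
  by (elim Pic_carrierE) (simp add: Pic_mult tensor_line_bundle, rule bundle_class_cong,
    simp_all add: tensor_line_bundle mult_ac)
next
 fix x y assume "x \<in> carrier (Pic X)" "y \<in> carrier (Pic X)"
 then show "x \<otimes>\<^bsub>Pic X\<^esub> y = y \<otimes>\<^bsub>Pic X\<^esub> x"
  by (elim Pic_carrierE) (simp add: Pic_mult tensor_line_bundle, rule bundle_class_cong,
    simp_all add: tensor_line_bundle mult_ac)
next
 fix x assume "x \<in> carrier (Pic X)"
 then show "\<one>\<^bsub>Pic X\<^esub> \<otimes>\<^bsub>Pic X\<^esub> x = x"
  by (elim Pic_carrierE) (simp add: Pic_one Pic_mult tensor_line_bundle trivial_line_bundle,
    rule bundle_class_cong, simp_all add: tensor_line_bundle trivial_line_bundle)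
next
 fix x assume "x \<in> carrier (Pic X)"
 then obtain L where L: "L \<in> line_bundles X" "x = bundle_class X L" by (rule Pic_carrierE)
 have "bundle_class X (dual L) \<otimes>\<^bsub>Pic X\<^esub> x = \<one>\<^bsub>Pic X\<^esub>"
  unfolding L(2) Pic_one Pic_mult[OF dual_line_bundle[OF L(1)] L(1)] using L(1)
  by (intro bundle_class_cong)
    (auto intro: tensor_line_bundle dual_line_bundle trivial_line_bundle simp: lb_nonzero)
 then show "\<exists>y\<in>carrier (Pic X). y \<otimes>\<^bsub>Pic X\<^esub> x = \<one>\<^bsub>Pic X\<^esub>"
  using L(1) by (blast intro: Pic_carrierI dual_line_bundle)
qed

sublocale Pic: comm_group "Pic X"
 by (rule Pic_comm_group)

lemma Pic_inv:
 assumes L: "L \<in> line_bundles X"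
 shows "inv\<^bsub>Pic X\<^esub> (bundle_class X L) = bundle_class X (dual L)"
proof (rule Pic.inv_equality)
 show "bundle_class X (dual L) \<otimes>\<^bsub>Pic X\<^esub> bundle_class X L = \<one>\<^bsub>Pic X\<^esub>"
  unfolding Pic_one Pic_mult[OF dual_line_bundle[OF L] L] using L
  by (intro bundle_class_cong)
    (auto intro: tensor_line_bundle dual_line_bundle trivial_line_bundle simp: lb_nonzero)
qed (auto intro: Pic_carrierI dual_line_bundle L)

end

section \<open>Pullback of line bundles along morphisms\<close>

lemma morphism_open:
 assumes "morphism Y X f" "openin (vtop X) V"
 shows "openin (vtop Y) {t \<in> points Y. f t \<in> V}"
 using assms by (auto simp: morphism_def continuous_map_def)

lemma morphism_reg:
 assumes "morphism Y X f" "openin (vtop X) V" "h \<in> vreg X V"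
 shows "(\<lambda>t. h (f t)) \<in> vreg Y {t \<in> points Y. f t \<in> V}"
 using assms unfolding morphism_def comp_def by blast

lemma morphism_unit:
 assumes "morphism Y X f" "openin (vtop X) V" "h \<in> unit_functions X V"
 shows "(\<lambda>t. h (f t)) \<in> unit_functions Y {t \<in> points Y. f t \<in> V}"
 using assms morphism_reg[of Y X f V h] by (auto simp: unit_functions_def)

lemma morphism_points:
 assumes "morphism Y X f" "t \<in> points Y"
 shows "f t \<in> points X"
 using assms by (auto simp: morphism_def continuous_map_def)

lemma fst_pullback_cocycle [simp]:
  "fst (pullback_cocycle Y f L) = (\<lambda>y. {t \<in> points Y. f t \<in> fst L (f y)})"
 and snd_pullback_cocycle [simp]:
  "snd (pullback_cocycle Y f L) = (\<lambda>y y' t. snd L (f y) (f y') (f t))"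
 by (simp_all add: pullback_cocycle_def)

lemma pullback_line_bundle:
 assumes "function_variety Y" "morphism Y X f" "L \<in> line_bundles X"
 shows "pullback_cocycle Y f L \<in> line_bundles Y"
proof -
 interpret function_variety Y by fact
 note pts = morphism_points[OF assms(2)]
 show ?thesis
 proof (rule line_bundlesI)
  fix x y assume "x \<in> points Y" "y \<in> points Y"
  with pts have *: "f x \<in> points X" "f y \<in> points X" by auto
  have "(\<lambda>t. snd L (f x) (f y) (f t)) \<in>
    unit_functions Y {t \<in> points Y. f t \<in> fst L (f x) \<inter> fst L (f y)}"
   by (rule morphism_unit[OF assms(2)]) (use * assms(3) in \<open>auto intro: lb_open lb_unit\<close>)
  then show "snd (pullback_cocycle Y f L) x y
   \<in> unit_functions Y (fst (pullback_cocycle Y f L) x \<inter> fst (pullback_cocycle Y f L) y)"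
   by simp (erule unit_subset, auto)
 qed (use pts assms(3) in \<open>auto intro: lb_mem lb_cocycle morphism_open[OF assms(2)] lb_open\<close>)
qed

lemma pullback_iso:
 assumes "function_variety Y" "morphism Y X f" and LM: "(L, M) \<in> bundle_iso X"
 shows "(pullback_cocycle Y f L, pullback_cocycle Y f M) \<in> bundle_iso Y"
proof -
 note pts = morphism_points[OF assms(2)]
 obtain W a where "bundle_iso_by X L M W a" by (rule bundle_isoE[OF LM])
  note W = bundle_iso_byD(1)[OF this] and a = bundle_iso_byD(2)[OF this]
 show ?thesis
 proof (rule bundle_isoI[of _ _ _ "\<lambda>y. {t \<in> points Y. f t \<in> W (f y)}" "\<lambda>y t. a (f y) (f t)"])
  show "pullback_cocycle Y f L \<in> line_bundles Y" "pullback_cocycle Y f M \<in> line_bundles Y"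
   using bundle_iso_line_bundles[OF LM] assms by (auto intro: pullback_line_bundle)
  fix x assume x: "x \<in> points Y"
  show "openin (vtop Y) {t \<in> points Y. f t \<in> W (f x)}"
   using W pts[OF x] by (auto intro: morphism_open[OF assms(2)])
  show "(\<lambda>t. a (f x) (f t)) \<in> unit_functions Y {t \<in> points Y. f t \<in> W (f x)}"
   using W pts[OF x] by (auto intro: morphism_unit[OF assms(2)])
  show "x \<in> {t \<in> points Y. f t \<in> W (f x)}" using x W pts by auto
  show "{t \<in> points Y. f t \<in> W (f x)} \<subseteq>
   fst (pullback_cocycle Y f L) x \<inter> fst (pullback_cocycle Y f M) x" using W pts[OF x] by auto
 next
  fix x y t assume "x \<in> points Y" "y \<in> points Y" "t \<in> {t \<in> points Y. f t \<in> W (f x)}"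
   "t \<in> {t \<in> points Y. f t \<in> W (f y)}"
  then show "snd (pullback_cocycle Y f L) x y t * a (f y) (f t) =
   a (f x) (f t) * snd (pullback_cocycle Y f M) x y t" using a pts by simp
 qed
qed

lemma pullback_bundle_class:
 assumes "function_variety X" "function_variety Y" "morphism Y X f" and L: "L \<in> line_bundles X"
 shows "pullback_class Y f (bundle_class X L) = bundle_class Y (pullback_cocycle Y f L)"
proof -
 have "bundle_class Y (pullback_cocycle Y f M) = bundle_class Y (pullback_cocycle Y f L)"
  if "(L, M) \<in> bundle_iso X" for M
  using function_variety.bundle_class_eqI[OF assms(2) pullback_iso[OF assms(2,3) that]] by simp
 then have "pullback_class Y f (bundle_class X L) =
   (\<Union>M\<in>bundle_class X L. bundle_class Y (pullback_cocycle Y f L))"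
  unfolding pullback_class_def by (intro SUP_cong refl) simp
 also have "L \<in> bundle_class X L" using function_variety.bundle_iso_refl[OF assms(1) L] by simp
 then have "(\<Union>M\<in>bundle_class X L. bundle_class Y (pullback_cocycle Y f L)) =
   bundle_class Y (pullback_cocycle Y f L)" by blast
 finally show ?thesis .
qed

section \<open>Divisor classes\<close>

abbreviation local_equation :: "'a variety => 'a set => 'a set => ('a => complex) => bool" where
 "local_equation X D V s \<equiv> \<forall>W. openin (vtop X) W \<and> W \<subseteq> V -->
  (\<forall>f\<in>vreg X W. (\<forall>t\<in>W \<inter> D. f t = 0) \<longleftrightarrow> (\<exists>h\<in>vreg X W. \<forall>t\<in>W. f t = s t * h t))"

text \<open>Density of the complement of \<open>D\<close> in the form in which it is used: it makes
  quotients by an equation of \<open>D\<close> unique, so that local quotients glue.\<close>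

definition off_dense :: "'a variety => 'a set => bool" where
 "off_dense X D \<longleftrightarrow> (\<forall>V f g. openin (vtop X) V --> f \<in> vreg X V --> g \<in> vreg X V -->
  (\<forall>t\<in>V - D. f t = g t) --> (\<forall>t\<in>V. f t = g t))"

lemma off_denseD:
 assumes "off_dense X D" "openin (vtop X) V" "f \<in> vreg X V" "g \<in> vreg X V"
  "\<And>t. t \<in> V ==> t \<notin> D ==> f t = g t" "t \<in> V"
 shows "f t = g t"
 using assms unfolding off_dense_def by blast

context function_variety
begin

text \<open>Two local quotients agree wherever \<open>s\<close> is nonzero, in particular off
  \<open>D\<close>, and hence on the whole overlap by density. The glued quotient takes at
  \<open>t\<close> the value of the quotient chosen around \<open>t\<close>.\<close>

lemma divisible_glue:
 assumes dense: "off_dense X D" and s: "s \<in> vreg X U" and sD: "\<And>t. t \<in> U ==> t \<notin> D ==> s t \<noteq> 0"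
  and W: "openin (vtop X) W" "W \<subseteq> U"
  and loc: "\<And>x. x \<in> W ==> \<exists>N h. openin (vtop X) N \<and> x \<in> N \<and> N \<subseteq> W \<and> h \<in> vreg X N \<and>
   (\<forall>t\<in>N. f t = s t * h t)"
 shows "\<exists>h\<in>vreg X W. \<forall>t\<in>W. f t = s t * h t"
proof -
 have "\<forall>x\<in>W. \<exists>N h. openin (vtop X) N \<and> x \<in> N \<and> N \<subseteq> W \<and> h \<in> vreg X N \<and> (\<forall>t\<in>N. f t = s t * h t)"
  using loc by blast
 from bchoice[OF this] obtain N where
  "\<forall>x\<in>W. \<exists>h. openin (vtop X) (N x) \<and> x \<in> N x \<and> N x \<subseteq> W \<and> h \<in> vreg X (N x) \<and> (\<forall>t\<in>N x. f t = s t * h t)" ..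
 from bchoice[OF this] obtain h where
  h: "\<forall>x\<in>W. openin (vtop X) (N x) \<and> x \<in> N x \<and> N x \<subseteq> W \<and> h x \<in> vreg X (N x) \<and>
   (\<forall>t\<in>N x. f t = s t * h x t)" ..
 have eq: "h x t = h y t" if "x \<in> W" "y \<in> W" "t \<in> N x" "t \<in> N y" for x y t
 proof (rule off_denseD[OF dense, of "N x \<inter> N y"])
  fix t assume t: "t \<in> N x \<inter> N y" "t \<notin> D"
  have "t \<in> W" "f t = s t * h x t" "f t = s t * h y t" using h[rule_format, OF that(1)] h[rule_format, OF that(2)] t by auto
  moreover have "s t \<noteq> 0" using sD[of t] t \<open>t \<in> W\<close> W(2) by auto
  ultimately show "h x t = h y t" by simp
 qed (use h[rule_format, OF that(1)] h[rule_format, OF that(2)] that in \<open>auto intro: reg_subset\<close>)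
 show ?thesis
 proof (rule bexI)
  show "\<forall>t\<in>W. f t = s t * h t t" using h by auto
  show "(\<lambda>t. h t t) \<in> vreg X W"
  proof (rule reg_local)
   fix x assume x: "x \<in> W"
   note hx = h[rule_format, OF x]
   show "\<exists>V k. openin (vtop X) V \<and> x \<in> V \<and> k \<in> vreg X (V \<inter> W) \<and> (\<forall>y\<in>V \<inter> W. h y y = k y)"
   proof (intro exI[of _ "N x"] exI[of _ "h x"] conjI ballI)
    show "h x \<in> vreg X (N x \<inter> W)" using hx by (auto intro: reg_subset)
    fix y assume "y \<in> N x \<inter> W"
    then show "h y y = h x y" using eq[of y x y] h x by auto
   qed (use hx in auto)
  qed
 qed
qed

text \<open>\<open>divisor_class\<close> collects all bundles with a generating section, so two
  inclusions are needed: a generating section is transported along isomorphisms, and two generating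
  sections differ by a unit. Divisibility is demanded only near points of \<open>D\<close>, since
  \<open>s\<close> is invertible elsewhere.\<close>

lemma divisor_class_eqI:
 assumes dense: "off_dense X D" and L: "L \<in> line_bundles X"
  and s: "\<And>x. x \<in> points X ==> s x \<in> vreg X (fst L x)"
  and s_cocycle: "\<And>x y t. x \<in> points X ==> y \<in> points X ==> t \<in> fst L x ==> t \<in> fst L y ==>
   s x t = snd L x y t * s y t"
  and s_zero: "\<And>x t. x \<in> points X ==> t \<in> fst L x ==> s x t = 0 \<longleftrightarrow> t \<in> D"
  and s_div: "\<And>x t0 W f. x \<in> points X ==> openin (vtop X) W ==> W \<subseteq> fst L x ==> t0 \<in> W ==> t0 \<in> D ==>
   f \<in> vreg X W ==> (\<And>t. t \<in> W ==> t \<in> D ==> f t = 0) ==>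
   \<exists>N h. openin (vtop X) N \<and> t0 \<in> N \<and> N \<subseteq> W \<and> h \<in> vreg X N \<and> (\<forall>t\<in>N. f t = s x t * h t)"
 shows "divisor_class X D = bundle_class X L"
proof (intro equalityI subsetI)
 fix M assume "M \<in> bundle_class X L"
 then have LM: "(L, M) \<in> bundle_iso X" by simp
 have M: "M \<in> line_bundles X" using bundle_iso_line_bundles[OF LM] by simp
 obtain W a where "bundle_iso_by X L M W a" by (rule bundle_isoE[OF LM])
  note W = bundle_iso_byD(1)[OF this] and a = bundle_iso_byD(2)[OF this]
 \<comment> \<open>The isomorphism \<open>a x\<close> lives on \<open>W x\<close>, which can be
   smaller than \<open>fst M x\<close>. So the section is transported at each \<open>t\<close>
   through the trivialisation indexed by \<open>t\<close> itself; \<open>s'_eq\<close> shows that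
   every nearby index gives the same value.\<close>
 define s' where "s' = (\<lambda>x t. snd M x t t * inverse (a t t) * s t t)"
 have mp: "t \<in> points X" if "t \<in> fst M x" "x \<in> points X" for x t
  using lb_subset_points[OF M] that by auto
 have s'_eq: "s' x t = snd M x y t * inverse (a y t) * s y t"
  if "x \<in> points X" "y \<in> points X" "t \<in> fst M x" "t \<in> W y" for x y t
 proof -
  have t: "t \<in> points X" using mp that by blast
  with W that have m: "t \<in> W t" "t \<in> fst L t" "t \<in> fst M t" "t \<in> fst L y" "t \<in> fst M y" by auto
  have nz: "a t t \<noteq> 0" "a y t \<noteq> 0" using W t m that by (auto simp: unit_functions_def)
  have "snd L y t t * a t t = a y t * snd M y t t" using a that t m by auto
  then have Lyt: "snd L y t t = a y t * snd M y t t * inverse (a t t)"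
   using nz by (simp add: divide_simps)
  have "snd M x y t * inverse (a y t) * s y t = snd M x y t * inverse (a y t) * (snd L y t t * s t t)"
   using s_cocycle[of y t t] that t m by simp
  also have "\<dots> = (snd M x y t * snd M y t t) * inverse (a t t) * s t t"
   unfolding Lyt using nz by simp
  also have "snd M x y t * snd M y t t = snd M x t t"
   using lb_cocycle[OF M, of x y t t] that t m by auto
  finally show ?thesis by (simp add: s'_def)
 qed
 have s'_zero: "s' x t = 0 \<longleftrightarrow> t \<in> D" if "x \<in> points X" "t \<in> fst M x" for x t
  using that W mp[of t x] s_zero[of t t] lb_nonzero[OF M, of x t t]
  by (auto simp: s'_def unit_functions_def)
 have s'_loc: "(\<lambda>t. snd M x y t * inverse (a y t)) \<in> unit_functions X (W y \<inter> fst M x)"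
  if "x \<in> points X" "y \<in> points X" for x y
 proof (rule unit_mult)
  show "(\<lambda>t. inverse (a y t)) \<in> unit_functions X (W y \<inter> fst M x)"
   using W that by (intro unit_inverse) (auto intro: unit_subset)
  show "snd M x y \<in> unit_functions X (W y \<inter> fst M x)"
   using lb_unit[OF M that] W that by (auto intro: unit_subset)
 qed
 have s'_reg: "s' x \<in> vreg X (fst M x)" if x: "x \<in> points X" for x
 proof (rule reg_local)
  fix y assume y: "y \<in> fst M x"
  then have yp: "y \<in> points X" using mp x by blast
  have "(\<lambda>t. snd M x y t * inverse (a y t) * s y t) \<in> vreg X (W y \<inter> fst M x)"
   using s'_loc[OF x yp] W yp
   by (intro reg_mult[of "\<lambda>t. snd M x y t * inverse (a y t)"] reg_subset[OF s[OF yp]])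
     (auto simp: unit_functions_def)
  then show "\<exists>V h. openin (vtop X) V \<and> y \<in> V \<and> h \<in> vreg X (V \<inter> fst M x) \<and>
    (\<forall>t\<in>V \<inter> fst M x. s' x t = h t)"
   using W yp s'_eq[OF x yp]
   by (intro exI[of _ "W y"] exI[of _ "\<lambda>t. snd M x y t * inverse (a y t) * s y t"]) auto
 qed
 have div: "(\<forall>t\<in>V \<inter> D. f t = 0) \<longleftrightarrow> (\<exists>h\<in>vreg X V. \<forall>t\<in>V. f t = s' x t * h t)"
  if x: "x \<in> points X" and V: "openin (vtop X) V" "V \<subseteq> fst M x" and f: "f \<in> vreg X V" for x V f
 proof
  assume "\<exists>h\<in>vreg X V. \<forall>t\<in>V. f t = s' x t * h t"
  then show "\<forall>t\<in>V \<inter> D. f t = 0" using s'_zero[OF x] V by auto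
 next
  assume fD: "\<forall>t\<in>V \<inter> D. f t = 0"
  show "\<exists>h\<in>vreg X V. \<forall>t\<in>V. f t = s' x t * h t"
  proof (rule divisible_glue[OF dense s'_reg[OF x] _ V])
   show "s' x t \<noteq> 0" if "t \<in> fst M x" "t \<notin> D" for t using s'_zero[OF x] that by auto
   fix y assume y: "y \<in> V"
   then have yM: "y \<in> fst M x" "y \<in> points X" using V mp x by auto
   show "\<exists>N h. openin (vtop X) N \<and> y \<in> N \<and> N \<subseteq> V \<and> h \<in> vreg X N \<and> (\<forall>t\<in>N. f t = s' x t * h t)"
   proof (cases "y \<in> D")
    case False
    define N where "N = {t \<in> V. s' x t \<noteq> 0}"
    have "s' x \<in> vreg X V" using s'_reg[OF x] V by (auto intro: reg_subset)
    then have N: "openin (vtop X) N" unfolding N_def by (rule reg_nonzero_open[OF V(1)])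
    have "(\<lambda>t. f t * inverse (s' x t)) \<in> vreg X N"
     using f \<open>s' x \<in> vreg X V\<close> by (intro reg_mult reg_inverse) (auto simp: N_def intro: reg_subset)
    then show ?thesis
     using N y False s'_zero[OF x yM(1)]
     by (intro exI[of _ N] exI[of _ "\<lambda>t. f t * inverse (s' x t)"]) (auto simp: N_def)
   next
    case True
    have Wy: "openin (vtop X) (W y)" "y \<in> W y" "W y \<subseteq> fst L y" "W y \<subseteq> fst M y" using W yM by auto
    have "\<exists>N h. openin (vtop X) N \<and> y \<in> N \<and> N \<subseteq> V \<inter> W y \<and> h \<in> vreg X N \<and> (\<forall>t\<in>N. f t = s y t * h t)"
     by (rule s_div[OF yM(2)]) (use V Wy y True f fD in \<open>auto intro: reg_subset\<close>)
    then obtain N h where N: "openin (vtop X) N" "y \<in> N" "N \<subseteq> V \<inter> W y" "h \<in> vreg X N"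
     "\<forall>t\<in>N. f t = s y t * h t" by (elim exE conjE)
    have u: "(\<lambda>t. snd M x y t * inverse (a y t)) \<in> unit_functions X N"
     using s'_loc[OF x yM(2)] by (rule unit_subset) (use N V in auto)
    then have h': "(\<lambda>t. h t * inverse (snd M x y t * inverse (a y t))) \<in> vreg X N"
     using N(4) unit_inverse[OF u] by (auto simp: unit_functions_def intro!: reg_mult)
    have "f t = s' x t * (h t * inverse (snd M x y t * inverse (a y t)))" if t: "t \<in> N" for t
    proof -
     have "s' x t = snd M x y t * inverse (a y t) * s y t"
      using s'_eq[OF x yM(2), of t] t N(3) V by auto
     moreover have "snd M x y t * inverse (a y t) \<noteq> 0" using u t by (auto simp: unit_functions_def)
     ultimately show ?thesis using N(5) t by (simp add: field_simps)
    qed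
    then show ?thesis using N h'
     by (intro exI[of _ N] exI[of _ "\<lambda>t. h t * inverse (snd M x y t * inverse (a y t))"]) auto
   qed
  qed
 qed
 have coc: "s' x t = snd M x y t * s' y t"
  if "x \<in> points X" "y \<in> points X" "t \<in> fst M x" "t \<in> fst M y" for x y t
 proof -
  have t: "t \<in> points X" using mp that by blast
  have "snd M x y t * snd M y t t = snd M x t t"
   using lb_cocycle[OF M, of x y t t] that t lb_mem[OF M t] by auto
  then show ?thesis by (simp add: s'_def mult.assoc[symmetric])
 qed
 show "M \<in> divisor_class X D"
  unfolding divisor_class_def split_def mem_Collect_eq
 proof (intro conjI exI[of _ s'] ballI allI impI)
  fix x V f assume "x \<in> points X" "openin (vtop X) V \<and> V \<subseteq> fst M x" "f \<in> vreg X V"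
  then show "(\<forall>t\<in>V \<inter> D. f t = 0) \<longleftrightarrow> (\<exists>h\<in>vreg X V. \<forall>t\<in>V. f t = s' x t * h t)" 
   by (elim conjE) (rule div)
 next
  fix x y t assume "x \<in> points X" "y \<in> points X" "t \<in> fst M x \<inter> fst M y"
  then show "s' x t = snd M x y t * s' y t" by (elim IntE) (rule coc)
 qed (use M s'_reg in simp_all)
next
 fix M assume "M \<in> divisor_class X D"
 then obtain s' where M': "(fst M, snd M) \<in> line_bundles X"
  and s'_reg: "\<forall>x\<in>points X. s' x \<in> vreg X (fst M x)"
  and s'_cocycle: "\<forall>x\<in>points X. \<forall>y\<in>points X. \<forall>t\<in>fst M x \<inter> fst M y. s' x t = snd M x y t * s' y t"
  and s'_div: "\<forall>x\<in>points X. local_equation X D (fst M x) (s' x)"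
  unfolding divisor_class_def split_def mem_Collect_eq by (elim conjE exE)
 have M: "M \<in> line_bundles X" using M' by simp
 define W where "W = (\<lambda>x. fst L x \<inter> fst M x)"
 have W: "openin (vtop X) (W x)" "x \<in> W x" "W x \<subseteq> fst L x" "W x \<subseteq> fst M x" if "x \<in> points X" for x
  using lb_open[OF L that] lb_open[OF M that] lb_mem[OF L that] lb_mem[OF M that]
  by (auto simp: W_def)
 have div: "(\<forall>t\<in>V \<inter> D. f t = 0) \<longleftrightarrow> (\<exists>h\<in>vreg X V. \<forall>t\<in>V. f t = s' x t * h t)"
  if "x \<in> points X" "openin (vtop X) V" "V \<subseteq> fst M x" "f \<in> vreg X V" for x V f
  using s'_div[rule_format, OF that(1) conjI[OF that(2,3)] that(4)] .
 have s'D: "s' x t = 0" if "x \<in> points X" "t \<in> W x" "t \<in> D" for x t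
 proof -
  have "s' x \<in> vreg X (W x)"
   using s'_reg that W[OF that(1)] by (auto intro: reg_subset)
  moreover have "(\<lambda>_. 1) \<in> vreg X (W x)"
   using W[OF that(1)] openin_subset by (intro reg_const) blast
  then have "\<exists>h\<in>vreg X (W x). \<forall>t\<in>W x. s' x t = s' x t * h t" by (intro bexI[of _ "\<lambda>_. 1"]) auto
  ultimately have "\<forall>t\<in>W x \<inter> D. s' x t = 0" using div[OF that(1) W(1,4)[OF that(1)]] by blast
  then show ?thesis using that by blast
 qed
 \<comment> \<open>Both sections generate the ideal of \<open>D\<close>, so each divides the other;
   the quotients are inverse to each other off \<open>D\<close>, hence everywhere by density, and
   \<open>b\<close> becomes the isomorphism.\<close>
 have "\<exists>b b'. b \<in> vreg X (W x) \<and> b' \<in> vreg X (W x) \<and>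
   (\<forall>t\<in>W x. s x t = s' x t * b t \<and> s' x t = s x t * b' t)" if x: "x \<in> points X" for x
 proof -
  have sW: "s x \<in> vreg X (W x)" "s' x \<in> vreg X (W x)"
   using s[OF x] s'_reg x W[OF x] by (auto intro: reg_subset)
  have "\<forall>t\<in>W x \<inter> D. s x t = 0" using s_zero[OF x] W[OF x] by auto
  then obtain b where b: "b \<in> vreg X (W x)" "\<forall>t\<in>W x. s x t = s' x t * b t"
   using div[OF x W(1,4)[OF x] sW(1)] by blast
  have "\<exists>b'\<in>vreg X (W x). \<forall>t\<in>W x. s' x t = s x t * b' t"
  proof (rule divisible_glue[OF dense s[OF x]])
   fix y assume y: "y \<in> W x"
   show "\<exists>N h. openin (vtop X) N \<and> y \<in> N \<and> N \<subseteq> W x \<and> h \<in> vreg X N \<and> (\<forall>t\<in>N. s' x t = s x t * h t)"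
   proof (cases "y \<in> D")
    case True
    show ?thesis by (rule s_div[OF x]) (use W[OF x] y True sW s'D[OF x] in auto)
   next
    case False
    define N where "N = {t \<in> W x. s x t \<noteq> 0}"
    have N: "openin (vtop X) N" unfolding N_def by (rule reg_nonzero_open[OF W(1)[OF x] sW(1)])
    have "(\<lambda>t. s' x t * inverse (s x t)) \<in> vreg X N"
     using sW by (intro reg_mult reg_inverse) (auto simp: N_def intro: reg_subset)
    then show ?thesis
     using N y False s_zero[OF x, of y] W[OF x]
     by (intro exI[of _ N] exI[of _ "\<lambda>t. s' x t * inverse (s x t)"]) (auto simp: N_def)
   qed
  qed (use s_zero[OF x] W[OF x] in auto)
  with b show ?thesis by blast
 qed
 then have "\<forall>x\<in>points X. \<exists>b b'. b \<in> vreg X (W x) \<and> b' \<in> vreg X (W x) \<and>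
   (\<forall>t\<in>W x. s x t = s' x t * b t \<and> s' x t = s x t * b' t)" by blast
 from bchoice[OF this] obtain b where "\<forall>x\<in>points X. \<exists>b'. b x \<in> vreg X (W x) \<and> b' \<in> vreg X (W x) \<and>
   (\<forall>t\<in>W x. s x t = s' x t * b x t \<and> s' x t = s x t * b' t)" ..
 from bchoice[OF this] obtain b' where b: "\<forall>x\<in>points X. b x \<in> vreg X (W x) \<and> b' x \<in> vreg X (W x) \<and>
   (\<forall>t\<in>W x. s x t = s' x t * b x t \<and> s' x t = s x t * b' x t)" ..
 have bs: "s x t = s' x t * b x t" "s' x t = s x t * b' x t" if "x \<in> points X" "t \<in> W x" for x t
  using b[rule_format, OF that(1)] that(2) by blast+
 have bb: "b x t * b' x t = 1" if x: "x \<in> points X" "t \<in> W x" for x t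
 proof (rule off_denseD[OF dense, of "W x" "\<lambda>t. b x t * b' x t" "\<lambda>_. 1"])
  fix t assume t: "t \<in> W x" "t \<notin> D"
  then have "s x t \<noteq> 0" using s_zero[OF x(1), of t] W[OF x(1)] by auto
  moreover have "s x t * (b x t * b' x t) = s x t * 1"
   using bs[OF x(1) t(1)] by (metis mult.assoc mult.commute mult_1_right)
  ultimately show "b x t * b' x t = 1" by simp
 next
  show "(\<lambda>_. 1) \<in> vreg X (W x)" using W[OF x(1)] openin_subset by (intro reg_const) blast
 qed (use b W[OF x(1)] x in \<open>auto intro: reg_mult\<close>)
 have "(L, M) \<in> bundle_iso X"
 proof (rule bundle_isoI[OF L M, of W b])
  fix x assume x: "x \<in> points X"
  show "b x \<in> unit_functions X (W x)"
   unfolding unit_functions_def mem_Collect_eq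
  proof (intro conjI ballI notI)
   show "b x \<in> vreg X (W x)" using b x by blast
   fix t assume "t \<in> W x" "b x t = 0"
   then show False using bb[OF x, of t] by simp
  qed
  show "W x \<subseteq> fst L x \<inter> fst M x" by (simp add: W_def)
 next
  fix x y t assume *: "x \<in> points X" "y \<in> points X" "t \<in> W x" "t \<in> W y"
  show "snd L x y t * b y t = b x t * snd M x y t"
  proof (rule off_denseD[OF dense, of "W x \<inter> W y" "\<lambda>t. snd L x y t * b y t" "\<lambda>t. b x t * snd M x y t"])
   fix t assume t: "t \<in> W x \<inter> W y" "t \<notin> D"
   have "s x t \<noteq> 0" using s_zero[OF *(1), of t] W[OF *(1)] t by auto
   have eqs: "s x t = snd L x y t * s y t" "s' x t = snd M x y t * s' y t"
     "s x t = s' x t * b x t" "s y t = s' y t * b y t"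
    using s_cocycle[OF *(1,2), of t] s'_cocycle[rule_format, OF *(1,2), of t] t
     bs(1)[OF *(1)] bs(1)[OF *(2)] by (simp_all add: W_def)
   then have "s' y t \<noteq> 0" using \<open>s x t \<noteq> 0\<close> by (metis mult_zero_left mult_zero_right)
   moreover have "snd L x y t * b y t * s' y t = b x t * snd M x y t * s' y t"
    using eqs by (metis mult.assoc mult.commute)
   ultimately show "snd L x y t * b y t = b x t * snd M x y t" by simp
  next
   have "snd L x y \<in> vreg X (W x \<inter> W y)" "snd M x y \<in> vreg X (W x \<inter> W y)"
    using lb_unit[OF L *(1,2)] lb_unit[OF M *(1,2)]
    by (auto simp: unit_functions_def W_def intro: reg_subset)
   moreover have "b x \<in> vreg X (W x \<inter> W y)" "b y \<in> vreg X (W x \<inter> W y)"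
    using b * by (auto intro: reg_subset)
   ultimately show "(\<lambda>t. snd L x y t * b y t) \<in> vreg X (W x \<inter> W y)"
    "(\<lambda>t. b x t * snd M x y t) \<in> vreg X (W x \<inter> W y)" by (auto intro: reg_mult)
  qed (use W * in auto)
 qed (use W in auto)
 then show "M \<in> bundle_class X L" by simp
qed

end

lemma glue_chart_regular:
 assumes "(U, phi) \<in> C" "V \<subseteq> U" "a \<in> polyfuns" "b \<in> polyfuns"
  and "\<And>y. y \<in> V ==> b (phi y) \<noteq> 0" "\<And>y. y \<in> V ==> f y = a (phi y) / b (phi y)"
 shows "f \<in> vreg (glue C) V"
 by (rule glue_regularI, rule exI[of _ U], rule exI[of _ phi], rule exI[of _ a], rule exI[of _ b])
   (use assms in auto)

text \<open>It suffices that around each point the chart coordinates of the image are fractions in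
  the chart coordinates of the source: substitution then pulls back principal open sets and regular
  functions.\<close>

lemma morphism_glueI:
 assumes C: "compatible_charts C" and D: "compatible_charts D"
  and loc: "\<And>x. x \<in> points (glue C) ==> \<exists>U phi V psi. (U, phi) \<in> C \<and> (V, psi) \<in> D \<and> x \<in> U \<and>
   (\<exists>b\<in>polyfuns. b (phi x) \<noteq> 0 \<and> (\<forall>y\<in>U. b (phi y) \<noteq> 0 --> f y \<in> V) \<and>
    (\<forall>k. \<exists>a\<in>polyfuns. \<forall>y\<in>U. b (phi y) \<noteq> 0 --> psi (f y) k = a (phi y) / b (phi y)))"
 shows "morphism (glue C) (glue D) f"
proof -
 have loc': "\<exists>U phi r a. (U, phi) \<in> C \<and> x \<in> U \<and> r \<in> polyfuns \<and> a \<in> polyfuns \<and> r (phi x) \<noteq> 0 \<and>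
   (\<forall>y\<in>U. r (phi y) \<noteq> 0 --> f y \<in> W \<and> h (f y) = a (phi y) / r (phi y))"
  if x: "x \<in> points (glue C)" and W: "openin (vtop (glue D)) W" "f x \<in> W" "h \<in> vreg (glue D) W" for x W h
 proof -
  from loc[OF x] obtain U phi V psi b where *: "(U, phi) \<in> C" "(V, psi) \<in> D" "x \<in> U"
   "b \<in> polyfuns" "b (phi x) \<noteq> 0" "\<forall>y\<in>U. b (phi y) \<noteq> 0 --> f y \<in> V"
   "\<forall>k. \<exists>a\<in>polyfuns. \<forall>y\<in>U. b (phi y) \<noteq> 0 --> psi (f y) k = a (phi y) / b (phi y)"
   by (elim exE conjE bexE) (rule that; assumption)
  let ?R = "{\<lambda>y. p (phi y) | p. p \<in> polyfuns}"
  have R: "func_ring ?R" by (rule func_ring_compose[OF func_ring_polyfuns])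
  have bR: "(\<lambda>y. b (phi y)) \<in> ?R" using *(4) by blast
  have co: "\<exists>a\<in>?R. \<forall>y\<in>U. b (phi y) \<noteq> 0 --> psi (f y) k = a y / b (phi y)" for k
  proof -
   from *(7) obtain a where "a \<in> polyfuns" "\<forall>y\<in>U. b (phi y) \<noteq> 0 --> psi (f y) k = a (phi y) / b (phi y)"
    by blast
   then show ?thesis by (intro bexI[of _ "\<lambda>y. a (phi y)"]) auto
  qed
  have fV: "f y \<in> V" if "y \<in> U" "b (phi y) \<noteq> 0" for y using *(6) that by blast
  obtain a r where ar: "a \<in> ?R" "r \<in> ?R" "r x \<noteq> 0"
   "\<forall>y\<in>U. r y \<noteq> 0 --> b (phi y) \<noteq> 0 \<and> f y \<in> W \<and> h (f y) = a y / r y"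
   by (rule glue_family_regular[where x = f, OF D *(2) R bR *(3) *(5) fV co W])
  from ar(1,2) obtain a' r' where "a' \<in> polyfuns" "r' \<in> polyfuns" "a = (\<lambda>y. a' (phi y))" "r = (\<lambda>y. r' (phi y))"
   by blast
  then show ?thesis using * ar(3-4)
   by (intro exI[of _ U] exI[of _ phi] exI[of _ r'] exI[of _ a']) auto
 qed
 have maps: "f x \<in> points (glue D)" if "x \<in> points (glue C)" for x
  using loc[OF that] by (force simp: points_glue)
 interpret D: function_variety "glue D" by (rule function_variety_glue[OF D])
 show ?thesis unfolding morphism_def
 proof (intro conjI allI impI)
  show "continuous_map (vtop (glue C)) (vtop (glue D)) f"
   unfolding continuous_map_def
  proof (intro conjI allI impI)
   fix W assume W: "openin (vtop (glue D)) W"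
   \<comment> \<open>The constant function turns the statement about regular functions into the one
     about open sets.\<close>
   have reg: "(\<lambda>_. 1) \<in> vreg (glue D) W" using openin_subset[OF W] by (rule D.reg_const)
   show "openin (vtop (glue C)) {x \<in> points (glue C). f x \<in> W}"
   proof (subst openin_subopen, safe)
    fix x assume x: "x \<in> points (glue C)" "f x \<in> W"
    from loc'[OF x(1) W x(2) reg] obtain U phi r where
     *: "(U, phi) \<in> C" "x \<in> U" "r \<in> polyfuns" "r (phi x) \<noteq> 0" "\<forall>y\<in>U. r (phi y) \<noteq> 0 --> f y \<in> W"
     by blast
    then show "\<exists>T. openin (vtop (glue C)) T \<and> x \<in> T \<and> T \<subseteq> {x \<in> points (glue C). f x \<in> W}"
     using glue_basic_open[OF *(1,3)]
     by (intro exI[of _ "{y \<in> U. r (phi y) \<noteq> 0}"]) (auto simp: points_glue)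
   qed
  qed (use maps in auto)
 next
  fix W h assume W: "openin (vtop (glue D)) W \<and> h \<in> vreg (glue D) W"
  show "h \<circ> f \<in> vreg (glue C) {x \<in> points (glue C). f x \<in> W}"
  proof (rule glue_regularI)
   fix x assume "x \<in> {x \<in> points (glue C). f x \<in> W}"
   then have x: "x \<in> points (glue C)" "f x \<in> W" by auto
   from loc'[OF x(1) conjunct1[OF W] x(2) conjunct2[OF W]] obtain U phi r a where
    *: "(U, phi) \<in> C" "x \<in> U" "r \<in> polyfuns" "a \<in> polyfuns" "r (phi x) \<noteq> 0"
    "\<forall>y\<in>U. r (phi y) \<noteq> 0 --> f y \<in> W \<and> h (f y) = a (phi y) / r (phi y)" by (elim exE conjE)
   then show "\<exists>U phi a b. (U, phi) \<in> C \<and> a \<in> polyfuns \<and> b \<in> polyfuns \<and> x \<in> U \<and> b (phi x) \<noteq> 0 \<and>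
    (\<forall>y\<in>{x \<in> points (glue C). f x \<in> W} \<inter> U. b (phi y) \<noteq> 0 --> (h \<circ> f) y = a (phi y) / b (phi y))"
    by (intro exI[of _ U] exI[of _ phi] exI[of _ a] exI[of _ r]) auto
  qed
 qed
qed

section \<open>Losev--Manin spaces\<close>

lemma permutes_less:
 fixes w :: "nat => nat"
 shows "w permutes {..<n} ==> k < n ==> w k < n"
 using permutes_in_image[of w "{..<n}" k] by simp

abbreviation chain_class :: "nat => marked_chain => marked_chain set" where
 "chain_class n C \<equiv> chain_iso n `` {C}"

lemma chain_isoE:
 assumes "(C, C') \<in> chain_iso n"
 obtains s where "C \<in> marked_chains n" "C' \<in> marked_chains n" "\<forall>i<n. component C' i = component C i \<and>
   s (component C i) \<noteq> 0 \<and> pos C' i = s (component C i) * pos C i"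
 using assms unfolding chain_iso_def by blast

lemma equiv_chain_iso: "equiv (marked_chains n) (chain_iso n)"
proof (rule equivI)
 show "chain_iso n \<subseteq> marked_chains n \<times> marked_chains n" by (auto simp: chain_iso_def)
 show "refl_on (marked_chains n) (chain_iso n)"
  by (auto simp: refl_on_def chain_iso_def intro: exI[of _ "\<lambda>_. 1"])
 show "sym (chain_iso n)"
 proof (rule symI)
  fix C C' assume "(C, C') \<in> chain_iso n"
  then obtain s where "C \<in> marked_chains n" "C' \<in> marked_chains n" "\<forall>i<n. component C' i = component C i \<and>
   s (component C i) \<noteq> 0 \<and> pos C' i = s (component C i) * pos C i" by (rule chain_isoE)
  then show "(C', C) \<in> chain_iso n"
   by (auto simp: chain_iso_def intro!: exI[of _ "\<lambda>c. inverse (s c)"])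
 qed
 show "trans (chain_iso n)"
 proof (rule transI)
  fix C C' C'' assume "(C, C') \<in> chain_iso n" "(C', C'') \<in> chain_iso n"
  from chain_isoE[OF this(1)] chain_isoE[OF this(2)] obtain s s' where
   "C \<in> marked_chains n" "C'' \<in> marked_chains n"
   "\<forall>i<n. component C' i = component C i \<and>
    s (component C i) \<noteq> 0 \<and> pos C' i = s (component C i) * pos C i"
   "\<forall>i<n. component C'' i = component C' i \<and>
    s' (component C' i) \<noteq> 0 \<and> pos C'' i = s' (component C' i) * pos C' i" by metis
  then show "(C, C'') \<in> chain_iso n"
   by (auto simp: chain_iso_def intro!: exI[of _ "\<lambda>c. s' c * s c"])
 qed
qed

lemma chain_class_self: "C \<in> marked_chains n ==> C \<in> chain_class n C"
 by (rule equiv_class_self[OF equiv_chain_iso])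

lemma chain_class_eqI: "(C, C') \<in> chain_iso n ==> chain_class n C = chain_class n C'"
 by (rule equiv_class_eq[OF equiv_chain_iso])

lemma pos_nonzero: "C \<in> marked_chains n ==> i < n ==> pos C i \<noteq> 0"
 by (auto simp: marked_chains_def)

definition chain_rep :: "marked_chain set => marked_chain" where
 "chain_rep P = (SOME C. C \<in> P)"

lemma chain_rep:
 assumes "P \<in> marked_chains n // chain_iso n"
 shows "chain_rep P \<in> P" "chain_rep P \<in> marked_chains n" "chain_class n (chain_rep P) = P"
proof -
 from assms obtain C where C: "C \<in> marked_chains n" "P = chain_class n C" by (auto elim: quotientE)
 then have "C \<in> P" using chain_class_self by blast
 then show r: "chain_rep P \<in> P" unfolding chain_rep_def by (rule someI[where P = "\<lambda>C. C \<in> P"])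
 then have "(C, chain_rep P) \<in> chain_iso n" using C by simp
 then show "chain_rep P \<in> marked_chains n" "chain_class n (chain_rep P) = P"
  using chain_class_eqI[of C "chain_rep P" n] C by (auto simp: chain_iso_def)
qed

lemma chain_class_quotient: "C \<in> marked_chains n ==> chain_class n C \<in> marked_chains n // chain_iso n"
 by (rule quotientI)

lemma chamber_set_iff:
 assumes C: "C \<in> marked_chains n" and w: "w permutes {..<n}"
 shows "chain_class n C \<in> chamber_set n w \<longleftrightarrow>
  (\<forall>k. Suc k < n --> component C (w k) \<le> component C (w (Suc k)))"
proof -
 note wn = permutes_less[OF w]
 have "component C' (w k) = component C (w k)" if "C' \<in> chain_class n C" "k < n" for C' k
  using that wn by (auto simp: chain_iso_def)
 then show ?thesis
  unfolding chamber_set_def mem_Collect_eq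
  using chain_class_quotient[OF C] chain_class_self[OF C] by (metis Suc_lessD)
qed

lemma chamber_mono:
 assumes C: "C \<in> marked_chains n" and w: "w permutes {..<n}" and "chain_class n C \<in> chamber_set n w"
  and "k \<le> l" "l < n"
 shows "component C (w k) \<le> component C (w l)"
 using \<open>k \<le> l\<close> \<open>l < n\<close>
proof (induction l rule: dec_induct)
 case (step l)
 moreover have "component C (w l) \<le> component C (w (Suc l))"
  using assms(3) step unfolding chamber_set_iff[OF C w] by simp
 ultimately show ?case by simp
qed simp

lemma chamber_coord_eq:
 assumes C: "C \<in> marked_chains n" and w: "w permutes {..<n}"
 shows "chamber_coord n w (chain_class n C) k =
  (if Suc k < n \<and> component C (w k) = component C (w (Suc k)) then pos C (w k) / pos C (w (Suc k)) else 0)"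
proof -
 let ?C = "SOME C'. C' \<in> chain_class n C"
 have "?C \<in> chain_class n C" using chain_rep(1)[OF chain_class_quotient[OF C]] by (simp add: chain_rep_def)
 then have "(C, ?C) \<in> chain_iso n" by simp
 then obtain s where s: "\<forall>i<n. component ?C i = component C i \<and>
   s (component C i) \<noteq> 0 \<and> pos ?C i = s (component C i) * pos C i"
  by (rule chain_isoE)
 note wn = permutes_less[OF w]
 show ?thesis unfolding chamber_coord_def Let_def using s wn[of k] wn[of "Suc k"] by auto
qed

text \<open>The ratios telescope as long as no node intervenes. A node makes a factor zero, and
  since components weakly increase along \<open>w\<close> the two end points are then on different
  components.\<close>

lemma chamber_coord_prod:
 assumes C: "C \<in> marked_chains n" and w: "w permutes {..<n}" and ch: "chain_class n C \<in> chamber_set n w"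
  and "k \<le> l" "l < n"
 shows "(\<Prod>s=k..<l. chamber_coord n w (chain_class n C) s) =
  (if component C (w k) = component C (w l) then pos C (w k) / pos C (w l) else 0)"
 using \<open>k \<le> l\<close> \<open>l < n\<close>
proof (induction l rule: dec_induct)
 case base
 then show ?case using pos_nonzero[OF C, of "w k"] permutes_in_image[OF w, of k] by simp
next
 case (step l)
 have m: "component C (w k) \<le> component C (w l)" "component C (w l) \<le> component C (w (Suc l))"
  using chamber_mono[OF C w ch] step by auto
 have "w l < n" using permutes_in_image[OF w, of l] step by simp
 then have "pos C (w l) \<noteq> 0" by (rule pos_nonzero[OF C])
 with m step show ?case by (auto simp: chamber_coord_eq[OF C w])
qed

text \<open>Sorting the marked points by their components gives the permutation.\<close>

lemma ex_chamber:
 assumes C: "C \<in> marked_chains n"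
 obtains w where "w permutes {..<n}" "chain_class n C \<in> chamber_set n w"
proof -
 define xs where "xs = sort_key (component C) [0..<n]"
 have xs: "distinct xs" "set xs = {..<n}" "length xs = n" "sorted (map (component C) xs)"
  unfolding xs_def by (simp_all add: atLeast0LessThan)
 define w where "w = (\<lambda>k. if k < n then xs ! k else k)"
 have "bij_betw w {..<n} {..<n} \<longleftrightarrow> bij_betw ((!) xs) {..<n} {..<n}"
  by (rule bij_betw_cong) (simp add: w_def)
 moreover have "bij_betw ((!) xs) {..<n} {..<n}"
  by (rule bij_betw_nth[OF xs(1)]) (use xs in auto)
 ultimately have "bij_betw w {..<n} {..<n}" by simp
 then have w: "w permutes {..<n}" by (rule bij_imp_permutes) (simp add: w_def)
 have "component C (w k) \<le> component C (w (Suc k))" if "Suc k < n" for k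
  using sorted_nth_mono[OF xs(4), of k "Suc k"] that xs(3) by (simp add: w_def)
 then have "chain_class n C \<in> chamber_set n w" unfolding chamber_set_iff[OF C w] by blast
 with w show thesis by (rule that)
qed

abbreviation LM_charts :: "nat => (marked_chain set set \<times> (marked_chain set => nat => complex)) set" where
 "LM_charts n \<equiv> {(chamber_set n w, chamber_coord n w) | w. w permutes {..<n}}"

lemma chamber_point:
 assumes "P \<in> chamber_set n w"
 obtains C where "C \<in> marked_chains n" "P = chain_class n C"
 using assms by (auto simp: chamber_set_def elim: quotientE)

text \<open>Near \<open>x\<close> only nodes already present in \<open>x\<close> can occur. Two
  chambers containing \<open>x\<close> order its components in the same way and differ only within
  components, where all ratios of positions are invertible.\<close>

lemma compatible_LM_charts: "compatible_charts (LM_charts n)"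
 unfolding compatible_charts_def
proof (intro allI impI)
 fix U phi V psi x
 assume "(U, phi) \<in> LM_charts n" "(V, psi) \<in> LM_charts n" and x: "x \<in> U" "x \<in> V"
 then obtain w w' where w: "w permutes {..<n}" "U = chamber_set n w" "phi = chamber_coord n w"
  and w': "w' permutes {..<n}" "V = chamber_set n w'" "psi = chamber_coord n w'" by auto
 from x w obtain C where C: "C \<in> marked_chains n" "x = chain_class n C" by (auto elim: chamber_point)
 \<comment> \<open>The neighbours along \<open>w\<close> that are not separated by a node in
   \<open>x\<close>; \<open>b\<close> is the product of their coordinates, and
   \<open>b \<noteq> 0\<close> keeps them unseparated in \<open>y\<close>.\<close>
 define S where "S = {s. Suc s < n \<and> component C (w s) = component C (w (Suc s))}"
 have S: "finite S" by (rule finite_subset[of _ "{..<n}"]) (auto simp: S_def)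
 define b :: "(nat => complex) => complex" where "b = (\<lambda>z. \<Prod>s\<in>S. z s)"
 have poly: "(\<lambda>z. \<Prod>s\<in>T. z s) \<in> polyfuns" for T :: "nat set"
  by (rule func_ring_prod[OF func_ring_polyfuns]) (rule polyfuns.coord)
 have win: "w k < n" if "k < n" for k using permutes_in_image[OF w(1), of k] that by simp
 \<comment> \<open>The place in the order \<open>w\<close> of the point standing at place
   \<open>k\<close> of the order \<open>w'\<close>.\<close>
 define ix where "ix = (\<lambda>k. inv_into UNIV w (w' k))"
 have ix: "w (ix k) = w' k" "ix k < n" if "k < n" for k
 proof -
  show "w (ix k) = w' k" by (simp add: ix_def permutes_inverses(1)[OF w(1)])
  then show "ix k < n"
   using permutes_in_image[OF w'(1), of k] permutes_in_image[OF w(1), of "ix k"] that by simp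
 qed
 have xch: "chain_class n C \<in> chamber_set n w" using x w C by simp
 have S_prod: "(\<Prod>s=j..<i. z s) * (\<Prod>s\<in>S - {j..<i}. z s) = b z"
  if "j < i" "i < n" "component C (w j) = component C (w i)" for i j and z :: "nat => complex"
 proof -
  have "{j..<i} \<subseteq> S"
  proof
   fix s assume s: "s \<in> {j..<i}"
   have "component C (w j) \<le> component C (w s)" "component C (w s) \<le> component C (w (Suc s))"
    "component C (w (Suc s)) \<le> component C (w i)"
    using chamber_mono[OF C(1) w(1) xch, of j s] chamber_mono[OF C(1) w(1) xch, of s "Suc s"]
     chamber_mono[OF C(1) w(1) xch, of "Suc s" i] s that by auto
   with that s show "s \<in> S" by (auto simp: S_def)
  qed
  then show ?thesis unfolding b_def by (metis S prod.subset_diff mult.commute)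
 qed
 have same: "component C' (w j) = component C' (w i)"
  if "C' \<in> marked_chains n" "chain_class n C' \<in> U" "b (phi (chain_class n C')) \<noteq> 0"
   "j < i" "i < n" "component C (w j) = component C (w i)" for C' i j
 proof -
  have "(\<Prod>s=j..<i. phi (chain_class n C') s) \<noteq> 0"
   using S_prod[OF that(4-6), of "phi (chain_class n C')"] that(3) by (metis mult_zero_left)
  moreover have "chain_class n C' \<in> chamber_set n w" using that(2) w(2) by simp
  note chamber_coord_prod[OF that(1) w(1) this less_imp_le[OF that(4)] that(5)]
  ultimately show ?thesis unfolding w(3) by metis
 qed
 have ord: "component C (w (ix k)) \<le> component C (w (ix (Suc k)))" if "Suc k < n" for k
  using x w' C chamber_set_iff[OF C(1) w'(1)] that by (simp add: ix)
 show "\<exists>b\<in>polyfuns. b (phi x) \<noteq> 0 \<and> (\<forall>y\<in>U. b (phi y) \<noteq> 0 --> y \<in> V) \<and>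
  (\<forall>k. \<exists>a\<in>polyfuns. \<forall>y\<in>U. b (phi y) \<noteq> 0 --> psi y k = a (phi y) / b (phi y))"
 proof (rule bexI[of _ b], intro conjI allI ballI impI)
  show "b \<in> polyfuns" unfolding b_def by (rule poly)
  show "b (phi x) \<noteq> 0"
   unfolding b_def using S win pos_nonzero[OF C(1)]
   by (auto simp: C(2) w(3) chamber_coord_eq[OF C(1) w(1)] S_def)
 next
  fix y assume y: "y \<in> U" "b (phi y) \<noteq> 0"
  from y(1) w obtain C' where C': "C' \<in> marked_chains n" "y = chain_class n C'"
   by (auto elim: chamber_point)
  have "component C' (w' k) \<le> component C' (w' (Suc k))" if k: "Suc k < n" for k
  proof (cases "ix k \<le> ix (Suc k)")
   case True
   then show ?thesis
    using chamber_mono[OF C'(1) w(1), of "ix k" "ix (Suc k)"] y w C' k ix[of k] ix[of "Suc k"] by simp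
  next
   case False
   then have "component C (w (ix (Suc k))) \<le> component C (w (ix k))"
    using chamber_mono[OF C(1) w(1), of "ix (Suc k)" "ix k"] x w C k ix[of k] by simp
   with ord[OF k] False k show ?thesis
    using same[OF C'(1), of "ix (Suc k)" "ix k"] y C' ix[of k] ix[of "Suc k"] by simp
  qed
  then show "y \<in> V" using w' C' chamber_set_iff[OF C'(1) w'(1)] by simp
 next
  fix k
  show "\<exists>a\<in>polyfuns. \<forall>y\<in>U. b (phi y) \<noteq> 0 --> psi y k = a (phi y) / b (phi y)"
  proof (cases "Suc k < n")
   case False
   have "psi y k = 0" if "y \<in> U" for y
   proof -
    from that w obtain C' where "C' \<in> marked_chains n" "y = chain_class n C'" by (auto elim: chamber_point)
    then show ?thesis using False w' by (simp add: chamber_coord_eq)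
   qed
   then show ?thesis by (intro bexI[of _ "\<lambda>_. 0"] polyfuns.const) simp
  next
   case k: True
   show ?thesis
   proof (cases "ix k \<le> ix (Suc k)")
    case True
    have "psi y k = (\<Prod>s=ix k..<ix (Suc k). phi y s) * b (phi y) / b (phi y)"
     if y: "y \<in> U" "b (phi y) \<noteq> 0" for y
    proof -
     from y(1) w obtain C' where C': "C' \<in> marked_chains n" "y = chain_class n C'"
      by (auto elim: chamber_point)
     then show ?thesis
      using chamber_coord_prod[OF C'(1) w(1), of "ix k" "ix (Suc k)"] True y w w' k ix[of k] ix[of "Suc k"]
      by (simp add: chamber_coord_eq)
    qed
    then show ?thesis
     by (intro bexI[of _ "\<lambda>z. (\<Prod>s=ix k..<ix (Suc k). z s) * b z"] polyfuns.mult poly)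
       (auto simp: b_def intro: poly)
   next
    case False
    then have le: "component C (w (ix (Suc k))) = component C (w (ix k))"
     using chamber_mono[OF C(1) w(1), of "ix (Suc k)" "ix k"] x w C k ix[of k] ord[OF k] by simp
    \<comment> \<open>Here \<open>w\<close> has the two points in the opposite order, so the ratio
      is the reciprocal of a product of coordinates indexed in \<open>S\<close>; the remaining
      factors of \<open>b\<close> bring it over the denominator \<open>b\<close>.\<close>
    have "psi y k = (\<Prod>s\<in>S - {ix (Suc k)..<ix k}. phi y s) / b (phi y)"
     if y: "y \<in> U" "b (phi y) \<noteq> 0" for y
    proof -
     from y(1) w obtain C' where C': "C' \<in> marked_chains n" "y = chain_class n C'"
      by (auto elim: chamber_point)
     have lt: "ix (Suc k) < ix k" "ix k < n" using False ix[of k] k by auto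
     have eq: "component C' (w' (Suc k)) = component C' (w' k)"
      using same[OF C'(1) _ _ lt le] y C' ix[of k] ix[of "Suc k"] k by simp
     have A: "(\<Prod>s=ix (Suc k)..<ix k. phi y s) = pos C' (w' (Suc k)) / pos C' (w' k)"
      using chamber_coord_prod[OF C'(1) w(1), of "ix (Suc k)" "ix k"] lt y w C' eq ix[of k] ix[of "Suc k"] k
      by simp
     have "psi y k = pos C' (w' k) / pos C' (w' (Suc k))"
      using C' w' k eq by (simp add: chamber_coord_eq)
     also have "\<dots> = 1 / (\<Prod>s=ix (Suc k)..<ix k. phi y s)" unfolding A by simp
     also have "\<dots> = (\<Prod>s\<in>S - {ix (Suc k)..<ix k}. phi y s) / b (phi y)"
      using S_prod[OF lt le, of "phi y"] y(2)
      by (metis mult_zero_right nonzero_divide_mult_cancel_right)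
     finally show ?thesis .
    qed
    then show ?thesis
     by (intro bexI[of _ "\<lambda>z. \<Prod>s\<in>S - {ix (Suc k)..<ix k}. z s"] poly) auto
   qed
  qed
 qed
qed

lemma LM_eq_glue: "LM n = glue (LM_charts n)"
 by (simp add: LM_def)

lemma function_variety_LM: "function_variety (LM n)"
 unfolding LM_eq_glue by (rule function_variety_glue[OF compatible_LM_charts])

lemma points_LM: "points (LM n) = marked_chains n // chain_iso n"
proof -
 have "P \<in> points (LM n)" if P: "P \<in> marked_chains n // chain_iso n" for P
 proof -
  note r = chain_rep[OF P]
  obtain w where "w permutes {..<n}" "chain_class n (chain_rep P) \<in> chamber_set n w"
   by (rule ex_chamber[OF r(2)])
  then show ?thesis unfolding LM_eq_glue points_glue r(3) by blast
 qed
 then show ?thesis unfolding LM_eq_glue points_glue by (auto simp: chamber_set_def)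
qed

lemma chamber_open: "w permutes {..<n} ==> openin (vtop (LM n)) (chamber_set n w)"
 unfolding LM_eq_glue by (rule glue_chart_open) blast

section \<open>Degeneration paths\<close>

text \<open>A chain is the limit for \<open>s \<rightarrow> 0\<close> of chains with one component.\<close>

definition chain_path :: "marked_chain => complex => marked_chain" where
 "chain_path C s = (if s = 0 then C else
  \<lparr>component = (\<lambda>_. 0), pos = (\<lambda>i. pos C i / s ^ component C i)\<rparr>)"

lemma one_component_chain:
 assumes "\<And>i. i < n ==> p i \<noteq> 0"
 shows "\<lparr>component = (\<lambda>_. 0), pos = p\<rparr> \<in> marked_chains n"
proof -
 have "(\<lambda>_. 0::nat) ` {..<n} = {..<if n = 0 then 0 else 1}" by auto
 then show ?thesis using assms unfolding marked_chains_def by (intro CollectI conjI exI) auto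
qed

lemma chain_path_chain: "C \<in> marked_chains n ==> chain_path C s \<in> marked_chains n"
 by (auto simp: chain_path_def pos_nonzero intro: one_component_chain)

lemma chain_path_0 [simp]: "chain_path C 0 = C"
 by (simp add: chain_path_def)

lemma chain_path_chamber:
 assumes C: "C \<in> marked_chains n" and w: "w permutes {..<n}" and "chain_class n C \<in> chamber_set n w"
 shows "chain_class n (chain_path C s) \<in> chamber_set n w"
 using assms(3) unfolding chamber_set_iff[OF chain_path_chain[OF C] w] chamber_set_iff[OF C w]
 by (simp add: chain_path_def)

lemma chain_path_coord:
 assumes C: "C \<in> marked_chains n" and w: "w permutes {..<n}" and ch: "chain_class n C \<in> chamber_set n w"
 shows "chamber_coord n w (chain_class n (chain_path C s)) k = (if Suc k < n then
  pos C (w k) / pos C (w (Suc k)) * s ^ (component C (w (Suc k)) - component C (w k)) else 0)"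
proof -
 have "component C (w k) \<le> component C (w (Suc k))" if "Suc k < n"
  using ch that unfolding chamber_set_iff[OF C w] by simp
 then show ?thesis
  unfolding chamber_coord_eq[OF chain_path_chain[OF C] w]
  by (auto simp: chain_path_def power_diff)
qed

text \<open>Chamber coordinates along the path are monomials in \<open>s\<close>, so a regular
  function becomes a rational function of \<open>s\<close> with no pole at 0. This stands in for
  continuity when passing to the limit.\<close>

lemma chain_path_regular:
 assumes C: "C \<in> marked_chains n" and V: "openin (vtop (LM n)) V" "chain_class n C \<in> V"
  and h: "h \<in> vreg (LM n) V"
 obtains a r where "poly r 0 \<noteq> 0" "\<forall>s. poly r s \<noteq> 0 --> chain_class n (chain_path C s) \<in> V \<and>
  h (chain_class n (chain_path C s)) = poly a s / poly r s"
proof -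
 obtain w where w: "w permutes {..<n}" "chain_class n C \<in> chamber_set n w" by (rule ex_chamber[OF C])
 let ?R = "{poly p | p. True} :: (complex => complex) set"
 have co: "\<exists>a\<in>?R. \<forall>y\<in>UNIV. (1::complex) \<noteq> 0 -->
   chamber_coord n w (chain_class n (chain_path C y)) k = a y / 1" for k
 proof (cases "Suc k < n")
  case True
  then show ?thesis
   unfolding chain_path_coord[OF C w]
   by (intro bexI[of _ "poly (monom (pos C (w k) / pos C (w (Suc k)))
    (component C (w (Suc k)) - component C (w k)))"]) (auto simp: poly_monom)
 next
  case False
  then show ?thesis
   unfolding chain_path_coord[OF C w] by (intro bexI[of _ "poly 0"]) auto
 qed
 have one: "(\<lambda>_. 1) \<in> ?R" by (rule func_ring_const[OF func_ring_poly])
 have wc: "(chamber_set n w, chamber_coord n w) \<in> LM_charts n" using w by blast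
 have V0: "chain_class n (chain_path C 0) \<in> V" using V by simp
 obtain a r where ar: "a \<in> ?R" "r \<in> ?R" "r 0 \<noteq> 0"
  "\<forall>y\<in>UNIV. r y \<noteq> 0 --> (1::complex) \<noteq> 0 \<and> chain_class n (chain_path C y) \<in> V \<and>
   h (chain_class n (chain_path C y)) = a y / r y"
  by (rule glue_family_regular[where x = "\<lambda>s. chain_class n (chain_path C s)",
     OF compatible_LM_charts wc func_ring_poly one UNIV_I one_neq_zero
     chain_path_chamber[OF C w] co V(1)[unfolded LM_eq_glue] V0 h[unfolded LM_eq_glue]])
 then obtain p q where "a = poly p" "r = poly q" by blast
 with ar(3,4) show thesis by (intro that[of q p]) auto
qed

text \<open>The identity theorem for polynomials; every passage to a limit in this development ends
  with it.\<close>

lemma poly_zero_off: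
 fixes p q :: "complex poly"
 assumes "\<And>s. poly q s \<noteq> 0 ==> poly p s = 0" "q \<noteq> 0"
 shows "p = 0"
proof -
 have "poly (p * q) s = 0" for s using assms(1)[of s] by auto
 then have "p * q = 0" using poly_all_0_iff_0 by blast
 with assms(2) show ?thesis by simp
qed

text \<open>Through every chain runs a path that lies in the torus for \<open>s \<noteq> 0\<close>,
  hence off \<open>D\<close>; the two functions are rational along it and agree for almost all
  \<open>s\<close>, so also at \<open>s = 0\<close>.\<close>

lemma LM_off_dense:
 assumes D: "\<And>p. (\<And>i. i < n ==> p i \<noteq> 0) ==>
  chain_class n \<lparr>component = (\<lambda>_. 0), pos = p\<rparr> \<notin> D"
 shows "off_dense (LM n) D"
 unfolding off_dense_def
proof (intro allI impI ballI)
 fix V f g t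
 assume V: "openin (vtop (LM n)) V" and f: "f \<in> vreg (LM n) V" and g: "g \<in> vreg (LM n) V"
  and eq: "\<forall>t\<in>V - D. f t = g t" and t: "t \<in> V"
 have "t \<in> marked_chains n // chain_iso n" using openin_subset[OF V] t by (auto simp: points_LM)
 note r = chain_rep[OF this]
 define C where "C = chain_rep t"
 have C: "C \<in> marked_chains n" "chain_class n C \<in> V" "chain_class n C = t" using r t by (simp_all add: C_def)
 obtain a r where r: "poly r 0 \<noteq> 0" "\<forall>s. poly r s \<noteq> 0 --> chain_class n (chain_path C s) \<in> V \<and>
   f (chain_class n (chain_path C s)) = poly a s / poly r s"
  by (rule chain_path_regular[OF C(1) V C(2) f])
 obtain a' r' where r': "poly r' 0 \<noteq> 0" "\<forall>s. poly r' s \<noteq> 0 --> chain_class n (chain_path C s) \<in> V \<and>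
   g (chain_class n (chain_path C s)) = poly a' s / poly r' s"
  by (rule chain_path_regular[OF C(1) V C(2) g])
 have "a * r' - a' * r = 0"
 proof (rule poly_zero_off[of "r * r' * [:0, 1:]"])
  show "r * r' * [:0, 1:] \<noteq> 0" using r(1) r'(1) by auto
  fix s assume "poly (r * r' * [:0, 1:]) s \<noteq> 0"
  then have nz: "poly r s \<noteq> 0" "poly r' s \<noteq> 0" "s \<noteq> 0" by auto
  have "chain_class n (chain_path C s) \<notin> D"
   using nz(3) D[of "\<lambda>i. pos C i / s ^ component C i"] pos_nonzero[OF C(1)] by (simp add: chain_path_def)
  then have "poly a s / poly r s = poly a' s / poly r' s"
   using eq r(2)[rule_format, OF nz(1)] r'(2)[rule_format, OF nz(2)] by auto
  then show "poly (a * r' - a' * r) s = 0" using nz by (simp add: field_simps)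
 qed
 then have "poly (a * r' - a' * r) 0 = 0" by simp
 then have "poly a 0 / poly r 0 = poly a' 0 / poly r' 0"
  using r(1) r'(1) by (simp add: divide_simps)
 then show "f t = g t"
  using r(2)[rule_format, OF r(1)] r'(2)[rule_format, OF r'(1)] C(3) by simp
qed

section \<open>Toric line bundles\<close>

definition chain_monomial :: "nat => (nat => int) => marked_chain => complex" where
 "chain_monomial n m C = (\<Prod>i<n. pos C i powi m i)"

text \<open>Rescaling the coordinate of one component multiplies the monomial by a power whose
  exponent is this sum; so balanced means that the monomial depends only on the isomorphism class of
  the chain.\<close>

definition balanced :: "nat => (nat => int) => marked_chain => bool" where
 "balanced n m C \<longleftrightarrow> (\<forall>c. (\<Sum>i\<in>{i\<in>{..<n}. component C i = c}. m i) = 0)"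

lemma balanced_add: "balanced n m C ==> balanced n m' C ==> balanced n (\<lambda>i. m i + m' i) C"
 by (simp add: balanced_def sum.distrib)

lemma chain_monomial_nonzero: "C \<in> marked_chains n ==> chain_monomial n m C \<noteq> 0"
 by (simp add: chain_monomial_def pos_nonzero)

lemma chain_monomial_add:
 assumes "C \<in> marked_chains n"
 shows "chain_monomial n (\<lambda>i. m i + m' i) C = chain_monomial n m C * chain_monomial n m' C"
 unfolding chain_monomial_def prod.distrib[symmetric]
 by (intro prod.cong refl) (simp add: power_int_add pos_nonzero[OF assms])

lemma chain_monomial_diff:
 assumes "C \<in> marked_chains n"
 shows "chain_monomial n (\<lambda>i. m i - m' i) C = chain_monomial n m C / chain_monomial n m' C"
 unfolding chain_monomial_def prod_dividef[symmetric]
 by (intro prod.cong refl) (simp add: power_int_diff pos_nonzero[OF assms])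

lemma chain_monomial_uminus:
 assumes "C \<in> marked_chains n"
 shows "chain_monomial n (\<lambda>i. - m i) C = inverse (chain_monomial n m C)"
 unfolding chain_monomial_def prod_inversef[symmetric]
 by (intro prod.cong refl) (simp add: power_int_minus)

lemma chain_monomial_cong:
 "(\<And>i. i < n ==> m i = m' i) ==> chain_monomial n m C = chain_monomial n m' C"
 unfolding chain_monomial_def by (intro prod.cong refl) simp

lemma chain_monomial_indicator:
 assumes "A \<subseteq> {..<n}"
 shows "chain_monomial n (\<lambda>i. of_bool (i \<in> A)) C = (\<Prod>i\<in>A. pos C i)"
proof -
 have "(\<Prod>i<n. pos C i powi of_bool (i \<in> A)) = (\<Prod>i<n. if i \<in> A then pos C i else 1)"
  by (intro prod.cong refl) simp
 also have "\<dots> = (\<Prod>i\<in>A. pos C i)"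
  using assms by (simp add: prod.If_cases Int_absorb1)
 finally show ?thesis by (simp add: chain_monomial_def)
qed

text \<open>The points up to a node, or all points, form a union of whole components, on each of
  which the exponents cancel.\<close>

lemma balanced_initial_sum:
 assumes C: "C \<in> marked_chains n" and w: "w permutes {..<n}" and ch: "chain_class n C \<in> chamber_set n w"
  and m: "balanced n m C" and k: "k < n" and node: "Suc k < n ==> component C (w k) \<noteq> component C (w (Suc k))"
 shows "(\<Sum>l\<le>k. m (w l)) = 0"
proof -
 define A where "A = {i\<in>{..<n}. component C i \<le> component C (w k)}"
 have img: "w ` {..k} = A"
 proof (intro equalityI subsetI)
  fix i assume "i \<in> w ` {..k}"
  then obtain l where l: "l \<le> k" "i = w l" by auto
  then show "i \<in> A"
   using chamber_mono[OF C w ch l(1) k] permutes_in_image[OF w, of l] k by (simp add: A_def)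
 next
  fix i assume i: "i \<in> A"
  obtain l where l: "i = w l" using permutes_surj[OF w] by (meson surjD)
  have "l < n" using i l permutes_in_image[OF w, of l] by (simp add: A_def)
  have "l \<le> k"
  proof (rule ccontr)
   assume "\<not> l \<le> k"
   then have "Suc k \<le> l" by simp
   then have "component C (w (Suc k)) \<le> component C (w l)"
    using chamber_mono[OF C w ch _ \<open>l < n\<close>] by blast
   moreover have "component C (w k) \<le> component C (w (Suc k))"
    using chamber_mono[OF C w ch, of k "Suc k"] \<open>Suc k \<le> l\<close> \<open>l < n\<close> by simp
   ultimately show False using node i l \<open>Suc k \<le> l\<close> \<open>l < n\<close> by (simp add: A_def)
  qed
  then show "i \<in> w ` {..k}" using l by blast
 qed
 have "inj_on w {..k}" using permutes_inj[OF w] by (rule inj_on_subset) simp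
 then have "(\<Sum>l\<le>k. m (w l)) = (\<Sum>i\<in>A. m i)" unfolding img[symmetric] by (simp add: sum.reindex)
 also have "\<dots> = (\<Sum>c\<le>component C (w k). \<Sum>i\<in>{i\<in>A. component C i = c}. m i)"
  by (rule sum.group[symmetric]) (auto simp: A_def)
 also have "\<dots> = (\<Sum>c\<le>component C (w k). \<Sum>i\<in>{i\<in>{..<n}. component C i = c}. m i)"
  by (intro sum.cong refl) (auto simp: A_def)
 also have "\<dots> = 0" using m by (simp add: balanced_def)
 finally show ?thesis .
qed

text \<open>Summation by parts along \<open>w\<close>: positions are traded for ratios of
  neighbours. At a node the coordinate is 0, but its exponent vanishes as well, and
  \<open>0 powi 0 = 1\<close>.\<close>

lemma chain_monomial_chamber:
 assumes C: "C \<in> marked_chains n" and w: "w permutes {..<n}" and ch: "chain_class n C \<in> chamber_set n w"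
  and m: "balanced n m C"
 shows "chain_monomial n m C =
  (\<Prod>k<n-1. chamber_coord n w (chain_class n C) k powi (\<Sum>l\<le>k. m (w l)))"
proof (cases "n = 0")
 case True
 then show ?thesis by (simp add: chain_monomial_def)
next
 case False
 define M where "M = (\<lambda>k. \<Sum>l\<le>k. m (w l))"
 have nz: "pos C (w l) \<noteq> 0" if "l < n" for l
  using permutes_in_image[OF w, of l] that pos_nonzero[OF C] by simp
 have "(\<Prod>k\<le>l. pos C (w k) powi m (w k)) =
   (\<Prod>k<l. chamber_coord n w (chain_class n C) k powi M k) * pos C (w l) powi M l" if "l < n" for l
  using that
 proof (induction l)
  case 0
  then show ?case by (simp add: M_def)
 next
  case (Suc l)
  have step: "pos C (w l) powi M l =
    chamber_coord n w (chain_class n C) l powi M l * pos C (w (Suc l)) powi M l"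
  proof (cases "component C (w l) = component C (w (Suc l))")
   case True
   then show ?thesis using nz[of l] nz[of "Suc l"] Suc.prems
    by (simp add: chamber_coord_eq[OF C w] power_int_divide_distrib)
  next
   case False
   then have "M l = 0" unfolding M_def using Suc.prems
    by (intro balanced_initial_sum[OF C w ch m]) auto
   then show ?thesis by simp
  qed
  have "(\<Prod>k\<le>Suc l. pos C (w k) powi m (w k)) =
   (\<Prod>k<l. chamber_coord n w (chain_class n C) k powi M k) * pos C (w l) powi M l *
   pos C (w (Suc l)) powi m (w (Suc l))"
   using Suc by (simp add: mult_ac)
  also have "\<dots> = (\<Prod>k<Suc l. chamber_coord n w (chain_class n C) k powi M k) *
   (pos C (w (Suc l)) powi M l * pos C (w (Suc l)) powi m (w (Suc l)))"
   unfolding step by (simp add: mult_ac)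
  also have "pos C (w (Suc l)) powi M l * pos C (w (Suc l)) powi m (w (Suc l)) =
    pos C (w (Suc l)) powi M (Suc l)"
   using nz[OF Suc.prems] by (simp add: M_def power_int_add)
  finally show ?case .
 qed
 from this[of "n - 1"] False have "(\<Prod>k\<le>n-1. pos C (w k) powi m (w k)) =
   (\<Prod>k<n-1. chamber_coord n w (chain_class n C) k powi M k) * pos C (w (n-1)) powi M (n-1)" by simp
 also have "M (n-1) = 0" unfolding M_def using False by (intro balanced_initial_sum[OF C w ch m]) auto
 also have "{..n-1} = {..<n}" using False by auto
 also have "(\<Prod>k<n. pos C (w k) powi m (w k)) = (\<Prod>i<n. pos C i powi m i)"
  by (rule prod.permute[OF w, of "\<lambda>i. pos C i powi m i", unfolded comp_def, symmetric])
 finally show ?thesis by (simp add: chain_monomial_def M_def)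
qed

lemma chain_monomial_class:
 assumes C: "C \<in> marked_chains n" and C': "C' \<in> marked_chains n"
  and "chain_class n C = chain_class n C'" and m: "balanced n m C"
 shows "chain_monomial n m C = chain_monomial n m C'"
proof -
 obtain w where w: "w permutes {..<n}" "chain_class n C \<in> chamber_set n w" by (rule ex_chamber[OF C])
 have "C' \<in> chain_class n C" unfolding assms(3) by (rule chain_class_self[OF C'])
 then have "(C, C') \<in> chain_iso n" by simp
 then have "\<forall>i<n. component C' i = component C i" by (auto simp: chain_iso_def)
 then have "{i\<in>{..<n}. component C' i = c} = {i\<in>{..<n}. component C i = c}" for c by auto
 then have m': "balanced n m C'" using m by (simp add: balanced_def)
 show ?thesis
  using chain_monomial_chamber[OF C w m] chain_monomial_chamber[OF C' w(1) _ m'] w(2) assms(3) by simp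
qed

lemma chain_monomial_unit:
 assumes w: "w permutes {..<n}" and V: "V \<subseteq> chamber_set n w"
  and m: "\<And>C. C \<in> marked_chains n ==> chain_class n C \<in> V ==> balanced n m C"
 shows "(\<lambda>t. chain_monomial n m (chain_rep t)) \<in> unit_functions (LM n) V"
proof -
 define M where "M = (\<lambda>k. \<Sum>l\<le>k. m (w l))"
 \<comment> \<open>Positive exponents go to the numerator and negative ones to \<open>b\<close>;
   \<open>nat\<close> truncates the other sign to exponent 0.\<close>
 define a where "a = (\<lambda>z :: nat => complex. \<Prod>k<n-1. z k ^ nat (M k))"
 define b where "b = (\<lambda>z :: nat => complex. \<Prod>k<n-1. z k ^ nat (- M k))"
 have ab: "a \<in> polyfuns" "b \<in> polyfuns" unfolding a_def b_def
  by (intro func_ring_prod[OF func_ring_polyfuns] func_ring_power[OF func_ring_polyfuns] polyfuns.coord)+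
 have t: "chain_monomial n m (chain_rep t) \<noteq> 0 \<and> b (chamber_coord n w t) \<noteq> 0 \<and>
   chain_monomial n m (chain_rep t) = a (chamber_coord n w t) / b (chamber_coord n w t)" if "t \<in> V" for t
 proof -
  have q: "t \<in> marked_chains n // chain_iso n" using V that by (auto simp: chamber_set_def)
  note r = chain_rep[OF q]
  have mon: "chain_monomial n m (chain_rep t) = (\<Prod>k<n-1. chamber_coord n w t k powi M k)"
   using chain_monomial_chamber[OF r(2) w _ m[OF r(2)]] r(3) V that by (auto simp: M_def)
  have nz: "chain_monomial n m (chain_rep t) \<noteq> 0" by (rule chain_monomial_nonzero[OF r(2)])
  then have nzk: "chamber_coord n w t k powi M k \<noteq> 0" if "k < n - 1" for k
   unfolding mon using that by simp
  have "b (chamber_coord n w t) \<noteq> 0"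
  proof -
   have "chamber_coord n w t k ^ nat (- M k) \<noteq> 0" if "k < n - 1" for k
    using nzk[OF that] by (cases "M k < 0") (auto simp: power_int_def)
   then show ?thesis by (simp add: b_def)
  qed
  moreover have "chain_monomial n m (chain_rep t) = a (chamber_coord n w t) / b (chamber_coord n w t)"
   unfolding mon a_def b_def prod_dividef[symmetric]
   by (intro prod.cong refl) (simp add: power_int_def field_simps)
  ultimately show ?thesis using nz by blast
 qed
 have "(\<lambda>t. chain_monomial n m (chain_rep t)) \<in> vreg (LM n) V"
  unfolding LM_eq_glue
  by (rule glue_chart_regular[of "chamber_set n w" "chamber_coord n w" _ _ a b])
    (use w V ab t in auto)
 moreover have "chain_monomial n m (chain_rep t) \<noteq> 0" if "t \<in> V" for t using t[OF that] by blast
 ultimately show ?thesis by (simp add: unit_functions_def)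
qed

definition chamber_of :: "nat => marked_chain set => nat => nat" where
 "chamber_of n P = (SOME w. w permutes {..<n} \<and> P \<in> chamber_set n w)"

lemma chamber_of:
 assumes "P \<in> points (LM n)"
 shows "chamber_of n P permutes {..<n}" "P \<in> chamber_set n (chamber_of n P)"
proof -
 note r = chain_rep[OF assms[unfolded points_LM]]
 obtain w where "w permutes {..<n}" "chain_class n (chain_rep P) \<in> chamber_set n w"
  by (rule ex_chamber[OF r(2)])
 then have "\<exists>w. w permutes {..<n} \<and> P \<in> chamber_set n w" using r(3) by auto
 from someI_ex[OF this] show "chamber_of n P permutes {..<n}" "P \<in> chamber_set n (chamber_of n P)"
  by (simp_all add: chamber_of_def)
qed

text \<open>The data \<open>chi\<close> assign to each Weyl chamber a character of the diagonal torus, up to characters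
 which are units on the overlaps of the charts: a piecewise linear function on the fan.\<close>

definition toric_data :: "nat => ((nat => nat) => nat => int) => bool" where
 "toric_data n chi \<longleftrightarrow> (\<forall>C\<in>marked_chains n. \<forall>w w'. w permutes {..<n} --> w' permutes {..<n} -->
  chain_class n C \<in> chamber_set n w --> chain_class n C \<in> chamber_set n w' -->
  balanced n (\<lambda>i. chi w i - chi w' i) C)"

text \<open>The cocycle of the bundle with a rational section whose expression over the chart of a
  chamber \<open>w\<close> is the character \<open>chi w\<close>.\<close>

definition toric_bundle :: "nat => ((nat => nat) => nat => int) => marked_chain set cocycle" where
 "toric_bundle n chi = (\<lambda>P. chamber_set n (chamber_of n P), \<lambda>P Q t.
   chain_monomial n (\<lambda>i. chi (chamber_of n P) i - chi (chamber_of n Q) i) (chain_rep t))"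

abbreviation toric_class :: "nat => ((nat => nat) => nat => int) => marked_chain set cocycle set" where
 "toric_class n chi \<equiv> bundle_class (LM n) (toric_bundle n chi)"

lemma fst_toric_bundle [simp]: "fst (toric_bundle n chi) = (\<lambda>P. chamber_set n (chamber_of n P))"
 and snd_toric_bundle: "snd (toric_bundle n chi) = (\<lambda>P Q t.
   chain_monomial n (\<lambda>i. chi (chamber_of n P) i - chi (chamber_of n Q) i) (chain_rep t))"
 by (simp_all add: toric_bundle_def)

lemma toric_dataD:
 assumes "toric_data n chi" "C \<in> marked_chains n" "w permutes {..<n}" "w' permutes {..<n}"
  "chain_class n C \<in> chamber_set n w" "chain_class n C \<in> chamber_set n w'"
 shows "balanced n (\<lambda>i. chi w i - chi w' i) C"
 using assms unfolding toric_data_def by blast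

lemma toric_data_add:
 assumes "toric_data n chi" "toric_data n chi'"
 shows "toric_data n (\<lambda>w i. chi w i + chi' w i)"
 unfolding toric_data_def
proof (intro ballI allI impI)
 fix C w w' assume *: "C \<in> marked_chains n" "w permutes {..<n}" "w' permutes {..<n}"
  "chain_class n C \<in> chamber_set n w" "chain_class n C \<in> chamber_set n w'"
 have "(\<lambda>i. chi w i + chi' w i - (chi w' i + chi' w' i)) = (\<lambda>i. (chi w i - chi w' i) + (chi' w i - chi' w' i))"
  by (simp add: fun_eq_iff)
 then show "balanced n (\<lambda>i. chi w i + chi' w i - (chi w' i + chi' w' i)) C"
  using balanced_add[OF toric_dataD[OF assms(1) *] toric_dataD[OF assms(2) *]] by simp
qed

lemma toric_data_scale: "toric_data n chi ==> toric_data n (\<lambda>w i. c * chi w i)"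
 by (simp add: toric_data_def balanced_def sum_distrib_left[symmetric] right_diff_distrib[symmetric])

lemma toric_data_zero: "toric_data n (\<lambda>w i. 0)"
 by (simp add: toric_data_def balanced_def)

lemma toric_data_sum: "(\<And>j. j \<in> A ==> toric_data n (chi j)) ==> toric_data n (\<lambda>w i. \<Sum>j\<in>A. chi j w i)"
 by (induction A rule: infinite_finite_induct) (auto intro: toric_data_zero toric_data_add)

lemma LM_point_rep:
 assumes "t \<in> chamber_set n w"
 shows "chain_rep t \<in> marked_chains n" "chain_class n (chain_rep t) = t"
 using assms chain_rep[of t n] by (auto simp: chamber_set_def)

lemma toric_line_bundle:
 assumes "toric_data n chi"
 shows "toric_bundle n chi \<in> line_bundles (LM n)"
proof (rule line_bundlesI)
 fix P assume "P \<in> points (LM n)"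
 then show "openin (vtop (LM n)) (fst (toric_bundle n chi) P)" "P \<in> fst (toric_bundle n chi) P"
  using chamber_of[of P n] by (simp_all add: chamber_open)
next
 fix P Q assume "P \<in> points (LM n)" "Q \<in> points (LM n)"
 then show "snd (toric_bundle n chi) P Q \<in>
   unit_functions (LM n) (fst (toric_bundle n chi) P \<inter> fst (toric_bundle n chi) Q)"
  unfolding snd_toric_bundle fst_toric_bundle using chamber_of[of P n] chamber_of[of Q n]
  by (intro chain_monomial_unit[of "chamber_of n P"]) (auto intro: toric_dataD[OF assms])
next
 fix P Q R t assume t: "t \<in> fst (toric_bundle n chi) P"
 have r: "chain_rep t \<in> marked_chains n" using t LM_point_rep by simp
 show "snd (toric_bundle n chi) P Q t * snd (toric_bundle n chi) Q R t = snd (toric_bundle n chi) P R t"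
  unfolding snd_toric_bundle chain_monomial_add[OF r, symmetric] by simp
qed

lemma toric_class_eqI:
 assumes "toric_data n chi" "toric_data n chi'"
  and "\<And>w i. w permutes {..<n} ==> i < n ==> chi w i = chi' w i"
 shows "toric_class n chi = toric_class n chi'"
proof -
 interpret function_variety "LM n" by (rule function_variety_LM)
 show ?thesis
  by (rule bundle_class_cong)
    (use assms chamber_of[of _ n] in \<open>auto simp: snd_toric_bundle intro!: toric_line_bundle chain_monomial_cong\<close>)
qed

lemma toric_class_mult:
 assumes "toric_data n chi" "toric_data n chi'"
 shows "toric_class n chi \<otimes>\<^bsub>Pic (LM n)\<^esub> toric_class n chi' =
  toric_class n (\<lambda>w i. chi w i + chi' w i)"
proof -
 interpret function_variety "LM n" by (rule function_variety_LM)
 note lb = toric_line_bundle[OF assms(1)] toric_line_bundle[OF assms(2)]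
  toric_line_bundle[OF toric_data_add[OF assms]]
 show ?thesis unfolding Pic_mult[OF lb(1,2)]
 proof (rule bundle_class_cong[OF tensor_line_bundle[OF lb(1,2)] lb(3)])
  fix P Q t
  assume "t \<in> fst (toric_bundle n (\<lambda>w i. chi w i + chi' w i)) P"
  then have r: "chain_rep t \<in> marked_chains n" using LM_point_rep by simp
  show "snd (tensor (toric_bundle n chi) (toric_bundle n chi')) P Q t =
   snd (toric_bundle n (\<lambda>w i. chi w i + chi' w i)) P Q t"
   unfolding snd_toric_bundle snd_tensor chain_monomial_add[OF r, symmetric]
   by (simp add: algebra_simps)
 qed
qed

lemma toric_class_inv:
 assumes "toric_data n chi"
 shows "inv\<^bsub>Pic (LM n)\<^esub> toric_class n chi =
  toric_class n (\<lambda>w i. - chi w i)"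
proof -
 interpret function_variety "LM n" by (rule function_variety_LM)
 have d: "toric_data n (\<lambda>w i. - chi w i)" using toric_data_scale[OF assms, of "-1"] by simp
 note lb = toric_line_bundle[OF assms] toric_line_bundle[OF d]
 show ?thesis unfolding Pic_inv[OF lb(1)]
 proof (rule bundle_class_cong[OF dual_line_bundle[OF lb(1)] lb(2)])
  fix P Q t
  assume "t \<in> fst (toric_bundle n (\<lambda>w i. - chi w i)) P"
  then have r: "chain_rep t \<in> marked_chains n" using LM_point_rep by simp
  show "snd (dual (toric_bundle n chi)) P Q t = snd (toric_bundle n (\<lambda>w i. - chi w i)) P Q t"
   unfolding snd_toric_bundle snd_dual chain_monomial_uminus[OF r, symmetric] by simp
 qed
qed

lemma toric_class_carrier:
 "toric_data n chi ==> toric_class n chi \<in> carrier (Pic (LM n))"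
 by (rule function_variety.Pic_carrierI[OF function_variety_LM toric_line_bundle])

lemma toric_class_one: "toric_class n (\<lambda>w i. 0) = \<one>\<^bsub>Pic (LM n)\<^esub>"
proof -
 interpret function_variety "LM n" by (rule function_variety_LM)
 show ?thesis unfolding Pic_one
  by (rule bundle_class_cong[OF toric_line_bundle[OF toric_data_zero] trivial_line_bundle])
    (simp add: snd_toric_bundle chain_monomial_def)
qed

lemma toric_class_pow:
 assumes "toric_data n chi"
 shows "toric_class n chi [^]\<^bsub>Pic (LM n)\<^esub> (k::nat) =
  toric_class n (\<lambda>w i. int k * chi w i)"
proof (induction k)
 case 0
 then show ?case by (simp add: toric_class_one)
next
 case (Suc k)
 then show ?case
  using toric_class_mult[OF toric_data_scale[OF assms, of "int k"] assms]
  by (simp add: algebra_simps)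
qed

lemma toric_class_finprod:
 assumes "finite A" "\<And>j. j \<in> A ==> toric_data n (chi j)"
 shows "finprod (Pic (LM n)) (\<lambda>j. toric_class n (chi j)) A =
  toric_class n (\<lambda>w i. \<Sum>j\<in>A. chi j w i)"
 using assms
proof (induction A rule: finite_induct)
 case empty
 interpret function_variety "LM n" by (rule function_variety_LM)
 show ?case by (simp add: toric_class_one)
next
 case (insert j A)
 interpret function_variety "LM n" by (rule function_variety_LM)
 have "finprod (Pic (LM n)) (\<lambda>j. toric_class n (chi j)) (insert j A) =
  toric_class n (chi j) \<otimes>\<^bsub>Pic (LM n)\<^esub>
  toric_class n (\<lambda>w i. \<Sum>j\<in>A. chi j w i)"
  using insert by (subst Pic.finprod_insert) (auto intro: toric_class_carrier)
 also have "\<dots> = toric_class n (\<lambda>w i. chi j w i + (\<Sum>j\<in>A. chi j w i))"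
  using insert by (intro toric_class_mult toric_data_sum) auto
 finally show ?case using insert by simp
qed

section \<open>Boundary divisors of Losev--Manin spaces\<close>

text \<open>Division with remainder by one coordinate, obtained along the inductive generation of
  polynomial functions. It extracts the local equation of a boundary divisor from a function
  vanishing on it.\<close>

lemma polyfuns_remainder:
 assumes "p \<in> polyfuns"
 shows "\<exists>q\<in>polyfuns. \<forall>z. p z = p (z(k := 0)) + z k * q z"
 using assms
proof induction
 case (const c)
 show ?case by (intro bexI[of _ "\<lambda>_. 0"] polyfuns.const) simp
next
 case (coord i)
 show ?case
  by (intro bexI[of _ "\<lambda>_. if i = k then 1 else 0"] polyfuns.const) simp
next
 case (add p q)
 then obtain a b where ab: "a \<in> polyfuns" "b \<in> polyfuns"
  "\<forall>z. p z = p (z(k := 0)) + z k * a z" "\<forall>z. q z = q (z(k := 0)) + z k * b z" by blast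
 have "p z + q z = p (z(k := 0)) + q (z(k := 0)) + z k * (a z + b z)" for z
  using ab(3)[rule_format, of z] ab(4)[rule_format, of z] by (simp add: algebra_simps)
 with ab(1,2) show ?case by (intro bexI[of _ "\<lambda>z. a z + b z"] polyfuns.add allI)
next
 case (mult p q)
 then obtain a b where ab: "a \<in> polyfuns" "b \<in> polyfuns"
  "\<forall>z. p z = p (z(k := 0)) + z k * a z" "\<forall>z. q z = q (z(k := 0)) + z k * b z" by blast
 have "p z * q z = p (z(k := 0)) * q (z(k := 0)) + z k * (a z * q z + (p z * b z + - 1 * (z k * (a z * b z))))" for z
 proof -
  have e: "p (z(k := 0)) = p z - z k * a z" "q (z(k := 0)) = q z - z k * b z"
   using ab(3)[rule_format, of z] ab(4)[rule_format, of z] by simp_all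
  show ?thesis unfolding e by (simp add: algebra_simps)
 qed
 with ab(1,2) mult.hyps show ?case
  by (intro bexI[of _ "\<lambda>z. a z * q z + (p z * b z + - 1 * (z k * (a z * b z)))"] allI
    polyfuns.add polyfuns.mult polyfuns.const polyfuns.coord)
qed

lemma delta_iff:
 assumes C: "C \<in> marked_chains n"
 shows "chain_class n C \<in> delta n J \<longleftrightarrow> (\<exists>m. J = {i\<in>{..<n}. component C i < m})"
proof -
 have "{i\<in>{..<n}. component C' i < m} = {i\<in>{..<n}. component C i < m}" if "(C, C') \<in> chain_iso n" for C' m
  using that by (auto simp: chain_iso_def)
 note same = this
 show ?thesis
 proof
  assume "chain_class n C \<in> delta n J"
  then obtain C' m where "(C, C') \<in> chain_iso n" "J = {i\<in>{..<n}. component C' i < m}"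
   unfolding delta_def by blast
  then show "\<exists>m. J = {i\<in>{..<n}. component C i < m}" using same[of C' m] by blast
 next
  assume "\<exists>m. J = {i\<in>{..<n}. component C i < m}"
  then show "chain_class n C \<in> delta n J"
   unfolding delta_def using chain_class_quotient[OF C] chain_class_self[OF C] by blast
 qed
qed

text \<open>The boundary divisor of \<open>J\<close> meets the chart of \<open>w\<close> only if the
  first \<open>card J\<close> points of \<open>w\<close> form \<open>J\<close>. Its local equation
  is then the ratio of the last point in \<open>J\<close> to the first point outside, and this is
  the character of that ratio.\<close>

definition cut_weight :: "nat set => (nat => nat) => nat => int" where
 "cut_weight J w i = (if w ` {..<card J} = J
  then of_bool (i = w (card J - 1)) - of_bool (i = w (card J)) else 0)"

definition cut_section :: "nat => nat set => (nat => nat) => marked_chain set => complex" where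
 "cut_section n J w P = (if w ` {..<card J} = J then chamber_coord n w P (card J - 1) else 1)"

context
 fixes n :: nat and J :: "nat set"
 assumes J: "J \<subseteq> {..<n}" "J \<noteq> {}" "card J < n"
begin

lemma card_J: "0 < card J"
 using J finite_subset[OF J(1)] by (simp add: card_gt_0_iff)

lemma cut_section_zero:
 assumes C: "C \<in> marked_chains n" and w: "w permutes {..<n}" and ch: "chain_class n C \<in> chamber_set n w"
 shows "cut_section n J w (chain_class n C) = 0 \<longleftrightarrow> chain_class n C \<in> delta n J"
proof -
 define k where "k = card J"
 have k: "0 < k" "k < n" "Suc (k - 1) = k" using card_J J by (auto simp: k_def)
 note wn = permutes_less[OF w]
 have inj: "inj w" by (rule permutes_inj[OF w])
 show ?thesis unfolding delta_iff[OF C]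
 proof
  assume z: "cut_section n J w (chain_class n C) = 0"
  then have Jw: "w ` {..<k} = J" by (auto simp: cut_section_def k_def split: if_splits)
  from z have "component C (w (k - 1)) \<noteq> component C (w k)"
   using Jw k pos_nonzero[OF C] wn by (auto simp: cut_section_def k_def[symmetric] chamber_coord_eq[OF C w])
  then have lt: "component C (w (k - 1)) < component C (w k)"
   using chamber_mono[OF C w ch, of "k-1" k] k by simp
  have "J = {i\<in>{..<n}. component C i < component C (w k)}"
  proof (intro equalityI subsetI)
   fix i assume "i \<in> J"
   then obtain l where l: "l < k" "i = w l" using Jw by auto
   then have "component C i \<le> component C (w (k-1))" using chamber_mono[OF C w ch, of l "k-1"] k by simp
   with lt l k wn show "i \<in> {i\<in>{..<n}. component C i < component C (w k)}" by simp
  next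
   fix i assume i: "i \<in> {i\<in>{..<n}. component C i < component C (w k)}"
   obtain l where l: "i = w l" using permutes_surj[OF w] by (meson surjD)
   have ln: "l < n" using i l permutes_in_image[OF w, of l] by simp
   have "l < k"
   proof (rule ccontr)
    assume "\<not> l < k"
    then have "component C (w k) \<le> component C (w l)" using chamber_mono[OF C w ch, of k l] ln by simp
    then show False using i l by simp
   qed
   then show "i \<in> J" using Jw l by blast
  qed
  then show "\<exists>m. J = {i\<in>{..<n}. component C i < m}" by blast
 next
  assume "\<exists>m. J = {i\<in>{..<n}. component C i < m}"
  then obtain m where m: "J = {i\<in>{..<n}. component C i < m}" ..
  \<comment> \<open>Components weakly increase along \<open>w\<close>, so these places form an
    initial segment, whose length must be \<open>card J\<close>.\<close>
  define L where "L = {l\<in>{..<n}. component C (w l) < m}"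
  have wL: "w ` L = J"
  proof (intro equalityI subsetI)
   fix i assume i: "i \<in> J"
   obtain l where l: "i = w l" using permutes_surj[OF w] by (meson surjD)
   then show "i \<in> w ` L" using i m permutes_in_image[OF w, of l] by (auto simp: L_def)
  qed (auto simp: L_def m wn)
  have cardL: "card L = k"
   using card_image[of w L] inj_on_subset[OF inj, of L] wL by (simp add: k_def)
  have down: "l' \<in> L" if "l \<in> L" "l' \<le> l" for l l'
   using chamber_mono[OF C w ch, of l' l] that by (auto simp: L_def)
  have "L \<subseteq> {..<k}"
  proof
   fix l assume l: "l \<in> L"
   have "{..l} \<subseteq> L" using down[OF l] by auto
   then have "card {..l} \<le> card L" by (rule card_mono[rotated]) (simp add: L_def)
   then show "l \<in> {..<k}" using cardL by simp
  qed
  then have L: "L = {..<k}" by (rule card_subset_eq[OF finite_lessThan]) (simp add: cardL)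
  have "k - 1 \<in> L" "k \<notin> L" unfolding L using k by simp_all
  then have "component C (w (k - 1)) < m" "\<not> component C (w k) < m" using k by (simp_all add: L_def)
  then show "cut_section n J w (chain_class n C) = 0"
   using k wL[unfolded L] by (simp add: cut_section_def k_def[symmetric] chamber_coord_eq[OF C w])
 qed
qed

lemma cut_weight_monomial:
 assumes C: "C \<in> marked_chains n" and w: "w permutes {..<n}"
  and nz: "cut_section n J w (chain_class n C) \<noteq> 0"
 shows "chain_monomial n (cut_weight J w) C = cut_section n J w (chain_class n C)"
proof (cases "w ` {..<card J} = J")
 case False
 then have "chain_monomial n (cut_weight J w) C = chain_monomial n (\<lambda>_. 0) C"
  by (intro chain_monomial_cong) (simp add: cut_weight_def)
 then show ?thesis using False by (simp add: cut_section_def chain_monomial_def)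
next
 case True
 define k where "k = card J"
 have k: "0 < k" "k < n" "Suc (k - 1) = k" using card_J J by (auto simp: k_def)
 note wn = permutes_less[OF w]
 have "chain_monomial n (cut_weight J w) C =
   chain_monomial n (\<lambda>i. of_bool (i \<in> {w (k-1)}) - of_bool (i \<in> {w k})) C"
  using True by (intro chain_monomial_cong) (simp add: cut_weight_def k_def)
 also have "\<dots> = pos C (w (k-1)) / pos C (w k)"
  unfolding chain_monomial_diff[OF C] using wn k by (subst (1 2) chain_monomial_indicator) auto
 also have "\<dots> = cut_section n J w (chain_class n C)"
  using nz True k by (simp add: cut_section_def k_def[symmetric] chamber_coord_eq[OF C w] split: if_splits)
 finally show ?thesis .
qed

text \<open>The right-hand side does not mention \<open>w\<close>, and this is what makes the
  differences between chambers balanced. If the chain has the node, the two exponents sit at the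
  last component of \<open>J\<close> and the first one outside; otherwise they share a component and
  cancel.\<close>

lemma cut_weight_component_sum:
 assumes C: "C \<in> marked_chains n" and w: "w permutes {..<n}" and ch: "chain_class n C \<in> chamber_set n w"
 shows "(\<Sum>i\<in>{i\<in>{..<n}. component C i = c}. cut_weight J w i) = (if chain_class n C \<in> delta n J then
  of_bool (c = Max (component C ` J)) - of_bool (c = Min (component C ` ({..<n} - J))) else 0)"
proof (cases "w ` {..<card J} = J")
 case False
 then have "chain_class n C \<notin> delta n J" using cut_section_zero[OF C w ch] by (simp add: cut_section_def)
 with False show ?thesis by (simp add: cut_weight_def)
next
 case True
 define k where "k = card J"
 have k: "0 < k" "k < n" "Suc (k - 1) = k" using card_J J by (auto simp: k_def)
 note wn = permutes_less[OF w]
 have Jw: "J = w ` {..<k}" using True by (simp add: k_def)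
 have ind: "(\<Sum>i\<in>{i\<in>{..<n}. component C i = c}. of_bool (i = w l)) = (of_bool (component C (w l) = c) :: int)"
  if "l < n" for l
 proof -
  define S where "S = {i\<in>{..<n}. component C i = c}"
  have "(\<Sum>i\<in>S. of_bool (i = w l)) = (\<Sum>i\<in>S. if i = w l then (1::int) else 0)"
   by (rule sum.cong) auto
  also have "\<dots> = (if w l \<in> S then 1 else 0)" by (rule sum.delta) (simp add: S_def)
  also have "\<dots> = of_bool (component C (w l) = c)" using wn[OF that] by (simp add: S_def)
  finally show ?thesis unfolding S_def .
 qed
 have cw: "cut_weight J w = (\<lambda>i. of_bool (i = w (k-1)) - of_bool (i = w k))"
  using True by (simp add: cut_weight_def k_def fun_eq_iff)
 have k1: "k - 1 < n" using k by simp
 have "(\<Sum>i\<in>{i\<in>{..<n}. component C i = c}. cut_weight J w i) =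
  of_bool (component C (w (k-1)) = c) - of_bool (component C (w k) = c)"
  unfolding cw sum_subtractf ind[OF k1] ind[OF k(2)] ..
 moreover have "component C (w (k-1)) = Max (component C ` J)"
 proof (rule Max_eqI[symmetric])
  show "finite (component C ` J)" using finite_subset[OF J(1)] by simp
  show "component C (w (k-1)) \<in> component C ` J" using k unfolding Jw by (auto intro!: imageI)
  fix y assume "y \<in> component C ` J"
  then obtain l where "l < k" "y = component C (w l)" unfolding Jw by auto
  then show "y \<le> component C (w (k-1))" using chamber_mono[OF C w ch, of l "k-1"] k by simp
 qed
 moreover have "component C (w k) = Min (component C ` ({..<n} - J))"
 proof (rule Min_eqI[symmetric])
  show "finite (component C ` ({..<n} - J))" by simp
  have "w k \<notin> J" using permutes_inj[OF w] unfolding Jw by (auto dest: injD)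
  then show "component C (w k) \<in> component C ` ({..<n} - J)" using wn k by auto
  fix y assume "y \<in> component C ` ({..<n} - J)"
  then obtain i where i: "i < n" "i \<notin> J" "y = component C i" by auto
  obtain l where l: "i = w l" using permutes_surj[OF w] by (meson surjD)
  have "l < n" using i l permutes_in_image[OF w, of l] by simp
  moreover have "k \<le> l" using i(2) l unfolding Jw by (meson imageI lessThan_iff not_less)
  ultimately show "component C (w k) \<le> y" using chamber_mono[OF C w ch, of k l] i l by simp
 qed
 moreover have "component C (w (k-1)) = component C (w k)" if "chain_class n C \<notin> delta n J"
 proof -
  have "cut_section n J w (chain_class n C) \<noteq> 0" using that cut_section_zero[OF C w ch] by simp
  then show ?thesis
   using True k by (simp add: cut_section_def k_def[symmetric] chamber_coord_eq[OF C w] split: if_splits)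
 qed
 ultimately show ?thesis by auto
qed

lemma toric_data_cut: "toric_data n (cut_weight J)"
 unfolding toric_data_def balanced_def sum_subtractf
proof (intro ballI allI impI)
 fix C w w' c assume *: "C \<in> marked_chains n" "w permutes {..<n}" "w' permutes {..<n}"
  "chain_class n C \<in> chamber_set n w" "chain_class n C \<in> chamber_set n w'"
 show "(\<Sum>i\<in>{i\<in>{..<n}. component C i = c}. cut_weight J w i) -
   (\<Sum>i\<in>{i\<in>{..<n}. component C i = c}. cut_weight J w' i) = 0"
  unfolding cut_weight_component_sum[OF *(1,2,4)] cut_weight_component_sum[OF *(1,3,5)] by simp
qed

text \<open>Putting the coordinate of the divisor to zero stays inside the chart and lands on the
  divisor: either the node is there already, or a component is split in two. So a polynomial
  vanishing on the divisor vanishes on the whole coordinate hyperplane of the chart.\<close>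

lemma chamber_zero_coord:
 assumes w: "w permutes {..<n}" and t: "t \<in> chamber_set n w" and Jw: "w ` {..<card J} = J"
 obtains t' where "t' \<in> chamber_set n w"
  "chamber_coord n w t' = (chamber_coord n w t)(card J - 1 := 0)" "t' \<in> delta n J"
proof -
 define k where "k = card J"
 have k: "0 < k" "k < n" "Suc (k - 1) = k" using card_J J by (auto simp: k_def)
 note wn = permutes_less[OF w]
 have inJ: "w l \<in> J \<longleftrightarrow> l < k" for l using Jw permutes_inj[OF w] unfolding k_def by (auto dest: injD)
 obtain C where C: "C \<in> marked_chains n" "t = chain_class n C" using t by (rule chamber_point)
 note ch = t[unfolded C(2)]
 show thesis
 proof (cases "component C (w (k - 1)) = component C (w k)")
  case False
  then have z: "chamber_coord n w t (k - 1) = 0"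
   using k unfolding C(2) by (simp add: chamber_coord_eq[OF C(1) w])
  have "cut_section n J w (chain_class n C) = 0" using z Jw C by (simp add: cut_section_def k_def)
  then have "t \<in> delta n J" using cut_section_zero[OF C(1) w ch] C by simp
  moreover have "chamber_coord n w t = (chamber_coord n w t)(k - 1 := 0)" using z by auto
  ultimately show thesis using that t by (simp add: k_def)
 next
  case True
  \<comment> \<open>Everything outside \<open>J\<close> moves one component to the right, which
    inserts a node between \<open>w (k - 1)\<close> and \<open>w k\<close> and keeps all other
    coordinates.\<close>
  define C' where "C' = \<lparr>component = (\<lambda>i. component C i + (if i \<in> J then 0 else 1)), pos = pos C\<rparr>"
  obtain m where m: "component C ` {..<n} = {..<m}" using C(1) by (auto simp: marked_chains_def)
  define c where "c = component C (w k)"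
  have le: "component C (w l) \<le> c" if "l < k" for l
   using chamber_mono[OF C(1) w ch, of l k] that k by (simp add: c_def)
  have ge: "c \<le> component C (w l)" if "k \<le> l" "l < n" for l
   using chamber_mono[OF C(1) w ch, of k l] that by (simp add: c_def)
  have "component C' ` {..<n} = {..<Suc m}"
  proof (intro equalityI subsetI)
   fix x assume "x \<in> component C' ` {..<n}"
   then obtain i where "i < n" "x = component C' i" by auto
   moreover have "component C i < m" using m \<open>i < n\<close> by blast
   ultimately show "x \<in> {..<Suc m}" by (simp add: C'_def)
  next
   fix x assume x: "x \<in> {..<Suc m}"
   have cm: "c < m" using m wn k unfolding c_def by blast
   consider "x < c" | "x = c" | "x = Suc c" | "Suc c < x" by linarith
   then show "x \<in> component C' ` {..<n}"
   proof cases
    case 1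
    then have "x \<in> component C ` {..<n}" unfolding m using cm by simp
    then obtain i where i: "i < n" "x = component C i" by auto
    obtain l where l: "i = w l" using permutes_surj[OF w] by (meson surjD)
    have "l < n" using i l permutes_in_image[OF w, of l] by simp
    then have "l < k" using ge[of l] 1 i l by (meson leD not_less)
    then have "component C' i = x" using i l inJ[of l] by (simp add: C'_def)
    then show ?thesis using i(1) by blast
   next
    case 2
    then have "component C' (w (k-1)) = x" using True inJ[of "k-1"] k by (simp add: C'_def c_def)
    moreover have "w (k-1) < n" using k wn by simp
    ultimately show ?thesis by blast
   next
    case 3
    then have "component C' (w k) = x" using inJ[of k] by (simp add: C'_def c_def)
    then show ?thesis using wn[OF k(2)] by blast
   next
    case 4
    then have "x - 1 \<in> component C ` {..<n}" unfolding m using x by auto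
    then obtain i where i: "i < n" "x - 1 = component C i" by auto
    obtain l where l: "i = w l" using permutes_surj[OF w] by (meson surjD)
    have "\<not> l < k" using le[of l] 4 i l by auto
    then have "component C' i = x" using i l inJ[of l] 4 by (simp add: C'_def)
    then show ?thesis using i(1) by blast
   qed
  qed
  then have C': "C' \<in> marked_chains n"
   using pos_nonzero[OF C(1)] unfolding marked_chains_def by (auto simp: C'_def)
  have ch': "chain_class n C' \<in> chamber_set n w"
   unfolding chamber_set_iff[OF C' w]
  proof (intro allI impI)
   fix l assume "Suc l < n"
   then have "component C (w l) \<le> component C (w (Suc l))"
    using chamber_mono[OF C(1) w ch, of l "Suc l"] by simp
   then show "component C' (w l) \<le> component C' (w (Suc l))"
    using inJ[of l] inJ[of "Suc l"] by (simp add: C'_def)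
  qed
  have co: "chamber_coord n w (chain_class n C') l = ((chamber_coord n w t)(k - 1 := 0)) l" for l
  proof (cases "l = k - 1")
   case True
   then show ?thesis
    using \<open>component C (w (k - 1)) = component C (w k)\<close> inJ[of "k-1"] inJ[of k] k
    by (simp add: chamber_coord_eq[OF C' w]) (simp add: C'_def)
  next
   case False
   then have "l < k \<longleftrightarrow> Suc l < k" using k by auto
   then show ?thesis using False inJ[of l] inJ[of "Suc l"] unfolding C(2)
    by (auto simp: chamber_coord_eq[OF C' w] chamber_coord_eq[OF C(1) w]) (auto simp: C'_def)
  qed
  have "cut_section n J w (chain_class n C') = 0"
   using co[of "k-1"] Jw by (simp add: cut_section_def k_def)
  then have "chain_class n C' \<in> delta n J" using cut_section_zero[OF C' w ch'] by simp
  with ch' co show thesis using that by (auto simp: k_def fun_eq_iff)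
 qed
qed

lemma delta_off_dense: "off_dense (LM n) (delta n J)"
proof (rule LM_off_dense)
 fix p :: "nat => complex" assume "\<And>i. i < n ==> p i \<noteq> 0"
 then have C: "\<lparr>component = (\<lambda>_. 0), pos = p\<rparr> \<in> marked_chains n" by (rule one_component_chain)
 show "chain_class n \<lparr>component = (\<lambda>_. 0), pos = p\<rparr> \<notin> delta n J"
  unfolding delta_iff[OF C] using J by (auto dest: arg_cong[of _ _ card])
qed

text \<open>The section given by \<open>cut_section\<close> vanishes exactly on the divisor and
  changes between charts by the characters \<open>cut_weight\<close>. That it generates the ideal is
  division by a single chart coordinate.\<close>

lemma divisor_class_delta:
 "divisor_class (LM n) (delta n J) = toric_class n (cut_weight J)"
proof -
 interpret function_variety "LM n" by (rule function_variety_LM)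
 define s where "s = (\<lambda>P. cut_section n J (chamber_of n P))"
 show ?thesis
 proof (rule divisor_class_eqI[where s = s])
  show "off_dense (LM n) (delta n J)" by (rule delta_off_dense)
  show "toric_bundle n (cut_weight J) \<in> line_bundles (LM n)" by (rule toric_line_bundle[OF toric_data_cut])
 next
  fix P assume P: "P \<in> points (LM n)"
  note w = chamber_of[OF P]
  show "s P \<in> vreg (LM n) (fst (toric_bundle n (cut_weight J)) P)"
   unfolding LM_eq_glue
  proof (rule glue_chart_regular)
   show "(chamber_set n (chamber_of n P), chamber_coord n (chamber_of n P)) \<in> LM_charts n" using w by blast
   show "(\<lambda>z. if chamber_of n P ` {..<card J} = J then z (card J - 1) else 1) \<in> polyfuns"
    by (cases "chamber_of n P ` {..<card J} = J") (simp_all add: polyfuns.coord polyfuns.const)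
   show "(\<lambda>_. 1) \<in> polyfuns" by (rule polyfuns.const)
  qed (auto simp: s_def cut_section_def)
 next
  fix P t assume P: "P \<in> points (LM n)" and t: "t \<in> fst (toric_bundle n (cut_weight J)) P"
  then show "s P t = 0 \<longleftrightarrow> t \<in> delta n J"
   using cut_section_zero[of "chain_rep t" "chamber_of n P"] chamber_of[OF P] LM_point_rep[of t n]
   by (simp add: s_def)
 next
  fix P Q t assume P: "P \<in> points (LM n)" and Q: "Q \<in> points (LM n)"
   and t: "t \<in> fst (toric_bundle n (cut_weight J)) P" "t \<in> fst (toric_bundle n (cut_weight J)) Q"
  note r = LM_point_rep[OF t(1)[unfolded fst_toric_bundle]]
  have z: "s P t = 0 \<longleftrightarrow> t \<in> delta n J" "s Q t = 0 \<longleftrightarrow> t \<in> delta n J"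
   using cut_section_zero[of "chain_rep t"] chamber_of[OF P] chamber_of[OF Q] r t by (simp_all add: s_def)
  show "s P t = snd (toric_bundle n (cut_weight J)) P Q t * s Q t"
  proof (cases "t \<in> delta n J")
   case True
   then show ?thesis using z by simp
  next
   case False
   then have "chain_monomial n (cut_weight J (chamber_of n P)) (chain_rep t) = s P t"
    "chain_monomial n (cut_weight J (chamber_of n Q)) (chain_rep t) = s Q t"
    using z cut_weight_monomial[OF r(1)] chamber_of[OF P] chamber_of[OF Q] r by (simp_all add: s_def)
   with False z show ?thesis unfolding snd_toric_bundle chain_monomial_diff[OF r(1)] by simp
  qed
 next
  fix P t0 W f assume P: "P \<in> points (LM n)" and W: "openin (vtop (LM n)) W"
   "W \<subseteq> fst (toric_bundle n (cut_weight J)) P" and t0: "t0 \<in> W" "t0 \<in> delta n J"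
   and f: "f \<in> vreg (LM n) W" and f0: "\<And>t. t \<in> W ==> t \<in> delta n J ==> f t = 0"
  define w where "w = chamber_of n P"
  have w: "w permutes {..<n}" "W \<subseteq> chamber_set n w" using chamber_of[OF P] W by (simp_all add: w_def)
  have wc: "(chamber_set n w, chamber_coord n w) \<in> LM_charts n" using w by blast
  define \<kappa> where "\<kappa> = card J - 1"
  define z where "z = chamber_coord n w"
  have t0w: "t0 \<in> chamber_set n w" using t0 w by blast
  have "cut_section n J w t0 = 0"
   using cut_section_zero[of "chain_rep t0" w] LM_point_rep[OF t0w] t0 t0w w by simp
  then have Jw: "w ` {..<card J} = J" by (auto simp: cut_section_def split: if_splits)
  have sP: "s P t = z t \<kappa>" for t using Jw by (simp add: s_def w_def[symmetric] cut_section_def z_def \<kappa>_def)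
  obtain a b where ab: "a \<in> polyfuns" "b \<in> polyfuns" "b (z t0) \<noteq> 0"
   "\<And>y. y \<in> W ==> y \<in> chamber_set n w ==> b (z y) \<noteq> 0 ==> f y = a (z y) / b (z y)"
   using glue_regular_chart[OF compatible_LM_charts f[unfolded LM_eq_glue] t0(1) wc t0w]
   unfolding z_def by blast
  obtain b' where b': "b' \<in> polyfuns" "b' (z t0) \<noteq> 0"
   "\<And>y. y \<in> chamber_set n w ==> b' (z y) \<noteq> 0 ==> y \<in> W"
   using glue_open_basis[OF compatible_LM_charts W(1)[unfolded LM_eq_glue] wc t0w t0(1)]
   unfolding z_def by blast
  \<comment> \<open>The factors \<open>b\<close> and \<open>b'\<close> make the numerator vanish
    also where \<open>f\<close> is undefined, so that \<open>p\<close> is zero on the whole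
    hyperplane and its remainder disappears.\<close>
  define p where "p = (\<lambda>z. a z * (b z * b' z))"
  have p: "p \<in> polyfuns" unfolding p_def using ab b' by (intro polyfuns.mult)
  obtain q where q: "q \<in> polyfuns" "\<forall>z. p z = p (z(\<kappa> := 0)) + z \<kappa> * q z"
   using polyfuns_remainder[OF p] by blast
  have p0: "p ((z y)(\<kappa> := 0)) = 0" if y: "y \<in> chamber_set n w" for y
  proof -
   obtain y' where y': "y' \<in> chamber_set n w" "z y' = (z y)(\<kappa> := 0)" "y' \<in> delta n J"
    using chamber_zero_coord[OF w(1) y Jw] unfolding z_def \<kappa>_def by blast
   show ?thesis
   proof (cases "b (z y') * b' (z y') = 0")
    case True
    then show ?thesis unfolding y'(2)[symmetric] by (auto simp: p_def)
   next
    case False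
    then have "y' \<in> W" using b'(3)[OF y'(1)] by auto
    then have "a (z y') / b (z y') = 0" using ab(4)[of y'] f0[of y'] y' False by auto
    then show ?thesis using False unfolding y'(2)[symmetric] by (auto simp: p_def)
   qed
  qed
  define N where "N = {y \<in> chamber_set n w. (\<lambda>z. b z * b' z) (z y) \<noteq> 0}"
  have N: "openin (vtop (LM n)) N" unfolding N_def z_def LM_eq_glue
   by (rule glue_basic_open[OF wc]) (intro polyfuns.mult ab b')
  have NW: "N \<subseteq> W" using b'(3) by (auto simp: N_def)
  have h: "(\<lambda>t. q (z t) / (b (z t) * (b (z t) * b' (z t)))) \<in> vreg (LM n) N"
   unfolding LM_eq_glue z_def
   by (rule glue_chart_regular[OF wc, of _ q "\<lambda>z. b z * (b z * b' z)"])
     (use q ab b' in \<open>auto simp: N_def z_def intro: polyfuns.mult\<close>)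
  have "f t = s P t * (q (z t) / (b (z t) * (b (z t) * b' (z t))))" if t: "t \<in> N" for t
  proof -
   have nz: "b (z t) \<noteq> 0" "b' (z t) \<noteq> 0" "t \<in> chamber_set n w" using t by (auto simp: N_def)
   then have "f t = a (z t) / b (z t)" using ab(4) NW t by blast
   also have "\<dots> = p (z t) / (b (z t) * (b (z t) * b' (z t)))" using nz by (simp add: p_def)
   also have "p (z t) = z t \<kappa> * q (z t)" using q(2)[rule_format, of "z t"] p0[OF nz(3)] by simp
   finally show ?thesis by (simp add: sP)
  qed
  then show "\<exists>N h. openin (vtop (LM n)) N \<and> t0 \<in> N \<and> N \<subseteq> W \<and> h \<in> vreg (LM n) N \<and>
    (\<forall>t\<in>N. f t = s P t * h t)"
   using N NW h ab b' t0w by (intro exI[of _ N] exI[of _ "\<lambda>t. q (z t) / (b (z t) * (b (z t) * b' (z t)))"])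
    (auto simp: N_def)
 qed
qed

end

section \<open>The psi class and the divisors \<open>G\<close>\<close>

lemma chain_monomial_ratio:
 assumes "C \<in> marked_chains n" "i < n" "j < n"
 shows "chain_monomial n (\<lambda>l. of_bool (l = i) - of_bool (l = j)) C = pos C i / pos C j"
proof -
 have "chain_monomial n (\<lambda>l. of_bool (l \<in> {i}) - of_bool (l \<in> {j})) C = pos C i / pos C j"
  unfolding chain_monomial_diff[OF assms(1)] using assms by (subst (1 2) chain_monomial_indicator) auto
 then show ?thesis by simp
qed

lemma sum_of_bool_component:
 assumes "i < n"
 shows "(\<Sum>l\<in>{l\<in>{..<n}. component C l = c}. of_bool (l = i)) = (of_bool (component C i = c) :: int)"
proof -
 define S where "S = {l\<in>{..<n}. component C l = c}"
 have "(\<Sum>l\<in>S. of_bool (l = i)) = (\<Sum>l\<in>S. if l = i then (1::int) else 0)"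
  by (rule sum.cong) auto
 also have "\<dots> = (if i \<in> S then 1 else 0)" by (rule sum.delta) (simp add: S_def)
 also have "\<dots> = of_bool (component C i = c)" using assms by (simp add: S_def)
 finally show ?thesis unfolding S_def .
qed

lemma balanced_ratio:
 assumes "i < n" "j < n" "component C i = component C j"
 shows "balanced n (\<lambda>l. of_bool (l = i) - of_bool (l = j)) C"
 unfolding balanced_def sum_subtractf sum_of_bool_component[OF assms(1)] sum_of_bool_component[OF assms(2)]
 using assms(3) by simp

lemma chamber_first:
 assumes C: "C \<in> marked_chains n" and w: "w permutes {..<n}" and ch: "chain_class n C \<in> chamber_set n w"
  and "i < n"
 shows "component C (w 0) \<le> component C i"
proof -
 obtain l where l: "i = w l" using permutes_surj[OF w] by (meson surjD)
 then show ?thesis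
  using chamber_mono[OF C w ch, of 0 l] permutes_in_image[OF w, of l] \<open>i < n\<close> by simp
qed

section \<open>The zero section of the universal curve and its conormal bundle\<close>

lemma add_at_zero_chain:
 assumes C: "C \<in> marked_chains n"
 shows "add_at_zero n C \<in> marked_chains (Suc n)"
proof -
 obtain m where m: "component C ` {..<n} = {..<m}" using C by (auto simp: marked_chains_def)
 have "component (add_at_zero n C) ` {..<n} = Suc ` component C ` {..<n}"
  unfolding image_image by (intro image_cong) (auto simp: add_at_zero_def)
 then have "component (add_at_zero n C) ` {..<Suc n} = insert 0 (Suc ` {..<m})"
  by (simp add: lessThan_Suc m) (simp add: add_at_zero_def)
 also have "\<dots> = {..<Suc m}" by (rule lessThan_Suc_eq_insert_0[symmetric])
 finally show ?thesis using pos_nonzero[OF C] unfolding marked_chains_def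
  by (auto simp: add_at_zero_def less_Suc_eq)
qed

lemma zero_section_class:
 assumes C: "C \<in> marked_chains n"
 shows "zero_section n (chain_class n C) = chain_class (Suc n) (add_at_zero n C)"
proof -
 have "chain_class (Suc n) (add_at_zero n C') = chain_class (Suc n) (add_at_zero n C)"
  if h: "(C, C') \<in> chain_iso n" for C'
 proof -
  obtain s where s: "C \<in> marked_chains n" "C' \<in> marked_chains n"
   "\<forall>i<n. component C' i = component C i \<and> s (component C i) \<noteq> 0 \<and> pos C' i = s (component C i) * pos C i"
   by (rule chain_isoE[OF h])
  have "(add_at_zero n C, add_at_zero n C') \<in> chain_iso (Suc n)"
   unfolding chain_iso_def using add_at_zero_chain[OF s(1)] add_at_zero_chain[OF s(2)] s(3)
   by (auto simp: add_at_zero_def less_Suc_eq intro!: exI[of _ "\<lambda>c. case c of 0 => 1 | Suc c => s c"])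
  then show ?thesis using chain_class_eqI by blast
 qed
 then have "zero_section n (chain_class n C) =
   (\<Union>C'\<in>chain_class n C. chain_class (Suc n) (add_at_zero n C))"
  unfolding zero_section_def by (intro SUP_cong refl) simp
 then show ?thesis using chain_class_self[OF C] by blast
qed

text \<open>The section is itself a boundary divisor of the larger space, that of the one-element
  set of the additional point, so its class is already known as a toric class.\<close>

lemma zero_section_image:
 "zero_section n ` points (LM n) = delta (Suc n) {n}"
proof (intro equalityI subsetI)
 fix t assume "t \<in> zero_section n ` points (LM n)"
 then obtain P where P: "P \<in> marked_chains n // chain_iso n" "t = zero_section n P" by (auto simp: points_LM)
 note r = chain_rep[OF P(1)]
 have "t = chain_class (Suc n) (add_at_zero n (chain_rep P))"
  using zero_section_class[OF r(2)] r(3) P(2) by simp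
 moreover have "{n} = {i\<in>{..<Suc n}. component (add_at_zero n (chain_rep P)) i < 1}"
  by (auto simp: add_at_zero_def)
 ultimately show "t \<in> delta (Suc n) {n}" using delta_iff[OF add_at_zero_chain[OF r(2)]] by blast
next
 fix t assume t: "t \<in> delta (Suc n) {n}"
 then have "t \<in> marked_chains (Suc n) // chain_iso (Suc n)" by (simp add: delta_def)
 note r = chain_rep[OF this]
 define C where "C = chain_rep t"
 have C: "C \<in> marked_chains (Suc n)" "t = chain_class (Suc n) C" using r by (simp_all add: C_def)
 obtain m where m: "{n} = {i\<in>{..<Suc n}. component C i < m}" using t C delta_iff[OF C(1)] by auto
 obtain M where M: "component C ` {..<Suc n} = {..<M}" using C(1) by (auto simp: marked_chains_def)
 have nm: "component C n < m" using m by (auto simp: set_eq_iff)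
 have pos_comp: "0 < component C i" if "i < n" for i
 proof -
  have "i \<notin> {n}" using that by simp
  then have "\<not> component C i < m" unfolding m using that by simp
  then show ?thesis using nm by simp
 qed
 have "component C n \<in> {..<M}" unfolding M[symmetric] by blast
 then have "0 \<in> component C ` {..<Suc n}" unfolding M by simp
 then obtain i where "i < Suc n" "component C i = 0" by auto
 then have n0: "component C n = 0" using pos_comp[of i] by (cases "i = n") auto
 \<comment> \<open>The additional point is alone on the leftmost component; deleting this component
   shifts the others down by one.\<close>
 define C' where "C' = \<lparr>component = (\<lambda>i. component C i - 1), pos = pos C\<rparr>"
 have "component C' ` {..<n} = {..<M - 1}"
 proof (intro equalityI subsetI)
  fix x assume "x \<in> component C' ` {..<n}"
  then obtain i where i: "i < n" "x = component C i - 1" by (auto simp: C'_def)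
  have "component C i \<in> {..<M}" unfolding M[symmetric] using i by auto
  then show "x \<in> {..<M - 1}" using i pos_comp[of i] by auto
 next
  fix x assume "x \<in> {..<M - 1}"
  then have "Suc x \<in> component C ` {..<Suc n}" unfolding M by auto
  then obtain i where i: "i < Suc n" "component C i = Suc x" by auto
  then have "i < n" using n0 by (cases "i = n") auto
  moreover have "component C' i = x" using i by (simp add: C'_def)
  ultimately show "x \<in> component C' ` {..<n}" by blast
 qed
 then have C': "C' \<in> marked_chains n"
  using pos_nonzero[OF C(1)] unfolding marked_chains_def by (auto simp: C'_def)
 \<comment> \<open>Only the leftmost component needs rescaling, to bring the additional point to the
   position 1 chosen in \<open>add_at_zero\<close>.\<close>
 have "(C, add_at_zero n C') \<in> chain_iso (Suc n)"
  unfolding chain_iso_def mem_Collect_eq case_prod_conv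
 proof (intro conjI C(1) add_at_zero_chain[OF C'] exI[of _ "\<lambda>c. if c = 0 then 1 / pos C n else 1"] allI impI)
  fix i assume "i < Suc n"
  then consider "i = n" | "i < n" by linarith
  then show "component (add_at_zero n C') i = component C i"
   "(if component C i = 0 then 1 / pos C n else 1) \<noteq> 0"
   "pos (add_at_zero n C') i = (if component C i = 0 then 1 / pos C n else 1) * pos C i"
   using n0 pos_comp[of i] pos_nonzero[OF C(1), of n] by (cases; simp add: add_at_zero_def C'_def)+
 qed
 then have "t = zero_section n (chain_class n C')"
  using C(2) zero_section_class[OF C'] chain_class_eqI by metis
 then show "t \<in> zero_section n ` points (LM n)"
  using chain_class_quotient[OF C'] by (auto simp: points_LM)
qed

text \<open>The order with the additional point in front: the section maps the chamber of
  \<open>w\<close> into the chamber of this permutation, with first coordinate 0.\<close>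

definition shift_perm :: "nat => (nat => nat) => nat => nat" where
 "shift_perm n w k = (case k of 0 => n | Suc k => if k < n then w k else Suc k)"

lemma shift_perm:
 assumes w: "w permutes {..<n}"
 shows "shift_perm n w permutes {..<Suc n}"
proof (rule bij_imp_permutes)
 note wn = permutes_less[OF w]
 have "inj_on (shift_perm n w) {..<Suc n}"
 proof (rule inj_onI)
  fix x y assume "x \<in> {..<Suc n}" "y \<in> {..<Suc n}" "shift_perm n w x = shift_perm n w y"
  then show "x = y"
   using wn[of "x - 1"] wn[of "y - 1"] injD[OF permutes_inj[OF w], of "x - 1" "y - 1"]
   by (cases x; cases y) (simp_all add: shift_perm_def)
 qed
 moreover have "shift_perm n w ` {..<Suc n} \<subseteq> {..<Suc n}"
  using less_SucI[OF wn] by (auto simp: shift_perm_def split: nat.splits)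
 ultimately show "bij_betw (shift_perm n w) {..<Suc n} {..<Suc n}"
  by (simp add: bij_betw_def endo_inj_surj)
 fix x assume "x \<notin> {..<Suc n}"
 then show "shift_perm n w x = x" by (auto simp: shift_perm_def split: nat.splits)
qed

lemma zero_section_chamber:
 assumes C: "C \<in> marked_chains n" and w: "w permutes {..<n}" and ch: "chain_class n C \<in> chamber_set n w"
 shows "zero_section n (chain_class n C) \<in> chamber_set (Suc n) (shift_perm n w)"
  and "chamber_coord (Suc n) (shift_perm n w) (zero_section n (chain_class n C)) k =
   (case k of 0 => 0 | Suc k => chamber_coord n w (chain_class n C) k)"
proof -
 note wn = permutes_less[OF w]
 note C' = add_at_zero_chain[OF C] and w' = shift_perm[OF w]
 have mono: "component C (w k) \<le> component C (w (Suc k))" if "Suc k < n" for k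
  using chamber_mono[OF C w ch, of k "Suc k"] that by simp
 show "zero_section n (chain_class n C) \<in> chamber_set (Suc n) (shift_perm n w)"
  unfolding zero_section_class[OF C] chamber_set_iff[OF C' w']
 proof (intro allI impI)
  fix k assume k: "Suc k < Suc n"
  show "component (add_at_zero n C) (shift_perm n w k) \<le> component (add_at_zero n C) (shift_perm n w (Suc k))"
  proof (cases k)
   case 0
   then show ?thesis by (simp add: add_at_zero_def shift_perm_def)
  next
   case (Suc l)
   then show ?thesis using wn[of l] wn[of "Suc l"] mono[of l] k
    by (simp add: add_at_zero_def shift_perm_def)
  qed
 qed
 show "chamber_coord (Suc n) (shift_perm n w) (zero_section n (chain_class n C)) k =
   (case k of 0 => 0 | Suc k => chamber_coord n w (chain_class n C) k)"
 proof (cases k)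
  case 0
  then show ?thesis unfolding zero_section_class[OF C] chamber_coord_eq[OF C' w'] using wn[of 0]
   by (auto simp: add_at_zero_def shift_perm_def)
 next
  case (Suc l)
  then show ?thesis
   unfolding zero_section_class[OF C] chamber_coord_eq[OF C' w'] chamber_coord_eq[OF C w]
   using wn[of l] wn[of "Suc l"]
   by (auto simp: add_at_zero_def shift_perm_def chamber_coord_eq[OF C w])
 qed
qed

lemma zero_section_morphism: "morphism (LM n) (LM (Suc n)) (zero_section n)"
 unfolding LM_eq_glue
proof (rule morphism_glueI[OF compatible_LM_charts compatible_LM_charts])
 fix x assume "x \<in> points (glue (LM_charts n))"
 then obtain w where w: "w permutes {..<n}" "x \<in> chamber_set n w" by (auto simp: points_glue)
 have y: "zero_section n y \<in> chamber_set (Suc n) (shift_perm n w) \<and>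
   chamber_coord (Suc n) (shift_perm n w) (zero_section n y) k =
    (case k of 0 => 0 | Suc k => chamber_coord n w y k)" if "y \<in> chamber_set n w" for y k
  using zero_section_chamber[OF LM_point_rep(1)[OF that] w(1), unfolded LM_point_rep(2)[OF that], OF that]
  by blast
 have co: "\<exists>a\<in>polyfuns. \<forall>y\<in>chamber_set n w.
   chamber_coord (Suc n) (shift_perm n w) (zero_section n y) k = a (chamber_coord n w y)" for k
 proof (cases k)
  case 0
  then show ?thesis using y by (intro bexI[of _ "\<lambda>_. 0"] polyfuns.const) simp
 next
  case (Suc l)
  then show ?thesis using y by (intro bexI[of _ "\<lambda>z. z l"] polyfuns.coord) simp
 qed
 show "\<exists>U phi V psi. (U, phi) \<in> LM_charts n \<and> (V, psi) \<in> LM_charts (Suc n) \<and> x \<in> U \<and>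
   (\<exists>b\<in>polyfuns. b (phi x) \<noteq> 0 \<and> (\<forall>y\<in>U. b (phi y) \<noteq> 0 --> zero_section n y \<in> V) \<and>
    (\<forall>k. \<exists>a\<in>polyfuns. \<forall>y\<in>U. b (phi y) \<noteq> 0 --> psi (zero_section n y) k = a (phi y) / b (phi y)))"
 proof (intro exI conjI)
  show "(chamber_set n w, chamber_coord n w) \<in> LM_charts n" using w by blast
  show "(chamber_set (Suc n) (shift_perm n w), chamber_coord (Suc n) (shift_perm n w)) \<in> LM_charts (Suc n)"
   using shift_perm[OF w(1)] by blast
  show "\<exists>b\<in>polyfuns. b (chamber_coord n w x) \<noteq> 0 \<and> (\<forall>y\<in>chamber_set n w. b (chamber_coord n w y) \<noteq> 0 -->
    zero_section n y \<in> chamber_set (Suc n) (shift_perm n w)) \<and>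
    (\<forall>k. \<exists>a\<in>polyfuns. \<forall>y\<in>chamber_set n w. b (chamber_coord n w y) \<noteq> 0 -->
     chamber_coord (Suc n) (shift_perm n w) (zero_section n y) k = a (chamber_coord n w y) / b (chamber_coord n w y))"
   using y co by (intro bexI[of _ "\<lambda>_. 1"] polyfuns.const) simp
 qed (rule w)
qed

lemma toric_data_first:
 assumes "0 < n"
 shows "toric_data n (\<lambda>w i. of_bool (i = w 0))"
 unfolding toric_data_def
proof (intro ballI allI impI)
 fix C w w' assume *: "C \<in> marked_chains n" "w permutes {..<n}" "w' permutes {..<n}"
  "chain_class n C \<in> chamber_set n w" "chain_class n C \<in> chamber_set n w'"
 have "w 0 < n" "w' 0 < n" using permutes_in_image[OF *(2), of 0] permutes_in_image[OF *(3), of 0] assms by auto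
 moreover have "component C (w 0) = component C (w' 0)"
  using chamber_first[OF *(1,2,4)] chamber_first[OF *(1,3,5)] calculation by (simp add: le_antisym)
 ultimately show "balanced n (\<lambda>i. of_bool (i = w 0) - of_bool (i = w' 0)) C" by (intro balanced_ratio)
qed

text \<open>In a chamber starting with the additional point \<open>n\<close>, the negative of the
  cut weight of \<open>{n}\<close> is the exponent vector of the second point minus that of
  \<open>n\<close>. The latter cancels in the transition functions, leaving the first of the
  original points.\<close>

lemma psi_zero_toric:
 assumes n: "0 < n"
 shows "psi_zero n = toric_class n (\<lambda>w i. of_bool (i = w 0))"
proof -
 interpret function_variety "LM n" by (rule function_variety_LM)
 have J: "{n} \<subseteq> {..<Suc n}" "{n} \<noteq> {}" "card {n} < Suc n" using n by auto
 define chi where "chi = (\<lambda>w i. - cut_weight {n} w i)"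
 have chi: "toric_data (Suc n) chi"
  using toric_data_scale[OF toric_data_cut[OF J], of "-1"] by (simp add: chi_def)
 have inv: "inv\<^bsub>Pic (LM (Suc n))\<^esub> divisor_class (LM (Suc n)) (zero_section n ` points (LM n)) =
   bundle_class (LM (Suc n)) (toric_bundle (Suc n) chi)"
  unfolding zero_section_image divisor_class_delta[OF J] toric_class_inv[OF toric_data_cut[OF J]] chi_def ..
 have "psi_zero n = bundle_class (LM n) (pullback_cocycle (LM n) (zero_section n) (toric_bundle (Suc n) chi))"
  unfolding psi_zero_def psi_class_def inv
  by (rule pullback_bundle_class[OF function_variety_LM function_variety_LM zero_section_morphism
     toric_line_bundle[OF chi]])
 also have "\<dots> = toric_class n (\<lambda>w i. of_bool (i = w 0))"
 proof (rule bundle_class_eqI)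
  define u where "u = (\<lambda>P. chamber_of (Suc n) (zero_section n P))"
  define W where "W = (\<lambda>P. chamber_set n (chamber_of n P) \<inter>
   {t \<in> points (LM n). zero_section n t \<in> chamber_set (Suc n) (u P)})"
  have u: "u P permutes {..<Suc n}" "zero_section n P \<in> chamber_set (Suc n) (u P)" if "P \<in> points (LM n)" for P
   using chamber_of[of "zero_section n P" "Suc n"] morphism_points[OF zero_section_morphism that]
   by (simp_all add: u_def)
  \<comment> \<open>The chamber \<open>u P\<close> comes from a choice and need not be the shift of
    \<open>chamber_of n P\<close>. Only its first two entries enter, and the second one lies on the
    leftmost component of the original chain, like the first entry of
    \<open>chamber_of n P\<close>.\<close>
  have first: "u P 0 = n \<and> u P 1 < n \<and> component (chain_rep t) (u P 1) = component (chain_rep t) (chamber_of n P 0)"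
   if P: "P \<in> points (LM n)" and t: "t \<in> W P" for P t
  proof -
   have tw: "t \<in> chamber_set n (chamber_of n P)" using t by (simp add: W_def)
   note r = LM_point_rep[OF tw]
   define C where "C = add_at_zero n (chain_rep t)"
   have C: "C \<in> marked_chains (Suc n)" using add_at_zero_chain[OF r(1)] by (simp add: C_def)
   have ch: "chain_class (Suc n) C \<in> chamber_set (Suc n) (u P)"
    using t zero_section_class[OF r(1)] r(2) by (simp add: W_def C_def)
   have "component C (u P 0) \<le> component C n" by (rule chamber_first[OF C u(1)[OF P] ch]) simp
   then have u0: "u P 0 = n" by (simp add: C_def add_at_zero_def split: if_splits)
   have "u P 1 \<in> {..<Suc n}" using permutes_in_image[OF u(1)[OF P], of 1] n by simp
   moreover have "u P 1 \<noteq> u P 0" using permutes_inj[OF u(1)[OF P]] by (auto dest: injD)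
   ultimately have u1: "u P 1 < n" using u0 by simp
   have "component (chain_rep t) (u P 1) \<le> component (chain_rep t) i" if i: "i < n" for i
   proof -
    obtain l where l: "i = u P l" using permutes_surj[OF u(1)[OF P]] by (meson surjD)
    have "l \<noteq> 0" using l u0 i by (cases l) auto
    moreover have "l < Suc n" using l i permutes_in_image[OF u(1)[OF P], of l] by simp
    ultimately have "component C (u P 1) \<le> component C (u P l)"
     using chamber_mono[OF C u(1)[OF P] ch, of 1 l] by simp
    then show ?thesis using u1 i l by (simp add: C_def add_at_zero_def)
   qed
   moreover have "chamber_of n P 0 < n"
    using permutes_in_image[OF chamber_of(1)[OF P], of 0] n by simp
   moreover have "component (chain_rep t) (chamber_of n P 0) \<le> component (chain_rep t) (u P 1)"
    using chamber_first[OF r(1) chamber_of(1)[OF P] _ u1] tw r(2) by simp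
   ultimately show ?thesis using u0 u1 by (simp add: le_antisym)
  qed
  have c0: "chamber_of n P 0 < n" if "P \<in> points (LM n)" for P
   using permutes_in_image[OF chamber_of(1)[OF that], of 0] n by simp
  \<comment> \<open>The two candidates for a first point share the leftmost component, so their
    ratio is a unit and compares the two bundles.\<close>
  define a where "a = (\<lambda>P t. chain_monomial n
   (\<lambda>i. of_bool (i = u P 1) - of_bool (i = chamber_of n P 0)) (chain_rep t))"
  show "(pullback_cocycle (LM n) (zero_section n) (toric_bundle (Suc n) chi),
   toric_bundle n (\<lambda>w i. of_bool (i = w 0))) \<in> bundle_iso (LM n)"
  proof (rule bundle_isoI[of _ _ _ W a])
   show "pullback_cocycle (LM n) (zero_section n) (toric_bundle (Suc n) chi) \<in> line_bundles (LM n)"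
    by (rule pullback_line_bundle[OF function_variety_LM zero_section_morphism toric_line_bundle[OF chi]])
   show "toric_bundle n (\<lambda>w i. of_bool (i = w 0)) \<in> line_bundles (LM n)"
    by (rule toric_line_bundle[OF toric_data_first[OF n]])
  next
   fix P assume P: "P \<in> points (LM n)"
   show "openin (vtop (LM n)) (W P)" unfolding W_def
    by (intro openin_Int chamber_open chamber_of P morphism_open[OF zero_section_morphism] u)
   show "P \<in> W P" using chamber_of[OF P] u[OF P] P by (simp add: W_def)
   show "W P \<subseteq> fst (pullback_cocycle (LM n) (zero_section n) (toric_bundle (Suc n) chi)) P \<inter>
     fst (toric_bundle n (\<lambda>w i. of_bool (i = w 0))) P"
    by (auto simp: W_def u_def)
   show "a P \<in> unit_functions (LM n) (W P)" unfolding a_def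
   proof (rule chain_monomial_unit[OF chamber_of(1)[OF P]])
    fix C assume C: "C \<in> marked_chains n" "chain_class n C \<in> W P"
    have "(C, chain_rep (chain_class n C)) \<in> chain_iso n"
     using chain_rep(1)[OF chain_class_quotient[OF C(1)]] by simp
    then have "component (chain_rep (chain_class n C)) i = component C i" if "i < n" for i
     using that by (auto simp: chain_iso_def)
    with first[OF P C(2)] c0[OF P] show "balanced n (\<lambda>i. of_bool (i = u P 1) - of_bool (i = chamber_of n P 0)) C"
     by (intro balanced_ratio) auto
   qed (auto simp: W_def)
  next
   fix P Q t assume P: "P \<in> points (LM n)" and Q: "Q \<in> points (LM n)" and t: "t \<in> W P" "t \<in> W Q"
   have tw: "t \<in> chamber_set n (chamber_of n P)" using t by (simp add: W_def)
   note r = LM_point_rep[OF tw]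
   define C where "C = add_at_zero n (chain_rep t)"
   have C: "C \<in> marked_chains (Suc n)" "zero_section n t = chain_class (Suc n) C"
    using add_at_zero_chain[OF r(1)] zero_section_class[OF r(1)] r(2) by (simp_all add: C_def)
   have zt: "zero_section n t \<in> chamber_set (Suc n) (u P)" "zero_section n t \<in> chamber_set (Suc n) (u Q)"
    using t by (simp_all add: W_def)
   note r' = LM_point_rep[OF zt(1)]
   have uP: "u P 0 = n" "u P 1 < n" and uQ: "u Q 0 = n" "u Q 1 < n"
    using first[OF P t(1)] first[OF Q t(2)] by auto
   have cw: "chi (u P) i - chi (u Q) i = of_bool (i = u P 1) - of_bool (i = u Q 1)" for i
    using uP uQ by (simp add: chi_def cut_weight_def lessThan_Suc)
   have "snd (pullback_cocycle (LM n) (zero_section n) (toric_bundle (Suc n) chi)) P Q t =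
     chain_monomial (Suc n) (\<lambda>i. chi (u P) i - chi (u Q) i) (chain_rep (zero_section n t))"
    by (simp add: snd_toric_bundle u_def)
   also have "\<dots> = chain_monomial (Suc n) (\<lambda>i. chi (u P) i - chi (u Q) i) C"
    by (rule chain_monomial_class[OF r'(1) C(1)])
      (use r'(2) C(2) toric_dataD[OF chi r'(1) u(1)[OF P] u(1)[OF Q]] zt in simp_all)
   also have "\<dots> = pos C (u P 1) / pos C (u Q 1)"
    unfolding cw using uP uQ by (intro chain_monomial_ratio[OF C(1)]) auto
   also have "\<dots> = pos (chain_rep t) (u P 1) / pos (chain_rep t) (u Q 1)"
    using uP uQ by (simp add: C_def add_at_zero_def)
   finally have g: "snd (pullback_cocycle (LM n) (zero_section n) (toric_bundle (Suc n) chi)) P Q t =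
    pos (chain_rep t) (u P 1) / pos (chain_rep t) (u Q 1)" .
   have aP: "a P t = pos (chain_rep t) (u P 1) / pos (chain_rep t) (chamber_of n P 0)"
    unfolding a_def using uP c0[OF P] by (intro chain_monomial_ratio[OF r(1)])
   have aQ: "a Q t = pos (chain_rep t) (u Q 1) / pos (chain_rep t) (chamber_of n Q 0)"
    unfolding a_def using uQ c0[OF Q] by (intro chain_monomial_ratio[OF r(1)])
   have h: "snd (toric_bundle n (\<lambda>w i. of_bool (i = w 0))) P Q t =
    pos (chain_rep t) (chamber_of n P 0) / pos (chain_rep t) (chamber_of n Q 0)"
    unfolding snd_toric_bundle using c0[OF P] c0[OF Q] by (intro chain_monomial_ratio[OF r(1)])
   show "snd (pullback_cocycle (LM n) (zero_section n) (toric_bundle (Suc n) chi)) P Q t * a Q t =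
    a P t * snd (toric_bundle n (\<lambda>w i. of_bool (i = w 0))) P Q t"
    unfolding g aP aQ h
    using pos_nonzero[OF r(1)] uP uQ c0[OF P] c0[OF Q] by simp
  qed
 qed
 finally show ?thesis .
qed

text \<open>Summation by parts: it explains the coefficients \<open>a - card J\<close> in the
  definition of \<open>G_class\<close>, which turn \<open>a\<close> copies of the first character
  into the sum of the first \<open>a\<close> characters.\<close>

lemma weighted_telescope:
 fixes f :: "nat => int"
 shows "(\<Sum>k=1..<a. int (a - k) * (f (k - 1) - f k)) = int a * f 0 - (\<Sum>k<a. f k)"
proof (induction a)
 case (Suc a)
 have tel: "(\<Sum>k=1..<Suc a. f (k - 1) - f k) = f 0 - f a"
  by (induction a) auto
 have "(\<Sum>k=1..<Suc a. int (Suc a - k) * (f (k - 1) - f k)) =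
   (\<Sum>k=1..<Suc a. int (a - k) * (f (k - 1) - f k) + (f (k - 1) - f k))"
  by (intro sum.cong refl) (simp add: Suc_diff_le algebra_simps)
 also have "\<dots> = (\<Sum>k=1..<a. int (a - k) * (f (k - 1) - f k)) + (f 0 - f a)"
  unfolding sum.distrib tel by (cases a) simp_all
 finally show ?case using Suc by (simp add: algebra_simps)
qed simp

lemma G_class_toric:
 assumes a: "1 \<le> a" "a < n"
 shows "G_class n a = toric_class n (\<lambda>w i. of_bool (i \<in> w ` {..<a}))"
  and "toric_data n (\<lambda>w i. of_bool (i \<in> w ` {..<a}))"
proof -
 interpret function_variety "LM n" by (rule function_variety_LM)
 define A where "A = {J. J \<noteq> {} \<and> J \<subseteq> {..<n} \<and> card J \<le> a - 1}"
 have A: "finite A" by (rule finite_subset[of _ "Pow {..<n}"]) (auto simp: A_def)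
 have J: "J \<subseteq> {..<n}" "J \<noteq> {}" "card J < n" if "J \<in> A" for J using that a by (auto simp: A_def)
 define chi where "chi = (\<lambda>J w i. int (a - card J) * cut_weight J w i)"
 have chi: "toric_data n (chi J)" if "J \<in> A" for J
  unfolding chi_def by (rule toric_data_scale[OF toric_data_cut[OF J[OF that]]])
 have chis: "toric_data n (\<lambda>w i. \<Sum>J\<in>A. chi J w i)" by (rule toric_data_sum[OF chi])
 have "0 < n" using a by simp
 note first = toric_data_first[OF this]
 have pow: "divisor_class (LM n) (delta n J) [^]\<^bsub>Pic (LM n)\<^esub> (a - card J) =
   toric_class n (chi J)" if "J \<in> A" for J
  unfolding divisor_class_delta[OF J[OF that]] toric_class_pow[OF toric_data_cut[OF J[OF that]]] chi_def ..
 have fin: "finprod (Pic (LM n)) (\<lambda>J. divisor_class (LM n) (delta n J) [^]\<^bsub>Pic (LM n)\<^esub> (a - card J)) A =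
   toric_class n (\<lambda>w i. \<Sum>J\<in>A. chi J w i)"
 proof -
  have "finprod (Pic (LM n)) (\<lambda>J. divisor_class (LM n) (delta n J) [^]\<^bsub>Pic (LM n)\<^esub> (a - card J)) A =
    finprod (Pic (LM n)) (\<lambda>J. toric_class n (chi J)) A"
   by (rule Pic.finprod_cong'[OF refl _ pow]) (use chi toric_class_carrier in auto)
  also have "\<dots> = toric_class n (\<lambda>w i. \<Sum>J\<in>A. chi J w i)"
   by (rule toric_class_finprod[OF A chi])
  finally show ?thesis .
 qed
 define theta where "theta = (\<lambda>w i. int a * of_bool (i = w 0) + - (\<Sum>J\<in>A. chi J w i))"
 have neg: "toric_data n (\<lambda>w i. - (\<Sum>J\<in>A. chi J w i))"
  using toric_data_scale[OF chis, of "-1"] by simp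
 have theta: "toric_data n theta" unfolding theta_def
  by (intro toric_data_add toric_data_scale first neg)
 have G: "G_class n a = toric_class n theta"
  unfolding G_class_def psi_zero_toric[OF \<open>0 < n\<close>] A_def[symmetric] fin toric_class_pow[OF first]
   toric_class_inv[OF chis] theta_def
  by (rule toric_class_mult[OF toric_data_scale[OF first] neg])
 have theta_eq: "theta w i = of_bool (i \<in> w ` {..<a})" if w: "w permutes {..<n}" for w i
 proof -
  have inj: "inj w" by (rule permutes_inj[OF w])
  have inj_on: "inj_on w {..<k}" for k by (rule inj_on_subset[OF inj subset_UNIV])
  have card: "card (w ` {..<k}) = k" for k by (simp add: card_image[OF inj_on])
  define F where "F = (\<lambda>k. w ` {..<k})"
  have sub: "F ` {1..<a} \<subseteq> A"
  proof
   fix J assume "J \<in> F ` {1..<a}"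
   then obtain k where k: "1 \<le> k" "k < a" "J = w ` {..<k}" by (auto simp: F_def)
   have wn: "w l < n" if "l < k" for l using permutes_in_image[OF w, of l] that k a by simp
   then have "J \<subseteq> {..<n}" unfolding k(3) by blast
   moreover have "w 0 \<in> J" using k by simp
   then have "J \<noteq> {}" by blast
   ultimately show "J \<in> A" using card[of k] k by (simp add: A_def)
  qed
  have "(\<Sum>J\<in>A. chi J w i) = (\<Sum>J\<in>F ` {1..<a}. chi J w i)"
  proof (rule sum.mono_neutral_right[OF A sub], rule ballI)
   fix J assume "J \<in> A - F ` {1..<a}"
   then have "J \<in> A" "J \<notin> F ` {1..<a}" by auto
   then have "card J \<noteq> 0" "card J < a" using finite_subset[of J "{..<n}"] a by (auto simp: A_def)
   then have "F (card J) \<noteq> J" using \<open>J \<notin> F ` {1..<a}\<close> by (metis One_nat_def Suc_leI atLeastLessThan_iff image_eqI neq0_conv)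
   then show "chi J w i = 0" by (simp add: chi_def cut_weight_def F_def)
  qed
  also have "\<dots> = (\<Sum>k=1..<a. chi (F k) w i)"
  proof (rule sum.reindex[unfolded comp_def])
   show "inj_on F {1..<a}" by (rule inj_onI) (metis F_def card)
  qed
  also have "\<dots> = (\<Sum>k=1..<a. int (a - k) * (of_bool (i = w (k - 1)) - of_bool (i = w k)))"
   by (intro sum.cong refl) (simp add: chi_def cut_weight_def F_def card)
  also have "\<dots> = int a * of_bool (i = w 0) - (\<Sum>k<a. of_bool (i = w k))"
   by (rule weighted_telescope)
  finally have "theta w i = (\<Sum>k<a. of_bool (i = w k))" by (simp add: theta_def)
  also have "\<dots> = (\<Sum>j\<in>w ` {..<a}. of_bool (i = j))"
   by (simp add: sum.reindex[OF inj_on])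
  also have "\<dots> = (\<Sum>j\<in>w ` {..<a}. if i = j then 1 else 0)" by (intro sum.cong) auto
  also have "\<dots> = of_bool (i \<in> w ` {..<a})" by (subst sum.delta') auto
  finally show ?thesis .
 qed
 have data: "toric_data n (\<lambda>w i. of_bool (i \<in> w ` {..<a}))"
  unfolding toric_data_def
 proof (intro ballI allI impI)
  fix C w w' assume *: "C \<in> marked_chains n" "w permutes {..<n}" "w' permutes {..<n}"
   "chain_class n C \<in> chamber_set n w" "chain_class n C \<in> chamber_set n w'"
  show "balanced n (\<lambda>i. of_bool (i \<in> w ` {..<a}) - of_bool (i \<in> w' ` {..<a})) C"
   using toric_dataD[OF theta *] unfolding theta_eq[OF *(2)] theta_eq[OF *(3)] .
 qed
 then show "toric_data n (\<lambda>w i. of_bool (i \<in> w ` {..<a}))" .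
 show "G_class n a = toric_class n (\<lambda>w i. of_bool (i \<in> w ` {..<a}))"
  unfolding G by (rule toric_class_eqI[OF theta data]) (rule theta_eq)
qed

section \<open>The product of projective spaces\<close>

abbreviation hom_class :: "nat => collineation => collineation set" where
 "hom_class n A \<equiv> hom_equiv n `` {A}"

abbreviation hom_indices :: "nat => (nat set \<times> nat set) set" where
 "hom_indices n \<equiv> \<Union>k\<in>{1..<n}. minor_indices n k"

lemma minor_indices_card: "q \<in> minor_indices n k ==> card (fst q) = k"
 by (auto simp: minor_indices_def)

lemma hom_equivI:
 assumes "A \<in> hom_vectors n" "B \<in> hom_vectors n" "\<And>k. k \<in> {1..<n} ==> s k \<noteq> 0"
  "\<And>k q. k \<in> {1..<n} ==> q \<in> minor_indices n k ==> B q = s k * A q"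
 shows "(A, B) \<in> hom_equiv n"
 using assms unfolding hom_equiv_def by blast

lemma hom_equivE:
 assumes "(A, B) \<in> hom_equiv n"
 obtains s where "A \<in> hom_vectors n" "B \<in> hom_vectors n" "\<forall>k\<in>{1..<n}. s k \<noteq> 0"
  "\<forall>k\<in>{1..<n}. \<forall>q\<in>minor_indices n k. B q = s k * A q"
 using assms unfolding hom_equiv_def by blast

lemma equiv_hom_equiv: "equiv (hom_vectors n) (hom_equiv n)"
proof (rule equivI)
 show "hom_equiv n \<subseteq> hom_vectors n \<times> hom_vectors n" by (auto simp: hom_equiv_def)
 show "refl_on (hom_vectors n) (hom_equiv n)"
  by (rule refl_onI) (rule hom_equivI[where s = "\<lambda>_. 1"], simp_all)
 show "sym (hom_equiv n)"
 proof (rule symI)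
  fix A B assume "(A, B) \<in> hom_equiv n"
  then obtain s where s: "A \<in> hom_vectors n" "B \<in> hom_vectors n" "\<forall>k\<in>{1..<n}. s k \<noteq> 0"
   "\<forall>k\<in>{1..<n}. \<forall>q\<in>minor_indices n k. B q = s k * A q" by (rule hom_equivE)
  show "(B, A) \<in> hom_equiv n"
   by (rule hom_equivI[where s = "\<lambda>k. inverse (s k)"]) (use s in auto)
 qed
 show "trans (hom_equiv n)"
 proof (rule transI)
  fix A B C assume AB: "(A, B) \<in> hom_equiv n" and BC: "(B, C) \<in> hom_equiv n"
  obtain s where s: "A \<in> hom_vectors n" "B \<in> hom_vectors n" "\<forall>k\<in>{1..<n}. s k \<noteq> 0"
   "\<forall>k\<in>{1..<n}. \<forall>q\<in>minor_indices n k. B q = s k * A q" by (rule hom_equivE[OF AB])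
  obtain s' where s': "B \<in> hom_vectors n" "C \<in> hom_vectors n" "\<forall>k\<in>{1..<n}. s' k \<noteq> 0"
   "\<forall>k\<in>{1..<n}. \<forall>q\<in>minor_indices n k. C q = s' k * B q" by (rule hom_equivE[OF BC])
  show "(A, C) \<in> hom_equiv n"
   by (rule hom_equivI[where s = "\<lambda>k. s' k * s k"]) (use s s' in auto)
 qed
qed

lemma hom_class_self: "A \<in> hom_vectors n ==> A \<in> hom_class n A"
 by (rule equiv_class_self[OF equiv_hom_equiv])

lemma hom_class_eqI: "(A, B) \<in> hom_equiv n ==> hom_class n A = hom_class n B"
 by (rule equiv_class_eq[OF equiv_hom_equiv])

lemma hom_class_quotient: "A \<in> hom_vectors n ==> hom_class n A \<in> hom_vectors n // hom_equiv n"
 by (rule quotientI)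

lemma hom_quotientE:
 assumes "P \<in> hom_vectors n // hom_equiv n"
 obtains A where "A \<in> hom_vectors n" "P = hom_class n A"
 using assms by (auto elim: quotientE)

lemma hom_vectors_zero:
 "A \<in> hom_vectors n ==> q \<notin> hom_indices n ==> A q = 0"
 unfolding hom_vectors_def by blast

definition frame :: "nat => (nat => nat set \<times> nat set) => bool" where
 "frame n tau \<longleftrightarrow> (\<forall>k\<in>{1..<n}. tau k \<in> minor_indices n k)"

abbreviation hom_charts ::
 "nat => (collineation set set \<times> (collineation set => nat set \<times> nat set => complex)) set" where
 "hom_charts n \<equiv> {(hom_chart_set n tau, hom_chart_coord tau) | tau. frame n tau}"

lemma hom_product_eq_glue: "hom_product n = glue (hom_charts n)"
 by (simp add: hom_product_def frame_def)

lemma hom_chart_set_iff: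
 assumes A: "A \<in> hom_vectors n" and tau: "frame n tau"
 shows "hom_class n A \<in> hom_chart_set n tau \<longleftrightarrow> (\<forall>k\<in>{1..<n}. A (tau k) \<noteq> 0)"
proof -
 have "(\<forall>k\<in>{1..<n}. B (tau k) \<noteq> 0) \<longleftrightarrow> (\<forall>k\<in>{1..<n}. A (tau k) \<noteq> 0)" if h: "(A, B) \<in> hom_equiv n" for B
 proof -
  obtain s where s: "\<forall>k\<in>{1..<n}. s k \<noteq> 0" "\<forall>k\<in>{1..<n}. \<forall>q\<in>minor_indices n k. B q = s k * A q"
   by (rule hom_equivE[OF h])
  have "B (tau k) = 0 \<longleftrightarrow> A (tau k) = 0" if "k \<in> {1..<n}" for k
   using s that tau by (auto simp: frame_def)
  then show ?thesis by blast
 qed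
 then show ?thesis
  unfolding hom_chart_set_def using hom_class_quotient[OF A] hom_class_self[OF A] by blast
qed

lemma hom_chart_coord_eq:
 assumes A: "A \<in> hom_vectors n" and tau: "frame n tau"
 shows "hom_chart_coord tau (hom_class n A) q = A q / A (tau (card (fst q)))"
proof -
 let ?B = "SOME B. B \<in> hom_class n A"
 have "?B \<in> hom_class n A" by (rule someI[where P = "\<lambda>B. B \<in> hom_class n A"]) (rule hom_class_self[OF A])
 then have "(A, ?B) \<in> hom_equiv n" by simp
 then obtain s where s: "?B \<in> hom_vectors n" "\<forall>k\<in>{1..<n}. s k \<noteq> 0"
  "\<forall>k\<in>{1..<n}. \<forall>q\<in>minor_indices n k. ?B q = s k * A q" by (rule hom_equivE)
 show ?thesis
 proof (cases "q \<in> hom_indices n")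
  case True
  then obtain k where k: "k \<in> {1..<n}" "q \<in> minor_indices n k" by blast
  then have "?B q = s k * A q" "?B (tau k) = s k * A (tau k)" "s k \<noteq> 0"
   using s tau by (simp_all add: frame_def)
  then show ?thesis using minor_indices_card[OF k(2)] by (simp add: hom_chart_coord_def Let_def)
 next
  case False
  then show ?thesis using hom_vectors_zero[OF A False] hom_vectors_zero[OF s(1) False]
   by (simp add: hom_chart_coord_def Let_def)
 qed
qed

lemma ex_frame:
 assumes A: "A \<in> hom_vectors n"
 obtains tau where "frame n tau" "\<forall>k\<in>{1..<n}. A (tau k) \<noteq> 0"
proof -
 have "\<forall>k\<in>{1..<n}. \<exists>q. q \<in> minor_indices n k \<and> A q \<noteq> 0" using A unfolding hom_vectors_def by blast
 from bchoice[OF this] obtain tau where "\<forall>k\<in>{1..<n}. tau k \<in> minor_indices n k \<and> A (tau k) \<noteq> 0" ..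
 then show thesis using that[of tau] by (simp add: frame_def)
qed

lemma prod_remove_divide:
 fixes f :: "nat => complex"
 assumes "k \<in> {1..<n}" "(\<Prod>j\<in>{1..<n}. f j) \<noteq> 0"
 shows "a / f k = a * (\<Prod>j\<in>{1..<n} - {k}. f j) / (\<Prod>j\<in>{1..<n}. f j)"
proof -
 have "(\<Prod>j\<in>{1..<n}. f j) = f k * (\<Prod>j\<in>{1..<n} - {k}. f j)" using assms(1) by (intro prod.remove) auto
 with assms(2) show ?thesis by (simp add: field_simps)
qed

text \<open>Charts need a single denominator for all coordinates, whereas each level is divided by
  its own frame coordinate; the product of all frame coordinates serves every level.\<close>

lemma hom_quotients:
 assumes R: "func_ring R" and A: "\<And>q. (\<lambda>y. A y q) \<in> R" and hv: "\<And>y. y \<in> Y ==> A y \<in> hom_vectors n"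
  and tau: "frame n tau"
 shows "\<exists>a\<in>R. \<forall>y\<in>Y. (\<Prod>j\<in>{1..<n}. A y (tau j)) \<noteq> 0 -->
  A y q / A y (tau (card (fst q))) = a y / (\<Prod>j\<in>{1..<n}. A y (tau j))"
proof (cases "q \<in> hom_indices n")
 case True
 then obtain k where k: "k \<in> {1..<n}" "card (fst q) = k" using minor_indices_card by blast
 show ?thesis
 proof (intro bexI ballI impI)
  fix y assume "(\<Prod>j\<in>{1..<n}. A y (tau j)) \<noteq> 0"
  then show "A y q / A y (tau (card (fst q))) =
   A y q * (\<Prod>j\<in>{1..<n} - {k}. A y (tau j)) / (\<Prod>j\<in>{1..<n}. A y (tau j))"
   unfolding k(2) by (rule prod_remove_divide[OF k(1)])
 qed (intro func_ring_mult[OF R] func_ring_prod[OF R] A)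
next
 case False
 then show ?thesis
  using hom_vectors_zero[OF hv False] by (intro bexI[of _ "\<lambda>_. 0"] func_ring_const[OF R]) simp
qed

lemma hom_chart_point:
 assumes "P \<in> hom_chart_set n tau"
 obtains A where "A \<in> hom_vectors n" "P = hom_class n A"
 using assms by (auto simp: hom_chart_set_def elim: hom_quotientE)

lemma hom_chart_coord_mem:
 assumes P: "P \<in> hom_chart_set n tau" and tau: "frame n tau"
 shows "hom_chart_coord tau P \<in> hom_vectors n" "P = hom_class n (hom_chart_coord tau P)"
proof -
 obtain A where A: "A \<in> hom_vectors n" "P = hom_class n A" using P by (rule hom_chart_point)
 have nz: "A (tau k) \<noteq> 0" if "k \<in> {1..<n}" for k
  using P that unfolding A(2) hom_chart_set_iff[OF A(1) tau] by blast
 have co: "hom_chart_coord tau P q = A q / A (tau (card (fst q)))" for q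
  unfolding A(2) by (rule hom_chart_coord_eq[OF A(1) tau])
 show hv: "hom_chart_coord tau P \<in> hom_vectors n"
  unfolding hom_vectors_def mem_Collect_eq co
 proof (intro conjI allI impI ballI)
  fix q assume "q \<notin> hom_indices n"
  then show "A q / A (tau (card (fst q))) = 0" using hom_vectors_zero[OF A(1)] by simp
 next
  fix k assume k: "k \<in> {1..<n}"
  then have t: "tau k \<in> minor_indices n k" using tau by (simp add: frame_def)
  show "\<exists>q\<in>minor_indices n k. A q / A (tau (card (fst q))) \<noteq> 0"
   by (rule bexI[OF _ t]) (use nz[OF k] minor_indices_card[OF t] in simp)
 qed
 show "P = hom_class n (hom_chart_coord tau P)"
  unfolding A(2)
 proof (rule hom_class_eqI[OF hom_equivI[where s = "\<lambda>k. 1 / A (tau k)"]])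
  show "hom_chart_coord tau (hom_class n A) \<in> hom_vectors n" using hv A(2) by simp
  fix k q assume "q \<in> minor_indices n k"
  then show "hom_chart_coord tau (hom_class n A) q = 1 / A (tau k) * A q"
   using minor_indices_card by (simp add: hom_chart_coord_eq[OF A(1) tau])
 qed (use A nz in auto)
qed

lemma compatible_hom_charts: "compatible_charts (hom_charts n)"
 unfolding compatible_charts_def
proof (intro allI impI)
 fix U phi V psi x
 assume "(U, phi) \<in> hom_charts n" "(V, psi) \<in> hom_charts n" and x: "x \<in> U" "x \<in> V"
 then obtain tau tau' where tau: "frame n tau" "U = hom_chart_set n tau" "phi = hom_chart_coord tau"
  and tau': "frame n tau'" "V = hom_chart_set n tau'" "psi = hom_chart_coord tau'" by auto
 define b where "b = (\<lambda>z :: nat set \<times> nat set => complex. \<Prod>j\<in>{1..<n}. z (tau' j))"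
 have mem: "phi y \<in> hom_vectors n" "y = hom_class n (phi y)" if "y \<in> U" for y
  using hom_chart_coord_mem[OF _ tau(1), of y] that tau by auto
 have V_iff: "y \<in> V \<longleftrightarrow> b (phi y) \<noteq> 0" if "y \<in> U" for y
  using hom_chart_set_iff[OF mem(1)[OF that] tau'(1)] mem(2)[OF that] unfolding tau'(2) b_def
  by (metis finite_atLeastLessThan prod_zero_iff)
 have "psi y k = phi y k / phi y (tau' (card (fst k)))" if "y \<in> U" for y k
  using hom_chart_coord_eq[OF mem(1)[OF that] tau'(1), of k] mem(2)[OF that] unfolding tau'(3) by metis
 moreover have "\<exists>a\<in>polyfuns. \<forall>z\<in>hom_vectors n. (\<Prod>j\<in>{1..<n}. z (tau' j)) \<noteq> 0 -->
   z k / z (tau' (card (fst k))) = a z / (\<Prod>j\<in>{1..<n}. z (tau' j))" for k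
  by (rule hom_quotients[OF func_ring_polyfuns _ _ tau'(1), where A = "\<lambda>z. z"]) (auto intro: polyfuns.coord)
 then have "\<exists>a\<in>polyfuns. \<forall>z\<in>hom_vectors n. b z \<noteq> 0 -->
   z k / z (tau' (card (fst k))) = a z / b z" for k unfolding b_def .
 ultimately have co: "\<exists>a\<in>polyfuns. \<forall>y\<in>U. b (phi y) \<noteq> 0 --> psi y k = a (phi y) / b (phi y)" for k
  using mem(1) by (metis (no_types, lifting))
 have "b \<in> polyfuns" unfolding b_def by (intro func_ring_prod[OF func_ring_polyfuns] polyfuns.coord)
 with V_iff co x show "\<exists>b\<in>polyfuns. b (phi x) \<noteq> 0 \<and> (\<forall>y\<in>U. b (phi y) \<noteq> 0 --> y \<in> V) \<and>
  (\<forall>k. \<exists>a\<in>polyfuns. \<forall>y\<in>U. b (phi y) \<noteq> 0 --> psi y k = a (phi y) / b (phi y))"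
  by (intro bexI[of _ b]) auto
qed

lemma function_variety_hom_product: "function_variety (hom_product n)"
 unfolding hom_product_eq_glue by (rule function_variety_glue[OF compatible_hom_charts])

lemma points_hom_product: "points (hom_product n) = hom_vectors n // hom_equiv n"
proof -
 have "P \<in> points (hom_product n)" if P: "P \<in> hom_vectors n // hom_equiv n" for P
 proof -
  obtain A where A: "A \<in> hom_vectors n" "P = hom_class n A" using P by (rule hom_quotientE)
  obtain tau where tau: "frame n tau" "\<forall>k\<in>{1..<n}. A (tau k) \<noteq> 0" by (rule ex_frame[OF A(1)])
  then have "P \<in> hom_chart_set n tau" unfolding A(2) hom_chart_set_iff[OF A(1) tau(1)] by blast
  then show ?thesis unfolding hom_product_eq_glue points_glue using tau(1) by blast
 qed
 then show ?thesis unfolding hom_product_eq_glue points_glue by (auto simp: hom_chart_set_def)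
qed

text \<open>For families given by homogeneous coordinates the frame nonzero at \<open>y0\<close>
  supplies both chart and denominator. It is used for polynomials in one parameter (curves,
  degenerations, shears) and for polynomials in chart coordinates (continuity of shears).\<close>

lemma hom_family_regular:
 assumes R: "func_ring R" and A: "\<And>q. (\<lambda>y. A y q) \<in> R" and hv: "\<And>y. y \<in> Y ==> A y \<in> hom_vectors n"
  and y0: "y0 \<in> Y" and V: "openin (vtop (hom_product n)) V" "hom_class n (A y0) \<in> V"
  and h: "h \<in> vreg (hom_product n) V"
 obtains a r where "a \<in> R" "r \<in> R" "r y0 \<noteq> 0"
  "\<forall>y\<in>Y. r y \<noteq> 0 --> hom_class n (A y) \<in> V \<and> h (hom_class n (A y)) = a y / r y"
proof -
 obtain tau where tau: "frame n tau" "\<forall>k\<in>{1..<n}. A y0 (tau k) \<noteq> 0" by (rule ex_frame[OF hv[OF y0]])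
 define b where "b = (\<lambda>y. \<Prod>j\<in>{1..<n}. A y (tau j))"
 have wc: "(hom_chart_set n tau, hom_chart_coord tau) \<in> hom_charts n" using tau by blast
 have b: "b \<in> R" "b y0 \<noteq> 0" using tau(2) by (auto simp: b_def intro: func_ring_prod[OF R] A)
 have U: "hom_class n (A y) \<in> hom_chart_set n tau" if "y \<in> Y" "b y \<noteq> 0" for y
  using that unfolding hom_chart_set_iff[OF hv[OF that(1)] tau(1)] b_def by auto
 have co: "\<exists>a\<in>R. \<forall>y\<in>Y. b y \<noteq> 0 --> hom_chart_coord tau (hom_class n (A y)) q = a y / b y" for q
  using hom_quotients[OF R A hv tau(1), where q = q] hom_chart_coord_eq[OF hv tau(1)]
  unfolding b_def by metis
 obtain a r where "a \<in> R" "r \<in> R" "r y0 \<noteq> 0"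
  "\<forall>y\<in>Y. r y \<noteq> 0 --> b y \<noteq> 0 \<and> hom_class n (A y) \<in> V \<and> h (hom_class n (A y)) = a y / r y"
  by (rule glue_family_regular[where x = "\<lambda>y. hom_class n (A y)", OF compatible_hom_charts wc R b(1) y0 b(2)
     U co V(1)[unfolded hom_product_eq_glue] V(2) h[unfolded hom_product_eq_glue]])
 then show thesis using that by blast
qed

lemma hom_family_open:
 assumes R: "func_ring R" and A: "\<And>q. (\<lambda>y. A y q) \<in> R" and hv: "\<And>y. y \<in> Y ==> A y \<in> hom_vectors n"
  and y0: "y0 \<in> Y" and V: "openin (vtop (hom_product n)) V" "hom_class n (A y0) \<in> V"
 obtains r where "r \<in> R" "r y0 \<noteq> 0" "\<forall>y\<in>Y. r y \<noteq> 0 --> hom_class n (A y) \<in> V"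
proof -
 have reg: "(\<lambda>_. 1) \<in> vreg (hom_product n) V"
  by (rule function_variety.reg_const[OF function_variety_hom_product openin_subset[OF V(1)]])
 obtain a r where "a \<in> R" "r \<in> R" "r y0 \<noteq> 0"
  "\<forall>y\<in>Y. r y \<noteq> 0 --> hom_class n (A y) \<in> V \<and> 1 = a y / r y"
  by (rule hom_family_regular[OF R A hv y0 V reg])
 then show thesis using that by blast
qed

lemma hom_open_nonzero:
 assumes F: "F \<in> polyfuns" and inv: "\<And>A B. (A, B) \<in> hom_equiv n ==> F A \<noteq> 0 ==> F B \<noteq> 0"
 shows "openin (vtop (hom_product n)) {P \<in> points (hom_product n). \<exists>A\<in>P. F A \<noteq> 0}"
proof (subst openin_subopen, safe)
 fix P A assume P: "P \<in> points (hom_product n)" and A: "A \<in> P" "F A \<noteq> 0"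
 obtain A' where A': "A' \<in> hom_vectors n" "P = hom_class n A'"
  using P unfolding points_hom_product by (rule hom_quotientE)
 then have AA: "(A', A) \<in> hom_equiv n" using A by simp
 then have hA: "A \<in> hom_vectors n" "P = hom_class n A"
  using hom_class_eqI[OF AA] A'(2) by (auto simp: hom_equiv_def)
 obtain tau where tau: "frame n tau" "\<forall>k\<in>{1..<n}. A (tau k) \<noteq> 0" by (rule ex_frame[OF hA(1)])
 have PU: "P \<in> hom_chart_set n tau" using tau(2) unfolding hA(2) hom_chart_set_iff[OF hA(1) tau(1)] .
 define V where "V = {x \<in> hom_chart_set n tau. F (hom_chart_coord tau x) \<noteq> 0}"
 have "openin (vtop (hom_product n)) V" unfolding V_def hom_product_eq_glue
  by (rule glue_basic_open[OF _ F]) (use tau in blast)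
 moreover have "P \<in> V"
 proof -
  have "hom_chart_coord tau P \<in> hom_class n A"
   using hom_chart_coord_mem[OF PU tau(1)] hom_class_self hA(2) by metis
  then have "F (hom_chart_coord tau P) \<noteq> 0" using inv[of A] A(2) by simp
  then show ?thesis using PU by (simp add: V_def)
 qed
 moreover have "V \<subseteq> {P \<in> points (hom_product n). \<exists>A\<in>P. F A \<noteq> 0}"
 proof
  fix x assume x: "x \<in> V"
  then have xU: "x \<in> hom_chart_set n tau" by (simp add: V_def)
  have "hom_chart_coord tau x \<in> x" using hom_chart_coord_mem[OF xU tau(1)] hom_class_self by metis
  then show "x \<in> {P \<in> points (hom_product n). \<exists>A\<in>P. F A \<noteq> 0}"
   using x by (auto simp: V_def points_hom_product hom_chart_set_def)
 qed
 ultimately show "\<exists>T. openin (vtop (hom_product n)) T \<and> P \<in> T \<and>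
   T \<subseteq> {P \<in> points (hom_product n). \<exists>A\<in>P. F A \<noteq> 0}" by blast
qed

section \<open>The wonderful compactification\<close>

lemma function_variety_wonderful: "function_variety (wonderful n)"
 unfolding wonderful_def by (rule function_variety_subvariety[OF function_variety_hom_product])

lemma points_wonderful: "points (wonderful n) = vtop (hom_product n) closure_of PGL n"
 unfolding wonderful_def points_subvariety by (rule Int_absorb1[OF closure_of_subset_topspace])

lemma wonderful_points_hom: "P \<in> points (wonderful n) ==> P \<in> hom_vectors n // hom_equiv n"
 unfolding wonderful_def points_subvariety points_hom_product by blast

lemma openin_wonderful:
 "openin (vtop (wonderful n)) V \<longleftrightarrow>
  (\<exists>W. openin (vtop (hom_product n)) W \<and> V = W \<inter> points (wonderful n))"
 unfolding points_wonderful unfolding wonderful_def openin_subvariety ..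

lemma wonderful_family_regular:
 assumes R: "func_ring R" and A: "\<And>q. (\<lambda>y. A y q) \<in> R" and hv: "\<And>y. y \<in> Y ==> A y \<in> hom_vectors n"
  and pts: "\<And>y. y \<in> Y ==> hom_class n (A y) \<in> points (wonderful n)"
  and y0: "y0 \<in> Y" and V: "openin (vtop (wonderful n)) V" "hom_class n (A y0) \<in> V"
  and h: "h \<in> vreg (wonderful n) V"
 obtains a r where "a \<in> R" "r \<in> R" "r y0 \<noteq> 0"
  "\<forall>y\<in>Y. r y \<noteq> 0 --> hom_class n (A y) \<in> V \<and> h (hom_class n (A y)) = a y / r y"
proof -
 obtain U k where U: "openin (vtop (hom_product n)) U" "hom_class n (A y0) \<in> U"
  "k \<in> vreg (hom_product n) U" "\<forall>y\<in>U \<inter> V. h y = k y"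
  by (rule vreg_subvarietyE[OF h[unfolded wonderful_def] V(2)])
 obtain W where W: "openin (vtop (hom_product n)) W" "V = W \<inter> points (wonderful n)"
  using V(1) unfolding openin_wonderful by blast
 have UW: "openin (vtop (hom_product n)) (U \<inter> W)" "hom_class n (A y0) \<in> U \<inter> W"
  using U W V by (auto intro: openin_Int)
 have k: "k \<in> vreg (hom_product n) (U \<inter> W)"
  by (rule function_variety.reg_subset[OF function_variety_hom_product U(3)]) simp
 obtain a r where ar: "a \<in> R" "r \<in> R" "r y0 \<noteq> 0"
  "\<forall>y\<in>Y. r y \<noteq> 0 --> hom_class n (A y) \<in> U \<inter> W \<and> k (hom_class n (A y)) = a y / r y"
  by (rule hom_family_regular[OF R A hv y0 UW k])
 have "\<forall>y\<in>Y. r y \<noteq> 0 --> hom_class n (A y) \<in> V \<and> h (hom_class n (A y)) = a y / r y"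
  using ar(4) U(4) W(2) pts by auto
 with ar(1-3) show thesis by (rule that)
qed

lemma wonderful_family_open:
 assumes R: "func_ring R" and A: "\<And>q. (\<lambda>y. A y q) \<in> R" and hv: "\<And>y. y \<in> Y ==> A y \<in> hom_vectors n"
  and pts: "\<And>y. y \<in> Y ==> hom_class n (A y) \<in> points (wonderful n)"
  and y0: "y0 \<in> Y" and V: "openin (vtop (wonderful n)) V" "hom_class n (A y0) \<in> V"
 obtains r where "r \<in> R" "r y0 \<noteq> 0" "\<forall>y\<in>Y. r y \<noteq> 0 --> hom_class n (A y) \<in> V"
proof -
 have reg: "(\<lambda>_. 1) \<in> vreg (wonderful n) V"
  by (rule function_variety.reg_const[OF function_variety_wonderful openin_subset[OF V(1)]])
 obtain a r where "a \<in> R" "r \<in> R" "r y0 \<noteq> 0"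
  "\<forall>y\<in>Y. r y \<noteq> 0 --> hom_class n (A y) \<in> V \<and> 1 = a y / r y"
  by (rule wonderful_family_regular[OF R A hv pts y0 V reg])
 then show thesis using that by blast
qed

lemma wonderful_coord_regular:
 assumes tau: "frame n tau" and a: "a \<in> polyfuns" and V: "V \<subseteq> hom_chart_set n tau \<inter> points (wonderful n)"
  and f: "\<And>t. t \<in> V ==> f t = a (hom_chart_coord tau t)"
 shows "f \<in> vreg (wonderful n) V"
 unfolding wonderful_def vreg_subvariety
proof
 fix x assume x: "x \<in> V"
 have wc: "(hom_chart_set n tau, hom_chart_coord tau) \<in> hom_charts n" using tau by blast
 have "(\<lambda>t. a (hom_chart_coord tau t)) \<in> vreg (hom_product n) (hom_chart_set n tau)"
  unfolding hom_product_eq_glue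
  by (rule glue_chart_regular[OF wc subset_refl a polyfuns.const[of 1]]) auto
 then show "\<exists>U h. openin (vtop (hom_product n)) U \<and> x \<in> U \<and> h \<in> vreg (hom_product n) U \<and>
   (\<forall>y\<in>U \<inter> V. f y = h y)"
  using x V f glue_chart_open[OF wc] unfolding hom_product_eq_glue
  by (intro exI[of _ "hom_chart_set n tau"] exI[of _ "\<lambda>t. a (hom_chart_coord tau t)"]) auto
qed

lemma wonderful_chart_open:
 assumes "frame n tau"
 shows "openin (vtop (wonderful n)) (hom_chart_set n tau \<inter> points (wonderful n))"
 unfolding openin_wonderful
 by (intro exI[of _ "hom_chart_set n tau"] conjI refl)
   (use assms in \<open>auto simp: hom_product_eq_glue intro: glue_chart_open\<close>)

section \<open>Minors\<close>

text \<open>Rows and columns are chosen by functions instead of sets, so that repeated and unsorted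
  indices are allowed; expansions and row replacements lead to such minors.\<close>

definition index_minor :: "complex mat => nat => (nat => nat) => (nat => nat) => complex" where
 "index_minor M k f g = det (mat k k (\<lambda>(i, j). M $$ (f i, g j)))"

lemma index_minor_cong:
 "(\<And>i. i < k ==> f i = f' i) ==> (\<And>i. i < k ==> g i = g' i) ==>
  index_minor M k f g = index_minor M k f' g'"
 unfolding index_minor_def by (intro arg_cong[of _ _ det] eq_matI) auto

lemma pick_lt:
 assumes "I \<subseteq> {..<n}" "i < card I"
 shows "pick I i < n"
 using pick_in_set[of i I] assms by auto

lemma det_submatrix:
 assumes M: "M \<in> carrier_mat n n" and I: "I \<subseteq> {..<n}" "card I = k" and J: "J \<subseteq> {..<n}" "card J = k"
 shows "det (submatrix M I J) = index_minor M k (pick I) (pick J)"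
proof -
 have "{i. i < n \<and> i \<in> I} = I" "{j. j < n \<and> j \<in> J} = J" using I J by auto
 then show ?thesis using M I J by (simp add: submatrix_def index_minor_def)
qed

lemma index_minor_transpose:
 assumes M: "M \<in> carrier_mat n n" and f: "f ` {..<k} \<subseteq> {..<n}" and g: "g ` {..<k} \<subseteq> {..<n}"
 shows "index_minor (transpose_mat M) k f g = index_minor M k g f"
proof -
 have fg: "f i < n" "g i < n" if "i < k" for i using f g that by auto
 have "mat k k (\<lambda>(i, j). (transpose_mat M) $$ (f i, g j)) =
   transpose_mat (mat k k (\<lambda>(i, j). M $$ (g i, f j)))"
  by (rule eq_matI) (use M fg in auto)
 then show ?thesis unfolding index_minor_def by (simp add: det_transpose[of _ k])
qed

text \<open>Sorting distinct row indices costs only the sign of a permutation.\<close>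

lemma index_minor_sort_rows:
 assumes f: "inj_on f {..<k}"
 obtains e where "e \<noteq> 0" "\<forall>g. index_minor M k f g = e * index_minor M k (pick (f ` {..<k})) g"
proof -
 define I where "I = f ` {..<k}"
 have I: "card I = k" "finite I" unfolding I_def using card_image[OF f] by simp_all
 \<comment> \<open>The rank of \<open>f i\<close> within the set of chosen rows.\<close>
 define sigma where "sigma = (\<lambda>i. if i < k then card {a\<in>I. a < f i} else i)"
 have pick: "pick I (sigma i) = f i" if "i < k" for i
  using pick_card_in_set[of "f i" I] that by (simp add: sigma_def I_def)
 have lt: "sigma i < k" if "i < k" for i
 proof -
  have "{a\<in>I. a < f i} \<subset> I" using that by (auto simp: I_def)
  then have "card {a\<in>I. a < f i} < card I" by (rule psubset_card_mono[OF I(2)])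
  then show ?thesis using that I(1) by (simp add: sigma_def)
 qed
 have inj: "inj_on sigma {0..<k}"
 proof (rule inj_onI)
  fix x y assume "x \<in> {0..<k}" "y \<in> {0..<k}" "sigma x = sigma y"
  then show "x = y" using pick[of x] pick[of y] inj_onD[OF f, of x y] by simp
 qed
 have "sigma ` {0..<k} = {0..<k}" by (rule endo_inj_surj[OF _ _ inj]) (use lt in auto)
 then have sigma: "sigma permutes {0..<k}"
  by (intro bij_imp_permutes) (use inj in \<open>auto simp: bij_betw_def sigma_def\<close>)
 have "index_minor M k f g = signof sigma * index_minor M k (pick I) g" for g
 proof -
  let ?N = "mat k k (\<lambda>(i, j). M $$ (pick I i, g j))"
  have "mat k k (\<lambda>(i, j). M $$ (f i, g j)) = mat k k (\<lambda>(i, j). ?N $$ (sigma i, j))"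
   by (rule eq_matI) (use lt pick in auto)
  then show ?thesis unfolding index_minor_def by (simp add: det_permute_rows[OF _ sigma])
 qed
 moreover have "signof sigma \<noteq> (0 :: complex)" by (simp add: sign_def)
 ultimately show thesis using that unfolding I_def by blast
qed

lemma index_minor_not_inj:
 assumes "\<not> inj_on f {..<k}"
 shows "index_minor M k f g = 0"
proof -
 from assms obtain i j where "i < k" "j < k" "i \<noteq> j" "f i = f j" by (auto simp: inj_on_def)
 then show ?thesis unfolding index_minor_def
  by (intro det_identical_rows[of _ k i j]) (auto intro!: eq_vecI)
qed

text \<open>Repeated indices give zero anyway, and distinct ones are sorted at the cost of a nonzero
  factor, in the rows directly and in the columns through the transpose.\<close>

lemma index_minor_zero:
 assumes M: "M \<in> carrier_mat n n" and f: "f ` {..<k} \<subseteq> {..<n}" and g: "g ` {..<k} \<subseteq> {..<n}"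
  and zero: "\<And>I J. I \<subseteq> {..<n} ==> J \<subseteq> {..<n} ==> card I = k ==> card J = k ==>
   index_minor M k (pick I) (pick J) = 0"
 shows "index_minor M k f g = 0"
proof (cases "inj_on f {..<k} \<and> inj_on g {..<k}")
 case False
 have "index_minor M k f g = 0" if "\<not> inj_on g {..<k}"
  using index_minor_not_inj[OF that, of "transpose_mat M" f] index_minor_transpose[OF M g f] by simp
 then show ?thesis using False index_minor_not_inj[of f k M g] by blast
next
 case True
 define I where "I = f ` {..<k}"
 define J where "J = g ` {..<k}"
 have IJ: "I \<subseteq> {..<n}" "J \<subseteq> {..<n}" "card I = k" "card J = k"
  using True f g by (simp_all add: I_def J_def card_image)
 have pI: "pick I ` {..<k} \<subseteq> {..<n}" using pick_lt[OF IJ(1)] IJ(3) by auto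
 have pJ: "pick J ` {..<k} \<subseteq> {..<n}" using pick_lt[OF IJ(2)] IJ(4) by auto
 obtain e where e: "\<forall>g. index_minor M k f g = e * index_minor M k (pick I) g"
  using index_minor_sort_rows[of f k M] True unfolding I_def by blast
 obtain e' where e': "\<forall>h. index_minor (transpose_mat M) k g h = e' * index_minor (transpose_mat M) k (pick J) h"
  using index_minor_sort_rows[of g k "transpose_mat M"] True unfolding J_def by blast
 have "index_minor M k (pick I) g = e' * index_minor M k (pick I) (pick J)"
  using e'[rule_format, of "pick I"] index_minor_transpose[OF M g pI] index_minor_transpose[OF M pJ pI] by simp
 then show ?thesis using e zero[OF IJ] by simp
qed

text \<open>Expanding along the first row.\<close>

lemma index_minor_Suc_zero:
 assumes zero: "\<And>f g. f ` {..<k} \<subseteq> {..<n} ==> g ` {..<k} \<subseteq> {..<n} ==> index_minor M k f g = 0"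
  and f: "f ` {..<Suc k} \<subseteq> {..<n}" and g: "g ` {..<Suc k} \<subseteq> {..<n}"
 shows "index_minor M (Suc k) f g = 0"
proof -
 let ?A = "mat (Suc k) (Suc k) (\<lambda>(i, j). M $$ (f i, g j))"
 have "cofactor ?A 0 j = 0" if j: "j < Suc k" for j
 proof -
  have "mat_delete ?A 0 j = mat k k (\<lambda>(i', j'). M $$ (f (Suc i'), g (if j' < j then j' else Suc j')))"
   by (rule eq_matI) (auto simp: mat_delete_def)
  then have "det (mat_delete ?A 0 j) = index_minor M k (\<lambda>i. f (Suc i)) (\<lambda>j'. g (if j' < j then j' else Suc j'))"
   by (simp add: index_minor_def)
  also have "\<dots> = 0"
  proof (rule zero)
   have "f i < n" "g i < n" if "i < Suc k" for i using f g that by auto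
   then show "(\<lambda>i. f (Suc i)) ` {..<k} \<subseteq> {..<n}"
    "(\<lambda>j'. g (if j' < j then j' else Suc j')) ` {..<k} \<subseteq> {..<n}" by auto
  qed
  finally show ?thesis by (simp add: cofactor_def)
 qed
 then show ?thesis
  unfolding index_minor_def by (subst laplace_expansion_row[of _ "Suc k" 0]) auto
qed

lemma index_minor_larger_zero:
 assumes zero: "\<And>f g. f ` {..<k} \<subseteq> {..<n} ==> g ` {..<k} \<subseteq> {..<n} ==> index_minor M k f g = 0"
  and "k \<le> l" and f: "f ` {..<l} \<subseteq> {..<n}" and g: "g ` {..<l} \<subseteq> {..<n}"
 shows "index_minor M l f g = 0"
 using \<open>k \<le> l\<close> f g
proof (induction l arbitrary: f g rule: dec_induct)
 case base
 then show ?case by (rule zero)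
next
 case (step l)
 show ?case by (rule index_minor_Suc_zero[of l n M]) (use step in auto)
qed

text \<open>If all minors of size \<open>k\<close> vanished, expansion along a row would make all
  larger ones vanish, up to the determinant.\<close>

lemma ex_nonzero_minor:
 assumes M: "M \<in> carrier_mat n n" and "det M \<noteq> 0" and k: "k \<le> n"
 obtains I J where "I \<subseteq> {..<n}" "J \<subseteq> {..<n}" "card I = k" "card J = k"
  "index_minor M k (pick I) (pick J) \<noteq> 0"
proof (rule ccontr)
 note obt = that
 assume "\<not> thesis"
 then have z: "index_minor M k (pick I) (pick J) = 0"
  if "I \<subseteq> {..<n}" "J \<subseteq> {..<n}" "card I = k" "card J = k" for I J
  using obt[OF that] by blast
 have all: "index_minor M k f g = 0" if "f ` {..<k} \<subseteq> {..<n}" "g ` {..<k} \<subseteq> {..<n}" for f g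
  by (rule index_minor_zero[OF M that]) (rule z)
 have "index_minor M n (\<lambda>i. i) (\<lambda>i. i) = 0"
  by (rule index_minor_larger_zero[OF _ k]) (rule all, assumption, assumption, simp_all)
 moreover have "mat n n (\<lambda>(i, j). M $$ (i, j)) = M" by (rule eq_matI) (use M in auto)
 ultimately show False using \<open>det M \<noteq> 0\<close> by (simp add: index_minor_def)
qed

text \<open>A matrix all of whose minors of size \<open>k + 1\<close> vanish is recovered from \<open>k\<close> rows and
 \<open>k\<close> columns with nonzero minor; hence its compound matrix of size \<open>k\<close> has rank one.\<close>

lemma skeleton:
 assumes zero: "\<And>f g. f ` {..<Suc k} \<subseteq> {..<n} ==> g ` {..<Suc k} \<subseteq> {..<n} ==>
   index_minor M (Suc k) f g = 0"
  and f0: "f0 ` {..<k} \<subseteq> {..<n}" and g0: "g0 ` {..<k} \<subseteq> {..<n}"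
  and nz: "index_minor M k f0 g0 \<noteq> 0" and N: "N \<in> carrier_mat k k"
  and N1: "N * mat k k (\<lambda>(i, j). M $$ (f0 i, g0 j)) = 1\<^sub>m k"
  and pq: "p < n" "q < n"
 shows "M $$ (p, q) = (\<Sum>a<k. \<Sum>b<k. M $$ (p, g0 a) * (N $$ (a, b) * M $$ (f0 b, q)))"
proof -
 define f where "f = (\<lambda>i. if i < k then f0 i else p)"
 define g where "g = (\<lambda>i. if i < k then g0 i else q)"
 let ?T = "mat (Suc k) (Suc k) (\<lambda>(i, j). M $$ (f i, g j))"
 let ?M0 = "mat k k (\<lambda>(i, j). M $$ (f0 i, g0 j))"
 have "det ?T = 0"
  using zero[of f g] f0 g0 pq by (simp add: index_minor_def f_def g_def image_subset_iff)
 \<comment> \<open>The minor bordered by row \<open>p\<close> and column \<open>q\<close> is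
   singular. A kernel vector expresses column \<open>q\<close> through the \<open>k\<close> chosen
   columns, with coefficients fixed by the invertible block.\<close>
 then obtain v where v: "v \<in> carrier_vec (Suc k)" "v \<noteq> 0\<^sub>v (Suc k)" "?T *\<^sub>v v = 0\<^sub>v (Suc k)"
  using det_0_iff_vec_prod_zero_field[of ?T "Suc k"] by auto
 have row: "(\<Sum>j<k. M $$ (f i, g0 j) * v $ j) + M $$ (f i, q) * v $ k = 0" if i: "i < Suc k" for i
 proof -
  have "(?T *\<^sub>v v) $ i = (\<Sum>j<Suc k. M $$ (f i, g j) * v $ j)"
   using i v(1) by (simp add: scalar_prod_def atLeast0LessThan)
  moreover have "(?T *\<^sub>v v) $ i = 0" unfolding v(3) using i by simp
  ultimately show ?thesis by (simp add: g_def)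
 qed
 define y where "y = vec k (\<lambda>j. v $ j)"
 define u where "u = vec k (\<lambda>i. M $$ (f0 i, q))"
 have yv: "y \<in> carrier_vec k" "u \<in> carrier_vec k" by (simp_all add: y_def u_def)
 have My: "?M0 *\<^sub>v y = (- (v $ k)) \<cdot>\<^sub>v u"
 proof (rule eq_vecI)
  fix i assume "i < dim_vec ((- (v $ k)) \<cdot>\<^sub>v u)"
  then have i: "i < k" by (simp add: u_def)
  have "(?M0 *\<^sub>v y) $ i = (\<Sum>j<k. M $$ (f0 i, g0 j) * v $ j)"
   using i by (simp add: scalar_prod_def y_def atLeast0LessThan)
  then show "(?M0 *\<^sub>v y) $ i = ((- (v $ k)) \<cdot>\<^sub>v u) $ i"
   using row[of i] i by (simp add: f_def u_def eq_neg_iff_add_eq_0 mult.commute)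
 qed (simp add: u_def)
 have "N *\<^sub>v (?M0 *\<^sub>v y) = (N * ?M0) *\<^sub>v y"
  by (rule assoc_mult_mat_vec[symmetric, of N k k ?M0 k]) (use N yv in auto)
 then have y: "y = N *\<^sub>v ((- (v $ k)) \<cdot>\<^sub>v u)" using N1 My yv by simp
 then have yj: "v $ a = - (v $ k) * (\<Sum>b<k. N $$ (a, b) * M $$ (f0 b, q))" if a: "a < k" for a
 proof -
  have "v $ a = (N *\<^sub>v ((- (v $ k)) \<cdot>\<^sub>v u)) $ a" using y a by (metis index_vec y_def)
  also have "\<dots> = (\<Sum>b<k. N $$ (a, b) * (- (v $ k) * M $$ (f0 b, q)))"
   using a N by (simp add: scalar_prod_def u_def atLeast0LessThan)
  finally show ?thesis by (simp add: sum_distrib_left mult_ac)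
 qed
 have vk: "v $ k \<noteq> 0"
 proof
  assume "v $ k = 0"
  then have "v $ a = 0" if "a < Suc k" for a
   using yj[of a] that by (cases "a = k") (auto simp: less_Suc_eq)
  then have "v = 0\<^sub>v (Suc k)" using v(1) by (intro eq_vecI) auto
  with v(2) show False by simp
 qed
 have "v $ k * M $$ (p, q) = - (\<Sum>a<k. M $$ (p, g0 a) * v $ a)"
  using row[of k] by (simp add: f_def eq_neg_iff_add_eq_0 mult.commute add.commute)
 also have "\<dots> = v $ k * (\<Sum>a<k. M $$ (p, g0 a) * (\<Sum>b<k. N $$ (a, b) * M $$ (f0 b, q)))"
  using yj by (simp add: sum_distrib_left sum_negf[symmetric] mult_ac)
 finally have "M $$ (p, q) = (\<Sum>a<k. M $$ (p, g0 a) * (\<Sum>b<k. N $$ (a, b) * M $$ (f0 b, q)))"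
  using vk by simp
 then show ?thesis by (simp add: sum_distrib_left)
qed

lemma compound_rank_one:
 assumes zero: "\<And>f g. f ` {..<Suc k} \<subseteq> {..<n} ==> g ` {..<Suc k} \<subseteq> {..<n} ==>
   index_minor M (Suc k) f g = 0"
  and f0: "f0 ` {..<k} \<subseteq> {..<n}" and g0: "g0 ` {..<k} \<subseteq> {..<n}" and nz: "index_minor M k f0 g0 \<noteq> 0"
  and f: "f ` {..<k} \<subseteq> {..<n}" and g: "g ` {..<k} \<subseteq> {..<n}"
 shows "index_minor M k f g * index_minor M k f0 g0 = index_minor M k f g0 * index_minor M k f0 g"
proof -
 let ?M = "\<lambda>f g. mat k k (\<lambda>(i, j). M $$ (f i, g j))"
 have c: "?M f g \<in> carrier_mat k k" for f g by simp
 from det_non_zero_imp_unit[OF c, of f0 g0 undefined] nz obtain N where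
  N: "N \<in> carrier_mat k k" "N * ?M f0 g0 = 1\<^sub>m k" "?M f0 g0 * N = 1\<^sub>m k"
  unfolding index_minor_def Units_def ring_mat_def by auto
 \<comment> \<open>The skeleton identity in matrix form; multiplicativity of the determinant turns
   it into the rank-one relation between minors.\<close>
 have "?M f g = ?M f g0 * (N * ?M f0 g)"
 proof (rule eq_matI)
  fix i j assume "i < dim_row (?M f g0 * (N * ?M f0 g))" "j < dim_col (?M f g0 * (N * ?M f0 g))"
  then have ij: "i < k" "j < k" by auto
  have fg: "f i < n" "g j < n" using f g ij by auto
  have "M $$ (f i, g j) = (\<Sum>a<k. \<Sum>b<k. M $$ (f i, g0 a) * (N $$ (a, b) * M $$ (f0 b, g j)))"
   by (rule skeleton[OF _ f0 g0 nz N(1,2) fg]) (rule zero)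
  then show "?M f g $$ (i, j) = (?M f g0 * (N * ?M f0 g)) $$ (i, j)"
   using ij N(1) by (simp add: scalar_prod_def atLeast0LessThan sum_distrib_left)
 qed (use N in auto)
 then have "det (?M f g) = det (?M f g0) * (det N * det (?M f0 g))"
  using N(1) by (simp add: det_mult[of _ k])
 moreover have "det N * det (?M f0 g0) = 1"
  using det_mult[OF N(1) c[of f0 g0]] N(2) by simp
 ultimately show ?thesis unfolding index_minor_def by (simp add: mult_ac)
qed

section \<open>The boundary of the wonderful compactification\<close>

lemma invertible_mat_iff_det:
 assumes g: "(g :: complex mat) \<in> carrier_mat n n"
 shows "invertible_mat g \<longleftrightarrow> det g \<noteq> 0"
proof
 assume "invertible_mat g"
 then obtain h where h: "g * h = 1\<^sub>m (dim_row g)" "h * g = 1\<^sub>m (dim_row h)"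
  unfolding invertible_mat_def inverts_mat_def by blast
 have "dim_col (g * h) = dim_row g" "dim_col (h * g) = dim_row h" unfolding h by simp_all
 then have "h \<in> carrier_mat n n" using g by auto
 then have "det g * det h = 1" using h(1) g det_mult[of g n h] by simp
 then show "det g \<noteq> 0" by auto
next
 assume "det g \<noteq> 0"
 from det_non_zero_imp_unit[OF g this, of undefined] obtain h where
  "h \<in> carrier_mat n n" "h * g = 1\<^sub>m n" "g * h = 1\<^sub>m n"
  unfolding Units_def ring_mat_def by auto
 then show "invertible_mat g" using g unfolding invertible_mat_def inverts_mat_def by auto
qed

definition level_minor :: "nat => complex mat => nat set \<times> nat set => complex" where
 "level_minor k M q = index_minor M k (pick (fst q)) (pick (snd q))"

lemma pick_minor_index:
 assumes "q \<in> minor_indices n k"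
 shows "pick (fst q) ` {..<k} \<subseteq> {..<n}" "pick (snd q) ` {..<k} \<subseteq> {..<n}"
 using assms pick_lt[of "fst q" n] pick_lt[of "snd q" n] by (auto simp: minor_indices_def)

lemma exterior_powers_minor:
 assumes g: "g \<in> carrier_mat n n" and k: "k \<in> {1..<n}" and q: "q \<in> minor_indices n k"
 shows "exterior_powers n g q = level_minor k g q"
proof -
 obtain I J where IJ: "q = (I, J)" "I \<subseteq> {..<n}" "card I = k" "J \<subseteq> {..<n}" "card J = k"
  using q by (auto simp: minor_indices_def)
 have "q \<in> hom_indices n" using k q by blast
 then show ?thesis unfolding exterior_powers_def level_minor_def IJ(1) fst_conv snd_conv
  using det_submatrix[OF g IJ(2-5)] by simp
qed

lemma exterior_powers_zero:
 "q \<notin> hom_indices n ==> exterior_powers n g q = 0"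
 by (cases q) (simp add: exterior_powers_def)

lemma exterior_powers_hom:
 assumes g: "g \<in> carrier_mat n n" and "det g \<noteq> 0"
 shows "exterior_powers n g \<in> hom_vectors n"
 unfolding hom_vectors_def mem_Collect_eq
proof (intro conjI allI impI ballI)
 fix q assume "q \<notin> hom_indices n"
 then show "exterior_powers n g q = 0" by (rule exterior_powers_zero)
next
 fix k assume k: "k \<in> {1..<n}"
 then have "k \<le> n" by simp
 obtain I J where IJ: "I \<subseteq> {..<n}" "J \<subseteq> {..<n}" "card I = k" "card J = k"
  "index_minor g k (pick I) (pick J) \<noteq> 0" by (rule ex_nonzero_minor[OF g assms(2) \<open>k \<le> n\<close>])
 then have "(I, J) \<in> minor_indices n k" by (simp add: minor_indices_def)
 moreover have "exterior_powers n g (I, J) \<noteq> 0"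
  unfolding exterior_powers_minor[OF g k calculation] using IJ(5) by (simp add: level_minor_def)
 ultimately show "\<exists>q\<in>minor_indices n k. exterior_powers n g q \<noteq> 0" by blast
qed

lemma PGL_iff: "P \<in> PGL n \<longleftrightarrow> (\<exists>g\<in>carrier_mat n n. det g \<noteq> 0 \<and> P = hom_class n (exterior_powers n g))"
 unfolding PGL_def pgl_point_def using invertible_mat_iff_det by blast

lemma PGL_points: "PGL n \<subseteq> points (hom_product n)"
 unfolding points_hom_product by (auto simp: PGL_iff intro!: hom_class_quotient exterior_powers_hom)

lemma PGL_wonderful: "PGL n \<subseteq> points (wonderful n)"
 unfolding points_wonderful by (rule closure_of_subset[OF PGL_points])

definition level_one :: "nat => collineation => complex mat" where
 "level_one n A = mat n n (\<lambda>(i, j). A ({i}, {j}))"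

lemma level_one_carrier [simp]: "level_one n A \<in> carrier_mat n n"
 by (simp add: level_one_def)

lemma singleton_minor_index: "i < n ==> j < n ==> ({i}, {j}) \<in> minor_indices n 1"
 by (simp add: minor_indices_def)

lemma pick_singleton: "pick {i} 0 = i"
 by (auto intro!: Least_equality)

lemma level_minor_one: "level_minor 1 M ({i}, {j}) = M $$ (i, j)"
proof -
 have "det (mat 1 1 (\<lambda>(a, b). M $$ (pick {i} a, pick {j} b))) =
   mat 1 1 (\<lambda>(a, b). M $$ (pick {i} a, pick {j} b)) $$ (0, 0)" by (rule det_single) simp
 then show ?thesis by (simp add: level_minor_def index_minor_def pick_singleton del: pick.simps)
qed

lemma level_one_exterior_powers:
 assumes g: "g \<in> carrier_mat n n" and n: "n \<ge> 2"
 shows "level_one n (exterior_powers n g) = g"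
proof (rule eq_matI)
 fix i j assume "i < dim_row g" "j < dim_col g"
 then have ij: "i < n" "j < n" using g by auto
 then have "exterior_powers n g ({i}, {j}) = g $$ (i, j)"
  using exterior_powers_minor[OF g _ singleton_minor_index[OF ij]] n level_minor_one by simp
 then show "level_one n (exterior_powers n g) $$ (i, j) = g $$ (i, j)" using ij by (simp add: level_one_def)
qed (use g in \<open>auto simp: level_one_def\<close>)

lemma polyfuns_det:
 assumes "\<And>i j. i < k ==> j < k ==> (\<lambda>z. F z i j) \<in> polyfuns"
 shows "(\<lambda>z. det (mat k k (\<lambda>(i, j). F z i j))) \<in> polyfuns"
proof -
 have "det (mat k k (\<lambda>(i, j). F z i j)) =
   (\<Sum>p\<in>{p. p permutes {0..<k}}. signof p * (\<Prod>i=0..<k. F z i (p i)))" for z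
  by (subst det_def'[of _ k]) (auto intro!: sum.cong prod.cong simp: permutes_in_image)
 moreover have "(\<lambda>z. \<Sum>p\<in>{p. p permutes {0..<k}}. signof p * (\<Prod>i=0..<k. F z i (p i))) \<in> polyfuns"
  by (intro func_ring_sum[OF func_ring_polyfuns] polyfuns.mult polyfuns.const
    func_ring_prod[OF func_ring_polyfuns] assms)
    (auto simp: permutes_in_image)
 ultimately show ?thesis by simp
qed

lemma polyfuns_level_minor:
 assumes "q \<in> minor_indices n k"
 shows "(\<lambda>A. level_minor k (level_one n A) q) \<in> polyfuns"
proof -
 have "level_minor k (level_one n A) q =
   det (mat k k (\<lambda>(i, j). A ({pick (fst q) i}, {pick (snd q) j})))" for A
 proof -
  have "pick (fst q) i < n" "pick (snd q) i < n" if "i < k" for i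
   using pick_minor_index[OF assms] that by auto
  then show ?thesis unfolding level_minor_def index_minor_def
   by (intro arg_cong[of _ _ det] eq_matI) (auto simp: level_one_def)
 qed
 then show ?thesis by (simp add: polyfuns_det polyfuns.coord)
qed

lemma level_minor_smult:
 assumes q: "q \<in> minor_indices n k" and M: "M \<in> carrier_mat n n" "M' \<in> carrier_mat n n"
  and "\<And>i j. i < n ==> j < n ==> M' $$ (i, j) = s * M $$ (i, j)"
 shows "level_minor k M' q = s ^ k * level_minor k M q"
proof -
 have "mat k k (\<lambda>(i, j). M' $$ (pick (fst q) i, pick (snd q) j)) =
   s \<cdot>\<^sub>m mat k k (\<lambda>(i, j). M $$ (pick (fst q) i, pick (snd q) j))"
 proof -
  have "pick (fst q) i < n" "pick (snd q) i < n" if "i < k" for i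
   using pick_minor_index[OF q] that by auto
  then show ?thesis by (intro eq_matI) (simp_all add: assms(4))
 qed
 then show ?thesis by (simp add: level_minor_def index_minor_def)
qed

lemma wonderful_avoid_open:
 assumes "openin (vtop (hom_product n)) V" "V \<inter> PGL n = {}" "P \<in> points (wonderful n)"
 shows "P \<notin> V"
 using openin_Int_closure_of_eq_empty[OF assms(1), of "PGL n"] assms(2,3) unfolding points_wonderful by blast

text \<open>On invertible matrices the coordinates of level \<open>k\<close> are the minors of the
  matrix on level one. Proportionality to these minors is a closed condition, invariant under
  rescaling of the levels, so it persists on the closure; where the minors all vanish it says
  nothing.\<close>

lemma wonderful_minor_relation:
 assumes P: "P \<in> points (wonderful n)" and A: "A \<in> P" and n: "n \<ge> 2" and k: "k \<in> {1..<n}"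
  and q: "q \<in> minor_indices n k" "q' \<in> minor_indices n k"
 shows "A q * level_minor k (level_one n A) q' = A q' * level_minor k (level_one n A) q"
proof -
 define F where "F = (\<lambda>A. A q * level_minor k (level_one n A) q' +
  - 1 * (A q' * level_minor k (level_one n A) q))"
 have F: "F \<in> polyfuns" unfolding F_def
  by (intro polyfuns.add polyfuns.mult polyfuns.const polyfuns.coord polyfuns_level_minor[OF q(1)]
    polyfuns_level_minor[OF q(2)])
 have inv: "F B \<noteq> 0" if AB: "(A, B) \<in> hom_equiv n" and "F A \<noteq> 0" for A B
 proof -
  obtain s where s: "\<forall>k\<in>{1..<n}. s k \<noteq> 0" "\<forall>k\<in>{1..<n}. \<forall>q\<in>minor_indices n k. B q = s k * A q"
   by (rule hom_equivE[OF AB])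
  have one: "1 \<in> {1..<n}" using n by simp
  have "level_one n B $$ (i, j) = s 1 * level_one n A $$ (i, j)" if "i < n" "j < n" for i j
   using s(2) one singleton_minor_index[OF that] that by (simp add: level_one_def)
  then have m: "level_minor k (level_one n B) p = s 1 ^ k * level_minor k (level_one n A) p"
   if "p \<in> minor_indices n k" for p
   by (intro level_minor_smult[OF that]) auto
  have "B q = s k * A q" "B q' = s k * A q'" using s(2) k q by auto
  then have "F B = s k * s 1 ^ k * F A"
   unfolding F_def m[OF q(1)] m[OF q(2)] by (simp add: algebra_simps)
  then show ?thesis using that(2) s(1) k one by simp
 qed
 define V where "V = {P \<in> points (hom_product n). \<exists>A\<in>P. F A \<noteq> 0}"
 have V: "openin (vtop (hom_product n)) V" unfolding V_def by (rule hom_open_nonzero[OF F inv])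
 have "V \<inter> PGL n = {}"
 proof (intro equals0I)
  fix Q assume "Q \<in> V \<inter> PGL n"
  then obtain B g where B: "B \<in> Q" "F B \<noteq> 0" and g: "g \<in> carrier_mat n n" "det g \<noteq> 0"
   "Q = hom_class n (exterior_powers n g)" by (auto simp: V_def PGL_iff)
  have "(exterior_powers n g, B) \<in> hom_equiv n" using B g by simp
  then have "(B, exterior_powers n g) \<in> hom_equiv n"
   using equiv_hom_equiv[of n] by (auto elim: equivE dest: symD)
  then have "F (exterior_powers n g) \<noteq> 0" using B(2) by (rule inv)
  then show False
   unfolding F_def level_one_exterior_powers[OF g(1) n] exterior_powers_minor[OF g(1) k q(1)]
    exterior_powers_minor[OF g(1) k q(2)] by simp
 qed
 from wonderful_avoid_open[OF V this P] have "F A = 0"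
  using A P unfolding V_def points_hom_product using wonderful_points_hom[OF P] by blast
 then show ?thesis by (simp add: F_def)
qed

text \<open>The coordinates of level \<open>k\<close> are the matrix of an endomorphism of the
  \<open>k\<close>-th exterior power, and the condition says that its rank is at most one. These
  loci replace explicit equations of the boundary divisors: they are closed and cover the
  boundary.\<close>

definition rank_one_locus :: "nat => nat => collineation set set" where
 "rank_one_locus n k = {P \<in> points (wonderful n). \<forall>A\<in>P. \<forall>I J I' J'. (I, J) \<in> minor_indices n k -->
  (I', J') \<in> minor_indices n k --> A (I, J) * A (I', J') = A (I, J') * A (I', J)}"

lemma minor_indices_swap:
 "(I, J) \<in> minor_indices n k ==> (I', J') \<in> minor_indices n k ==> (I, J') \<in> minor_indices n k"
 by (simp add: minor_indices_def)

lemma rank_one_open: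
 assumes k: "k \<in> {1..<n}" and q: "(I, J) \<in> minor_indices n k" "(I', J') \<in> minor_indices n k"
 shows "openin (vtop (hom_product n)) {P \<in> points (hom_product n). \<exists>A\<in>P.
  A (I, J) * A (I', J') + - 1 * (A (I, J') * A (I', J)) \<noteq> 0}"
proof (rule hom_open_nonzero)
 show "(\<lambda>A. A (I, J) * A (I', J') + - 1 * (A (I, J') * A (I', J))) \<in> polyfuns"
  by (intro polyfuns.add polyfuns.mult polyfuns.const polyfuns.coord)
 fix A B assume AB: "(A, B) \<in> hom_equiv n" and nz: "A (I, J) * A (I', J') + - 1 * (A (I, J') * A (I', J)) \<noteq> 0"
 obtain s where s: "\<forall>k\<in>{1..<n}. s k \<noteq> 0" "\<forall>k\<in>{1..<n}. \<forall>q\<in>minor_indices n k. B q = s k * A q"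
  by (rule hom_equivE[OF AB])
 have "B (I, J) * B (I', J') + - 1 * (B (I, J') * B (I', J)) =
   s k * s k * (A (I, J) * A (I', J') + - 1 * (A (I, J') * A (I', J)))"
  using s(2) k q minor_indices_swap[OF q] minor_indices_swap[OF q(2) q(1)] by (simp add: algebra_simps)
 then show "B (I, J) * B (I', J') + - 1 * (B (I, J') * B (I', J)) \<noteq> 0"
  using nz s(1) k by (simp del: mult_minus1)
qed

lemma closedin_rank_one:
 assumes k: "k \<in> {1..<n}"
 shows "closedin (vtop (wonderful n)) (rank_one_locus n k)"
 unfolding closedin_def
proof
 show "rank_one_locus n k \<subseteq> points (wonderful n)" by (auto simp: rank_one_locus_def)
 show "openin (vtop (wonderful n)) (points (wonderful n) - rank_one_locus n k)"
 proof (subst openin_subopen, rule ballI)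
  fix P assume P: "P \<in> points (wonderful n) - rank_one_locus n k"
  then obtain A I J I' J' where A: "A \<in> P" and q: "(I, J) \<in> minor_indices n k" "(I', J') \<in> minor_indices n k"
   and ne: "A (I, J) * A (I', J') \<noteq> A (I, J') * A (I', J)" unfolding rank_one_locus_def by blast
  define V where "V = {P \<in> points (hom_product n). \<exists>A\<in>P.
   A (I, J) * A (I', J') + - 1 * (A (I, J') * A (I', J)) \<noteq> 0}"
  have V: "openin (vtop (wonderful n)) (V \<inter> points (wonderful n))"
   unfolding openin_wonderful V_def using rank_one_open[OF k q] by blast
  have "P \<in> V" using P A ne wonderful_points_hom[of P n] by (auto simp: V_def points_hom_product)
  moreover have "V \<inter> points (wonderful n) \<subseteq> points (wonderful n) - rank_one_locus n k"
  proof
   fix Q assume Q: "Q \<in> V \<inter> points (wonderful n)"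
   then obtain B where "B \<in> Q" "B (I, J) * B (I', J') \<noteq> B (I, J') * B (I', J)" by (auto simp: V_def)
   then have "Q \<notin> rank_one_locus n k" using q unfolding rank_one_locus_def by blast
   then show "Q \<in> points (wonderful n) - rank_one_locus n k" using Q by blast
  qed
  ultimately show "\<exists>T. openin (vtop (wonderful n)) T \<and> P \<in> T \<and> T \<subseteq> points (wonderful n) - rank_one_locus n k"
   using V P by blast
 qed
qed

lemma rank_one_locusI:
 assumes A: "A \<in> hom_vectors n" "hom_class n A \<in> points (wonderful n)" and k: "k \<in> {1..<n}"
  and r: "\<And>I J I' J'. (I, J) \<in> minor_indices n k ==> (I', J') \<in> minor_indices n k ==>
   A (I, J) * A (I', J') = A (I, J') * A (I', J)"
 shows "hom_class n A \<in> rank_one_locus n k"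
 unfolding rank_one_locus_def mem_Collect_eq
proof (intro conjI ballI allI impI A(2))
 fix B I J I' J' assume "B \<in> hom_class n A" and q: "(I, J) \<in> minor_indices n k" "(I', J') \<in> minor_indices n k"
 then have AB: "(A, B) \<in> hom_equiv n" by simp
 obtain s where s: "\<forall>k\<in>{1..<n}. s k \<noteq> 0" "\<forall>k\<in>{1..<n}. \<forall>q\<in>minor_indices n k. B q = s k * A q"
  by (rule hom_equivE[OF AB])
 have "B (I, J) * B (I', J') = s k * s k * (A (I, J) * A (I', J'))"
  "B (I, J') * B (I', J) = s k * s k * (A (I, J') * A (I', J))"
  using s(2) k q minor_indices_swap[OF q] minor_indices_swap[OF q(2) q(1)] by simp_all
 then show "B (I, J) * B (I', J') = B (I, J') * B (I', J)" using r[OF q] by simp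
qed

text \<open>If the matrix on level one is invertible, all levels are its minors and the point is not
  in the boundary. Otherwise, with \<open>r\<close> its rank, level \<open>r\<close> is proportional
  to the minors of size \<open>r\<close>, and the compound matrix of size \<open>r\<close> of a
  matrix of rank \<open>r\<close> has rank one.\<close>

lemma boundary_rank_one:
 assumes n: "n \<ge> 2" and P: "P \<in> wonderful_boundary n"
 shows "\<exists>k\<in>{1..<n}. P \<in> rank_one_locus n k"
proof -
 have Pw: "P \<in> points (wonderful n)" "P \<notin> PGL n" using P by (auto simp: wonderful_boundary_def)
 obtain A where A: "A \<in> hom_vectors n" "P = hom_class n A"
  using wonderful_points_hom[OF Pw(1)] by (rule hom_quotientE)
 have AP: "A \<in> P" unfolding A(2) by (rule hom_class_self[OF A(1)])
 define M where "M = level_one n A"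
 have M: "M \<in> carrier_mat n n" by (simp add: M_def)
 note rel = wonderful_minor_relation[OF Pw(1) AP n, folded M_def]
 have nzA: "\<exists>q\<in>minor_indices n k. A q \<noteq> 0" if "k \<in> {1..<n}" for k
  using A(1) that unfolding hom_vectors_def by blast
 have propn: "A q' \<noteq> 0 \<and> (\<forall>q\<in>minor_indices n k. A q = A q' / level_minor k M q' * level_minor k M q)"
  if k: "k \<in> {1..<n}" and q': "q' \<in> minor_indices n k" "level_minor k M q' \<noteq> 0" for k q'
 proof
  obtain q where q: "q \<in> minor_indices n k" "A q \<noteq> 0" using nzA[OF k] by blast
  then show "A q' \<noteq> 0" using rel[OF k q(1) q'(1)] q'(2) by auto
  show "\<forall>q\<in>minor_indices n k. A q = A q' / level_minor k M q' * level_minor k M q"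
   using rel[OF k _ q'(1)] q'(2) by (simp add: field_simps)
 qed
 show ?thesis
 proof (cases "det M = 0")
  case False
  have "\<forall>k\<in>{1..<n}. \<exists>q'. q' \<in> minor_indices n k \<and> level_minor k M q' \<noteq> 0"
  proof
   fix k assume "k \<in> {1..<n}"
   then have "k \<le> n" by simp
   obtain I J where "I \<subseteq> {..<n}" "J \<subseteq> {..<n}" "card I = k" "card J = k"
    "index_minor M k (pick I) (pick J) \<noteq> 0" by (rule ex_nonzero_minor[OF M False \<open>k \<le> n\<close>])
   then show "\<exists>q'. q' \<in> minor_indices n k \<and> level_minor k M q' \<noteq> 0"
    by (intro exI[of _ "(I, J)"]) (simp add: minor_indices_def level_minor_def)
  qed
  from bchoice[OF this] obtain tau where tau: "\<forall>k\<in>{1..<n}. tau k \<in> minor_indices n k \<and> level_minor k M (tau k) \<noteq> 0" ..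
  have "(exterior_powers n M, A) \<in> hom_equiv n"
  proof (rule hom_equivI[where s = "\<lambda>k. A (tau k) / level_minor k M (tau k)"])
   fix k assume k: "k \<in> {1..<n}"
   then show "A (tau k) / level_minor k M (tau k) \<noteq> 0" using propn[OF k] tau by auto
   fix q assume q: "q \<in> minor_indices n k"
   then show "A q = A (tau k) / level_minor k M (tau k) * exterior_powers n M q"
    unfolding exterior_powers_minor[OF M k q] using propn[OF k] tau k by blast
  qed (use exterior_powers_hom[OF M False] A in auto)
  then have "P = hom_class n (exterior_powers n M)" using hom_class_eqI A(2) by metis
  then have "P \<in> PGL n" unfolding PGL_iff using M False by blast
  with Pw(2) show ?thesis by simp
 next
  case True
  \<comment> \<open>The sizes with a nonvanishing minor; the maximum is the rank of
    \<open>M\<close>, positive because level one is not zero.\<close>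
  define S where "S = {k \<in> {1..<n}. \<exists>q\<in>minor_indices n k. level_minor k M q \<noteq> 0}"
  have one: "1 \<in> {1..<n}" using n by simp
  obtain q1 where q1: "q1 \<in> minor_indices n 1" "A q1 \<noteq> 0" using nzA[OF one] by blast
  then obtain i j where ij: "q1 = ({i}, {j})" "i < n" "j < n"
   by (auto simp: minor_indices_def card_1_singleton_iff)
  have "level_minor 1 M q1 \<noteq> 0"
   unfolding ij(1) level_minor_one using q1(2) ij by (simp add: M_def level_one_def)
  then have "1 \<in> S" using one q1(1) by (auto simp: S_def)
  have fS: "finite S" by (simp add: S_def)
  define r where "r = Max S"
  have r: "r \<in> S" unfolding r_def using \<open>1 \<in> S\<close> fS by (intro Max_in) auto
  have r1: "r \<in> {1..<n}" using r by (simp add: S_def)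
  obtain q0 where q0: "q0 \<in> minor_indices n r" "level_minor r M q0 \<noteq> 0"
   using r unfolding S_def by blast
  have zero: "index_minor M (Suc r) f g = 0"
   if fg: "f ` {..<Suc r} \<subseteq> {..<n}" "g ` {..<Suc r} \<subseteq> {..<n}" for f g
  proof (rule index_minor_zero[OF M fg])
   fix I J assume IJ: "I \<subseteq> {..<n}" "J \<subseteq> {..<n}" "card I = Suc r" "card J = Suc r"
   show "index_minor M (Suc r) (pick I) (pick J) = 0"
   \<comment> \<open>Size \<open>n\<close> is not one of the levels: there the only minor is the
     determinant, which vanishes in this case.\<close>
   proof (cases "Suc r = n")
    case True
    then have "I = {..<n}" "J = {..<n}"
     using card_subset_eq[OF finite_lessThan IJ(1)] card_subset_eq[OF finite_lessThan IJ(2)] IJ(3,4)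
     by simp_all
    have "pick {..<n} i = i" if "i < n" for i
    proof -
     have "{a\<in>{..<n}. a < i} = {..<i}" using that by auto
     then show ?thesis using pick_card_in_set[of i "{..<n}"] that by simp
    qed
    then have "mat n n (\<lambda>(i, j). M $$ (pick {..<n} i, pick {..<n} j)) = M"
     using M by (intro eq_matI) auto
    then show ?thesis using \<open>det M = 0\<close> \<open>I = {..<n}\<close> \<open>J = {..<n}\<close> \<open>Suc r = n\<close>
     by (simp add: index_minor_def)
   next
    case False
    then have "Suc r \<in> {1..<n}" using r1 by simp
    moreover have "Suc r \<notin> S" using Max_ge[OF fS, of "Suc r"] by (auto simp: r_def)
    moreover have "(I, J) \<in> minor_indices n (Suc r)" using IJ by (simp add: minor_indices_def)
    ultimately have "level_minor (Suc r) M (I, J) = 0" unfolding S_def by blast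
    then show ?thesis by (simp add: level_minor_def)
   qed
  qed
  have minor: "level_minor r M (I, J) * level_minor r M q0 =
    level_minor r M (I, snd q0) * level_minor r M (fst q0, J)"
   if "(I, J) \<in> minor_indices n r" for I J
   unfolding level_minor_def fst_conv snd_conv
   by (rule compound_rank_one[OF _ pick_minor_index[OF q0(1)] q0(2)[unfolded level_minor_def]
      pick_minor_index[OF that, unfolded fst_conv snd_conv]]) (rule zero)
  define c where "c = A q0 / level_minor r M q0"
  have Ac: "A q = c * level_minor r M q" if "q \<in> minor_indices n r" for q
   using propn[OF r1 q0] that by (auto simp: c_def)
  have "P \<in> rank_one_locus n r" unfolding A(2)
  proof (rule rank_one_locusI[OF A(1) _ r1])
   show "hom_class n A \<in> points (wonderful n)" using Pw(1) A(2) by simp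
   fix I J I' J' assume q: "(I, J) \<in> minor_indices n r" "(I', J') \<in> minor_indices n r"
   note q' = minor_indices_swap[OF q] minor_indices_swap[OF q(2) q(1)]
   have "(level_minor r M (I, J) * level_minor r M q0) * (level_minor r M (I', J') * level_minor r M q0) =
    (level_minor r M (I, J') * level_minor r M q0) * (level_minor r M (I', J) * level_minor r M q0)"
    unfolding minor[OF q(1)] minor[OF q(2)] minor[OF q'(1)] minor[OF q'(2)] by (simp add: mult_ac)
   then have "level_minor r M (I, J) * level_minor r M (I', J') =
     level_minor r M (I, J') * level_minor r M (I', J)" using q0(2) by (simp add: mult_ac)
   then show "A (I, J) * A (I', J') = A (I, J') * A (I', J)"
    unfolding Ac[OF q(1)] Ac[OF q(2)] Ac[OF q'(1)] Ac[OF q'(2)] by (simp add: mult_ac)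
  qed
  then show ?thesis using r1 by blast
 qed
qed

lemma irreducible_subset_finite_union:
 assumes "irreducible_subset T Z" "finite K" "\<And>k. k \<in> K ==> closedin T (F k)" "Z \<subseteq> (\<Union>k\<in>K. F k)"
 shows "\<exists>k\<in>K. Z \<subseteq> F k"
 using assms(2,3,4)
proof (induction K rule: finite_induct)
 case empty
 then show ?case using assms(1) by (simp add: irreducible_subset_def)
next
 case (insert k K)
 have "closedin T (F k)" "closedin T (\<Union>k\<in>K. F k)"
  using insert by (auto intro!: closedin_Union)
 moreover have "Z \<subseteq> F k \<union> (\<Union>k\<in>K. F k)" using insert.prems by auto
 ultimately have "Z \<subseteq> F k \<or> Z \<subseteq> (\<Union>k\<in>K. F k)" using assms(1) unfolding irreducible_subset_def by blast
 then show ?case using insert by auto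
qed

abbreviation (input) boundary_component :: "nat => collineation set set => bool" where
 "boundary_component n D \<equiv> D \<in> irreducible_components (vtop (wonderful n)) (wonderful_boundary n)"

text \<open>An irreducible set inside a finite union of closed sets lies in one of them. Which level
  occurs is decided later by a test point on the curve.\<close>

lemma boundary_component_rank_one:
 assumes n: "n \<ge> 2" and D: "boundary_component n D"
 shows "\<exists>k\<in>{1..<n}. D \<subseteq> rank_one_locus n k"
proof (rule irreducible_subset_finite_union)
 show "irreducible_subset (vtop (wonderful n)) D" using D by (simp add: irreducible_components_def)
 show "closedin (vtop (wonderful n)) (rank_one_locus n k)" if "k \<in> {1..<n}" for k
  by (rule closedin_rank_one[OF that])
 have "D \<subseteq> wonderful_boundary n" using D by (simp add: irreducible_components_def)
 then show "D \<subseteq> (\<Union>k\<in>{1..<n}. rank_one_locus n k)"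
  using boundary_rank_one[OF n] by (meson UN_I subsetD subsetI)
qed simp

section \<open>Elementary operations on complete collineations\<close>

lemma PGL_E:
 assumes "P \<in> PGL n"
 obtains g where "g \<in> carrier_mat n n" "det g \<noteq> 0" "P = hom_class n (exterior_powers n g)"
 using assms unfolding PGL_iff by blast

text \<open>The action of an elementary unipotent matrix on minors, stripped to its combinatorial
  shape: coordinates satisfying \<open>Q\<close> receive \<open>s\<close> times the coordinate at
  their partner \<pi>. Row and column operations are both of this form.\<close>

definition shear :: "(nat set \<times> nat set => bool) => (nat set \<times> nat set => nat set \<times> nat set) =>
  complex => collineation => collineation" where
 "shear Q \<pi> s A q = A q + (if Q q then s * A (\<pi> q) else 0)"

text \<open>\<open>nilpotent\<close> says that the partner coordinate is left fixed, so the shear by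
  \<open>- s\<close> is the inverse; \<open>group\<close> ties the shears to invertible matrices, so
  that they preserve \<open>PGL n\<close> and therefore its closure.\<close>

locale coordinate_shear =
 fixes n :: nat and Q :: "nat set \<times> nat set => bool" and \<pi> :: "nat set \<times> nat set => nat set \<times> nat set"
 assumes level: "\<And>k q. k \<in> {1..<n} ==> q \<in> minor_indices n k ==> Q q ==> \<pi> q \<in> minor_indices n k"
  and inside: "\<And>q. Q q ==> q \<in> hom_indices n"
  and nilpotent: "\<And>q. Q q ==> \<not> Q (\<pi> q)"
  and group: "\<And>g s. g \<in> carrier_mat n n ==> det g \<noteq> 0 ==>
   \<exists>h\<in>carrier_mat n n. det h \<noteq> 0 \<and> shear Q \<pi> s (exterior_powers n g) = exterior_powers n h"
begin

abbreviation "sh \<equiv> shear Q \<pi>"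

lemma shear_inverse: "sh (- s) (sh s A) = A"
 by (rule ext) (simp add: shear_def nilpotent)

lemma shear_zero: "sh 0 A = A"
 by (rule ext) (simp add: shear_def)

lemma shear_hom:
 assumes A: "A \<in> hom_vectors n"
 shows "sh s A \<in> hom_vectors n"
 unfolding hom_vectors_def mem_Collect_eq
proof (intro conjI allI impI ballI)
 fix q assume q: "q \<notin> hom_indices n"
 then have "\<not> Q q" using inside by blast
 then show "sh s A q = 0" using hom_vectors_zero[OF A q] by (simp add: shear_def)
next
 fix k assume k: "k \<in> {1..<n}"
 show "\<exists>q\<in>minor_indices n k. sh s A q \<noteq> 0"
 proof (rule ccontr)
  assume "\<not> ?thesis"
  then have z: "sh s A q = 0" if "q \<in> minor_indices n k" for q using that by blast
  have "A q = 0" if q: "q \<in> minor_indices n k" for q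
  proof -
   have "A q = sh (- s) (sh s A) q" by (simp add: shear_inverse)
   also have "\<dots> = 0" unfolding shear_def[of Q \<pi> "- s"] using z[OF q] z[OF level[OF k q]] by simp
   finally show ?thesis .
  qed
  then show False using A k unfolding hom_vectors_def by blast
 qed
qed

lemma shear_equiv:
 assumes "(A, B) \<in> hom_equiv n"
 shows "(sh s A, sh s B) \<in> hom_equiv n"
proof -
 obtain c where c: "A \<in> hom_vectors n" "B \<in> hom_vectors n" "\<forall>k\<in>{1..<n}. c k \<noteq> 0"
  "\<forall>k\<in>{1..<n}. \<forall>q\<in>minor_indices n k. B q = c k * A q" by (rule hom_equivE[OF assms])
 show ?thesis
 proof (rule hom_equivI[where s = c])
  fix k q assume k: "k \<in> {1..<n}" and q: "q \<in> minor_indices n k"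
  then show "sh s B q = c k * sh s A q"
   using c(4) level[OF k q] by (simp add: shear_def algebra_simps)
 qed (use c shear_hom in auto)
qed

definition shear_point :: "complex => collineation set => collineation set" where
 "shear_point s P = hom_class n (sh s (SOME A. A \<in> P))"

lemma shear_point_class:
 assumes A: "A \<in> hom_vectors n"
 shows "shear_point s (hom_class n A) = hom_class n (sh s A)"
proof -
 have "(SOME B. B \<in> hom_class n A) \<in> hom_class n A"
  by (rule someI[where P = "\<lambda>B. B \<in> hom_class n A"]) (rule hom_class_self[OF A])
 then have "(A, SOME B. B \<in> hom_class n A) \<in> hom_equiv n" by simp
 from hom_class_eqI[OF shear_equiv[OF this]] show ?thesis by (simp add: shear_point_def)
qed

lemma shear_point_points:
 assumes "P \<in> points (hom_product n)"
 shows "shear_point s P \<in> points (hom_product n)"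
proof -
 obtain A where "A \<in> hom_vectors n" "P = hom_class n A"
  using assms unfolding points_hom_product by (rule hom_quotientE)
 then show ?thesis unfolding points_hom_product
  by (simp add: shear_point_class hom_class_quotient shear_hom del: Image_singleton_iff)
qed

lemma shear_point_inverse:
 assumes "P \<in> points (hom_product n)"
 shows "shear_point (- s) (shear_point s P) = P"
proof -
 obtain A where "A \<in> hom_vectors n" "P = hom_class n A"
  using assms unfolding points_hom_product by (rule hom_quotientE)
 then show ?thesis by (simp add: shear_point_class shear_hom shear_inverse)
qed

text \<open>In a chart of the source the sheared vector has polynomial entries, so the result on
  families with values in that ring applies.\<close>

lemma shear_point_continuous: "continuous_map (vtop (hom_product n)) (vtop (hom_product n)) (shear_point s)"
 unfolding continuous_map_def
proof (intro conjI allI impI)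
 show "shear_point s \<in> points (hom_product n) \<rightarrow> points (hom_product n)"
  using shear_point_points by auto
 fix V assume V: "openin (vtop (hom_product n)) V"
 show "openin (vtop (hom_product n)) {P \<in> points (hom_product n). shear_point s P \<in> V}"
 proof (subst openin_subopen, rule ballI)
  fix P assume P: "P \<in> {P \<in> points (hom_product n). shear_point s P \<in> V}"
  then obtain A where A: "A \<in> hom_vectors n" "P = hom_class n A"
   unfolding points_hom_product by (auto elim: hom_quotientE)
  obtain tau where tau: "frame n tau" "\<forall>k\<in>{1..<n}. A (tau k) \<noteq> 0" by (rule ex_frame[OF A(1)])
  have PU: "P \<in> hom_chart_set n tau" using tau(2) unfolding A(2) hom_chart_set_iff[OF A(1) tau(1)] .
  define phi where "phi = hom_chart_coord tau"
  have phi: "phi y \<in> hom_vectors n" "y = hom_class n (phi y)" if "y \<in> hom_chart_set n tau" for y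
   using hom_chart_coord_mem[OF that tau(1)] by (simp_all add: phi_def)
  have sp: "hom_class n (sh s (phi y)) = shear_point s y" if "y \<in> hom_chart_set n tau" for y
   using shear_point_class[OF phi(1)[OF that], of s] phi(2)[OF that] by simp
  let ?R = "{\<lambda>y. p (phi y) | p. p \<in> polyfuns}"
  have R: "(\<lambda>y. sh s (phi y) q) \<in> ?R" for q
  proof -
   have "(\<lambda>z. z q + (if Q q then s * z (\<pi> q) else 0)) \<in> polyfuns"
    by (cases "Q q") (simp_all add: polyfuns.intros)
   then show ?thesis by (auto simp: shear_def intro!: exI[of _ "\<lambda>z. z q + (if Q q then s * z (\<pi> q) else 0)"])
  qed
  have in_V: "hom_class n (sh s (phi P)) \<in> V" using sp[OF PU] P by simp
  obtain r where r: "r \<in> ?R" "r P \<noteq> 0"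
   "\<forall>y\<in>hom_chart_set n tau. r y \<noteq> 0 --> hom_class n (sh s (phi y)) \<in> V"
   by (rule hom_family_open[OF func_ring_compose[OF func_ring_polyfuns] R shear_hom[OF phi(1)] PU V in_V])
  from r(1) obtain p where p: "p \<in> polyfuns" "r = (\<lambda>y. p (phi y))" by blast
  have "openin (vtop (hom_product n)) {y \<in> hom_chart_set n tau. p (phi y) \<noteq> 0}"
   unfolding phi_def hom_product_eq_glue by (rule glue_basic_open[OF _ p(1)]) (use tau in blast)
  moreover have "{y \<in> hom_chart_set n tau. p (phi y) \<noteq> 0} \<subseteq>
    {P \<in> points (hom_product n). shear_point s P \<in> V}"
   using r(3) p(2) sp by (auto simp: points_hom_product hom_chart_set_def)
  ultimately show "\<exists>T. openin (vtop (hom_product n)) T \<and> P \<in> T \<and>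
    T \<subseteq> {P \<in> points (hom_product n). shear_point s P \<in> V}"
   using PU r(2) p(2) by blast
 qed
qed

lemma shear_point_PGL:
 assumes "P \<in> PGL n"
 shows "shear_point s P \<in> PGL n"
proof -
 obtain g where g: "g \<in> carrier_mat n n" "det g \<noteq> 0" "P = hom_class n (exterior_powers n g)"
  using assms by (rule PGL_E)
 obtain h where h: "h \<in> carrier_mat n n" "det h \<noteq> 0" "sh s (exterior_powers n g) = exterior_powers n h"
  using group[OF g(1,2)] by blast
 have "shear_point s P = hom_class n (exterior_powers n h)"
  using shear_point_class[OF exterior_powers_hom[OF g(1,2)], of s] g(3) h(3) by simp
 then show ?thesis unfolding PGL_iff using h by blast
qed

lemma shear_point_wonderful:
 assumes "P \<in> points (wonderful n)"
 shows "shear_point s P \<in> points (wonderful n)"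
proof -
 have "shear_point s ` (vtop (hom_product n) closure_of PGL n) \<subseteq>
   vtop (hom_product n) closure_of (shear_point s ` PGL n)"
  by (rule continuous_map_image_closure_subset[OF shear_point_continuous])
 also have "\<dots> \<subseteq> vtop (hom_product n) closure_of PGL n"
  by (rule closure_of_mono) (use shear_point_PGL in blast)
 finally show ?thesis using assms unfolding points_wonderful by blast
qed

lemma shear_point_boundary:
 assumes "P \<in> wonderful_boundary n"
 shows "shear_point s P \<in> wonderful_boundary n"
proof -
 have P: "P \<in> points (wonderful n)" "P \<notin> PGL n" using assms by (auto simp: wonderful_boundary_def)
 have Ph: "P \<in> points (hom_product n)" using wonderful_points_hom[OF P(1)] by (simp add: points_hom_product)
 have "shear_point s P \<notin> PGL n"
 proof
  assume "shear_point s P \<in> PGL n"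
  from shear_point_PGL[OF this, of "- s"] show False using shear_point_inverse[OF Ph] P(2) by simp
 qed
 then show ?thesis using shear_point_wonderful[OF P(1)] by (simp add: wonderful_boundary_def)
qed

lemma shear_preimage_closed:
 assumes A: "closedin (vtop (wonderful n)) A"
 shows "closedin (vtop (wonderful n)) {P \<in> points (wonderful n). shear_point s P \<in> A}"
proof -
 have "openin (vtop (wonderful n)) (points (wonderful n) - A)" using A by blast
 then obtain W where W: "openin (vtop (hom_product n)) W" "points (wonderful n) - A = W \<inter> points (wonderful n)"
  unfolding openin_wonderful by blast
 have "openin (vtop (hom_product n)) {P \<in> points (hom_product n). shear_point s P \<in> W}"
  using shear_point_continuous[of s] W(1) unfolding continuous_map_def by blast
 moreover have "points (wonderful n) - {P \<in> points (wonderful n). shear_point s P \<in> A} =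
   {P \<in> points (hom_product n). shear_point s P \<in> W} \<inter> points (wonderful n)"
  using W(2) shear_point_wonderful wonderful_points_hom unfolding points_hom_product by blast
 ultimately have "openin (vtop (wonderful n)) (points (wonderful n) - {P \<in> points (wonderful n). shear_point s P \<in> A})"
  unfolding openin_wonderful by blast
 then show ?thesis by (simp add: closedin_def)
qed

text \<open>The orbit of \<open>d\<close> is a polynomial family in \<open>s\<close>, and leaving a
  closed set at one parameter means leaving it for all but finitely many.\<close>

lemma shear_family_avoids:
 assumes B: "closedin (vtop (wonderful n)) B" and d: "d \<in> points (wonderful n)" and s: "shear_point s d \<notin> B"
 obtains p where "p \<noteq> 0" "\<forall>s. poly p s \<noteq> 0 --> shear_point s d \<notin> B"
proof -
 obtain A where A: "A \<in> hom_vectors n" "d = hom_class n A"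
  using wonderful_points_hom[OF d] by (rule hom_quotientE)
 let ?R = "{poly p | p. True} :: (complex => complex) set"
 have R: "(\<lambda>y. sh y A q) \<in> ?R" for q
 proof (cases "Q q")
  case True
  then have "(\<lambda>y. sh y A q) = poly [:A q, A (\<pi> q):]" by (auto simp: shear_def fun_eq_iff)
  then show ?thesis by blast
 next
  case False
  then have "(\<lambda>y. sh y A q) = poly [:A q:]" by (auto simp: shear_def fun_eq_iff)
  then show ?thesis by blast
 qed
 have sp: "hom_class n (sh y A) = shear_point y d" for y using shear_point_class[OF A(1)] A(2) by simp
 have V: "openin (vtop (wonderful n)) (points (wonderful n) - B)" using B by blast
 have pts: "hom_class n (sh y A) \<in> points (wonderful n)" for y
  unfolding sp by (rule shear_point_wonderful[OF d])
 have in_V: "hom_class n (sh s A) \<in> points (wonderful n) - B" using pts s unfolding sp by blast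
 obtain r where r: "r \<in> ?R" "r s \<noteq> 0" "\<forall>y\<in>UNIV. r y \<noteq> 0 --> hom_class n (sh y A) \<in> points (wonderful n) - B"
  by (rule wonderful_family_open[OF func_ring_poly R shear_hom[OF A(1)] pts UNIV_I V in_V])
 then obtain p where p: "r = poly p" by blast
 then have "p \<noteq> 0" using r(2) by auto
 then show thesis using that[of p] r(3) sp p by auto
qed

text \<open>The argument that a connected group preserves irreducible components, carried out for
  one-parameter families: the union of all translates of \<open>D\<close> is irreducible, lies in
  the boundary and contains \<open>D\<close>, so it equals \<open>D\<close> by maximality.\<close>

lemma component_shear_stable:
 assumes D: "boundary_component n D" and d: "d \<in> D"
 shows "shear_point s d \<in> D"
proof -
 have D1: "D \<subseteq> wonderful_boundary n" and D2: "irreducible_subset (vtop (wonderful n)) D"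
  and D3: "\<And>Z. D \<subseteq> Z ==> Z \<subseteq> wonderful_boundary n ==> irreducible_subset (vtop (wonderful n)) Z ==> Z = D"
  using D unfolding irreducible_components_def by blast+
 have bp: "wonderful_boundary n \<subseteq> points (wonderful n)" by (auto simp: wonderful_boundary_def)
 define Z where "Z = (\<Union>s. shear_point s ` D)"
 have DZ: "D \<subseteq> Z"
 proof
  fix x assume x: "x \<in> D"
  then obtain A where "A \<in> hom_vectors n" "x = hom_class n A"
   using D1 bp wonderful_points_hom[of x n] by (auto elim: hom_quotientE)
  then have "shear_point 0 x = x" by (simp add: shear_point_class shear_zero)
  then show "x \<in> Z" unfolding Z_def using x by (metis UN_I UNIV_I image_eqI)
 qed
 have Zb: "Z \<subseteq> wonderful_boundary n" using D1 shear_point_boundary by (auto simp: Z_def)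
 have "irreducible_subset (vtop (wonderful n)) Z"
  unfolding irreducible_subset_def
 proof (intro conjI allI impI)
  show "Z \<noteq> {}" using DZ d by blast
  show "Z \<subseteq> points (wonderful n)" using Zb bp by blast
  fix A B assume "closedin (vtop (wonderful n)) A \<and> closedin (vtop (wonderful n)) B \<and> Z \<subseteq> A \<union> B"
  then have AB: "closedin (vtop (wonderful n)) A" "closedin (vtop (wonderful n)) B" "Z \<subseteq> A \<union> B" by auto
  have each: "(\<forall>x\<in>D. shear_point s x \<in> A) \<or> (\<forall>x\<in>D. shear_point s x \<in> B)" for s
  proof -
   let ?F = "\<lambda>A. {P \<in> points (wonderful n). shear_point s P \<in> A}"
   have "D \<subseteq> ?F A \<union> ?F B" using AB(3) D1 bp by (auto simp: Z_def)
   then have "D \<subseteq> ?F A \<or> D \<subseteq> ?F B"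
    using D2 shear_preimage_closed[OF AB(1), of s] shear_preimage_closed[OF AB(2), of s]
    unfolding irreducible_subset_def by blast
   then show ?thesis by blast
  qed
  show "Z \<subseteq> A \<or> Z \<subseteq> B"
  proof (rule ccontr)
   assume "\<not> (Z \<subseteq> A \<or> Z \<subseteq> B)"
   then obtain s1 d1 s2 d2 where 1: "d1 \<in> D" "shear_point s1 d1 \<notin> A" and 2: "d2 \<in> D" "shear_point s2 d2 \<notin> B"
    unfolding Z_def by blast
   have dp: "d1 \<in> points (wonderful n)" "d2 \<in> points (wonderful n)" using 1 2 D1 bp by blast+
   obtain p1 where p1: "p1 \<noteq> 0" "\<forall>s. poly p1 s \<noteq> 0 --> shear_point s d1 \<notin> A"
    by (rule shear_family_avoids[OF AB(1) dp(1) 1(2)])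
   obtain p2 where p2: "p2 \<noteq> 0" "\<forall>s. poly p2 s \<noteq> 0 --> shear_point s d2 \<notin> B"
    by (rule shear_family_avoids[OF AB(2) dp(2) 2(2)])
   \<comment> \<open>Each translate lies in \<open>A\<close> or in \<open>B\<close>. A parameter
     that is generic for both bad points \<open>d1\<close> and \<open>d2\<close> gives a translate
     lying in neither.\<close>
   have "p1 * p2 \<noteq> 0" using p1 p2 by simp
   then obtain s where "poly (p1 * p2) s \<noteq> 0" using poly_all_0_iff_0 by blast
   then show False using each[of s] p1(2) p2(2) 1(1) 2(1) by auto
  qed
 qed
 from D3[OF DZ Zb this] show ?thesis using d by (auto simp: Z_def)
qed

lemma component_shear_class:
 assumes "boundary_component n D"
  and "A \<in> hom_vectors n" "hom_class n A \<in> D"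
 shows "hom_class n (sh s A) \<in> D"
 using component_shear_stable[OF assms(1,3), of s] shear_point_class[OF assms(2)] by simp

end

section \<open>Row and column operations\<close>

definition row_cond :: "nat => nat => nat => nat set \<times> nat set => bool" where
 "row_cond n a b q \<longleftrightarrow> q \<in> hom_indices n \<and> a \<in> fst q \<and> b \<notin> fst q"

definition row_move :: "nat => nat => nat set \<times> nat set => nat set \<times> nat set" where
 "row_move a b q = (insert b (fst q - {a}), snd q)"

lemma row_move_index:
 assumes "q \<in> minor_indices n k" "a \<in> fst q" "b \<notin> fst q" "b < n"
 shows "row_move a b q \<in> minor_indices n k"
proof -
 have "finite (fst q)" using assms(1) finite_subset[of "fst q" "{..<n}"] by (auto simp: minor_indices_def)
 then have "card (insert b (fst q - {a})) = Suc (card (fst q - {a}))"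
  using assms(3) by (intro card_insert_disjoint) auto
 also have "\<dots> = card (fst q)" by (rule card_Suc_Diff1[OF \<open>finite (fst q)\<close> assms(2)])
 finally have "card (insert b (fst q - {a})) = card (fst q)" .
 then show ?thesis using assms by (auto simp: minor_indices_def row_move_def)
qed

text \<open>Nothing lies strictly between adjacent numbers, so exchanging \<open>a\<close> for
  \<open>b\<close> preserves the sorted order. For this reason only adjacent rows are sheared: no
  signs arise.\<close>

lemma pick_adjacent:
 assumes I: "finite I" "a \<in> I" "b \<notin> I" and ab: "b = Suc a \<or> a = Suc b" and i: "i < card I"
 shows "pick (insert b (I - {a})) i = (if pick I i = a then b else pick I i)"
proof -
 define rho where "rho = (\<lambda>x. if x = a then b else x)"
 define I' where "I' = insert b (I - {a})"
 have x: "pick I i \<in> I" by (rule pick_in_set) (use i in simp)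
 have order: "rho y < rho x \<longleftrightarrow> y < x" if "x \<in> I" "y \<in> I" for x y
  using that I(3) ab unfolding rho_def by (auto simp: nat_neq_iff; metis less_antisym less_SucE not_less_eq)
 have "{y \<in> I'. y < rho (pick I i)} = rho ` {y \<in> I. y < pick I i}"
 proof (intro equalityI subsetI)
  fix y assume y: "y \<in> {y \<in> I'. y < rho (pick I i)}"
  define z where "z = (if y = b then a else y)"
  have z: "z \<in> I" "rho z = y" using y I by (auto simp: z_def I'_def rho_def)
  then have "z < pick I i" using order[OF x z(1)] y by simp
  then show "y \<in> rho ` {y \<in> I. y < pick I i}" using z by blast
 next
  fix y assume "y \<in> rho ` {y \<in> I. y < pick I i}"
  then obtain z where z: "z \<in> I" "z < pick I i" "y = rho z" by blast
  then show "y \<in> {y \<in> I'. y < rho (pick I i)}" using order[OF x z(1)] by (auto simp: I'_def rho_def)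
 qed
 moreover have "inj_on rho {y \<in> I. y < pick I i}" using I by (auto simp: inj_on_def rho_def)
 ultimately have "card {y \<in> I'. y < rho (pick I i)} = card {y \<in> I. y < pick I i}" by (simp add: card_image)
 also have "\<dots> = i" by (rule card_pick) (use i in simp)
 finally have c: "card {y \<in> I'. y < rho (pick I i)} = i" .
 have "rho (pick I i) \<in> I'" using x by (auto simp: I'_def rho_def)
 from pick_card_in_set[OF this] have "pick I' i = rho (pick I i)" unfolding c .
 then show ?thesis by (simp add: I'_def rho_def)
qed

lemma index_minor_row_add:
 assumes i0: "i0 < k"
  and h: "\<And>i j. i < k ==> j < k ==> h $$ (f i, g j) =
   (if i = i0 then M $$ (f i, g j) + s * M $$ (b, g j) else M $$ (f i, g j))"
 shows "index_minor h k f g = index_minor M k f g + s * index_minor M k (f(i0 := b)) g"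
proof -
 let ?H = "mat k k (\<lambda>(i, j). h $$ (f i, g j))"
 let ?A = "mat k k (\<lambda>(i, j). M $$ (f i, g j))"
 let ?B = "mat k k (\<lambda>(i, j). M $$ ((f(i0 := b)) i, g j))"
 have c: "cofactor ?H i0 j = cofactor ?A i0 j" "cofactor ?B i0 j = cofactor ?A i0 j" if "j < k" for j
 proof -
  have "mat_delete ?H i0 j = mat_delete ?A i0 j" "mat_delete ?B i0 j = mat_delete ?A i0 j"
   using i0 that by (auto simp: mat_delete_def h intro!: eq_matI)
  then show "cofactor ?H i0 j = cofactor ?A i0 j" "cofactor ?B i0 j = cofactor ?A i0 j"
   by (simp_all add: cofactor_def)
 qed
 have "det ?H = (\<Sum>j<k. ?H $$ (i0, j) * cofactor ?H i0 j)" by (rule laplace_expansion_row) (use i0 in auto)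
 also have "\<dots> = (\<Sum>j<k. ?A $$ (i0, j) * cofactor ?A i0 j + s * (?B $$ (i0, j) * cofactor ?B i0 j))"
  by (rule sum.cong) (use i0 h[OF i0] c in \<open>auto simp: algebra_simps\<close>)
 also have "\<dots> = (\<Sum>j<k. ?A $$ (i0, j) * cofactor ?A i0 j) + s * (\<Sum>j<k. ?B $$ (i0, j) * cofactor ?B i0 j)"
  by (simp add: sum.distrib sum_distrib_left)
 also have "(\<Sum>j<k. ?A $$ (i0, j) * cofactor ?A i0 j) = det ?A"
  by (rule laplace_expansion_row[symmetric]) (use i0 in auto)
 also have "(\<Sum>j<k. ?B $$ (i0, j) * cofactor ?B i0 j) = det ?B"
  by (rule laplace_expansion_row[symmetric]) (use i0 in auto)
 finally show ?thesis by (simp add: index_minor_def)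
qed

text \<open>Linearity of the minor in the modified row. Without \<open>a\<close> in the row set
  nothing changes; with \<open>a\<close> the extra term is the minor in which row \<open>b\<close>
  replaces row \<open>a\<close>.\<close>

lemma exterior_powers_addrow:
 assumes g: "g \<in> carrier_mat n n" and ab: "a < n" "b < n" "b = Suc a \<or> a = Suc b"
 shows "shear (row_cond n a b) (row_move a b) s (exterior_powers n g) = exterior_powers n (addrow s a b g)"
proof
 fix q
 have h: "addrow s a b g \<in> carrier_mat n n" using g by simp
 show "shear (row_cond n a b) (row_move a b) s (exterior_powers n g) q = exterior_powers n (addrow s a b g) q"
 proof (cases "q \<in> hom_indices n")
  case False
  then show ?thesis by (simp add: shear_def row_cond_def exterior_powers_zero)
 next
  case True
  then obtain k where k: "k \<in> {1..<n}" and q: "q \<in> minor_indices n k" by blast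
  obtain I J where IJ: "q = (I, J)" "I \<subseteq> {..<n}" "card I = k" "J \<subseteq> {..<n}" "card J = k"
   using q by (auto simp: minor_indices_def)
  have fI: "finite I" using IJ finite_subset by blast
  have pI: "pick I i \<in> I" "pick I i < n" "pick J i < n" if "i < k" for i
   using pick_in_set[of i I] pick_lt[OF IJ(2)] pick_lt[OF IJ(4)] IJ that by auto
  have entry: "addrow s a b g $$ (pick I i, pick J j) =
    (if pick I i = a then g $$ (pick I i, pick J j) + s * g $$ (b, pick J j) else g $$ (pick I i, pick J j))"
   if "i < k" "j < k" for i j using g pI that by auto
  have lhs: "exterior_powers n g q = index_minor g k (pick I) (pick J)"
   and rhs: "exterior_powers n (addrow s a b g) q = index_minor (addrow s a b g) k (pick I) (pick J)"
   using exterior_powers_minor[OF g k q] exterior_powers_minor[OF h k q] IJ by (simp_all add: level_minor_def)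
  show ?thesis
  proof (cases "a \<in> I")
   case False
   then have "index_minor (addrow s a b g) k (pick I) (pick J) = index_minor g k (pick I) (pick J)"
    unfolding index_minor_def using entry pI by (intro arg_cong[of _ _ det] eq_matI) auto
   then show ?thesis using False lhs rhs IJ by (simp add: shear_def row_cond_def)
  next
   case True
   define i0 where "i0 = card {y\<in>I. y < a}"
   have i0: "pick I i0 = a" unfolding i0_def by (rule pick_card_in_set[OF True])
   have "{y\<in>I. y < a} \<subset> I" using True by auto
   then have i0k: "i0 < k" using psubset_card_mono[OF fI] IJ by (auto simp: i0_def)
   have only: "pick I i = a \<longleftrightarrow> i = i0" if "i < k" for i
    using card_pick[of i I] that IJ(3) i0 by (auto simp: i0_def)
   have eq: "index_minor (addrow s a b g) k (pick I) (pick J) =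
     index_minor g k (pick I) (pick J) + s * index_minor g k ((pick I)(i0 := b)) (pick J)"
    by (rule index_minor_row_add[OF i0k]) (use entry only in auto)
   show ?thesis
   \<comment> \<open>If \<open>b\<close> is already among the rows, the extra minor has a repeated
     row and vanishes.\<close>
   proof (cases "b \<in> I")
    case True
    define i1 where "i1 = card {y\<in>I. y < b}"
    have i1: "pick I i1 = b" unfolding i1_def by (rule pick_card_in_set[OF True])
    have "{y\<in>I. y < b} \<subset> I" using True by auto
    then have "i1 < k" using psubset_card_mono[OF fI] IJ by (auto simp: i1_def)
    moreover have "i1 \<noteq> i0" using i0 i1 ab by auto
    ultimately have "\<not> inj_on ((pick I)(i0 := b)) {..<k}"
     using i1 i0k inj_onD[of "(pick I)(i0 := b)" "{..<k}" i0 i1] by auto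
    from index_minor_not_inj[OF this] show ?thesis
     using True lhs rhs eq IJ by (simp add: shear_def row_cond_def)
   next
    case False
    have rc: "row_cond n a b q" using \<open>q \<in> hom_indices n\<close> \<open>a \<in> I\<close> False IJ
     by (simp add: row_cond_def)
    have mq: "row_move a b q \<in> minor_indices n k"
     by (rule row_move_index[OF q]) (use IJ \<open>a \<in> I\<close> False ab in auto)
    have "exterior_powers n g (row_move a b q) = index_minor g k (pick (insert b (I - {a}))) (pick J)"
     unfolding exterior_powers_minor[OF g k mq] level_minor_def by (simp add: row_move_def IJ)
    also have "\<dots> = index_minor g k ((pick I)(i0 := b)) (pick J)"
     by (rule index_minor_cong) (use pick_adjacent[OF fI \<open>a \<in> I\<close> False ab(3)] only IJ in auto)
    finally show ?thesis using rc lhs rhs eq by (simp add: shear_def)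
   qed
  qed
 qed
qed

lemma row_shear:
 assumes ab: "a < n" "b < n" "b = Suc a \<or> a = Suc b"
 shows "coordinate_shear n (row_cond n a b) (row_move a b)"
proof
 fix k q assume "k \<in> {1..<n}" "q \<in> minor_indices n k" "row_cond n a b q"
 then show "row_move a b q \<in> minor_indices n k" using ab by (auto simp: row_cond_def intro: row_move_index)
next
 fix q assume "row_cond n a b q"
 then show "q \<in> hom_indices n" by (simp add: row_cond_def)
 show "\<not> row_cond n a b (row_move a b q)" using ab by (auto simp: row_cond_def row_move_def)
next
 fix g :: "complex mat" and s assume g: "g \<in> carrier_mat n n" "det g \<noteq> 0"
 have "det (addrow s a b g) = det g" by (rule det_addrow) (use ab g in auto)
 then show "\<exists>h\<in>carrier_mat n n. det h \<noteq> 0 \<and>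
   shear (row_cond n a b) (row_move a b) s (exterior_powers n g) = exterior_powers n h"
  using exterior_powers_addrow[OF g(1) ab] g by (intro bexI[of _ "addrow s a b g"]) auto
qed

section \<open>Column operations by transposition\<close>

lemma minor_indices_flip: "prod.swap q \<in> minor_indices n k \<longleftrightarrow> q \<in> minor_indices n k"
 by (auto simp: minor_indices_def prod.swap_def split: prod.splits)

lemma exterior_powers_transpose:
 assumes g: "g \<in> carrier_mat n n"
 shows "exterior_powers n (transpose_mat g) q = exterior_powers n g (prod.swap q)"
proof (cases "q \<in> hom_indices n")
 case True
 then obtain k where k: "k \<in> {1..<n}" and q: "q \<in> minor_indices n k" by blast
 have gt: "transpose_mat g \<in> carrier_mat n n" using g by simp
 have q': "prod.swap q \<in> minor_indices n k" using q by (simp add: minor_indices_flip)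
 show ?thesis unfolding exterior_powers_minor[OF gt k q] exterior_powers_minor[OF g k q'] level_minor_def
  by (simp add: index_minor_transpose[OF g pick_minor_index[OF q]])
next
 case False
 then have "prod.swap q \<notin> hom_indices n" by (simp add: minor_indices_flip)
 with False show ?thesis by (simp add: exterior_powers_zero)
qed

definition col_cond :: "nat => nat => nat => nat set \<times> nat set => bool" where
 "col_cond n a b q \<longleftrightarrow> row_cond n a b (prod.swap q)"

definition col_move :: "nat => nat => nat set \<times> nat set => nat set \<times> nat set" where
 "col_move a b q = prod.swap (row_move a b (prod.swap q))"

lemma col_shear:
 assumes ab: "a < n" "b < n" "b = Suc a \<or> a = Suc b"
 shows "coordinate_shear n (col_cond n a b) (col_move a b)"
proof -
 interpret row: coordinate_shear n "row_cond n a b" "row_move a b" by (rule row_shear[OF ab])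
 show ?thesis
 proof
  fix k q assume "k \<in> {1..<n}" "q \<in> minor_indices n k" "col_cond n a b q"
  then show "col_move a b q \<in> minor_indices n k"
   using row.level[of k "prod.swap q"] by (simp add: minor_indices_flip col_cond_def col_move_def)
 next
  fix q assume q: "col_cond n a b q"
  then show "q \<in> hom_indices n"
   using row.inside[of "prod.swap q"] by (simp add: minor_indices_flip col_cond_def)
  show "\<not> col_cond n a b (col_move a b q)"
   using row.nilpotent[of "prod.swap q"] q by (simp add: col_cond_def col_move_def)
 next
  fix g :: "complex mat" and s assume g: "g \<in> carrier_mat n n" "det g \<noteq> 0"
  have gt: "transpose_mat g \<in> carrier_mat n n" "det (transpose_mat g) \<noteq> 0"
   using g det_transpose[OF g(1)] by simp_all
  obtain h where h: "h \<in> carrier_mat n n" "det h \<noteq> 0"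
   "shear (row_cond n a b) (row_move a b) s (exterior_powers n (transpose_mat g)) = exterior_powers n h"
   using row.group[OF gt] by blast
  have "shear (col_cond n a b) (col_move a b) s (exterior_powers n g) q = exterior_powers n (transpose_mat h) q" for q
  proof -
   have "shear (col_cond n a b) (col_move a b) s (exterior_powers n g) q =
    shear (row_cond n a b) (row_move a b) s (exterior_powers n (transpose_mat g)) (prod.swap q)"
    by (simp add: shear_def col_cond_def col_move_def exterior_powers_transpose[OF g(1)])
   then show ?thesis unfolding h(3) exterior_powers_transpose[OF h(1)] .
  qed
  then show "\<exists>h\<in>carrier_mat n n. det h \<noteq> 0 \<and>
    shear (col_cond n a b) (col_move a b) s (exterior_powers n g) = exterior_powers n h"
   using h det_transpose[OF h(1)] by (intro bexI[of _ "transpose_mat h"]) (auto simp: fun_eq_iff)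
 qed
qed

text \<open>The classical product of an upper, a lower and again an upper unipotent matrix in rank
  two, with parameters 1, -1, 1: it represents the nontrivial Weyl group element.\<close>

lemma shear_triple:
 assumes Q: "\<And>q. Q q ==> Q' (\<pi> q) \<and> \<pi>' (\<pi> q) = q \<and> \<not> Q' q \<and> \<not> Q (\<pi> q)"
  and Q': "\<And>q. Q' q ==> Q (\<pi>' q) \<and> \<pi> (\<pi>' q) = q \<and> \<not> Q q \<and> \<not> Q' (\<pi>' q)"
 shows "shear Q \<pi> 1 (shear Q' \<pi>' (-1) (shear Q \<pi> 1 A)) q =
  (if Q q then A (\<pi> q) else if Q' q then - A (\<pi>' q) else A q)"
 using Q[of q] Q'[of q] by (auto simp: shear_def)

definition permuted_vector :: "(nat => nat) => collineation => collineation" where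
 "permuted_vector sigma A q = A (sigma ` fst q, sigma ` snd q)"

lemma image_transpose:
 assumes "a \<noteq> b"
 shows "Transposition.transpose a b ` I =
  (if a \<in> I \<and> b \<notin> I then insert b (I - {a}) else if b \<in> I \<and> a \<notin> I then insert a (I - {b}) else I)"
 using assms by (auto simp: Transposition.transpose_def image_iff split: if_splits)

lemma permutes_image_minor_index:
 assumes "sigma permutes {..<n}" "sigma' permutes {..<n}"
 shows "(sigma ` I, sigma' ` J) \<in> minor_indices n k \<longleftrightarrow> (I, J) \<in> minor_indices n k"
proof -
 have *: "rho ` K \<subseteq> {..<n} \<longleftrightarrow> K \<subseteq> {..<n}" "card (rho ` K) = card K" if r: "rho permutes {..<n}" for rho K
 proof -
  show "card (rho ` K) = card K" by (rule card_image[OF inj_on_subset[OF permutes_inj[OF r] subset_UNIV]])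
  have "rho x < n \<longleftrightarrow> x < n" for x using permutes_in_image[OF r, of x] by simp
  then show "rho ` K \<subseteq> {..<n} \<longleftrightarrow> K \<subseteq> {..<n}" by auto
 qed
 show ?thesis by (simp add: minor_indices_def *[OF assms(1)] *[OF assms(2)])
qed

text \<open>The triple of shears replaces row \<open>a\<close> by the old row \<open>b\<close>, and
  row \<open>b\<close> by minus the old row \<open>a\<close>. The sign is visible just when the
  second is picked without the first; on both rows the determinant is 1.\<close>

definition swap_sign :: "nat => nat => nat set => complex" where
 "swap_sign a b I = (if b \<in> I \<and> a \<notin> I then - 1 else 1)"

lemma row_triple:
 assumes zero: "\<And>q. q \<notin> hom_indices n ==> A q = 0" and ab: "a < n" "b < n" "a \<noteq> b"
 shows "shear (row_cond n a b) (row_move a b) 1 (shear (row_cond n b a) (row_move b a) (-1)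
   (shear (row_cond n a b) (row_move a b) 1 A)) q =
  swap_sign a b (fst q) * A (Transposition.transpose a b ` fst q, snd q)"
proof (cases "q \<in> hom_indices n")
 case True
 have rc: "row_cond n b a (row_move a b q) \<and> row_move b a (row_move a b q) = q \<and>
   \<not> row_cond n b a q \<and> \<not> row_cond n a b (row_move a b q)"
  if "row_cond n a b q" "a < n" "b < n" "a \<noteq> b" for a b q
 proof -
  from that obtain k where "k \<in> {1..<n}" "q \<in> minor_indices n k" "a \<in> fst q" "b \<notin> fst q"
   by (auto simp: row_cond_def)
  with row_move_index[OF this(2-4) that(3)] that show ?thesis
   by (auto simp: row_cond_def row_move_def insert_absorb prod_eq_iff)
 qed
 have "shear (row_cond n a b) (row_move a b) 1 (shear (row_cond n b a) (row_move b a) (-1)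
   (shear (row_cond n a b) (row_move a b) 1 A)) q =
  (if row_cond n a b q then A (row_move a b q) else if row_cond n b a q then - A (row_move b a q) else A q)"
  by (rule shear_triple) (use rc[of a b] rc[of b a] ab in auto)
 then show ?thesis
  using True by (auto simp: row_cond_def row_move_def swap_sign_def image_transpose[OF ab(3)])
next
 case False
 then have nc: "\<not> row_cond n a b q" "\<not> row_cond n b a q" by (auto simp: row_cond_def)
 have "Transposition.transpose a b permutes {..<n}" using ab by (intro permutes_swap_id) auto
 from permutes_image_minor_index[OF this permutes_id, of "fst q" "snd q"] False
 have "(Transposition.transpose a b ` fst q, snd q) \<notin> hom_indices n" by simp
 from zero[OF this] zero[OF False] nc show ?thesis by (simp add: shear_def)
qed

lemma col_triple:
 assumes zero: "\<And>q. q \<notin> hom_indices n ==> A q = 0" and ab: "a < n" "b < n" "a \<noteq> b"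
 shows "shear (col_cond n a b) (col_move a b) 1 (shear (col_cond n b a) (col_move b a) (-1)
   (shear (col_cond n a b) (col_move a b) 1 A)) q =
  swap_sign a b (snd q) * A (fst q, Transposition.transpose a b ` snd q)"
proof -
 have flip: "shear (col_cond n a b) (col_move a b) s B q =
   shear (row_cond n a b) (row_move a b) s (\<lambda>q. B (prod.swap q)) (prod.swap q)" for a b s B q
  by (simp add: shear_def col_cond_def col_move_def)
 have zero': "A (prod.swap q) = 0" if "q \<notin> hom_indices n" for q
  using zero[of "prod.swap q"] that by (simp add: minor_indices_flip)
 show ?thesis using row_triple[of n "\<lambda>q. A (prod.swap q)" a b "prod.swap q", OF zero' ab]
  by (simp add: flip)
qed

text \<open>Points in the closure of the diagonal torus have such coordinates. For them the signs of
  a row swap and of the corresponding column swap cancel.\<close>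

definition diagonal_vector :: "collineation => bool" where
 "diagonal_vector A \<longleftrightarrow> (\<forall>I J. A (I, J) \<noteq> 0 --> I = J)"

text \<open>Conjugation by an adjacent transposition is a composition of six shears, three on rows
  and three on columns, each of which preserves \<open>D\<close>.\<close>

lemma component_adjacent_swap:
 assumes D: "boundary_component n D"
  and A: "A \<in> hom_vectors n" "diagonal_vector A" "hom_class n A \<in> D" and a: "Suc a < n"
 shows "hom_class n (permuted_vector (Transposition.transpose a (Suc a)) A) \<in> D"
proof -
 define b where "b = Suc a"
 have ab: "a < n" "b < n" "a \<noteq> b" and adj: "b = Suc a \<or> a = Suc b" "a = Suc b \<or> b = Suc a"
  using a by (auto simp: b_def)
 interpret r: coordinate_shear n "row_cond n a b" "row_move a b" by (rule row_shear[OF ab(1,2) adj(1)])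
 interpret r': coordinate_shear n "row_cond n b a" "row_move b a" by (rule row_shear[OF ab(2,1) adj(2)])
 interpret c: coordinate_shear n "col_cond n a b" "col_move a b" by (rule col_shear[OF ab(1,2) adj(1)])
 interpret c': coordinate_shear n "col_cond n b a" "col_move b a" by (rule col_shear[OF ab(2,1) adj(2)])
 define B where "B = r.sh 1 (r'.sh (-1) (r.sh 1 A))"
 define E where "E = c.sh 1 (c'.sh (-1) (c.sh 1 B))"
 have B: "B \<in> hom_vectors n" "hom_class n B \<in> D" unfolding B_def
  by (intro r.shear_hom r'.shear_hom A r.component_shear_class[OF D] r'.component_shear_class[OF D])+
 have E: "hom_class n E \<in> D" unfolding E_def
  by (intro c.shear_hom c'.shear_hom B c.component_shear_class[OF D] c'.component_shear_class[OF D])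
 have "E q = permuted_vector (Transposition.transpose a b) A q" for q
 proof -
  have "E q = swap_sign a b (snd q) * B (fst q, Transposition.transpose a b ` snd q)"
   unfolding E_def by (rule col_triple[OF hom_vectors_zero[OF B(1)] ab])
  also have "B (fst q, Transposition.transpose a b ` snd q) = swap_sign a b (fst q) *
    A (Transposition.transpose a b ` fst q, Transposition.transpose a b ` snd q)"
   unfolding B_def by (subst row_triple[OF hom_vectors_zero[OF A(1)] ab]) simp_all
  finally have E: "E q = swap_sign a b (snd q) * (swap_sign a b (fst q) *
    permuted_vector (Transposition.transpose a b) A q)" by (simp add: permuted_vector_def)
  show ?thesis
  proof (cases "permuted_vector (Transposition.transpose a b) A q = 0")
   case True
   then show ?thesis using E by simp
  next
   case False
   then have "Transposition.transpose a b ` fst q = Transposition.transpose a b ` snd q"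
    using A(2) unfolding diagonal_vector_def permuted_vector_def by blast
   moreover have "Transposition.transpose a b permutes {..<n}" using ab by (intro permutes_swap_id) auto
   ultimately have "fst q = snd q" using inj_image_eq_iff[OF permutes_inj] by blast
   then show ?thesis using E by (simp add: swap_sign_def)
  qed
 qed
 then have "E = permuted_vector (Transposition.transpose a b) A" by (rule ext)
 with E show ?thesis by (simp add: b_def)
qed

lemma permuted_vector_comp: "permuted_vector sigma (permuted_vector sigma' A) = permuted_vector (sigma' \<circ> sigma) A"
 by (simp add: permuted_vector_def fun_eq_iff image_comp)

lemma permuted_vector_hom:
 assumes sigma: "sigma permutes {..<n}" and A: "A \<in> hom_vectors n" "diagonal_vector A"
 shows "permuted_vector sigma A \<in> hom_vectors n" "diagonal_vector (permuted_vector sigma A)"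
proof -
 note idx = permutes_image_minor_index[OF sigma sigma]
 show "permuted_vector sigma A \<in> hom_vectors n"
  unfolding hom_vectors_def mem_Collect_eq
 proof (intro conjI allI impI ballI)
  fix q assume q: "q \<notin> hom_indices n"
  then have "(sigma ` fst q, sigma ` snd q) \<notin> hom_indices n" by (simp add: idx)
  then show "permuted_vector sigma A q = 0" unfolding permuted_vector_def by (rule hom_vectors_zero[OF A(1)])
 next
  fix k assume "k \<in> {1..<n}"
  then obtain q where q: "q \<in> minor_indices n k" "A q \<noteq> 0" using A(1) unfolding hom_vectors_def by blast
  define rho where "rho = inv_into UNIV sigma"
  have "sigma ` rho ` K = K" for K
   by (simp add: rho_def image_comp comp_def permutes_inverses(1)[OF sigma])
  then have "permuted_vector sigma A (rho ` fst q, rho ` snd q) = A q"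
   "(rho ` fst q, rho ` snd q) \<in> minor_indices n k"
   using q(1) idx[of "rho ` fst q" "rho ` snd q" k] by (simp_all add: permuted_vector_def)
  with q(2) show "\<exists>q\<in>minor_indices n k. permuted_vector sigma A q \<noteq> 0" by (intro bexI[of _ "(rho ` fst q, rho ` snd q)"]) auto
 qed
 show "diagonal_vector (permuted_vector sigma A)"
  using A(2) inj_image_eq_iff[OF permutes_inj[OF sigma]] unfolding diagonal_vector_def permuted_vector_def
  by (metis fst_conv snd_conv)
qed

text \<open>Adjacent transpositions generate all transpositions, and these generate all
  permutations; diagonality of the vector is preserved on the way, which keeps the swap lemma
  applicable.\<close>

lemma component_permuted:
 assumes D: "boundary_component n D"
  and sigma: "sigma permutes {..<n}" and A: "A \<in> hom_vectors n" "diagonal_vector A" "hom_class n A \<in> D"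
 shows "hom_class n (permuted_vector sigma A) \<in> D"
proof -
 define S where "S = (\<lambda>sigma. \<forall>A. A \<in> hom_vectors n --> diagonal_vector A --> hom_class n A \<in> D -->
  hom_class n (permuted_vector sigma A) \<in> D)"
 have comp: "S (sigma' \<circ> sigma)" if "S sigma" "S sigma'" "sigma' permutes {..<n}" for sigma sigma'
  using that permuted_vector_hom[OF that(3)] unfolding S_def permuted_vector_comp[symmetric] by blast
 have tp: "Transposition.transpose a b permutes {..<n}" if "a < n" "b < n" for a b
  using that by (intro permutes_swap_id) auto
 have adj: "S (Transposition.transpose a (Suc a))" if "Suc a < n" for a
  unfolding S_def using component_adjacent_swap[OF D _ _ _ that] by blast
 have lt: "S (Transposition.transpose a b)" if "a < b" "b < n" for a b
  using that
 proof (induction b)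
  case (Suc b)
  show ?case
  proof (cases "a = b")
   case True
   then show ?thesis using adj Suc.prems by simp
  next
   case False
   then have ih: "S (Transposition.transpose a b)" using Suc by simp
   \<comment> \<open>Conjugating by an adjacent transposition lengthens the distance by one.\<close>
   have "Transposition.transpose a (Suc b) =
     Transposition.transpose b (Suc b) \<circ> (Transposition.transpose a b \<circ> Transposition.transpose b (Suc b))"
    using False Suc.prems by (auto simp: fun_eq_iff Transposition.transpose_def)
   moreover have "S (Transposition.transpose b (Suc b) \<circ> (Transposition.transpose a b \<circ> Transposition.transpose b (Suc b)))"
    using Suc.prems by (intro comp adj ih tp) auto
   ultimately show ?thesis by (simp only:)
  qed
 qed simp
 have tr: "S (Transposition.transpose a b)" if "a < n" "b < n" "a \<noteq> b" for a b
  using lt[of a b] lt[of b a] that by (cases "a < b") (auto simp: transpose_commute)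
 have "S sigma"
  using sigma finite_lessThan[of n]
 proof (induction rule: permutes_induct)
  case id
  have "permuted_vector id A = A" for A by (simp add: fun_eq_iff permuted_vector_def)
  then show ?case unfolding S_def by metis
 next
  case (swap a b p)
  then show ?case by (intro comp tr tp) auto
 qed
 then show ?thesis using A by (simp add: S_def)
qed

section \<open>Diagonal matrices and the torus closure\<close>

text \<open>For \<open>I \<noteq> J\<close> some row of the submatrix meets no diagonal entry and is
  zero; for \<open>I = J\<close> the submatrix is diagonal.\<close>

lemma exterior_powers_diag:
 assumes k: "k \<in> {1..<n}" and q: "(I, J) \<in> minor_indices n k"
 shows "exterior_powers n (mat_diag n p) (I, J) = (if I = J then \<Prod>i\<in>I. p i else 0)"
proof -
 have IJ: "I \<subseteq> {..<n}" "card I = k" "J \<subseteq> {..<n}" "card J = k" using q by (auto simp: minor_indices_def)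
 have fin: "finite I" "finite J" using IJ finite_subset by blast+
 have lt: "pick I i < n" "pick J i < n" if "i < k" for i
  using pick_lt[OF IJ(1)] pick_lt[OF IJ(3)] IJ that by auto
 have inI: "pick I i \<in> I" "pick J i \<in> J" if "i < k" for i using pick_in_set[of i I] pick_in_set[of i J] IJ that by auto
 let ?M = "mat k k (\<lambda>(i, j). mat_diag n p $$ (pick I i, pick J j))"
 have e: "exterior_powers n (mat_diag n p) (I, J) = det ?M"
  by (simp add: exterior_powers_minor[OF mat_diag_dim k q] level_minor_def index_minor_def)
 show ?thesis
 proof (cases "I = J")
  case False
  then have "\<not> I \<subseteq> J" using card_subset_eq[OF fin(2), of I] IJ by auto
  then obtain i where i: "i \<in> I" "i \<notin> J" by blast
  define i0 where "i0 = card {y\<in>I. y < i}"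
  have p0: "pick I i0 = i" unfolding i0_def by (rule pick_card_in_set[OF i(1)])
  have "{y\<in>I. y < i} \<subset> I" using i by auto
  then have i0: "i0 < k" using psubset_card_mono[OF fin(1)] IJ by (auto simp: i0_def)
  have row: "?M $$ (i0, j) = 0" if "j < k" for j
   using that i0 p0 i inI[OF that] lt[OF that] lt[OF i0] by (auto simp: mat_diag_def)
  have "det ?M = (\<Sum>j<k. ?M $$ (i0, j) * cofactor ?M i0 j)" by (rule laplace_expansion_row) (use i0 in auto)
  also have "\<dots> = 0" by (rule sum.neutral) (use row in \<open>auto simp del: index_mat\<close>)
  finally have "det ?M = 0" .
  then show ?thesis unfolding e using False by (simp only: if_False)
 next
  case True
  have px: "card {a\<in>I. a < pick I x} = x" if "x < k" for x
   by (rule card_pick) (simp add: IJ(2) that)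
  have inj: "inj_on (pick I) {0..<k}"
  proof (rule inj_onI)
   fix x y assume "x \<in> {0..<k}" "y \<in> {0..<k}" "pick I x = pick I y"
   then show "x = y" by (metis px atLeastLessThan_iff)
  qed
  have entry: "?M $$ (i, j) = (if i = j then p (pick I i) else 0)" if "i < k" "j < k" for i j
   using that lt inj_onD[OF inj, of i j] True by (auto simp: mat_diag_def)
  have "upper_triangular ?M" by (rule upper_triangularI) (use entry in auto)
  then have "det ?M = prod_list (diag_mat ?M)" by (rule det_upper_triangular[where n = k]) simp
  also have "\<dots> = (\<Prod>i=0..<k. p (pick I i))"
   using entry by (simp add: prod_list_diag_prod)
  also have "\<dots> = (\<Prod>i\<in>pick I ` {0..<k}. p i)" by (simp add: prod.reindex[OF inj])
  also have "pick I ` {0..<k} = I"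
   by (rule card_subset_eq[OF fin(1)]) (use inI IJ card_image[OF inj] in auto)
  finally have "det ?M = (\<Prod>i\<in>I. p i)" .
  then show ?thesis unfolding e using True by (simp only: if_True simp_thms)
 qed
qed

lemma det_mat_diag: "det (mat_diag n p) = (\<Prod>i<n. p i)" for p :: "nat => complex"
proof -
 have "upper_triangular (mat_diag n p)" by (rule upper_triangularI) (auto simp: mat_diag_def)
 then have "det (mat_diag n p) = prod_list (diag_mat (mat_diag n p))" by (rule det_upper_triangular[of _ n]) simp
 also have "\<dots> = (\<Prod>i=0..<n. p i)"
  by (simp add: prod_list_diag_prod) (auto simp: mat_diag_def intro!: prod.cong)
 finally show ?thesis by (simp add: atLeast0LessThan)
qed

abbreviation diag_index :: "nat => nat set \<times> nat set => bool" where
 "diag_index n q \<equiv> fst q = snd q \<and> fst q \<subseteq> {..<n} \<and> card (fst q) \<in> {1..<n}"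

definition diag_family :: "nat => (nat set => complex) => collineation" where
 "diag_family n c q = (if diag_index n q then c (fst q) else 0)"

lemma diag_family_index:
 "fst q = snd q \<and> fst q \<subseteq> {..<n} \<and> card (fst q) = k \<longleftrightarrow> q \<in> minor_indices n k \<and> fst q = snd q"
proof -
 obtain I J where q: "q = (I, J)" by (cases q)
 show ?thesis unfolding q minor_indices_def by (simp, blast)
qed

lemma diag_family_hom:
 assumes "\<And>k. k \<in> {1..<n} ==> \<exists>I\<subseteq>{..<n}. card I = k \<and> c I \<noteq> 0"
 shows "diag_family n c \<in> hom_vectors n" "diagonal_vector (diag_family n c)"
proof -
 show "diag_family n c \<in> hom_vectors n"
  unfolding hom_vectors_def mem_Collect_eq
 proof (intro conjI allI impI ballI)
  fix q assume q: "q \<notin> hom_indices n"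
  have "\<not> (diag_index n q)"
  proof (rule notI, elim conjE)
   assume h: "fst q = snd q" "fst q \<subseteq> {..<n}" "card (fst q) \<in> {1..<n}"
   have "q \<in> minor_indices n (card (fst q))"
    by (rule conjunct1[OF diag_family_index[THEN iffD1]]) (intro conjI h refl)
   then show False using q h(3) by blast
  qed
  then show "diag_family n c q = 0" unfolding diag_family_def by (rule if_not_P)
 next
  fix k assume k: "k \<in> {1..<n}"
  from assms[OF k] obtain I where "I \<subseteq> {..<n}" "card I = k" "c I \<noteq> 0" by blast
  then show "\<exists>q\<in>minor_indices n k. diag_family n c q \<noteq> 0"
   using k by (intro bexI[of _ "(I, I)"]) (auto simp: diag_family_def minor_indices_def)
 qed
 show "diagonal_vector (diag_family n c)" by (auto simp: diagonal_vector_def diag_family_def)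
qed

text \<open>The factors \<open>s k\<close> are the independent rescalings of the levels, which do
  not change the point of the product of projective spaces.\<close>

lemma diag_family_pgl:
 assumes p: "\<And>i. i < n ==> p i \<noteq> 0" and s: "\<And>k. k \<in> {1..<n} ==> s k \<noteq> 0"
  and c: "\<And>I. I \<subseteq> {..<n} ==> card I \<in> {1..<n} ==> c I = s (card I) * (\<Prod>i\<in>I. p i)"
 shows "hom_class n (diag_family n c) = pgl_point n (mat_diag n p)"
  and "pgl_point n (mat_diag n p) \<in> PGL n"
proof -
 have d: "det (mat_diag n p) \<noteq> 0" using p by (simp add: det_mat_diag)
 then show "pgl_point n (mat_diag n p) \<in> PGL n"
  unfolding PGL_iff pgl_point_def using mat_diag_dim by blast
 have nz: "(\<Prod>i\<in>I. p i) \<noteq> 0" if "I \<subseteq> {..<n}" for I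
  using that p finite_subset[OF that] by auto
 have hv: "diag_family n c \<in> hom_vectors n"
 proof (rule diag_family_hom)
  fix k assume k: "k \<in> {1..<n}"
  then have "{..<k} \<subseteq> {..<n}" "card {..<k} = k" by auto
  moreover have "c {..<k} = s k * (\<Prod>i<k. p i)" using c[of "{..<k}"] k by auto
  then have "c {..<k} \<noteq> 0" using s[OF k] nz[of "{..<k}"] k by auto
  ultimately show "\<exists>I\<subseteq>{..<n}. card I = k \<and> c I \<noteq> 0" by blast
 qed
 have "(exterior_powers n (mat_diag n p), diag_family n c) \<in> hom_equiv n"
 proof (rule hom_equivI[where s = s])
  fix k q assume k: "k \<in> {1..<n}" and q: "q \<in> minor_indices n k"
  obtain I J where IJ: "q = (I, J)" "I \<subseteq> {..<n}" "card I = k" using q by (auto simp: minor_indices_def)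
  show "diag_family n c q = s k * exterior_powers n (mat_diag n p) q"
   using exterior_powers_diag[OF k q[unfolded IJ(1)], of p] c[OF IJ(2)] IJ k
   by (auto simp: diag_family_def)
 qed (use exterior_powers_hom[OF mat_diag_dim d] hv s in auto)
 from hom_class_eqI[OF this] show "hom_class n (diag_family n c) = pgl_point n (mat_diag n p)"
  by (simp add: pgl_point_def)
qed

section \<open>Homogeneous coordinates of limits of torus points\<close>

definition component_sum :: "marked_chain => nat set => nat" where
 "component_sum C I = (\<Sum>i\<in>I. component C i)"

abbreviation subsets_of :: "nat => nat => nat set set" where
 "subsets_of n k \<equiv> {K. K \<subseteq> {..<n} \<and> card K = k}"

text \<open>The largest pole order in the parameter among the coordinates of level \<open>k\<close>
  along a degeneration path; removing it leaves exactly the subsets attaining the maximum when the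
  parameter becomes 0.\<close>

definition top_sum :: "nat => marked_chain => nat => nat" where
 "top_sum n C k = Max (component_sum C ` subsets_of n k)"

lemma finite_card_subsets: "finite {K. K \<subseteq> {..<n::nat} \<and> card K = k}"
 by (rule finite_subset[of _ "Pow {..<n}"]) auto

lemma component_sum_le_top:
 assumes "I \<subseteq> {..<n}" "card I = k"
 shows "component_sum C I \<le> top_sum n C k"
 unfolding top_sum_def using assms finite_card_subsets by (intro Max_ge) auto

lemma top_sum_attained:
 assumes "k \<le> n"
 obtains I where "I \<subseteq> {..<n}" "card I = k" "component_sum C I = top_sum n C k"
proof -
 have "{..<k} \<in> subsets_of n k" using assms by auto
 then have "top_sum n C k \<in> component_sum C ` subsets_of n k"
  unfolding top_sum_def by (intro Max_in finite_imageI finite_card_subsets) blast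
 then show thesis by (rule imageE) (rule that, auto)
qed

lemma top_sumI:
 assumes "I \<subseteq> {..<n}" "card I = k" "\<And>K. K \<subseteq> {..<n} ==> card K = k ==> component_sum C K \<le> component_sum C I"
 shows "top_sum n C k = component_sum C I"
 unfolding top_sum_def by (rule Max_eqI) (use assms finite_card_subsets in auto)

text \<open>Homogeneous coordinates of the images of the points on a degeneration path: the products of the
 coordinates of the diagonal matrix, cleared of the common power of the parameter on each level.\<close>

definition path_vector :: "nat => marked_chain => complex => collineation" where
 "path_vector n C s = diag_family n (\<lambda>I. (\<Prod>i\<in>I. pos C i) * s ^ (top_sum n C (card I) - component_sum C I))"

lemma path_vector_hom:
 assumes C: "C \<in> marked_chains n"
 shows "path_vector n C s \<in> hom_vectors n" "diagonal_vector (path_vector n C s)"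
proof -
 have "\<exists>I\<subseteq>{..<n}. card I = k \<and> (\<Prod>i\<in>I. pos C i) * s ^ (top_sum n C (card I) - component_sum C I) \<noteq> 0"
  if k: "k \<in> {1..<n}" for k
 proof -
  have kn: "k \<le> n" using k by simp
  obtain I where I: "I \<subseteq> {..<n}" "card I = k" "component_sum C I = top_sum n C k"
   by (rule top_sum_attained[OF kn])
  have "(\<Prod>i\<in>I. pos C i) \<noteq> 0" using finite_subset[OF I(1)] pos_nonzero[OF C] I(1) by auto
  then show ?thesis using I by (intro exI[of _ I]) simp
 qed
 note h = diag_family_hom[of n "\<lambda>I. (\<Prod>i\<in>I. pos C i) * s ^ (top_sum n C (card I) - component_sum C I)", OF this]
 show "path_vector n C s \<in> hom_vectors n" "diagonal_vector (path_vector n C s)"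
  unfolding path_vector_def using h by simp_all
qed

lemma path_vector_pgl:
 assumes C: "C \<in> marked_chains n" and s: "s \<noteq> 0"
 shows "hom_class n (path_vector n C s) = pgl_point n (mat_diag n (\<lambda>i. pos C i / s ^ component C i))"
 unfolding path_vector_def
proof (rule diag_family_pgl(1)[where s = "\<lambda>k. s ^ top_sum n C k"])
 fix I assume I: "I \<subseteq> {..<n}" "card I \<in> {1..<n}"
 have "(\<Prod>i\<in>I. pos C i) * s ^ (top_sum n C (card I) - component_sum C I) =
   (\<Prod>i\<in>I. pos C i) * (s ^ top_sum n C (card I) / s ^ component_sum C I)"
  using s component_sum_le_top[OF I(1) refl] by (simp add: power_diff)
 also have "\<dots> = s ^ top_sum n C (card I) * (\<Prod>i\<in>I. pos C i / s ^ component C i)"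
  by (simp add: prod_dividef power_sum component_sum_def)
 finally show "(\<Prod>i\<in>I. pos C i) * s ^ (top_sum n C (card I) - component_sum C I) =
   s ^ top_sum n C (card I) * (\<Prod>i\<in>I. pos C i / s ^ component C i)" .
qed (use s pos_nonzero[OF C] in auto)

lemma path_vector_poly: "\<exists>p. \<forall>s. path_vector n C s q = poly p s"
proof (cases "diag_index n q")
 case True
 then show ?thesis unfolding path_vector_def diag_family_def if_P[OF True] poly_monom[symmetric] by blast
next
 case False
 then show ?thesis unfolding path_vector_def diag_family_def if_not_P[OF False]
  by (intro exI[of _ 0] allI poly_0[symmetric])
qed

section \<open>The identification of the Losev--Manin space with the torus closure\<close>

lemma morphism_subvariety:
 assumes "morphism Y (subvariety X Z) f"
 shows "morphism Y X f"
 unfolding morphism_def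
proof (intro conjI allI impI)
 have cm: "continuous_map (vtop Y) (subtopology (vtop X) Z) f"
  using assms by (simp add: morphism_def subvariety_def)
 then show cmX: "continuous_map (vtop Y) (vtop X) f" by (simp add: continuous_map_in_subtopology)
 fix V h assume V: "openin (vtop X) V \<and> h \<in> vreg X V"
 have "openin (vtop (subvariety X Z)) (V \<inter> Z)" unfolding openin_subvariety using V by blast
 moreover have "h \<in> vreg (subvariety X Z) (V \<inter> Z)" unfolding vreg_subvariety using V by blast
 ultimately have "h \<circ> f \<in> vreg Y {x \<in> points Y. f x \<in> V \<inter> Z}" using assms unfolding morphism_def by blast
 moreover have "f x \<in> Z" if "x \<in> points Y" for x
  using cm that by (auto simp: continuous_map_in_subtopology)
 then have "{x \<in> points Y. f x \<in> V \<inter> Z} = {x \<in> points Y. f x \<in> V}" by blast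
 ultimately show "h \<circ> f \<in> vreg Y {x \<in> points Y. f x \<in> V}" by simp
qed

lemma torus_identification_morphism:
 assumes "torus_identification n \<iota>"
 shows "morphism (LM n) (wonderful n) \<iota>"
proof (rule morphism_subvariety)
 show "morphism (LM n) (subvariety (wonderful n) (vtop (wonderful n) closure_of diagonal_torus n)) \<iota>"
  using assms unfolding torus_identification_def isomorphism_def torus_closure_def by (elim conjE)
qed

text \<open>Both sides are limits of the same path in the torus.\<close>

lemma torus_identification_class:
 assumes \<iota>: "torus_identification n \<iota>" and C: "C \<in> marked_chains n"
 shows "\<iota> (chain_class n C) = hom_class n (path_vector n C 0)"
proof -
 note mor = torus_identification_morphism[OF \<iota>]
 have P: "chain_class n C \<in> points (LM n)" unfolding points_LM by (rule chain_class_quotient[OF C])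
 have xw: "\<iota> (chain_class n C) \<in> points (wonderful n)" by (rule morphism_points[OF mor P])
 obtain B where B: "B \<in> hom_vectors n" "\<iota> (chain_class n C) = hom_class n B"
  using wonderful_points_hom[OF xw] by (rule hom_quotientE)
 obtain tau where tau: "frame n tau" "\<forall>k\<in>{1..<n}. B (tau k) \<noteq> 0" by (rule ex_frame[OF B(1)])
 define V where "V = hom_chart_set n tau \<inter> points (wonderful n)"
 have V: "openin (vtop (wonderful n)) V" unfolding V_def by (rule wonderful_chart_open[OF tau(1)])
 have xV: "\<iota> (chain_class n C) \<in> V"
  using xw tau(2) hom_chart_set_iff[OF B(1) tau(1)] unfolding V_def B(2) by blast
 define U where "U = {t \<in> points (LM n). \<iota> t \<in> V}"
 have U: "openin (vtop (LM n)) U" "chain_class n C \<in> U"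
  unfolding U_def using morphism_open[OF mor V] xV P by auto
 define x where "x = hom_chart_coord tau (\<iota> (chain_class n C))"
 have xU: "\<iota> (chain_class n C) \<in> hom_chart_set n tau" using xV by (simp add: V_def)
 note x_hom = hom_chart_coord_mem[OF xU tau(1), folded x_def]
 have rel: "path_vector n C 0 q = x q * path_vector n C 0 (tau (card (fst q)))" for q
 proof -
  define h where "h = (\<lambda>y. hom_chart_coord tau y q)"
  have "h \<in> vreg (wonderful n) V"
   by (rule wonderful_coord_regular[OF tau(1) polyfuns.coord[of q]]) (auto simp: V_def h_def)
  then have hU: "(\<lambda>t. h (\<iota> t)) \<in> vreg (LM n) U" unfolding U_def by (rule morphism_reg[OF mor V])
  obtain a r where ar: "poly r 0 \<noteq> 0" "\<forall>s. poly r s \<noteq> 0 --> chain_class n (chain_path C s) \<in> U \<and>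
    h (\<iota> (chain_class n (chain_path C s))) = poly a s / poly r s"
   by (rule chain_path_regular[OF C U hU])
  obtain p where p: "\<forall>s. path_vector n C s q = poly p s" using path_vector_poly by blast
  obtain p' where p': "\<forall>s. path_vector n C s (tau (card (fst q))) = poly p' s" using path_vector_poly by blast
  \<comment> \<open>The cross-multiplied form of the equation between chart coordinates. For
    \<open>s \<noteq> 0\<close> it holds because \<iota> is prescribed on the torus, and being
    polynomial it extends to \<open>s = 0\<close>.\<close>
  have "p * r - a * p' = 0"
  proof (rule poly_zero_off[of "r * [:0, 1:]"])
   show "r * [:0, 1:] \<noteq> 0" using ar(1) by auto
   fix s assume "poly (r * [:0, 1:]) s \<noteq> 0"
   then have s: "poly r s \<noteq> 0" "s \<noteq> 0" by auto
   define P where "P = (\<lambda>i. pos C i / s ^ component C i)"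
   have "\<forall>i<n. P i \<noteq> 0" using pos_nonzero[OF C] s(2) by (simp add: P_def)
   then have "\<iota> (chain_class n (chain_path C s)) = pgl_point n (mat_diag n P)"
    using \<iota> s(2) unfolding torus_identification_def chain_path_def P_def by auto
   also have "\<dots> = hom_class n (path_vector n C s)" unfolding P_def by (rule path_vector_pgl[OF C s(2), symmetric])
   finally have i: "\<iota> (chain_class n (chain_path C s)) = hom_class n (path_vector n C s)" .
   have "hom_class n (path_vector n C s) \<in> hom_chart_set n tau"
    using ar(2) s(1) i by (auto simp: U_def V_def)
   then have nz: "\<forall>k\<in>{1..<n}. path_vector n C s (tau k) \<noteq> 0"
    unfolding hom_chart_set_iff[OF path_vector_hom(1)[OF C] tau(1)] .
   have "poly a s / poly r s = path_vector n C s q / path_vector n C s (tau (card (fst q)))"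
    using ar(2)[rule_format, OF s(1)] hom_chart_coord_eq[OF path_vector_hom(1)[OF C] tau(1), of s q] i
    unfolding h_def by simp
   then have quot: "poly a s / poly r s = poly p s / poly p' s" using p p' by simp
   show "poly (p * r - a * p') s = 0"
   proof (cases "q \<in> hom_indices n")
    case True
    then have "card (fst q) \<in> {1..<n}" using minor_indices_card by blast
    then have "poly p' s \<noteq> 0" using nz p' by metis
    then show ?thesis using quot s(1) by (simp add: divide_simps mult.commute)
   next
    case False
    then have "poly p s = 0" using hom_vectors_zero[OF path_vector_hom(1)[OF C] False, of s] p by simp
    moreover have "poly a s = 0" using quot calculation s(1) by simp
    ultimately show ?thesis by simp
   qed
  qed
  then have "poly (p * r - a * p') 0 = 0" by simp
  then have "poly p 0 * poly r 0 = poly a 0 * poly p' 0" by simp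
  moreover have "x q = poly a 0 / poly r 0"
   using ar(2)[rule_format, OF ar(1)] by (simp add: h_def x_def)
  ultimately have "poly p 0 * poly r 0 = (x q * poly p' 0) * poly r 0" using ar(1) by simp
  then have "poly p 0 = x q * poly p' 0" using ar(1) mult_right_cancel by blast
  then show ?thesis using p p' by simp
 qed
 have nz: "path_vector n C 0 (tau k) \<noteq> 0" if k: "k \<in> {1..<n}" for k
 proof -
  obtain q where "q \<in> minor_indices n k" "path_vector n C 0 q \<noteq> 0"
   using path_vector_hom(1)[OF C, of 0] k unfolding hom_vectors_def by blast
  then show ?thesis using rel[of q] minor_indices_card[of q n k] by auto
 qed
 have "(x, path_vector n C 0) \<in> hom_equiv n"
 proof (rule hom_equivI[where s = "\<lambda>k. path_vector n C 0 (tau k)"])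
  fix k q assume "q \<in> minor_indices n k"
  then show "path_vector n C 0 q = path_vector n C 0 (tau k) * x q"
   using rel[of q] minor_indices_card[of q n k] by simp
 qed (use x_hom path_vector_hom(1)[OF C] nz in auto)
 from hom_class_eqI[OF this] show ?thesis using x_hom(2) by simp
qed

section \<open>The line bundles of the levels\<close>

definition frame_of :: "nat => collineation set => nat => nat set \<times> nat set" where
 "frame_of n P = (SOME tau. frame n tau \<and> P \<in> hom_chart_set n tau)"

lemma frame_of:
 assumes "P \<in> points (wonderful n)"
 shows "frame n (frame_of n P)" "P \<in> hom_chart_set n (frame_of n P)"
proof -
 obtain A where A: "A \<in> hom_vectors n" "P = hom_class n A"
  using wonderful_points_hom[OF assms] by (rule hom_quotientE)
 obtain tau where tau: "frame n tau" "\<forall>k\<in>{1..<n}. A (tau k) \<noteq> 0" by (rule ex_frame[OF A(1)])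
 then have "P \<in> hom_chart_set n tau" unfolding A(2) hom_chart_set_iff[OF A(1) tau(1)] by blast
 with tau(1) have "\<exists>tau. frame n tau \<and> P \<in> hom_chart_set n tau" by blast
 from someI_ex[OF this] show "frame n (frame_of n P)" "P \<in> hom_chart_set n (frame_of n P)"
  by (simp_all add: frame_of_def)
qed

text \<open>The pullback of \<open>\<O>(1)\<close> from the projective space of level \<open>k\<close>.\<close>

definition level_bundle :: "nat => nat => collineation set cocycle" where
 "level_bundle n k = (\<lambda>P. hom_chart_set n (frame_of n P) \<inter> points (wonderful n),
   \<lambda>P Q t. hom_chart_coord (frame_of n P) t (frame_of n Q k))"

lemma fst_level_bundle [simp]:
  "fst (level_bundle n k) = (\<lambda>P. hom_chart_set n (frame_of n P) \<inter> points (wonderful n))"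
 and snd_level_bundle: "snd (level_bundle n k) = (\<lambda>P Q t. hom_chart_coord (frame_of n P) t (frame_of n Q k))"
 by (simp_all add: level_bundle_def)

lemma frame_card: "frame n tau ==> k \<in> {1..<n} ==> card (fst (tau k)) = k"
 unfolding frame_def by (blast intro: minor_indices_card)

lemma level_bundle_value:
 assumes A: "A \<in> hom_vectors n" and P: "P \<in> points (wonderful n)" and Q: "Q \<in> points (wonderful n)"
  and k: "k \<in> {1..<n}"
 shows "snd (level_bundle n k) P Q (hom_class n A) = A (frame_of n Q k) / A (frame_of n P k)"
 unfolding snd_level_bundle hom_chart_coord_eq[OF A frame_of(1)[OF P]] frame_card[OF frame_of(1)[OF Q] k] ..

lemma level_line_bundle:
 assumes k: "k \<in> {1..<n}"
 shows "level_bundle n k \<in> line_bundles (wonderful n)"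
proof (rule line_bundlesI)
 fix P assume P: "P \<in> points (wonderful n)"
 show "openin (vtop (wonderful n)) (fst (level_bundle n k) P)" "P \<in> fst (level_bundle n k) P"
  using wonderful_chart_open[OF frame_of(1)[OF P]] frame_of(2)[OF P] P by simp_all
next
 fix P Q assume P: "P \<in> points (wonderful n)" and Q: "Q \<in> points (wonderful n)"
 let ?V = "fst (level_bundle n k) P \<inter> fst (level_bundle n k) Q"
 have "snd (level_bundle n k) P Q \<in> vreg (wonderful n) ?V"
  by (rule wonderful_coord_regular[OF frame_of(1)[OF P] polyfuns.coord[of "frame_of n Q k"]])
    (auto simp: snd_level_bundle)
 moreover have "snd (level_bundle n k) P Q t \<noteq> 0" if t: "t \<in> ?V" for t
 proof -
  obtain A where A: "A \<in> hom_vectors n" "t = hom_class n A"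
   using t wonderful_points_hom[of t n] by (auto elim: hom_quotientE)
  have "A (frame_of n P k) \<noteq> 0" "A (frame_of n Q k) \<noteq> 0"
   using t k hom_chart_set_iff[OF A(1) frame_of(1)[OF P]] hom_chart_set_iff[OF A(1) frame_of(1)[OF Q]]
   unfolding A(2) by auto
  then show ?thesis unfolding A(2) level_bundle_value[OF A(1) P Q k] by simp
 qed
 ultimately show "snd (level_bundle n k) P Q \<in> unit_functions (wonderful n) ?V" by (simp add: unit_functions_def)
next
 fix P Q R t assume P: "P \<in> points (wonderful n)" and Q: "Q \<in> points (wonderful n)"
  and R: "R \<in> points (wonderful n)" and t: "t \<in> fst (level_bundle n k) P" "t \<in> fst (level_bundle n k) Q"
 obtain A where A: "A \<in> hom_vectors n" "t = hom_class n A"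
  using t wonderful_points_hom[of t n] by (auto elim: hom_quotientE)
 have "A (frame_of n Q k) \<noteq> 0"
  using t k hom_chart_set_iff[OF A(1) frame_of(1)[OF Q]] unfolding A(2) by auto
 then show "snd (level_bundle n k) P Q t * snd (level_bundle n k) Q R t = snd (level_bundle n k) P R t"
  unfolding A(2) level_bundle_value[OF A(1) P Q k] level_bundle_value[OF A(1) Q R k]
   level_bundle_value[OF A(1) P R k] by simp
qed

text \<open>Along \<open>w\<close> the components increase, so the last \<open>n - a\<close> points
  have the largest ones: exchanging the points outside this set for those inside never lowers the
  sum. This is why level \<open>n - a\<close> sees the complement of the first \<open>a\<close>
  points.\<close>

lemma chamber_top_sum:
 assumes C: "C \<in> marked_chains n" and w: "w permutes {..<n}" and ch: "chain_class n C \<in> chamber_set n w"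
  and a: "a < n"
 shows "card ({..<n} - w ` {..<a}) = n - a"
  and "top_sum n C (n - a) = component_sum C ({..<n} - w ` {..<a})"
proof -
 define T where "T = {..<n} - w ` {..<a}"
 note wn = permutes_less[OF w]
 have "card (w ` {..<a}) = a" using card_image[OF inj_on_subset[OF permutes_inj[OF w] subset_UNIV], of "{..<a}"] by simp
 moreover have "w ` {..<a} \<subseteq> {..<n}" using wn a by auto
 ultimately show cT: "card ({..<n} - w ` {..<a}) = n - a" by (simp add: card_Diff_subset)
 have low: "component C x \<le> component C (w a)" if "x < n" "x \<notin> T" for x
 proof -
  from that obtain l where "l < a" "x = w l" by (auto simp: T_def)
  then show ?thesis using chamber_mono[OF C w ch, of l a] a by simp
 qed
 have high: "component C (w a) \<le> component C x" if "x \<in> T" for x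
 proof -
  obtain l where l: "x = w l" using permutes_surj[OF w] by (meson surjD)
  have "l < n" using that l permutes_in_image[OF w, of l] by (simp add: T_def)
  moreover have "a \<le> l" using that l unfolding T_def by (meson DiffD2 imageI lessThan_iff not_less)
  ultimately show ?thesis using chamber_mono[OF C w ch, of a l] l by simp
 qed
 show "top_sum n C (n - a) = component_sum C ({..<n} - w ` {..<a})"
 proof (rule top_sumI[OF _ cT])
  fix K assume K: "K \<subseteq> {..<n}" "card K = n - a"
  have fin: "finite K" "finite T" using K finite_subset by (auto simp: T_def)
  have "card (K - T) = card (T - K)"
   using K(2) cT card_Diff_subset_Int[of K T] card_Diff_subset_Int[of T K] fin by (simp add: T_def Int_commute)
  have "(\<Sum>x\<in>K - T. component C x) \<le> card (K - T) * component C (w a)"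
   using sum_bounded_above[of "K - T" "component C" "component C (w a)"] low K(1) by auto
  also have "\<dots> = card (T - K) * component C (w a)" using \<open>card (K - T) = card (T - K)\<close> by simp
  also have "\<dots> \<le> (\<Sum>x\<in>T - K. component C x)"
   using sum_bounded_below[of "T - K" "component C (w a)" "component C"] high by auto
  finally have "(\<Sum>x\<in>K - T. component C x) + (\<Sum>x\<in>K \<inter> T. component C x) \<le>
    (\<Sum>x\<in>T - K. component C x) + (\<Sum>x\<in>K \<inter> T. component C x)" by simp
  moreover have "component_sum C K = (\<Sum>x\<in>K - T. component C x) + (\<Sum>x\<in>K \<inter> T. component C x)"
   unfolding component_sum_def using sum.Int_Diff[OF fin(1), of "component C" T] by simp
  moreover have "component_sum C T = (\<Sum>x\<in>T - K. component C x) + (\<Sum>x\<in>K \<inter> T. component C x)"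
   unfolding component_sum_def using sum.Int_Diff[OF fin(2), of "component C" K] by (simp add: Int_commute)
  ultimately show "component_sum C K \<le> component_sum C ({..<n} - w ` {..<a})" by (simp add: T_def)
 qed auto
qed

lemma path_vector_top:
 assumes C: "C \<in> marked_chains n" and w: "w permutes {..<n}" and ch: "chain_class n C \<in> chamber_set n w"
  and a: "1 \<le> a" "a < n"
 shows "path_vector n C 0 ({..<n} - w ` {..<a}, {..<n} - w ` {..<a}) = (\<Prod>i\<in>{..<n} - w ` {..<a}. pos C i)"
 using chamber_top_sum[OF C w ch a(2)] a by (simp add: path_vector_def diag_family_def)

text \<open>Over the chart of \<open>w\<close> the coordinate of level \<open>n - a\<close> at the
  complement of the first \<open>a\<close> points is nowhere zero and trivialises the pullback. Its
  value is the product of all positions divided by that of the first \<open>a\<close>; the total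
  product cancels between charts, leaving the transition functions of
  \<open>G_class n a\<close>.\<close>

lemma pullback_level_bundle:
 assumes \<iota>: "torus_identification n \<iota>" and a: "1 \<le> a" "a < n"
 shows "pullback_class (LM n) \<iota> (bundle_class (wonderful n) (level_bundle n (n - a))) = G_class n a"
proof -
 interpret function_variety "LM n" by (rule function_variety_LM)
 note mor = torus_identification_morphism[OF \<iota>]
 define k where "k = n - a"
 have k: "k \<in> {1..<n}" using a by (auto simp: k_def)
 note lb = level_line_bundle[OF k]
 define chi :: "(nat => nat) => nat => int" where "chi = (\<lambda>w i. of_bool (i \<in> w ` {..<a}))"
 have chi: "toric_data n chi" unfolding chi_def by (rule G_class_toric(2)[OF a])
 define w where "w = chamber_of n"
 define T where "T = (\<lambda>P. {..<n} - w P ` {..<a})"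
 define tau where "tau = (\<lambda>P. frame_of n (\<iota> P))"
 \<comment> \<open>The bundle is trivialised by the frame of \<iota> \<open>P\<close>, whose entry
   at level \<open>k\<close> need not be \<open>T P\<close>; this quotient of the two coordinates
   corrects the difference.\<close>
 define f where "f = (\<lambda>P x. hom_chart_coord (tau P) x (T P, T P))"
 define V where "V = (\<lambda>P. {x \<in> hom_chart_set n (tau P) \<inter> points (wonderful n). f P x \<noteq> 0})"
 define W where "W = (\<lambda>P. {t \<in> points (LM n). \<iota> t \<in> V P} \<inter> chamber_set n (w P))"
 have w: "w P permutes {..<n}" "P \<in> chamber_set n (w P)" if "P \<in> points (LM n)" for P
  using chamber_of[OF that] by (simp_all add: w_def)
 have \<iota>P: "\<iota> P \<in> points (wonderful n)" if "P \<in> points (LM n)" for P by (rule morphism_points[OF mor that])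
 have tau: "frame n (tau P)" "\<iota> P \<in> hom_chart_set n (tau P)" if "P \<in> points (LM n)" for P
  using frame_of[OF \<iota>P[OF that]] by (simp_all add: tau_def)
 have \<iota>t: "\<iota> t = hom_class n (path_vector n (chain_rep t) 0)" "chain_rep t \<in> marked_chains n"
  "chain_class n (chain_rep t) = t" if "t \<in> points (LM n)" for t
  using torus_identification_class[OF \<iota>, of "chain_rep t"] chain_rep[of t n] that by (simp_all add: points_LM)
 have T_prod: "path_vector n (chain_rep t) 0 (T P, T P) = (\<Prod>i\<in>T P. pos (chain_rep t) i)"
  if "P \<in> points (LM n)" "t \<in> points (LM n)" "t \<in> chamber_set n (w P)" for P t
  unfolding T_def using path_vector_top[OF \<iota>t(2)[OF that(2)] w(1)[OF that(1)] _ a] \<iota>t(3)[OF that(2)] that(3) by simp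
 have T_nz: "(\<Prod>i\<in>T P. pos (chain_rep t) i) \<noteq> 0" if "t \<in> points (LM n)" for P t
  using pos_nonzero[OF \<iota>t(2)[OF that]] by (auto simp: T_def)
 have cT: "card (T P) = k" if "P \<in> points (LM n)" for P
  unfolding T_def k_def
  using chamber_top_sum(1)[OF \<iota>t(2)[OF that] w(1)[OF that] _ a(2)] \<iota>t(3)[OF that] w(2)[OF that] by simp
 have f_eq: "f P (\<iota> t) = (\<Prod>i\<in>T P. pos (chain_rep t) i) / path_vector n (chain_rep t) 0 (tau P k)"
  if "P \<in> points (LM n)" "t \<in> points (LM n)" "t \<in> chamber_set n (w P)" for P t
  unfolding f_def \<iota>t(1)[OF that(2)] hom_chart_coord_eq[OF path_vector_hom(1)[OF \<iota>t(2)[OF that(2)]] tau(1)[OF that(1)]]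
  using T_prod[OF that] cT[OF that(1)] by simp
 have V: "openin (vtop (wonderful n)) (V P)" "f P \<in> unit_functions (wonderful n) (V P)" if "P \<in> points (LM n)" for P
 proof -
  interpret w: function_variety "wonderful n" by (rule function_variety_wonderful)
  have r: "f P \<in> vreg (wonderful n) (hom_chart_set n (tau P) \<inter> points (wonderful n))"
   by (rule wonderful_coord_regular[OF tau(1)[OF that] polyfuns.coord[of "(T P, T P)"]]) (auto simp: f_def)
  show "openin (vtop (wonderful n)) (V P)" unfolding V_def
   by (rule w.reg_nonzero_open[OF wonderful_chart_open[OF tau(1)[OF that]] r])
  show "f P \<in> unit_functions (wonderful n) (V P)"
   unfolding unit_functions_def using w.reg_subset[OF r, of "V P"] by (auto simp: V_def)
 qed
 have "(pullback_cocycle (LM n) \<iota> (level_bundle n k), toric_bundle n chi) \<in> bundle_iso (LM n)"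
 proof (rule bundle_isoI[of _ _ _ W "\<lambda>P t. f P (\<iota> t)"])
  show "pullback_cocycle (LM n) \<iota> (level_bundle n k) \<in> line_bundles (LM n)"
   by (rule pullback_line_bundle[OF function_variety_LM mor lb])
  show "toric_bundle n chi \<in> line_bundles (LM n)" by (rule toric_line_bundle[OF chi])
 next
  fix P assume P: "P \<in> points (LM n)"
  show "openin (vtop (LM n)) (W P)"
   unfolding W_def by (intro openin_Int morphism_open[OF mor V(1)[OF P]] chamber_open w(1)[OF P])
  have "path_vector n (chain_rep P) 0 (tau P k) \<noteq> 0"
   using tau(2)[OF P] k hom_chart_set_iff[OF path_vector_hom(1)[OF \<iota>t(2)[OF P]] tau(1)[OF P]]
   unfolding \<iota>t(1)[OF P] by blast
  then have "f P (\<iota> P) \<noteq> 0" using f_eq[OF P P w(2)[OF P]] T_nz[OF P] by simp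
  then show "P \<in> W P" using P w(2)[OF P] tau(2)[OF P] \<iota>P[OF P] by (simp add: W_def V_def)
  show "W P \<subseteq> fst (pullback_cocycle (LM n) \<iota> (level_bundle n k)) P \<inter> fst (toric_bundle n chi) P"
   by (auto simp: W_def V_def tau_def w_def)
  show "(\<lambda>t. f P (\<iota> t)) \<in> unit_functions (LM n) (W P)"
   using morphism_unit[OF mor V[OF P]] by (rule unit_subset) (auto simp: W_def)
 next
  fix P Q t assume P: "P \<in> points (LM n)" and Q: "Q \<in> points (LM n)" and t: "t \<in> W P" "t \<in> W Q"
  have tp: "t \<in> points (LM n)" "t \<in> chamber_set n (w P)" "t \<in> chamber_set n (w Q)" using t by (simp_all add: W_def)
  define C where "C = chain_rep t"
  define A where "A = path_vector n C 0"
  have C: "C \<in> marked_chains n" using \<iota>t(2)[OF tp(1)] by (simp add: C_def)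
  have A: "A \<in> hom_vectors n" unfolding A_def by (rule path_vector_hom(1)[OF C])
  have tA: "\<iota> t = hom_class n A" using \<iota>t(1)[OF tp(1)] by (simp add: A_def C_def)
  have "\<iota> t \<in> hom_chart_set n (tau P)" "\<iota> t \<in> hom_chart_set n (tau Q)" using t unfolding W_def V_def by blast+
  then have nz: "A (tau P k) \<noteq> 0" "A (tau Q k) \<noteq> 0"
   unfolding tA hom_chart_set_iff[OF A tau(1)[OF P]] hom_chart_set_iff[OF A tau(1)[OF Q]] using k by blast+
  have g: "snd (pullback_cocycle (LM n) \<iota> (level_bundle n k)) P Q t = A (tau Q k) / A (tau P k)"
   using level_bundle_value[OF A \<iota>P[OF P] \<iota>P[OF Q] k] by (simp add: tA tau_def)
  have split: "(\<Prod>i\<in>w R ` {..<a}. pos C i) * (\<Prod>i\<in>T R. pos C i) = (\<Prod>i<n. pos C i)"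
   if "R \<in> points (LM n)" for R
  proof -
   have "w R l < n" if "l < n" for l using permutes_in_image[OF w(1)[OF \<open>R \<in> points (LM n)\<close>], of l] that by simp
   then have "w R ` {..<a} \<subseteq> {..<n}" using a by auto
   then show ?thesis unfolding T_def by (subst prod.subset_diff[of "w R ` {..<a}" "{..<n}"]) (auto simp: mult.commute)
  qed
  have chi: "chain_monomial n (chi (w R)) C = (\<Prod>i\<in>w R ` {..<a}. pos C i)" if "R \<in> points (LM n)" for R
   unfolding chi_def
  proof (rule chain_monomial_indicator)
   have "w R l < n" if "l < n" for l using permutes_in_image[OF w(1)[OF \<open>R \<in> points (LM n)\<close>], of l] that by simp
   then show "w R ` {..<a} \<subseteq> {..<n}" using a by auto
  qed
  have h: "snd (toric_bundle n chi) P Q t = (\<Prod>i\<in>w P ` {..<a}. pos C i) / (\<Prod>i\<in>w Q ` {..<a}. pos C i)"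
   unfolding snd_toric_bundle C_def[symmetric] w_def[symmetric] chain_monomial_diff[OF C] chi[OF P] chi[OF Q] ..
  have nzw: "(\<Prod>i\<in>w Q ` {..<a}. pos C i) \<noteq> 0"
   using chain_monomial_nonzero[OF C, of "chi (w Q)"] unfolding chi[OF Q] .
  have "(\<Prod>i\<in>T Q. pos C i) * (\<Prod>i\<in>w Q ` {..<a}. pos C i) = (\<Prod>i\<in>T P. pos C i) * (\<Prod>i\<in>w P ` {..<a}. pos C i)"
   using split[OF P] split[OF Q] by (simp add: mult.commute)
  then have "(\<Prod>i\<in>T Q. pos C i) = (\<Prod>i\<in>T P. pos C i) * ((\<Prod>i\<in>w P ` {..<a}. pos C i) / (\<Prod>i\<in>w Q ` {..<a}. pos C i))"
   using nzw by (simp add: field_simps)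
  then show "snd (pullback_cocycle (LM n) \<iota> (level_bundle n k)) P Q t * f Q (\<iota> t) =
    f P (\<iota> t) * snd (toric_bundle n chi) P Q t"
   unfolding g h f_eq[OF P tp(1,2)] f_eq[OF Q tp(1,3)] C_def[symmetric] A_def[symmetric]
   using nz by simp
 qed
 from bundle_class_eqI[OF this] show ?thesis
  unfolding G_class_toric(1)[OF a] chi_def[symmetric] k_def[symmetric]
   pullback_bundle_class[OF function_variety_wonderful function_variety_LM mor lb] .
qed

section \<open>Degrees along rational curves\<close>

text \<open>A rational function without zeros and poles is constant.\<close>

lemma poly_proportional:
 fixes a r :: "complex poly"
 assumes "a \<noteq> 0" "r \<noteq> 0"
  and "\<And>z. \<exists>b s. poly b z \<noteq> 0 \<and> poly s z \<noteq> 0 \<and> a * s = b * r"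
 shows "\<exists>c. c \<noteq> 0 \<and> a = smult c r"
 using assms
proof (induction "degree r" arbitrary: a r rule: less_induct)
 case less
 have root: "poly a z = 0 \<longleftrightarrow> poly r z = 0" for z
 proof -
  obtain b s where bs: "poly b z \<noteq> 0" "poly s z \<noteq> 0" "a * s = b * r" using less.prems(3) by blast
  then have "poly a z * poly s z = poly b z * poly r z" by (metis poly_mult)
  then show ?thesis using bs(1,2) by auto
 qed
 show ?case
 proof (cases "\<exists>z. poly r z = 0")
  case True
  then obtain z where z: "poly r z = 0" by blast
  then obtain r' where r': "r = [:- z, 1:] * r'" unfolding poly_eq_0_iff_dvd by (elim dvdE)
  from z root obtain a' where a': "a = [:- z, 1:] * a'" unfolding poly_eq_0_iff_dvd by (blast elim: dvdE)
  have nz: "a' \<noteq> 0" "r' \<noteq> 0" using less.prems(1,2) a' r' by auto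
  have "degree r = Suc (degree r')" unfolding r' using nz by (subst degree_mult_eq) auto
  then have "degree r' < degree r" by simp
  moreover have "\<exists>b s. poly b y \<noteq> 0 \<and> poly s y \<noteq> 0 \<and> a' * s = b * r'" for y
  proof -
   obtain b s where bs: "poly b y \<noteq> 0" "poly s y \<noteq> 0" "a * s = b * r" using less.prems(3) by blast
   have "[:- z, 1:] * (a' * s) = [:- z, 1:] * (b * r')"
    using bs(3) unfolding a' r' by (simp only: mult.assoc mult.left_commute)
   then have "a' * s = b * r'" by (subst (asm) mult_left_cancel) auto
   with bs show ?thesis by blast
  qed
  ultimately obtain c where "c \<noteq> 0" "a' = smult c r'" using less.hyps[OF _ nz] by blast
  then show ?thesis unfolding a' r' by (intro exI[of _ c]) simp
 next
  case False
  have const: "degree q = 0" if "\<forall>z. poly q z \<noteq> 0" for q :: "complex poly"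
   using fundamental_theorem_of_algebra[of q] that by (auto simp: constant_degree)
  have "degree r = 0" "degree a = 0" using const False root by auto
  then obtain c c' where "r = [:c:]" "a = [:c':]" by (meson degree_eq_zeroE)
  with less.prems(1,2) show ?thesis by (intro exI[of _ "c' / c"]) auto
 qed
qed

text \<open>Rational functions that are regular and nonzero at \<open>t0\<close>; the values at the zeros of the
 auxiliary polynomial \<open>w\<close> do not matter.\<close>

definition unit_at :: "complex poly => complex => (complex => complex) => bool" where
 "unit_at w t0 f \<longleftrightarrow> (\<exists>a r. poly a t0 \<noteq> 0 \<and> poly r t0 \<noteq> 0 \<and>
   (\<forall>t. poly w t \<noteq> 0 --> poly r t \<noteq> 0 --> f t = poly a t / poly r t))"

lemma unit_atI:
 assumes "poly a t0 \<noteq> 0" "poly r t0 \<noteq> 0"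
  and "\<And>t. poly w t \<noteq> 0 ==> poly r t \<noteq> 0 ==> f t = poly a t / poly r t"
 shows "unit_at w t0 f"
 unfolding unit_at_def using assms by blast

lemma unit_atE:
 assumes "unit_at w t0 f"
 obtains a r where "poly a t0 \<noteq> 0" "poly r t0 \<noteq> 0"
  "\<forall>t. poly w t \<noteq> 0 --> poly r t \<noteq> 0 --> f t = poly a t / poly r t"
 using assms unfolding unit_at_def by blast

lemma unit_at_mult:
 assumes "unit_at w t0 f" "unit_at w t0 g"
 shows "unit_at w t0 (\<lambda>t. f t * g t)"
proof -
 obtain a r where ar: "poly a t0 \<noteq> 0" "poly r t0 \<noteq> 0"
  "\<forall>t. poly w t \<noteq> 0 --> poly r t \<noteq> 0 --> f t = poly a t / poly r t" by (rule unit_atE[OF assms(1)])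
 obtain b s where bs: "poly b t0 \<noteq> 0" "poly s t0 \<noteq> 0"
  "\<forall>t. poly w t \<noteq> 0 --> poly s t \<noteq> 0 --> g t = poly b t / poly s t" by (rule unit_atE[OF assms(2)])
 show ?thesis by (rule unit_atI[of "a * b" _ "r * s"]) (use ar bs in simp_all)
qed

lemma unit_at_inverse:
 assumes "unit_at w t0 f"
 shows "unit_at w t0 (\<lambda>t. inverse (f t))"
proof -
 obtain a r where ar: "poly a t0 \<noteq> 0" "poly r t0 \<noteq> 0"
  "\<forall>t. poly w t \<noteq> 0 --> poly r t \<noteq> 0 --> f t = poly a t / poly r t" by (rule unit_atE[OF assms])
 show ?thesis
 proof (rule unit_atI[of "r * r" _ "a * r"])
  fix t assume "poly w t \<noteq> 0" "poly (a * r) t \<noteq> 0"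
  then show "inverse (f t) = poly (r * r) t / poly (a * r) t" using ar(3) by simp
 qed (use ar in simp_all)
qed

lemma unit_at_cong:
 assumes "unit_at w t0 f" "\<And>t. poly w t \<noteq> 0 ==> f t = g t"
 shows "unit_at w t0 g"
 using assms unfolding unit_at_def by metis

lemma unit_at_near:
 assumes "unit_at w t0 f" "poly q t0 \<noteq> 0" "\<And>t. poly w t \<noteq> 0 ==> poly q t \<noteq> 0 ==> f t = g t"
 shows "unit_at w t0 g"
proof -
 obtain a r where ar: "poly a t0 \<noteq> 0" "poly r t0 \<noteq> 0"
  "\<forall>t. poly w t \<noteq> 0 --> poly r t \<noteq> 0 --> f t = poly a t / poly r t" by (rule unit_atE[OF assms(1)])
 show ?thesis
 proof (rule unit_atI[of "a * q" _ "r * q"])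
  fix t assume "poly w t \<noteq> 0" "poly (r * q) t \<noteq> 0"
  then show "g t = poly (a * q) t / poly (r * q) t" using ar(3) assms(3)[of t] by simp
 qed (use ar assms(2) in simp_all)
qed

definition regular_path :: "'a variety => (complex => 'a) => bool" where
 "regular_path X gamma \<longleftrightarrow> (\<forall>t. gamma t \<in> points X) \<and>
   (\<forall>V h t0. openin (vtop X) V --> h \<in> vreg X V --> gamma t0 \<in> V -->
    (\<exists>a r. poly r t0 \<noteq> 0 \<and> (\<forall>t. poly r t \<noteq> 0 --> gamma t \<in> V \<and> h (gamma t) = poly a t / poly r t)))"

lemma regular_pathE:
 assumes "regular_path X gamma" "openin (vtop X) V" "h \<in> vreg X V" "gamma t0 \<in> V"
 obtains a r where "poly r t0 \<noteq> 0" "\<forall>t. poly r t \<noteq> 0 --> gamma t \<in> V \<and> h (gamma t) = poly a t / poly r t"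
 using assms unfolding regular_path_def by blast

lemma regular_path_unit:
 assumes "regular_path X gamma" "openin (vtop X) V" "h \<in> unit_functions X V" "gamma t0 \<in> V"
 shows "unit_at w t0 (\<lambda>t. h (gamma t))"
proof -
 have h: "h \<in> vreg X V" "h (gamma t0) \<noteq> 0" using assms(3,4) by (auto simp: unit_functions_def)
 obtain a r where ar: "poly r t0 \<noteq> 0" "\<forall>t. poly r t \<noteq> 0 --> gamma t \<in> V \<and> h (gamma t) = poly a t / poly r t"
  by (rule regular_pathE[OF assms(1,2) h(1) assms(4)])
 show ?thesis
 proof (rule unit_atI[of a _ r])
  show "poly a t0 \<noteq> 0" using h(2) ar by auto
 qed (use ar in simp_all)
qed

text \<open>A map \<open>gamma\<close> from the affine line, together with its expression \<open>gamma'\<close> in the coordinate at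
 infinity. Sections need only be controlled off the zeros of \<open>w\<close>.\<close>

locale rational_curve = function_variety X for X :: "'a variety" +
 fixes gamma gamma' :: "complex => 'a" and w :: "complex poly"
 assumes w_nonzero: "w \<noteq> 0"
  and curve: "regular_path X gamma"
  and curve': "regular_path X gamma'"
  and curve_infinity: "u \<noteq> 0 ==> gamma' u = gamma (1 / u)"
begin

text \<open>The polynomial \<open>w\<close> in the coordinate at infinity. The additional factor
  excludes the point at infinity itself, where \<open>1 / u\<close> has the default value 0.\<close>

definition w' :: "complex poly" where
 "w' = reflect_poly w * [:0, 1:]"

lemma w'_nonzero: "w' \<noteq> 0"
 using w_nonzero by (simp add: w'_def)

lemma poly_w': "poly w' u \<noteq> 0 \<longleftrightarrow> u \<noteq> 0 \<and> poly w (1 / u) \<noteq> 0"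
proof (cases "u = 0")
 case False
 then show ?thesis
  using poly_reflect_poly_nz[of "1 / u" w] poly_reflect_poly_nz[of u w]
  by (simp add: w'_def field_simps)
qed (simp add: w'_def)

lemma curve_point: "gamma t \<in> points X" and curve'_point: "gamma' t \<in> points X"
 using curve curve' by (simp_all add: regular_path_def)

lemma path_open:
 assumes "regular_path X \<delta>" "openin (vtop X) V" "\<delta> t0 \<in> V"
 obtains r where "poly r t0 \<noteq> 0" "\<forall>t. poly r t \<noteq> 0 --> \<delta> t \<in> V"
proof -
 have "(\<lambda>_. 1) \<in> vreg X V" by (rule reg_const[OF openin_subset[OF assms(2)]])
 from regular_pathE[OF assms(1,2) this assms(3)] that show thesis by metis
qed

text \<open>A trivialisation \<open>sigma\<close> of the bundle along the affine line, whose order at infinity is minus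
 the degree.\<close>

definition trivialises :: "'a cocycle => int => ('a => 'a set) => ('a => complex => complex) => bool" where
 "trivialises L d N sigma \<longleftrightarrow>
   (\<forall>x\<in>points X. openin (vtop X) (N x) \<and> x \<in> N x \<and> N x \<subseteq> fst L x) \<and>
   (\<forall>x\<in>points X. \<forall>y\<in>points X. \<forall>t. poly w t \<noteq> 0 --> gamma t \<in> N x --> gamma t \<in> N y -->
    sigma x t = snd L x y (gamma t) * sigma y t) \<and>
   (\<forall>t0. unit_at w t0 (sigma (gamma t0))) \<and>
   unit_at w' 0 (\<lambda>u. sigma (gamma' 0) (1 / u) * u powi (- d))"

lemma trivialisesD:
 assumes "trivialises L d N sigma"
 shows "\<forall>x\<in>points X. openin (vtop X) (N x) \<and> x \<in> N x \<and> N x \<subseteq> fst L x"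
  and "\<And>x y t. x \<in> points X ==> y \<in> points X ==> poly w t \<noteq> 0 ==> gamma t \<in> N x ==> gamma t \<in> N y ==>
   sigma x t = snd L x y (gamma t) * sigma y t"
  and "\<And>t0. unit_at w t0 (sigma (gamma t0))"
  and "unit_at w' 0 (\<lambda>u. sigma (gamma' 0) (1 / u) * u powi (- d))"
 using assms unfolding trivialises_def by blast+

definition has_degree :: "'a cocycle => int => bool" where
 "has_degree L d \<longleftrightarrow> (\<exists>N sigma. trivialises L d N sigma)"

lemma has_degreeI:
 assumes "\<And>x. x \<in> points X ==> openin (vtop X) (N x)" "\<And>x. x \<in> points X ==> x \<in> N x"
  and "\<And>x. x \<in> points X ==> N x \<subseteq> fst L x"
  and "\<And>x y t. x \<in> points X ==> y \<in> points X ==> poly w t \<noteq> 0 ==> gamma t \<in> N x ==> gamma t \<in> N y ==>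
    sigma x t = snd L x y (gamma t) * sigma y t"
  and "\<And>t0. unit_at w t0 (sigma (gamma t0))"
  and "unit_at w' 0 (\<lambda>u. sigma (gamma' 0) (1 / u) * u powi (- d))"
 shows "has_degree L d"
 unfolding has_degree_def trivialises_def
 using assms by (intro exI[of _ N] exI[of _ sigma] conjI ballI allI impI)

lemma degree_tensor:
 assumes L: "has_degree L d" and M: "has_degree M e"
 shows "has_degree (tensor L M) (d + e)"
proof -
 obtain N sigma where "trivialises L d N sigma" using L unfolding has_degree_def by blast
 note N = trivialisesD[OF this]
 obtain N' sigma' where "trivialises M e N' sigma'" using M unfolding has_degree_def by blast
 note N' = trivialisesD[OF this]
 show ?thesis
 proof (rule has_degreeI[where N = "\<lambda>x. N x \<inter> N' x" and sigma = "\<lambda>x t. sigma x t * sigma' x t"])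
  fix x y t assume "x \<in> points X" "y \<in> points X" "poly w t \<noteq> 0" "gamma t \<in> N x \<inter> N' x" "gamma t \<in> N y \<inter> N' y"
  then have "sigma x t = snd L x y (gamma t) * sigma y t" "sigma' x t = snd M x y (gamma t) * sigma' y t"
   using N(2) N'(2) by blast+
  then show "sigma x t * sigma' x t = snd (tensor L M) x y (gamma t) * (sigma y t * sigma' y t)"
   by (simp add: tensor_def mult_ac)
 next
  show "unit_at w' 0 (\<lambda>u. sigma (gamma' 0) (1 / u) * sigma' (gamma' 0) (1 / u) * u powi - (d + e))"
   by (rule unit_at_cong[OF unit_at_mult[OF N(4) N'(4)]])
     (auto simp: poly_w' power_int_add power_int_diff power_int_minus divide_simps)
 qed (use N(1,3) N'(1,3) in \<open>auto simp: tensor_def intro: unit_at_mult\<close>)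
qed

lemma degree_dual:
 assumes L: "has_degree L d"
 shows "has_degree (dual L) (- d)"
proof -
 obtain N sigma where "trivialises L d N sigma" using L unfolding has_degree_def by blast
 note N = trivialisesD[OF this]
 show ?thesis
 proof (rule has_degreeI[where N = N and sigma = "\<lambda>x t. inverse (sigma x t)"])
  fix x y t assume "x \<in> points X" "y \<in> points X" "poly w t \<noteq> 0" "gamma t \<in> N x" "gamma t \<in> N y"
  then have "sigma x t = snd L x y (gamma t) * sigma y t" using N(2) by blast
  then show "inverse (sigma x t) = snd (dual L) x y (gamma t) * inverse (sigma y t)"
   by (simp add: dual_def)
 next
  show "unit_at w' 0 (\<lambda>u. inverse (sigma (gamma' 0) (1 / u)) * u powi - (- d))"
   by (rule unit_at_cong[OF unit_at_inverse[OF N(4)]]) (simp add: power_int_minus)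
 qed (use N(1,3) in \<open>auto intro: unit_at_inverse\<close>)
qed

lemma degree_iso:
 assumes L: "has_degree L d" and iso: "(L, M) \<in> bundle_iso X"
 shows "has_degree M d"
proof -
 obtain N sigma where "trivialises L d N sigma" using L unfolding has_degree_def by blast
 note N = trivialisesD[OF this]
 obtain W a where "bundle_iso_by X L M W a" by (rule bundle_isoE[OF iso])
  note W = bundle_iso_byD[OF this]
 have a_unit: "unit_at v t0 (\<lambda>t. a (\<delta> t0) (\<delta> t))" if "regular_path X \<delta>" for v t0 \<delta>
  using W(1) that by (intro regular_path_unit[of X \<delta> "W (\<delta> t0)"]) (auto simp: regular_path_def)
 show ?thesis
 proof (rule has_degreeI[where N = "\<lambda>x. N x \<inter> W x" and sigma = "\<lambda>x t. sigma x t * inverse (a x (gamma t))"])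
  fix x y t assume x: "x \<in> points X" and y: "y \<in> points X" and t: "poly w t \<noteq> 0" "gamma t \<in> N x \<inter> W x" "gamma t \<in> N y \<inter> W y"
  have "a x (gamma t) \<noteq> 0" "a y (gamma t) \<noteq> 0" using W(1) x y t by (auto simp: unit_functions_def)
  moreover have "snd L x y (gamma t) * a y (gamma t) = a x (gamma t) * snd M x y (gamma t)" using W(2) x y t by blast
  ultimately have "snd L x y (gamma t) * inverse (a x (gamma t)) = snd M x y (gamma t) * inverse (a y (gamma t))"
   by (simp add: field_simps)
  moreover have "sigma x t = snd L x y (gamma t) * sigma y t" using N(2) x y t by blast
  ultimately show "sigma x t * inverse (a x (gamma t)) = snd M x y (gamma t) * (sigma y t * inverse (a y (gamma t)))"
   by (simp add: mult_ac)
 next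
  fix t0 show "unit_at w t0 (\<lambda>t. sigma (gamma t0) t * inverse (a (gamma t0) (gamma t)))"
   using N(3) by (intro unit_at_mult unit_at_inverse a_unit[OF curve]) blast
 next
  have "unit_at w' 0 (\<lambda>u. sigma (gamma' 0) (1 / u) * u powi - d * inverse (a (gamma' 0) (gamma' u)))"
   by (intro unit_at_mult unit_at_inverse a_unit[OF curve'] N(4))
  then show "unit_at w' 0 (\<lambda>u. sigma (gamma' 0) (1 / u) * inverse (a (gamma' 0) (gamma (1 / u))) * u powi - d)"
   by (rule unit_at_cong) (simp add: poly_w' curve_infinity)
 qed (use N(1) W(1) in auto)
qed

text \<open>With trivial transition functions the local trivialisations are one rational function
  without zeros and poles on the affine line, hence constant; a constant has order 0 at infinity.
  This gives uniqueness of degrees.\<close>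

lemma degree_trivial:
 assumes "has_degree (trivial_bundle X) d"
 shows "d = 0"
proof -
 obtain N sigma where "trivialises (trivial_bundle X) d N sigma"
  using assms unfolding has_degree_def by blast
 note N = trivialisesD[OF this]
 define h where "h = (\<lambda>t. sigma (gamma t) t)"
 have glue: "h t = sigma x t" if "x \<in> points X" "poly w t \<noteq> 0" "gamma t \<in> N x" for x t
 proof -
  have "gamma t \<in> N (gamma t)" using N(1) curve_point by blast
  from N(2)[OF curve_point that(1) that(2) this that(3)]
  show ?thesis by (simp add: h_def trivial_bundle_def)
 qed
 have unit: "unit_at w t0 h" for t0
 proof -
  have "openin (vtop X) (N (gamma t0))" "gamma t0 \<in> N (gamma t0)" using N(1) curve_point[of t0] by blast+
  then obtain q where q: "poly q t0 \<noteq> 0" "\<forall>t. poly q t \<noteq> 0 --> gamma t \<in> N (gamma t0)"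
   by (rule path_open[OF curve])
  show ?thesis
   by (rule unit_at_near[OF N(3)[of t0] q(1)])
     (rule glue[OF curve_point _ q(2)[rule_format], symmetric])
 qed
 obtain a r where ar: "poly a 0 \<noteq> 0" "poly r 0 \<noteq> 0"
  "\<forall>t. poly w t \<noteq> 0 --> poly r t \<noteq> 0 --> h t = poly a t / poly r t" by (rule unit_atE[OF unit[of 0]])
 have nz: "a \<noteq> 0" "r \<noteq> 0" using ar(1,2) by auto
 have "\<exists>b s. poly b z \<noteq> 0 \<and> poly s z \<noteq> 0 \<and> a * s = b * r" for z
 proof -
  obtain b s where bs: "poly b z \<noteq> 0" "poly s z \<noteq> 0"
   "\<forall>t. poly w t \<noteq> 0 --> poly s t \<noteq> 0 --> h t = poly b t / poly s t" by (rule unit_atE[OF unit[of z]])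
  have "a * s - b * r = 0"
  proof (rule poly_zero_off[of "w * (r * s)"])
   show "w * (r * s) \<noteq> 0" using w_nonzero nz bs(2) by auto
   fix t assume "poly (w * (r * s)) t \<noteq> 0"
   then have t: "poly w t \<noteq> 0" "poly r t \<noteq> 0" "poly s t \<noteq> 0" by auto
   then have "poly a t / poly r t = poly b t / poly s t" using ar(3) bs(3) by metis
   then show "poly (a * s - b * r) t = 0" using t by (simp add: field_simps)
  qed
  with bs(1,2) show ?thesis by (intro exI[of _ b] exI[of _ s]) simp
 qed
 from poly_proportional[OF nz this] obtain c where c: "c \<noteq> 0" "a = smult c r" by blast
 have hc: "h t = c" if "poly w t \<noteq> 0" "poly r t \<noteq> 0" for t using ar(3) that c(2) by simp
 obtain b s where bs: "poly b 0 \<noteq> 0" "poly s 0 \<noteq> 0"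
  "\<forall>u. poly w' u \<noteq> 0 --> poly s u \<noteq> 0 --> sigma (gamma' 0) (1 / u) * u powi (- d) = poly b u / poly s u"
  by (rule unit_atE[OF N(4)])
 have "openin (vtop X) (N (gamma' 0))" "gamma' 0 \<in> N (gamma' 0)" using N(1) curve'_point[of 0] by blast+
 then obtain q where q: "poly q 0 \<noteq> 0" "\<forall>u. poly q u \<noteq> 0 --> gamma' u \<in> N (gamma' 0)"
  by (rule path_open[OF curve'])
 define v where "v = w' * s * q * reflect_poly r"
 have v: "v \<noteq> 0" using w'_nonzero bs(2) q(1) nz(2) by (auto simp: v_def)
 \<comment> \<open>Comparison at infinity: both \<open>b\<close> and \<open>s\<close> are nonzero at
   0, so no power of \<open>u\<close> can remain.\<close>
 have eq: "c * poly s u = u powi d * poly b u" if "poly v u \<noteq> 0" for u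
 proof -
  have u: "poly w' u \<noteq> 0" "poly s u \<noteq> 0" "poly q u \<noteq> 0" "poly (reflect_poly r) u \<noteq> 0"
   using that by (auto simp: v_def)
  have u0: "u \<noteq> 0" and w: "poly w (1 / u) \<noteq> 0" using u(1) by (auto simp: poly_w')
  have "poly r (1 / u) \<noteq> 0"
   using u(4) u0 poly_reflect_poly_nz[of u r] by (simp add: divide_inverse)
  then have "c = h (1 / u)" using hc w by simp
  also have "\<dots> = sigma (gamma' 0) (1 / u)"
   using q(2)[rule_format, OF u(3)] unfolding curve_infinity[OF u0] by (rule glue[OF curve'_point w])
  finally have "c * u powi (- d) = poly b u / poly s u" using bs(3) u by simp
  then show ?thesis using u0 u(2) by (simp add: power_int_minus field_simps)
 qed
 show ?thesis
 proof (rule ccontr)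
  assume "d \<noteq> 0"
  then consider "d > 0" | "d < 0" by linarith
  then show False
  proof cases
   case 1
   then obtain m where m: "d = int m" "m > 0" by (metis zero_less_imp_eq_int)
   have "smult c s - monom 1 m * b = 0"
    by (rule poly_zero_off[OF _ v]) (use eq m in \<open>simp add: poly_monom\<close>)
   then have "poly (smult c s - monom 1 m * b) 0 = 0" by simp
   then show False using c(1) bs(2) m by (simp add: poly_monom power_0_left)
  next
   case 2
   then obtain m where m: "- d = int m" "m > 0" by (metis zero_less_imp_eq_int neg_0_less_iff_less)
   then have d: "d = - int m" by simp
   have "smult c (monom 1 m * s) - b = 0"
   proof (rule poly_zero_off[OF _ v])
    fix u assume u: "poly v u \<noteq> 0"
    then have "u \<noteq> 0" by (auto simp: v_def poly_w')
    then show "poly (smult c (monom 1 m * s) - b) u = 0"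
     using eq[OF u] by (simp add: d poly_monom power_int_minus field_simps)
   qed
   then have "poly (smult c (monom 1 m * s) - b) 0 = 0" by simp
   then show False using bs(1) m by (simp add: poly_monom power_0_left)
  qed
 qed
qed

text \<open>A relation instead of a function: degrees are exhibited for the bundles at hand by
  explicit trivialisations, and uniqueness is proved separately.\<close>

definition class_degree :: "'a cocycle set => int => bool" where
 "class_degree c d \<longleftrightarrow> (\<exists>L\<in>line_bundles X. c = bundle_class X L \<and> has_degree L d)"

lemma class_degree_carrier: "class_degree c d ==> c \<in> carrier (Pic X)"
 by (auto simp: class_degree_def Pic_carrierI)

lemma class_degree_mult:
 assumes "class_degree c d" "class_degree c' d'"
 shows "class_degree (c \<otimes>\<^bsub>Pic X\<^esub> c') (d + d')"
 using assms unfolding class_degree_def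
 by (metis Pic_mult tensor_line_bundle degree_tensor)

lemma class_degree_inv:
 assumes "class_degree c d"
 shows "class_degree (inv\<^bsub>Pic X\<^esub> c) (- d)"
 using assms unfolding class_degree_def
 by (metis Pic_inv dual_line_bundle degree_dual)

lemma class_degree_one:
 assumes "class_degree \<one>\<^bsub>Pic X\<^esub> d"
 shows "d = 0"
proof -
 obtain L where L: "L \<in> line_bundles X" "\<one>\<^bsub>Pic X\<^esub> = bundle_class X L" "has_degree L d"
  using assms unfolding class_degree_def by blast
 have "(L, trivial_bundle X) \<in> bundle_iso X"
  using eq_equiv_class[OF L(2)[unfolded Pic_one, symmetric] equiv_bundle_iso trivial_line_bundle] .
 then show ?thesis using degree_iso[OF L(3)] degree_trivial by blast
qed

lemma class_degree_unique:
 assumes "class_degree c d" "class_degree c e"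
 shows "d = e"
proof -
 interpret Pic: comm_group "Pic X" by (rule Pic_comm_group)
 have "class_degree \<one>\<^bsub>Pic X\<^esub> (d + - e)"
  using class_degree_mult[OF assms(1) class_degree_inv[OF assms(2)]] class_degree_carrier[OF assms(1)] by simp
 from class_degree_one[OF this] show ?thesis by simp
qed

end

section \<open>Curves meeting a single boundary component\<close>

lemma regular_path_wonderful:
 assumes A: "\<And>q. \<exists>p. \<forall>t. A t q = poly p t" and hv: "\<And>t. A t \<in> hom_vectors n"
  and pts: "\<And>t. hom_class n (A t) \<in> points (wonderful n)"
 shows "regular_path (wonderful n) (\<lambda>t. hom_class n (A t))"
 unfolding regular_path_def
proof (intro conjI allI impI pts)
 fix V h t0 assume V: "openin (vtop (wonderful n)) V" "h \<in> vreg (wonderful n) V" "hom_class n (A t0) \<in> V"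
 have R: "(\<lambda>t. A t q) \<in> {poly p | p. True}" for q
  using A[of q] by (auto simp: fun_eq_iff)
 obtain a r where ar: "a \<in> {poly p | p. True}" "r \<in> {poly p | p. True}" "r t0 \<noteq> 0"
  "\<forall>t\<in>UNIV. r t \<noteq> 0 --> hom_class n (A t) \<in> V \<and> h (hom_class n (A t)) = a t / r t"
  by (rule wonderful_family_regular[OF func_ring_poly R _ _ _ V(1,3,2), of UNIV])
    (use hv pts in auto)
 then show "\<exists>a r. poly r t0 \<noteq> 0 \<and> (\<forall>t. poly r t \<noteq> 0 --> hom_class n (A t) \<in> V \<and>
   h (hom_class n (A t)) = poly a t / poly r t)" by auto
qed

text \<open>The compactification is closed, so a polynomial family leaving it at one parameter would
  leave it for almost all, against the assumption at the nonzeros of \<open>q\<close>.\<close>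

lemma wonderful_family_points:
 assumes A: "\<And>q. \<exists>p. \<forall>t. A t q = poly p t" and hv: "\<And>t. A t \<in> hom_vectors n"
  and q: "q \<noteq> 0" "\<And>t. poly q t \<noteq> 0 ==> hom_class n (A t) \<in> points (wonderful n)"
 shows "hom_class n (A t0) \<in> points (wonderful n)"
proof (rule ccontr)
 assume t0: "hom_class n (A t0) \<notin> points (wonderful n)"
 define V where "V = points (hom_product n) - points (wonderful n)"
 have V: "openin (vtop (hom_product n)) V"
  unfolding V_def points_wonderful by (intro openin_diff openin_topspace closedin_closure_of)
 have tV: "hom_class n (A t0) \<in> V"
  using t0 hom_class_quotient[OF hv, of t0] by (simp add: V_def points_hom_product)
 have R: "(\<lambda>t. A t q) \<in> {poly p | p. True}" for q
  using A[of q] by (auto simp: fun_eq_iff)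
 obtain r where r: "r \<in> {poly p | p. True}" "r t0 \<noteq> 0" "\<forall>t\<in>UNIV. r t \<noteq> 0 --> hom_class n (A t) \<in> V"
  by (rule hom_family_open[OF func_ring_poly R _ _ V tV, of UNIV]) (use hv in auto)
 then obtain p where p: "r = poly p" by blast
 have "q * p = 0"
 proof (rule poly_zero_off[of 1])
  fix t
  show "poly (q * p) t = 0"
   using q(2)[of t] r(3)[rule_format, of t] unfolding p V_def by (cases "poly q t = 0") auto
 qed simp
 then show False using q(1) r(2) p by auto
qed

text \<open>The cyclic interval of length \<open>i\<close> starting at \<open>j\<close>; adding
  \<open>n\<close> avoids truncated subtraction.\<close>

definition cyclic_block :: "nat => nat => nat => nat set" where
 "cyclic_block n i j = {l \<in> {..<n}. (l + n - j) mod n < i}"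

text \<open>The order of vanishing at the node \<open>j\<close> of the product of diagonal entries
  over \<open>I\<close>, less the order common to all subsets of that size. By inclusion and
  exclusion the common order is \<open>card I + i - n\<close>, truncated at 0 by natural
  subtraction.\<close>

definition curve_exponent :: "nat => nat => nat set => nat => nat" where
 "curve_exponent n i I j = card (I \<inter> cyclic_block n i j) - (card I + i - n)"

definition curve_vector :: "nat => nat => complex => collineation" where
 "curve_vector n i t = diag_family n (\<lambda>I. \<Prod>j<n. (t - of_nat j) ^ curve_exponent n i I j)"

definition infinity_vector :: "nat => nat => complex => collineation" where
 "infinity_vector n i u = diag_family n (\<lambda>I. \<Prod>j<n. (1 - of_nat j * u) ^ curve_exponent n i I j)"

definition curve_degree :: "nat => nat => nat => nat" where
 "curve_degree n i k = k * i - n * (k + i - n)"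

section \<open>Combinatorics of cyclic intervals\<close>

lemma card_less_image:
 assumes "inj_on f {..<n::nat}" "f ` {..<n} \<subseteq> {..<n}" "i \<le> (n::nat)"
 shows "card {x \<in> {..<n}. f x < i} = i"
proof -
 have surj: "f ` {..<n} = {..<n}" by (rule endo_inj_surj[OF _ assms(2,1)]) simp
 have "f ` {x \<in> {..<n}. f x < i} = {..<i}"
 proof
  show "{..<i} \<subseteq> f ` {x \<in> {..<n}. f x < i}"
  proof
   fix y assume y: "y \<in> {..<i}"
   then have "y \<in> f ` {..<n}" using assms(3) surj by auto
   then show "y \<in> f ` {x \<in> {..<n}. f x < i}" using y by auto
  qed
 qed auto
 moreover have "inj_on f {x \<in> {..<n}. f x < i}" by (rule inj_on_subset[OF assms(1)]) auto
 ultimately show ?thesis using card_image by fastforce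
qed

lemma rotation_eq: "l < n ==> j < n ==> (l + n - j) mod n = (if j \<le> l then l - j else l + n - (j::nat))"
 by (simp add: mod_if)

lemma rotation_inj:
 assumes "j < n"
 shows "inj_on (\<lambda>l. (l + n - j) mod n) {..<n::nat}"
 by (rule inj_onI) (use assms in \<open>auto simp: rotation_eq split: if_splits\<close>)

lemma rotation_inj':
 assumes "l < n"
 shows "inj_on (\<lambda>j. (l + n - j) mod n) {..<n::nat}"
 by (rule inj_onI) (use assms in \<open>auto simp: rotation_eq split: if_splits\<close>)

locale cyclic_curve =
 fixes n i :: nat
 assumes i: "i \<in> {1..<n}"
begin

abbreviation B :: "nat => nat set" where "B \<equiv> cyclic_block n i"

lemma block_subset: "B j \<subseteq> {..<n}"
 by (auto simp: cyclic_block_def)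

lemma block_card: "j < n ==> card (B j) = i"
 unfolding cyclic_block_def using i by (intro card_less_image rotation_inj) auto

lemma block_complement_card: "j < n ==> card ({..<n} - B j) = n - i"
 using card_Diff_subset[OF finite_subset[OF block_subset finite_lessThan] block_subset, of j] block_card[of j] by simp

text \<open>This even distribution gives all coordinates of one level the same degree, so at
  infinity every principal coordinate becomes 1: the point at infinity is the identity matrix and
  avoids the boundary.\<close>

lemma block_count:
 assumes l: "l < n"
 shows "card {j \<in> {..<n}. l \<in> B j} = i"
proof -
 have "card {j \<in> {..<n}. (l + n - j) mod n < i} = i"
  by (rule card_less_image[OF rotation_inj'[OF l]]) (use i in auto)
 then show ?thesis using l by (simp add: cyclic_block_def)
qed

lemma sum_block:
 assumes I: "I \<subseteq> {..<n}"
 shows "(\<Sum>j<n. card (I \<inter> B j)) = card I * i"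
proof -
 have fin: "finite I" using I finite_subset by blast
 have "(\<Sum>j<n. card (I \<inter> B j)) = (\<Sum>j<n. \<Sum>l\<in>I. if l \<in> B j then 1 else 0)"
  using fin by (simp add: sum.If_cases Int_def)
 also have "\<dots> = (\<Sum>l\<in>I. \<Sum>j<n. if l \<in> B j then 1 else 0)" by (rule sum.swap)
 also have "\<dots> = (\<Sum>l\<in>I. card {j \<in> {..<n}. l \<in> B j})"
  by (simp add: sum.If_cases Int_def)
 also have "\<dots> = (\<Sum>l\<in>I. i)" using block_count I by (intro sum.cong) auto
 finally show ?thesis by simp
qed

lemma block_lower:
 assumes I: "I \<subseteq> {..<n}" and j: "j < n"
 shows "card I + i - n \<le> card (I \<inter> B j)"
proof -
 have fin: "finite I" "finite (B j)"
  using finite_subset[OF I finite_lessThan] finite_subset[OF block_subset finite_lessThan] by simp_all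
 have "card (I \<union> B j) \<le> n" using card_mono[of "{..<n}" "I \<union> B j"] I block_subset by auto
 then show ?thesis using card_Un_Int[OF fin] block_card[OF j] by simp
qed

lemma sum_exponent:
 assumes I: "I \<subseteq> {..<n}"
 shows "(\<Sum>j<n. curve_exponent n i I j) = curve_degree n i (card I)"
proof -
 have "(\<Sum>j<n. curve_exponent n i I j) + n * (card I + i - n) = (\<Sum>j<n. card (I \<inter> B j))"
  unfolding curve_exponent_def
  using sum.distrib[of "\<lambda>j. card (I \<inter> B j) - (card I + i - n)" "\<lambda>_. card I + i - n" "{..<n}"]
   sum.cong[of "{..<n}" "{..<n}" "\<lambda>j. card (I \<inter> B j) - (card I + i - n) + (card I + i - n)" "\<lambda>j. card (I \<inter> B j)"]
   block_lower[OF I] by simp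
 then show ?thesis unfolding sum_block[OF I] curve_degree_def by simp
qed

text \<open>A subset meets the block least if it first fills the complement, which has
  \<open>n - i\<close> elements. So some coordinate of every level survives at the node.\<close>

lemma ex_block_minimal:
 assumes j: "j < n" and k: "k \<le> n"
 obtains I where "I \<subseteq> {..<n}" "card I = k" "card (I \<inter> B j) = k + i - n"
proof (cases "k \<le> n - i")
 case True
 note cc = block_complement_card[OF j]
 obtain I where "I \<subseteq> {..<n} - B j" "card I = k"
  using obtain_subset_with_card_n[of k "{..<n} - B j"] True cc by metis
 moreover have "I \<inter> B j = {}" using calculation by blast
 moreover have "k + i - n = 0" using True i by auto
 ultimately show thesis using that[of I] by (metis Diff_subset card.empty subset_trans)
next
 case False
 note cc = block_complement_card[OF j]
 have "k - (n - i) \<le> card (B j)" using block_card[OF j] k i by auto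
 then obtain S where S: "S \<subseteq> B j" "card S = k - (n - i)" by (rule obtain_subset_with_card_n)
 have fin: "finite S" "finite ({..<n} - B j)"
  using finite_subset[OF S(1) finite_subset[OF block_subset finite_lessThan]] by simp_all
 have "card (({..<n} - B j) \<union> S) = k"
  using card_Un_disjoint[OF fin(2,1)] S cc False by auto
 moreover have "(({..<n} - B j) \<union> S) \<inter> B j = S" using S(1) by blast
 moreover have "k - (n - i) = k + i - n" "({..<n} - B j) \<union> S \<subseteq> {..<n}" using False i S(1) block_subset[of j] by auto
 ultimately show thesis using that[of "({..<n} - B j) \<union> S"] S(2) by simp
qed

text \<open>For \<open>k = n - i\<close> the complement of the block is the only minimiser. For
  every other size there is a choice, outside the block or inside it, and two surviving diagonal
  coordinates exclude rank one.\<close>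

lemma ex_block_minimal_pair:
 assumes j: "j < n" and k: "k \<in> {1..<n}" "k \<noteq> n - i"
 obtains I I' where "I \<noteq> I'" "I \<subseteq> {..<n}" "card I = k" "card (I \<inter> B j) = k + i - n"
  "I' \<subseteq> {..<n}" "card I' = k" "card (I' \<inter> B j) = k + i - n"
proof -
 note cc = block_complement_card[OF j]
 have pair: "\<exists>a b. a \<in> S \<and> b \<in> S \<and> a \<noteq> b" if "card S \<ge> 2" for S :: "nat set"
  using that by (metis One_nat_def card_le_Suc0_iff_eq card.infinite not_less_eq_eq numeral_2_eq_2 zero_le)
 show thesis
 proof (cases "k < n - i")
  case True
  obtain S where S: "S \<subseteq> {..<n} - B j" "card S = Suc k" "finite S"
   using obtain_subset_with_card_n[of "Suc k" "{..<n} - B j"] True cc by (metis Suc_leI)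
  obtain a b where ab: "a \<in> S" "b \<in> S" "a \<noteq> b" using pair[of S] S(2) k by auto
  have e: "(S - {x}) \<inter> B j = {}" for x using S(1) by blast
  show thesis
  proof (rule that[of "S - {a}" "S - {b}"])
   show "card ((S - {a}) \<inter> B j) = k + i - n" "card ((S - {b}) \<inter> B j) = k + i - n"
    unfolding e using True by auto
  qed (use S ab in auto)
 next
  case False
  then have kn: "k > n - i" using k(2) by simp
  have "Suc (k - (n - i)) \<le> card (B j)" using block_card[OF j] k i kn by auto
  from obtain_subset_with_card_n[OF this] obtain S where S: "S \<subseteq> B j" "card S = Suc (k - (n - i))" "finite S"
   by metis
  have "2 \<le> card S" using S(2) kn by linarith
  then obtain a b where ab: "a \<in> S" "b \<in> S" "a \<noteq> b" using pair by blast
  have e: "(({..<n} - B j) \<union> (S - {x})) \<inter> B j = S - {x}" for x using S(1) by blast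
  have c: "card (({..<n} - B j) \<union> (S - {x})) = k" if "x \<in> S" for x
   using card_Un_disjoint[of "{..<n} - B j" "S - {x}"] S that cc kn by auto
  show thesis
  proof (rule that[of "({..<n} - B j) \<union> (S - {a})" "({..<n} - B j) \<union> (S - {b})"])
   show "card (({..<n} - B j \<union> (S - {a})) \<inter> B j) = k + i - n" "card (({..<n} - B j \<union> (S - {b})) \<inter> B j) = k + i - n"
    unfolding e using S ab kn i by auto
   show "({..<n} - B j) \<union> (S - {a}) \<noteq> ({..<n} - B j) \<union> (S - {b})" using ab S(1) by blast
  qed (use c ab S(1) block_subset[of j] in auto)
 qed
qed

section \<open>The curve in both coordinates and its position relative to
  \<open>PGL n\<close>\<close>

lemma curve_vector_nonzero:
 assumes "I \<subseteq> {..<n}" "card I \<in> {1..<n}"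
 shows "curve_vector n i t (I, I) \<noteq> 0 \<longleftrightarrow> (\<forall>j<n. t = of_nat j --> card (I \<inter> B j) = card I + i - n)"
proof -
 have "curve_exponent n i I j = 0 \<longleftrightarrow> card (I \<inter> B j) = card I + i - n" if "j < n" for j
  using block_lower[OF assms(1) that] by (auto simp: curve_exponent_def)
 then show ?thesis using assms by (auto simp: curve_vector_def diag_family_def)
qed

lemma curve_vector_diagonal: "diagonal_vector (curve_vector n i t)"
 by (auto simp: diagonal_vector_def curve_vector_def diag_family_def)

lemma ex_curve_nonzero:
 assumes k: "k \<in> {1..<n}"
 shows "\<exists>I\<subseteq>{..<n}. card I = k \<and> curve_vector n i t (I, I) \<noteq> 0"
proof (cases "\<exists>j<n. t = of_nat j")
 case True
 then obtain j where j: "j < n" "t = of_nat j" by blast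
 have kn: "k \<le> n" using k by simp
 obtain I where I: "I \<subseteq> {..<n}" "card I = k" "card (I \<inter> B j) = k + i - n" by (rule ex_block_minimal[OF j(1) kn])
 then have "curve_vector n i t (I, I) \<noteq> 0" using curve_vector_nonzero[OF I(1), of t] k j by auto
 with I show ?thesis by blast
next
 case False
 have I: "{..<k} \<subseteq> {..<n}" "card {..<k} = k" using k by auto
 then have "curve_vector n i t ({..<k}, {..<k}) \<noteq> 0" using curve_vector_nonzero[OF I(1), of t] k False by auto
 with I show ?thesis by blast
qed

lemma diag_family_level: "diag_family n c (I, I) \<noteq> 0 ==> c I \<noteq> 0"
 by (auto simp: diag_family_def split: if_splits)

lemma curve_vector_hom: "curve_vector n i t \<in> hom_vectors n"
proof -
 have "\<exists>I\<subseteq>{..<n}. card I = k \<and> (\<Prod>j<n. (t - of_nat j) ^ curve_exponent n i I j) \<noteq> 0" if "k \<in> {1..<n}" for k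
  using ex_curve_nonzero[OF that, of t] diag_family_level unfolding curve_vector_def by blast
 from diag_family_hom(1)[of n "\<lambda>I. \<Prod>j<n. (t - of_nat j) ^ curve_exponent n i I j", OF this]
 show ?thesis by (simp add: curve_vector_def)
qed

lemma diag_family_poly:
 assumes "\<And>I. \<exists>p. \<forall>t. c t I = poly p t"
 shows "\<exists>p. \<forall>t. diag_family n (c t) q = poly p t"
proof (cases "diag_index n q")
 case True
 then show ?thesis unfolding diag_family_def if_P[OF True] by (intro assms)
next
 case False
 then show ?thesis unfolding diag_family_def if_not_P[OF False]
  by (intro exI[of _ 0] allI poly_0[symmetric])
qed

lemma curve_vector_poly: "\<exists>p. \<forall>t. curve_vector n i t q = poly p t"
 unfolding curve_vector_def
proof (rule diag_family_poly)
 fix I show "\<exists>p. \<forall>t::complex. (\<Prod>j<n. (t - of_nat j) ^ curve_exponent n i I j) = poly p t"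
  by (intro exI[of _ "(\<Prod>j<n. [:- of_nat j, 1:] ^ curve_exponent n i I j) :: complex poly"]) (simp add: poly_prod)
qed

lemma infinity_vector_poly: "\<exists>p. \<forall>t. infinity_vector n i t q = poly p t"
 unfolding infinity_vector_def
proof (rule diag_family_poly)
 fix I show "\<exists>p. \<forall>t::complex. (\<Prod>j<n. (1 - of_nat j * t) ^ curve_exponent n i I j) = poly p t"
  by (intro exI[of _ "(\<Prod>j<n. [:1, - of_nat j:] ^ curve_exponent n i I j) :: complex poly"]) (simp add: poly_prod mult.commute)
qed

lemma infinity_vector_eq:
 assumes u: "u \<noteq> 0"
 shows "infinity_vector n i u q = u ^ curve_degree n i (card (fst q)) * curve_vector n i (1 / u) q"
proof (cases "diag_index n q")
 case True
 have "(\<Prod>j<n. (1 - of_nat j * u) ^ curve_exponent n i (fst q) j) =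
   (\<Prod>j<n. u ^ curve_exponent n i (fst q) j * (1 / u - of_nat j) ^ curve_exponent n i (fst q) j)"
  using u by (intro prod.cong refl) (simp add: field_simps flip: power_mult_distrib)
 also have "\<dots> = u ^ curve_degree n i (card (fst q)) * (\<Prod>j<n. (1 / u - of_nat j) ^ curve_exponent n i (fst q) j)"
  unfolding prod.distrib power_sum[symmetric] sum_exponent[OF True[THEN conjunct2, THEN conjunct1]] ..
 finally show ?thesis unfolding infinity_vector_def curve_vector_def diag_family_def if_P[OF True] .
next
 case False
 then show ?thesis unfolding infinity_vector_def curve_vector_def diag_family_def if_not_P[OF False] by simp
qed

lemma infinity_vector_zero:
 assumes "I \<subseteq> {..<n}" "card I \<in> {1..<n}"
 shows "infinity_vector n i 0 (I, I) = 1"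
 using assms by (simp add: infinity_vector_def diag_family_def)

lemma infinity_vector_hom: "infinity_vector n i u \<in> hom_vectors n"
proof -
 have "\<exists>I\<subseteq>{..<n}. card I = k \<and> infinity_vector n i u (I, I) \<noteq> 0" if k: "k \<in> {1..<n}" for k
 proof (cases "u = 0")
  case True
  have "{..<k} \<subseteq> {..<n}" "card {..<k} = k" using k by auto
  then show ?thesis using infinity_vector_zero[of "{..<k}"] k True by (intro exI[of _ "{..<k}"]) simp
 next
  case False
  then show ?thesis using ex_curve_nonzero[OF k, of "1 / u"] by (simp add: infinity_vector_eq)
 qed
 then have "\<exists>I\<subseteq>{..<n}. card I = k \<and> (\<Prod>j<n. (1 - of_nat j * u) ^ curve_exponent n i I j) \<noteq> 0" if "k \<in> {1..<n}" for k
  using that diag_family_level unfolding infinity_vector_def by blast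
 from diag_family_hom(1)[of n "\<lambda>I. \<Prod>j<n. (1 - of_nat j * u) ^ curve_exponent n i I j", OF this]
 show ?thesis by (simp add: infinity_vector_def)
qed

lemma infinity_class:
 assumes u: "u \<noteq> 0"
 shows "hom_class n (infinity_vector n i u) = hom_class n (curve_vector n i (1 / u))"
proof -
 have "(curve_vector n i (1 / u), infinity_vector n i u) \<in> hom_equiv n"
 proof (rule hom_equivI[where s = "\<lambda>k. u ^ curve_degree n i k"])
  fix k q assume "q \<in> minor_indices n k"
  then show "infinity_vector n i u q = u ^ curve_degree n i k * curve_vector n i (1 / u) q"
   using infinity_vector_eq[OF u, of q] minor_indices_card[of q n k] by simp
 qed (use u curve_vector_hom infinity_vector_hom in auto)
 from hom_class_eqI[OF this] show ?thesis by simp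
qed

lemma block_prod:
 fixes g :: "nat => complex"
 assumes "finite I"
 shows "(\<Prod>l\<in>I. \<Prod>j\<in>K. if l \<in> B j then g j else 1) = (\<Prod>j\<in>K. g j ^ card (I \<inter> B j))"
proof -
 have "(\<Prod>l\<in>I. \<Prod>j\<in>K. if l \<in> B j then g j else 1) = (\<Prod>j\<in>K. \<Prod>l\<in>I. if l \<in> B j then g j else 1)"
  by (rule prod.swap)
 also have "\<dots> = (\<Prod>j\<in>K. g j ^ card (I \<inter> B j))"
  by (intro prod.cong refl) (simp flip: prod.inter_restrict[OF assms])
 finally show ?thesis .
qed

lemma curve_PGL:
 assumes t: "\<forall>j<n. t \<noteq> of_nat j"
 shows "hom_class n (curve_vector n i t) \<in> PGL n"
proof -
 define p where "p = (\<lambda>l. \<Prod>j<n. if l \<in> B j then t - of_nat j else 1)"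
 define s where "s = (\<lambda>k. \<Prod>j<n. inverse ((t - of_nat j) ^ (k + i - n)))"
 have p: "p l \<noteq> 0" for l using t by (auto simp: p_def)
 have s: "s k \<noteq> 0" for k using t by (auto simp: s_def)
 have c: "(\<Prod>j<n. (t - of_nat j) ^ curve_exponent n i I j) = s (card I) * (\<Prod>l\<in>I. p l)"
  if I: "I \<subseteq> {..<n}" for I
 proof -
  have fin: "finite I" using I finite_subset by blast
  have "(\<Prod>j<n. (t - of_nat j) ^ curve_exponent n i I j) =
    (\<Prod>j<n. inverse ((t - of_nat j) ^ (card I + i - n)) * (t - of_nat j) ^ card (I \<inter> B j))"
   using t block_lower[OF I] unfolding curve_exponent_def
   by (intro prod.cong refl) (simp add: power_diff divide_inverse mult.commute)
  then show ?thesis unfolding p_def block_prod[OF fin] s_def prod.distrib .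
 qed
 show ?thesis unfolding curve_vector_def
  using diag_family_pgl[of n p s "\<lambda>I. \<Prod>j<n. (t - of_nat j) ^ curve_exponent n i I j"] p s c by simp
qed

definition node_poly :: "complex poly" where
 "node_poly = (\<Prod>j<n. [:- of_nat j, 1:])"

lemma node_poly_nonzero: "node_poly \<noteq> 0"
 by (simp add: node_poly_def)

lemma poly_node_poly: "poly node_poly t = (\<Prod>j<n. t - of_nat j)"
 by (simp add: node_poly_def poly_prod)

lemma node_poly_iff: "poly node_poly t \<noteq> 0 \<longleftrightarrow> (\<forall>j<n. t \<noteq> of_nat j)"
 by (auto simp: poly_node_poly)

lemma curve_points: "hom_class n (curve_vector n i t) \<in> points (wonderful n)"
 by (rule wonderful_family_points[OF curve_vector_poly curve_vector_hom node_poly_nonzero])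
   (use curve_PGL PGL_wonderful node_poly_iff in blast)

lemma infinity_points: "hom_class n (infinity_vector n i u) \<in> points (wonderful n)"
 by (rule wonderful_family_points[OF infinity_vector_poly infinity_vector_hom, of "[:0, 1:]"])
   (simp_all add: infinity_class curve_points)

sublocale rational_curve "wonderful n" "\<lambda>t. hom_class n (curve_vector n i t)"
  "\<lambda>u. hom_class n (infinity_vector n i u)" node_poly
proof (intro rational_curve.intro rational_curve_axioms.intro function_variety_wonderful)
 show "regular_path (wonderful n) (\<lambda>t. hom_class n (curve_vector n i t))"
  by (rule regular_path_wonderful[OF curve_vector_poly curve_vector_hom curve_points])
 show "regular_path (wonderful n) (\<lambda>t. hom_class n (infinity_vector n i t))"
  by (rule regular_path_wonderful[OF infinity_vector_poly infinity_vector_hom infinity_points])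
qed (simp_all add: node_poly_nonzero infinity_class)

end

section \<open>Degrees of boundary divisors and level bundles along the curves\<close>

lemma divisor_classE:
 assumes "L \<in> divisor_class X D"
 obtains s where "L \<in> line_bundles X" "\<forall>x\<in>points X. s x \<in> vreg X (fst L x)"
  "\<forall>x\<in>points X. \<forall>y\<in>points X. \<forall>t\<in>fst L x \<inter> fst L y. s x t = snd L x y t * s y t"
  "\<forall>x\<in>points X. local_equation X D (fst L x) (s x)"
 using assms unfolding divisor_class_def split_def mem_Collect_eq fst_conv snd_conv
 by (elim conjE exE) (rule that, auto)

context function_variety
begin

text \<open>The section is a multiple of itself, hence lies in the ideal that it generates.\<close>

lemma divisor_section_vanishes:
 assumes s: "s \<in> vreg X V"
  and ideal: "local_equation X D V s"
  and V: "openin (vtop X) V" and t: "t \<in> V" "t \<in> D"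
 shows "s t = 0"
proof -
 have "(\<lambda>_. 1) \<in> vreg X V" by (rule reg_const[OF openin_subset[OF V]])
 then have "\<exists>h\<in>vreg X V. \<forall>t\<in>V. s t = s t * h t" by (rule bexI[rotated]) simp
 then have "\<forall>t\<in>V \<inter> D. s t = 0" using ideal[rule_format, of V "s"] V s by blast
 then show ?thesis using t by blast
qed

text \<open>Off \<open>D\<close> the ideal condition is empty, so the constant 1 is a multiple of
  \<open>s\<close>.\<close>

lemma divisor_section_unit:
 assumes s: "s \<in> vreg X V"
  and ideal: "local_equation X D V s"
  and V: "openin (vtop X) V" and W: "openin (vtop X) W" "W \<inter> D = {}"
 shows "s \<in> unit_functions X (V \<inter> W)"
proof -
 have o: "openin (vtop X) (V \<inter> W)" using V W(1) by (rule openin_Int)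
 have "(\<lambda>_. 1) \<in> vreg X (V \<inter> W)" by (rule reg_const[OF openin_subset[OF o]])
 moreover have "\<forall>t\<in>(V \<inter> W) \<inter> D. (1::complex) = 0" using W(2) by blast
 ultimately have "\<exists>h\<in>vreg X (V \<inter> W). \<forall>t\<in>V \<inter> W. 1 = s t * h t"
  using ideal[rule_format, of "V \<inter> W" "\<lambda>_. 1"] o by blast
 then have "\<forall>t\<in>V \<inter> W. s t \<noteq> 0" by (metis mult_zero_left zero_neq_one)
 then show ?thesis using reg_subset[OF s, of "V \<inter> W"] by (simp add: unit_functions_def)
qed

end

context rational_curve
begin

lemma class_degreeI:
 assumes "c \<in> carrier (Pic X)" "\<And>L. L \<in> c ==> L \<in> line_bundles X ==> has_degree L d"
 shows "class_degree c d"
proof -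
 obtain L where L: "L \<in> line_bundles X" "c = bundle_class X L" by (rule Pic_carrierE[OF assms(1)])
 then have "L \<in> c" using equiv_class_self[OF equiv_bundle_iso] by blast
 then show ?thesis using L assms(2) unfolding class_degree_def by blast
qed

lemma divisor_section_along:
 assumes L: "L \<in> line_bundles X" and s: "\<forall>x\<in>points X. s x \<in> vreg X (fst L x)"
  and ideal: "\<forall>x\<in>points X. local_equation X D (fst L x) (s x)"
  and Z: "closedin (vtop X) Z" "D \<subseteq> Z" and \<delta>: "regular_path X \<delta>" "\<delta> t0 \<notin> Z"
 shows "unit_at v t0 (\<lambda>t. s (\<delta> t0) (\<delta> t))"
proof (rule regular_path_unit[OF \<delta>(1)])
 let ?W = "points X - Z"
 have W: "openin (vtop X) ?W" "?W \<inter> D = {}" using Z by auto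
 have p: "\<delta> t0 \<in> points X" using \<delta>(1) by (simp add: regular_path_def)
 show "openin (vtop X) (fst L (\<delta> t0) \<inter> ?W)" using lb_open[OF L p] W(1) by (rule openin_Int)
 show "s (\<delta> t0) \<in> unit_functions X (fst L (\<delta> t0) \<inter> ?W)"
  by (rule divisor_section_unit[OF s[rule_format, OF p] ideal[THEN bspec, OF p] lb_open[OF L p] W])
 show "\<delta> t0 \<in> fst L (\<delta> t0) \<inter> ?W" using lb_mem[OF L p] p \<delta>(2) by simp
qed

text \<open>The section defining the divisor has no zeros along the curve and trivialises the bundle
  with order 0 at infinity. The closed set \<open>Z\<close> around \<open>D\<close> provides the
  open set on which the section is a unit.\<close>

lemma degree_disjoint_divisor:
 assumes L: "L \<in> divisor_class X D" and Z: "closedin (vtop X) Z" "D \<subseteq> Z"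
  and gamma: "\<And>t. gamma t \<notin> Z" "gamma' 0 \<notin> Z"
 shows "has_degree L 0"
proof -
 obtain s where L: "L \<in> line_bundles X" and s: "\<forall>x\<in>points X. s x \<in> vreg X (fst L x)"
  and gl: "\<forall>x\<in>points X. \<forall>y\<in>points X. \<forall>t\<in>fst L x \<inter> fst L y. s x t = snd L x y t * s y t"
  and ideal: "\<forall>x\<in>points X. local_equation X D (fst L x) (s x)"
  by (rule divisor_classE[OF L])
 note unit = divisor_section_along[OF L s ideal Z]
 show ?thesis
 proof (rule has_degreeI[where N = "fst L" and sigma = "\<lambda>x t. s x (gamma t)"])
  fix x y t assume "x \<in> points X" "y \<in> points X" "gamma t \<in> fst L x" "gamma t \<in> fst L y"
  then show "s x (gamma t) = snd L x y (gamma t) * s y (gamma t)" using gl by blast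
 next
  fix t0 show "unit_at w t0 (\<lambda>t. s (gamma t0) (gamma t))" by (rule unit[OF curve gamma(1)])
 next
  show "unit_at w' 0 (\<lambda>u. s (gamma' 0) (gamma (1 / u)) * u powi - 0)"
   by (rule unit_at_cong[OF unit[OF curve' gamma(2)]]) (simp add: poly_w' curve_infinity)
 qed (use lb_open[OF L] lb_mem[OF L] in auto)
qed

end

lemma rank_one_locusD:
 assumes "P \<in> rank_one_locus n k" "A \<in> P" "(I, J) \<in> minor_indices n k" "(I', J') \<in> minor_indices n k"
 shows "A (I, J) * A (I', J') = A (I, J') * A (I', J)"
 using assms unfolding rank_one_locus_def by blast

context cyclic_curve
begin

lemma minor_indices_diagonal: "I \<subseteq> {..<n} ==> card I = k ==> (I, I) \<in> minor_indices n k"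
 by (simp add: minor_indices_def)

text \<open>Two nonzero diagonal coordinates at \<open>(I, I)\<close> and \<open>(I', I')\<close>
  with zeros off the diagonal give a nonzero two by two minor. Off the nodes any two subsets will
  do; at a node the pair of minimisers is taken.\<close>

lemma curve_not_rank_one:
 assumes k: "k \<in> {1..<n}" and t: "k \<noteq> n - i \<or> (\<forall>j<n. t \<noteq> of_nat j)"
 shows "hom_class n (curve_vector n i t) \<notin> rank_one_locus n k"
proof -
 have "\<exists>I I'. I \<noteq> I' \<and> I \<subseteq> {..<n} \<and> card I = k \<and> I' \<subseteq> {..<n} \<and> card I' = k \<and>
   curve_vector n i t (I, I) \<noteq> 0 \<and> curve_vector n i t (I', I') \<noteq> 0"
 proof (cases "\<exists>j<n. t = of_nat j")
  case True
  then obtain j where j: "j < n" "t = of_nat j" by blast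
  have "k \<noteq> n - i" using t j by blast
  then obtain I I' where I: "I \<noteq> I'" "I \<subseteq> {..<n}" "card I = k" "card (I \<inter> B j) = k + i - n"
   "I' \<subseteq> {..<n}" "card I' = k" "card (I' \<inter> B j) = k + i - n" by (rule ex_block_minimal_pair[OF j(1) k])
  have "curve_vector n i t (K, K) \<noteq> 0" if K: "K \<subseteq> {..<n}" "card K = k" "card (K \<inter> B j) = k + i - n" for K
   using curve_vector_nonzero[OF K(1), of t] K(2,3) k unfolding j(2) by simp
  note nz = this
  show ?thesis
   by (intro exI[of _ I] exI[of _ I'] conjI I(1) I(2) I(3) I(5) I(6) nz[OF I(2-4)] nz[OF I(5-7)])
 next
  case False
  have nz: "curve_vector n i t (K, K) \<noteq> 0" if K: "K \<subseteq> {..<n}" "card K = k" for K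
   using curve_vector_nonzero[OF K(1), of t] K(2) k False by simp
  have "0 \<in> {..<k}" "0 \<notin> {1..<Suc k}" using k by simp_all
  then have "{..<k} \<noteq> {1..<Suc k}" by metis
  moreover have "{..<k} \<subseteq> {..<n}" "{1..<Suc k} \<subseteq> {..<n}" "card {..<k} = k" "card {1..<Suc k} = k"
   using k by (simp_all add: subset_iff)
  moreover note K = calculation
  show ?thesis
   by (intro exI[of _ "{..<k}"] exI[of _ "{1..<Suc k}"] conjI K nz)
 qed
 then obtain I I' where I: "I \<noteq> I'" "(I, I) \<in> minor_indices n k" "(I', I') \<in> minor_indices n k"
  "curve_vector n i t (I, I) \<noteq> 0" "curve_vector n i t (I', I') \<noteq> 0"
  using minor_indices_diagonal by blast
 have "curve_vector n i t (I, I') = 0" using curve_vector_diagonal[of t] I(1) unfolding diagonal_vector_def by blast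
 then show ?thesis
  using rank_one_locusD[OF _ hom_class_self[OF curve_vector_hom] I(2,3), of t] I(4,5) by auto
qed

lemma infinity_not_rank_one:
 assumes k: "k \<in> {1..<n}"
 shows "hom_class n (infinity_vector n i 0) \<notin> rank_one_locus n k"
proof -
 have I: "{..<k} \<subseteq> {..<n}" "{1..<Suc k} \<subseteq> {..<n}" "card {..<k} \<in> {1..<n}" "card {1..<Suc k} \<in> {1..<n}" using k by auto
 have "0 \<in> {..<k}" "0 \<notin> {1..<Suc k}" using k by simp_all
 then have "{..<k} \<noteq> {1..<Suc k}" by metis
 then have "infinity_vector n i 0 ({..<k}, {1..<Suc k}) = 0" by (simp add: infinity_vector_def diag_family_def)
 moreover have q: "({..<k}, {..<k}) \<in> minor_indices n k" "({1..<Suc k}, {1..<Suc k}) \<in> minor_indices n k"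
  using I k by (auto simp: minor_indices_def)
 ultimately show ?thesis
  using infinity_vector_zero[OF I(1,3)] infinity_vector_zero[OF I(2,4)]
   rank_one_locusD[OF _ hom_class_self[OF infinity_vector_hom] q, of 0]
  by auto
qed

lemma unit_at_family:
 assumes "\<exists>p. \<forall>t. A t q = poly p t" "A t0 q \<noteq> (0::complex)"
 shows "unit_at v t0 (\<lambda>t. 1 / A t q)"
proof -
 obtain p where p: "\<forall>t. A t q = poly p t" using assms(1) by blast
 show ?thesis by (rule unit_atI[of 1 _ p]) (use p assms(2) in auto)
qed

text \<open>The reciprocals of the frame coordinates satisfy the transition rule of the bundle and
  are units along the affine line. Passing to the coordinates at infinity multiplies level
  \<open>k\<close> by \<open>u ^ curve_degree n i k\<close>, which is the degree.\<close>

lemma degree_level_bundle: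
 assumes k: "k \<in> {1..<n}"
 shows "has_degree (level_bundle n k) (int (curve_degree n i k))"
proof -
 note lb = level_line_bundle[OF k]
 have nz: "A (frame_of n x k) \<noteq> 0"
  if "x \<in> points (wonderful n)" "A \<in> hom_vectors n" "hom_class n A \<in> fst (level_bundle n k) x" for x A
  using that hom_chart_set_iff[OF that(2) frame_of(1)[OF that(1)]] k by auto
 show ?thesis
 proof (rule has_degreeI[where N = "fst (level_bundle n k)" and sigma = "\<lambda>x t. 1 / curve_vector n i t (frame_of n x k)"])
  fix x y t assume x: "x \<in> points (wonderful n)" and y: "y \<in> points (wonderful n)"
   and t: "hom_class n (curve_vector n i t) \<in> fst (level_bundle n k) y"
  show "1 / curve_vector n i t (frame_of n x k) =
    snd (level_bundle n k) x y (hom_class n (curve_vector n i t)) * (1 / curve_vector n i t (frame_of n y k))"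
   unfolding level_bundle_value[OF curve_vector_hom x y k] using nz[OF y curve_vector_hom t] by simp
 next
  fix t0
  show "unit_at node_poly t0 (\<lambda>t. 1 / curve_vector n i t (frame_of n (hom_class n (curve_vector n i t0)) k))"
  proof (rule unit_at_family[where A = "curve_vector n i", OF curve_vector_poly])
   show "curve_vector n i t0 (frame_of n (hom_class n (curve_vector n i t0)) k) \<noteq> 0"
    using curve_points[of t0] curve_vector_hom lb_mem[OF lb curve_points[of t0]] by (rule nz)
  qed
 next
  let ?x = "hom_class n (infinity_vector n i 0)"
  have "unit_at w' 0 (\<lambda>u. 1 / infinity_vector n i u (frame_of n ?x k))"
  proof (rule unit_at_family[where A = "infinity_vector n i", OF infinity_vector_poly])
   show "infinity_vector n i 0 (frame_of n ?x k) \<noteq> 0"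
    using infinity_points[of 0] infinity_vector_hom lb_mem[OF lb infinity_points[of 0]] by (rule nz)
  qed
  then show "unit_at w' 0 (\<lambda>u. 1 / curve_vector n i (1 / u) (frame_of n ?x k) * u powi - int (curve_degree n i k))"
  proof (rule unit_at_cong)
   fix u assume "poly w' u \<noteq> 0"
   then have u: "u \<noteq> 0" by (simp add: poly_w')
   have "card (fst (frame_of n ?x k)) = k" by (rule frame_card[OF frame_of(1)[OF infinity_points] k])
   then show "1 / infinity_vector n i u (frame_of n ?x k) =
     1 / curve_vector n i (1 / u) (frame_of n ?x k) * u powi - int (curve_degree n i k)"
    using u by (simp add: infinity_vector_eq power_int_minus divide_simps)
  qed
 qed (use lb_open[OF lb] lb_mem[OF lb] in auto)
qed

lemma class_degree_level_bundle:
 assumes k: "k \<in> {1..<n}"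
 shows "class_degree (bundle_class (wonderful n) (level_bundle n k)) (int (curve_degree n i k))"
 unfolding class_degree_def using level_line_bundle[OF k] degree_level_bundle[OF k] by blast

lemma degree_other_divisor:
 assumes "L \<in> divisor_class (wonderful n) D" "D \<subseteq> rank_one_locus n k" "k \<in> {1..<n}" "k \<noteq> n - i"
 shows "has_degree L 0"
 by (rule degree_disjoint_divisor[OF assms(1) closedin_rank_one[OF assms(3)] assms(2)])
   (use curve_not_rank_one infinity_not_rank_one assms(3,4) in auto)

lemma node_poly_infinity:
 assumes "u \<noteq> 0"
 shows "poly node_poly (1 / u) * u ^ n = (\<Prod>j<n. 1 - of_nat j * u)"
proof -
 have "poly node_poly (1 / u) * u ^ n = (\<Prod>j<n. (1 / u - of_nat j) * u)"
  by (simp add: poly_node_poly prod.distrib)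
 also have "\<dots> = (\<Prod>j<n. 1 - of_nat j * u)" using assms by (intro prod.cong refl) (simp add: field_simps)
 finally show ?thesis .
qed

text \<open>The curve meets the divisor transversally at the nodes: a two by two minor vanishing on the
 divisor has a simple zero there.\<close>

lemma section_simple_zero:
 assumes D: "D \<subseteq> rank_one_locus n (n - i)" and j: "j < n"
  and V: "openin (vtop (wonderful n)) V" "hom_class n (curve_vector n i (of_nat j)) \<in> V"
  and jD: "hom_class n (curve_vector n i (of_nat j)) \<in> D"
  and s: "s \<in> vreg (wonderful n) V"
  and ideal: "local_equation (wonderful n) D V s"
 shows "unit_at node_poly (of_nat j) (\<lambda>t. s (hom_class n (curve_vector n i t)) / poly node_poly t)"
proof -
 define k where "k = n - i"
 have k: "k \<in> {1..<n}" using i by (auto simp: k_def)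
 define A where "A = (\<lambda>t. curve_vector n i t)"
 have A: "A t \<in> hom_vectors n" for t by (simp add: A_def curve_vector_hom)
 \<comment> \<open>The only subset of size \<open>k = n - i\<close> whose coordinate survives at the
   node.\<close>
 define I0 where "I0 = {..<n} - B j"
 have I0: "I0 \<subseteq> {..<n}" "card I0 = k"
  using block_complement_card[OF j] by (auto simp: I0_def k_def)
 have "I0 \<noteq> {}" using I0(2) k by auto
 then obtain b where b: "b \<in> I0" by blast
 have "B j \<noteq> {}" using block_card[OF j] i by auto
 then obtain c where c: "c \<in> B j" by blast
 \<comment> \<open>One exchanged element meets the block once, so this coordinate vanishes at the
   node to order exactly one.\<close>
 define I1 where "I1 = insert c (I0 - {b})"
 have fin: "finite I0" using I0(1) finite_subset by blast
 have cI0: "c \<notin> I0" using c by (simp add: I0_def)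
 have I1: "I1 \<subseteq> {..<n}" "card I1 = k" "I1 \<noteq> I0"
  using I0 c block_subset[of j] cI0 b fin k by (auto simp: I1_def)
 have e0: "card (I0 \<inter> B j) = 0" by (simp add: I0_def Diff_Int_distrib2)
 have "I1 \<inter> B j = {c}" using c by (auto simp: I1_def I0_def)
 then have e1: "card (I1 \<inter> B j) = 1" by simp
 have kin: "k + i - n = 0" using i by (simp add: k_def)
 define b0 b1 where "b0 = (\<Prod>j'<n. [:- of_nat j', 1:] ^ curve_exponent n i I0 j' :: complex poly)"
  and "b1 = (\<Prod>j'\<in>{..<n} - {j}. [:- of_nat j', 1:] ^ curve_exponent n i I1 j' :: complex poly)"
 have A0: "A t (I0, I0) = poly b0 t" for t
  using I0 k by (simp add: A_def curve_vector_def diag_family_def b0_def poly_prod)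
 have A1: "A t (I1, I1) = (t - of_nat j) * poly b1 t" for t
 proof -
  have "A t (I1, I1) = (\<Prod>j'<n. (t - of_nat j') ^ curve_exponent n i I1 j')"
   using I1 k by (simp add: A_def curve_vector_def diag_family_def)
  also have "\<dots> = (t - of_nat j) ^ curve_exponent n i I1 j * (\<Prod>j'\<in>{..<n} - {j}. (t - of_nat j') ^ curve_exponent n i I1 j')"
   using j by (intro prod.remove) auto
  finally show ?thesis using e1 I1(2) kin by (simp add: curve_exponent_def b1_def poly_prod)
 qed
 have offdiag: "A t (I0, I1) = 0" "A t (I1, I0) = 0" for t
  using curve_vector_diagonal[of t] I1(3) unfolding diagonal_vector_def A_def by blast+
 have b1j: "poly b1 (of_nat j) \<noteq> 0" by (auto simp: b1_def poly_prod)
 have A0j: "A (of_nat j) (I0, I0) \<noteq> 0"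
  unfolding A_def using curve_vector_nonzero[OF I0(1), of "of_nat j"] I0(2) k e0 kin by simp
 obtain tau0 where tau0: "frame n tau0" "\<forall>k\<in>{1..<n}. A (of_nat j) (tau0 k) \<noteq> 0" by (rule ex_frame[OF A])
 \<comment> \<open>Normalising level \<open>k\<close> by the surviving coordinate makes the minor
   along the curve equal to the coordinate at \<open>I1\<close> divided by that at
   \<open>I0\<close>.\<close>
 define tau where "tau = tau0(k := (I0, I0))"
 have q: "(I0, I0) \<in> minor_indices n k" "(I1, I1) \<in> minor_indices n k" using I0 I1 by (auto simp: minor_indices_def)
 have tau: "frame n tau" using tau0(1) q(1) by (simp add: frame_def tau_def)
 have "hom_class n (A (of_nat j)) \<in> hom_chart_set n tau"
  unfolding hom_chart_set_iff[OF A tau] using tau0(2) A0j by (simp add: tau_def)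
 define W where "W = hom_chart_set n tau \<inter> points (wonderful n) \<inter> V"
 have W: "openin (vtop (wonderful n)) W" "W \<subseteq> V"
  unfolding W_def using wonderful_chart_open[OF tau] V(1) by (auto intro: openin_Int)
 have jW: "hom_class n (curve_vector n i (of_nat j)) \<in> W"
  unfolding W_def using V(2) \<open>hom_class n (A (of_nat j)) \<in> hom_chart_set n tau\<close> curve_points by (simp add: A_def)
 \<comment> \<open>This minor vanishes on \<open>D\<close>, so it is a multiple of the local
   equation \<open>s\<close>. Its simple zero bounds the order of \<open>s\<close> by one from
   above; membership of the node in \<open>D\<close> bounds it from below.\<close>
 define m where "m = (\<lambda>z :: nat set \<times> nat set => complex. z (I1, I1) * z (I0, I0) + (- 1) * (z (I1, I0) * z (I0, I1)))"
 define f where "f = (\<lambda>P. m (hom_chart_coord tau P))"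
 have "f \<in> vreg (wonderful n) W"
 proof (rule wonderful_coord_regular[OF tau])
  show "m \<in> polyfuns" unfolding m_def by (intro polyfuns.intros)
 qed (auto simp: W_def f_def)
 moreover have "\<forall>t\<in>W \<inter> D. f t = 0"
 proof
  fix t assume t: "t \<in> W \<inter> D"
  then have "t \<in> hom_chart_set n tau" by (simp add: W_def)
  note x = hom_chart_coord_mem[OF this tau]
  have "t \<in> rank_one_locus n k" using t D by (auto simp: k_def)
  moreover have "hom_chart_coord tau t \<in> t" using hom_class_self[OF x(1)] x(2) by simp
  ultimately have "hom_chart_coord tau t (I1, I1) * hom_chart_coord tau t (I0, I0) =
    hom_chart_coord tau t (I1, I0) * hom_chart_coord tau t (I0, I1)"
   by (rule rank_one_locusD[OF _ _ q(2,1)])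
  then show "f t = 0" by (simp add: f_def m_def)
 qed
 ultimately obtain h where h: "h \<in> vreg (wonderful n) W" "\<forall>t\<in>W. f t = s t * h t"
  using ideal[rule_format, OF conjI[OF W], of f] by blast
 obtain a r where ar: "poly r (of_nat j) \<noteq> 0" "\<forall>t. poly r t \<noteq> 0 --> hom_class n (curve_vector n i t) \<in> V \<and>
   s (hom_class n (curve_vector n i t)) = poly a t / poly r t"
  by (rule regular_pathE[OF curve V(1) s V(2)])
 obtain a' r' where ar': "poly r' (of_nat j) \<noteq> 0" "\<forall>t. poly r' t \<noteq> 0 --> hom_class n (curve_vector n i t) \<in> W \<and>
   h (hom_class n (curve_vector n i t)) = poly a' t / poly r' t"
  by (rule regular_pathE[OF curve W(1) h(1) jW])
 have "s (hom_class n (curve_vector n i (of_nat j))) = 0"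
  by (rule divisor_section_vanishes[OF s ideal V(1) V(2) jD])
 then have "poly a (of_nat j) = 0" using ar by auto
 then obtain alpha where alpha: "a = [:- of_nat j, 1:] * alpha" unfolding poly_eq_0_iff_dvd by (elim dvdE)
 have "[:- of_nat j, 1:] * b1 * (r * r') - a * a' * b0 = 0"
 proof (rule poly_zero_off[of "r * r'"])
  show "r * r' \<noteq> 0" using ar(1) ar'(1) by auto
  fix t assume "poly (r * r') t \<noteq> 0"
  then have t: "poly r t \<noteq> 0" "poly r' t \<noteq> 0" by auto
  have tW: "hom_class n (A t) \<in> W" using ar'(2) t(2) by (simp add: A_def)
  then have "hom_class n (A t) \<in> hom_chart_set n tau" by (simp add: W_def)
  then have "A t (tau k) \<noteq> 0" unfolding hom_chart_set_iff[OF A tau] using k by blast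
  then have nz: "A t (I0, I0) \<noteq> 0" by (simp add: tau_def)
  have "f (hom_class n (A t)) = A t (I1, I1) / A t (I0, I0)"
  proof -
   have "tau k = (I0, I0)" by (simp add: tau_def)
   then show ?thesis unfolding f_def m_def hom_chart_coord_eq[OF A tau] fst_conv I0(2) I1(2) offdiag using nz by simp
  qed
  moreover have "f (hom_class n (A t)) = (poly a t / poly r t) * (poly a' t / poly r' t)"
   using h(2)[rule_format, OF tW] ar(2) ar'(2) t by (simp add: A_def)
  ultimately have "A t (I1, I1) * (poly r t * poly r' t) = poly a t * poly a' t * A t (I0, I0)"
   using nz t by (simp add: field_simps)
  then show "poly ([:- of_nat j, 1:] * b1 * (r * r') - a * a' * b0) t = 0" by (simp add: A0 A1 algebra_simps)
 qed
 then have "[:- of_nat j, 1:] * b1 * (r * r') = a * a' * b0" by (simp only: right_minus_eq)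
 then have "[:- of_nat j, 1:] * (b1 * (r * r')) = [:- of_nat j, 1:] * (alpha * a' * b0)"
  unfolding alpha by (simp only: mult.assoc)
 then have "b1 * (r * r') = alpha * a' * b0" by (subst (asm) mult_left_cancel) auto
 then have "poly (alpha * a' * b0) (of_nat j) = poly (b1 * (r * r')) (of_nat j)" by simp
 \<comment> \<open>After cancelling one factor \<open>t - j\<close> on both sides, the side of the
   minor is still nonzero at the node; so \<open>s\<close> has order exactly one.\<close>
 then have alphaj: "poly alpha (of_nat j) \<noteq> 0" using b1j ar(1) ar'(1) by auto
 define v where "v = (\<Prod>j'\<in>{..<n} - {j}. [:- of_nat j', 1:] :: complex poly)"
 have w: "node_poly = [:- of_nat j, 1:] * v" unfolding node_poly_def v_def using j by (intro prod.remove) auto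
 have vj: "poly v (of_nat j) \<noteq> 0" by (auto simp: v_def poly_prod)
 show ?thesis
 proof (rule unit_atI[of alpha _ "r * v"])
  fix t assume t: "poly node_poly t \<noteq> 0" "poly (r * v) t \<noteq> 0"
  then have "t - of_nat j \<noteq> 0" by (auto simp: w)
  moreover have "s (hom_class n (curve_vector n i t)) = (t - of_nat j) * poly alpha t / poly r t"
   using ar(2) t(2) by (simp add: alpha algebra_simps)
  moreover have "poly node_poly t = (t - of_nat j) * poly v t" by (simp add: w algebra_simps)
  ultimately show "s (hom_class n (curve_vector n i t)) / poly node_poly t = poly alpha t / poly (r * v) t"
   by simp
 qed (use alphaj ar(1) vj in auto)
qed

text \<open>Dividing the section of the divisor by \<open>node_poly\<close> removes its
  \<open>n\<close> simple zeros and yields a trivialisation along the affine line. At infinity the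
  section is a unit and \<open>node_poly\<close> has a pole of order \<open>n\<close>.\<close>

lemma degree_own_divisor:
 assumes L: "L \<in> divisor_class (wonderful n) D" and D: "D \<subseteq> rank_one_locus n (n - i)"
  and nodes: "\<And>j. j < n ==> hom_class n (curve_vector n i (of_nat j)) \<in> D"
 shows "has_degree L (int n)"
proof -
 let ?gamma = "\<lambda>t. hom_class n (curve_vector n i t)"
 let ?gamma' = "\<lambda>t. hom_class n (infinity_vector n i t)"
 let ?X = "wonderful n"
 obtain s where L: "L \<in> line_bundles ?X" and s: "\<forall>x\<in>points ?X. s x \<in> vreg ?X (fst L x)"
  and gl: "\<forall>x\<in>points ?X. \<forall>y\<in>points ?X. \<forall>t\<in>fst L x \<inter> fst L y. s x t = snd L x y t * s y t"
  and ideal: "\<forall>x\<in>points ?X. local_equation ?X D (fst L x) (s x)"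
  by (rule divisor_classE[OF L])
 have k: "n - i \<in> {1..<n}" using i by auto
 note unit = divisor_section_along[OF L s ideal closedin_rank_one[OF k] D]
 show ?thesis
 proof (rule has_degreeI[where N = "fst L" and sigma = "\<lambda>x t. s x (?gamma t) / poly node_poly t"])
  fix x y t assume "x \<in> points ?X" "y \<in> points ?X" "?gamma t \<in> fst L x" "?gamma t \<in> fst L y"
  then have "s x (?gamma t) = snd L x y (?gamma t) * s y (?gamma t)" using gl by blast
  then show "s x (?gamma t) / poly node_poly t = snd L x y (?gamma t) * (s y (?gamma t) / poly node_poly t)" by simp
 next
  fix t0 show "unit_at node_poly t0 (\<lambda>t. s (?gamma t0) (?gamma t) / poly node_poly t)"
  proof (cases "poly node_poly t0 = 0")
   case True
   then obtain j where j: "j < n" "t0 = of_nat j" using node_poly_iff by blast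
   note p = curve_points[of "of_nat j"]
   show ?thesis unfolding j(2)
    by (rule section_simple_zero[OF D j(1) lb_open[OF L p] lb_mem[OF L p] nodes[OF j(1)]
       s[rule_format, OF p] ideal[THEN bspec, OF p]])
  next
   case False
   then have "?gamma t0 \<notin> rank_one_locus n (n - i)" using curve_not_rank_one[OF k] node_poly_iff by blast
   from unit[OF curve this] have "unit_at node_poly t0 (\<lambda>t. s (?gamma t0) (?gamma t))" .
   moreover have "unit_at node_poly t0 (\<lambda>t. 1 / poly node_poly t)"
    by (rule unit_atI[of 1 _ node_poly]) (use False in auto)
   ultimately have "unit_at node_poly t0 (\<lambda>t. s (?gamma t0) (?gamma t) * (1 / poly node_poly t))" by (rule unit_at_mult)
   then show ?thesis by simp
  qed
 next
  \<comment> \<open>The polynomial \<open>node_poly\<close> in the coordinate at infinity, freed of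
    its pole; its value at 0 is 1.\<close>
  define v where "v = (\<Prod>j<n. [:1, - of_nat j:] :: complex poly)"
  have "unit_at w' 0 (\<lambda>u. s (?gamma' 0) (?gamma' u))" by (rule unit[OF curve' infinity_not_rank_one[OF k]])
  moreover have "unit_at w' 0 (\<lambda>u. 1 / poly v u)"
   by (rule unit_atI[of 1 _ v]) (auto simp: v_def poly_prod)
  ultimately have "unit_at w' 0 (\<lambda>u. s (?gamma' 0) (?gamma' u) * (1 / poly v u))" by (rule unit_at_mult)
  then show "unit_at w' 0 (\<lambda>u. s (?gamma' 0) (?gamma (1 / u)) / poly node_poly (1 / u) * u powi - int n)"
  proof (rule unit_at_cong)
   fix u assume "poly w' u \<noteq> 0"
   then have u: "u \<noteq> 0" by (simp add: poly_w')
   have "poly v u = poly node_poly (1 / u) * u ^ n"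
    using node_poly_infinity[OF u] by (simp add: v_def poly_prod mult.commute)
   then show "s (?gamma' 0) (?gamma' u) * (1 / poly v u) =
     s (?gamma' 0) (?gamma (1 / u)) / poly node_poly (1 / u) * u powi - int n"
    using u by (simp add: infinity_class power_int_minus divide_inverse)
  qed
 qed (use lb_open[OF L] lb_mem[OF L] in auto)
qed

end

section \<open>The nodes of the curve and the components containing them\<close>

lemma path_vector_permuted:
 assumes sigma: "sigma permutes {..<n}"
  and C: "\<And>l. l < n ==> component C l = component C0 (sigma l)" "\<And>l. l < n ==> pos C l = pos C0 (sigma l)"
 shows "permuted_vector sigma (path_vector n C0 s) = path_vector n C s"
proof
 fix q
 have inj: "inj sigma" by (rule permutes_inj[OF sigma])
 have sub: "sigma ` I \<subseteq> {..<n} \<longleftrightarrow> I \<subseteq> {..<n}" for I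
  using permutes_in_image[OF sigma] by blast
 have card: "card (sigma ` I) = card I" for I
  by (rule card_image[OF inj_on_subset[OF inj subset_UNIV]])
 have comp: "component_sum C0 (sigma ` I) = component_sum C I" if "I \<subseteq> {..<n}" for I
  using that C(1) unfolding component_sum_def sum.reindex[OF inj_on_subset[OF inj subset_UNIV]] o_def
  by (intro sum.cong refl) (metis lessThan_iff subsetD)
 have prod: "(\<Prod>l\<in>sigma ` I. pos C0 l) = (\<Prod>l\<in>I. pos C l)" if "I \<subseteq> {..<n}" for I
  using that C(2) unfolding prod.reindex[OF inj_on_subset[OF inj subset_UNIV]] o_def
  by (intro prod.cong refl) (metis lessThan_iff subsetD)
 have top: "top_sum n C0 k = top_sum n C k" for k
 proof -
  have "component_sum C0 ` subsets_of n k = component_sum C ` subsets_of n k"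
  proof
   show "component_sum C0 ` subsets_of n k \<subseteq> component_sum C ` subsets_of n k"
   proof
    fix x assume "x \<in> component_sum C0 ` subsets_of n k"
    then obtain K where K: "x = component_sum C0 K" "K \<subseteq> {..<n}" "card K = k" by blast
    define K' where "K' = inv_into UNIV sigma ` K"
    have e: "sigma ` K' = K" unfolding K'_def using permutes_surj[OF sigma] by (simp add: image_f_inv_f)
    then have "K' \<subseteq> {..<n}" "card K' = k" using K sub[of K'] card[of K'] by auto
    moreover have "x = component_sum C K'" using K(1) comp[OF calculation(1)] e by simp
    ultimately show "x \<in> component_sum C ` subsets_of n k" by blast
   qed
   show "component_sum C ` subsets_of n k \<subseteq> component_sum C0 ` subsets_of n k"
   proof
    fix x assume "x \<in> component_sum C ` subsets_of n k"
    then obtain K where K: "x = component_sum C K" "K \<subseteq> {..<n}" "card K = k" by blast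
    then have "x = component_sum C0 (sigma ` K)" "sigma ` K \<subseteq> {..<n}" "card (sigma ` K) = k"
     using comp[OF K(2)] sub[of K] card[of K] by simp_all
    then show "x \<in> component_sum C0 ` subsets_of n k" by blast
   qed
  qed
  then show ?thesis by (simp only: top_sum_def)
 qed
 show "permuted_vector sigma (path_vector n C0 s) q = path_vector n C s q"
 proof (cases "diag_index n q")
  case True
  then have True': "sigma ` fst q = sigma ` snd q \<and> sigma ` fst q \<subseteq> {..<n} \<and> card (sigma ` fst q) \<in> {1..<n}"
   unfolding sub card inj_image_eq_iff[OF inj] .
  have I: "fst q \<subseteq> {..<n}" using True by blast
  show ?thesis
   unfolding permuted_vector_def path_vector_def diag_family_def fst_conv snd_conv if_P[OF True] if_P[OF True']
   unfolding comp[OF I] prod[OF I] card top ..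
 next
  case False
  then have False': "\<not> (sigma ` fst q = sigma ` snd q \<and> sigma ` fst q \<subseteq> {..<n} \<and> card (sigma ` fst q) \<in> {1..<n})"
   unfolding sub card inj_image_eq_iff[OF inj] .
  show ?thesis
   unfolding permuted_vector_def path_vector_def diag_family_def fst_conv snd_conv if_not_P[OF False] if_not_P[OF False'] ..
 qed
qed

context cyclic_curve
begin

text \<open>The limit of the curve at \<open>t = j\<close> as a chain: entries in the block acquire
  the factor \<open>t - j\<close> and stay on the left component, and the positions are the diagonal
  entries at \<open>j\<close> with this factor removed.\<close>

definition node_chain :: "nat => marked_chain" where
 "node_chain j = \<lparr>component = (\<lambda>l. if l \<in> B j then 0 else 1),
   pos = (\<lambda>l. \<Prod>j'\<in>{..<n} - {j}. if l \<in> B j' then of_nat j - of_nat j' else 1)\<rparr>"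

lemma two_component_chain:
 assumes J: "J \<subseteq> {..<n}" "card J = i" and p: "\<And>l. l < n ==> p l \<noteq> 0"
 shows "\<lparr>component = (\<lambda>l. if l \<in> J then 0 else 1), pos = p\<rparr> \<in> marked_chains n"
proof -
 have fin: "finite J" using J(1) finite_subset by blast
 have "J \<noteq> {}" using J i by auto
 then obtain a where a: "a \<in> J" "a < n" using J by blast
 have "J \<noteq> {..<n}" using J i by auto
 then obtain b where b: "b < n" "b \<notin> J" using J by blast
 have "(\<lambda>l. if l \<in> J then 0 else 1) ` {..<n} = {..<2::nat}"
 proof
  show "{..<2::nat} \<subseteq> (\<lambda>l. if l \<in> J then 0 else 1) ` {..<n}"
  proof
   fix x :: nat assume "x \<in> {..<2}"
   then have "x = 0 \<or> x = 1" by auto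
   then show "x \<in> (\<lambda>l. if l \<in> J then 0 else 1) ` {..<n}"
    using a b by (auto intro: rev_image_eqI[of a] rev_image_eqI[of b])
  qed
 qed auto
 then show ?thesis using p by (auto simp: marked_chains_def)
qed

lemma node_pos_nonzero: "pos (node_chain j) l \<noteq> 0"
 by (auto simp: node_chain_def)

lemma node_chain: "j < n ==> node_chain j \<in> marked_chains n"
 using two_component_chain[OF block_subset block_card, of j "pos (node_chain j)"] node_pos_nonzero
 by (simp add: node_chain_def)

lemma component_sum_node:
 assumes "I \<subseteq> {..<n}"
 shows "component_sum (node_chain j) I = card I - card (I \<inter> B j)"
proof -
 have fin: "finite I" using assms finite_subset by blast
 have "component_sum (node_chain j) I = card (I - B j)"
  using fin by (simp add: component_sum_def node_chain_def sum.If_cases Diff_eq)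
 then show ?thesis using card_Diff_subset_Int[of I "B j"] fin by simp
qed

lemma top_sum_node:
 assumes j: "j < n" and k: "k \<le> n"
 shows "top_sum n (node_chain j) k = k - (k + i - n)"
proof -
 obtain I where I: "I \<subseteq> {..<n}" "card I = k" "card (I \<inter> B j) = k + i - n" by (rule ex_block_minimal[OF j k])
 have "top_sum n (node_chain j) k = component_sum (node_chain j) I"
 proof (rule top_sumI[OF I(1,2)])
  fix K assume K: "K \<subseteq> {..<n}" "card K = k"
  then show "component_sum (node_chain j) K \<le> component_sum (node_chain j) I"
   using block_lower[OF K(1) j] I by (simp add: component_sum_node)
 qed
 then show ?thesis using I by (simp add: component_sum_node)
qed

lemma node_class:
 assumes j: "j < n"
 shows "hom_class n (curve_vector n i (of_nat j)) = hom_class n (path_vector n (node_chain j) 0)"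
proof -
 \<comment> \<open>The common factors of level \<open>k\<close> from the other nodes, which the
   exponents of the curve omit but the products of positions contain.\<close>
 define s where "s = (\<lambda>k. \<Prod>j'\<in>{..<n} - {j}. (of_nat j - of_nat j' :: complex) ^ (k + i - n))"
 have "(curve_vector n i (of_nat j), path_vector n (node_chain j) 0) \<in> hom_equiv n"
 proof (rule hom_equivI[where s = s])
  fix k q assume kk: "k \<in> {1..<n}" and q: "q \<in> minor_indices n k"
  have ck: "card (fst q) = k" by (rule minor_indices_card[OF q])
  show "path_vector n (node_chain j) 0 q = s k * curve_vector n i (of_nat j) q"
  proof (cases "diag_index n q")
   case True
   define I where "I = fst q"
   have I: "I \<subseteq> {..<n}" "card I = k" unfolding I_def using True ck by blast+
   have fin: "finite I" using I(1) finite_subset by blast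
   have kn: "k \<le> n" using kk by simp
   have le: "card (I \<inter> B j') \<le> k" for j' using card_mono[OF fin, of "I \<inter> B j'"] I(2) by simp
   have low: "k + i - n \<le> card (I \<inter> B j')" if "j' < n" for j' using block_lower[OF I(1) that] I(2) by simp
   have ex: "top_sum n (node_chain j) (card I) - component_sum (node_chain j) I = curve_exponent n i I j"
    using top_sum_node[OF j kn] component_sum_node[OF I(1), of j] le[of j] low[OF j] I(2)
    by (simp add: curve_exponent_def)
   have "(\<Prod>l\<in>I. pos (node_chain j) l) = (\<Prod>j'\<in>{..<n} - {j}. (of_nat j - of_nat j') ^ card (I \<inter> B j'))"
    unfolding node_chain_def using block_prod[OF fin, where K = "{..<n} - {j}" and g = "\<lambda>j'. of_nat j - of_nat j'"] by simp
   also have "\<dots> = (\<Prod>j'\<in>{..<n} - {j}. (of_nat j - of_nat j') ^ (k + i - n) * (of_nat j - of_nat j') ^ curve_exponent n i I j')"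
    using low I(2) by (intro prod.cong refl) (simp add: curve_exponent_def flip: power_add)
   finally have p: "(\<Prod>l\<in>I. pos (node_chain j) l) =
     s k * (\<Prod>j'\<in>{..<n} - {j}. (of_nat j - of_nat j') ^ curve_exponent n i I j')"
    unfolding s_def prod.distrib .
   have "(\<Prod>j'<n. (of_nat j - of_nat j' :: complex) ^ curve_exponent n i I j') =
     0 ^ curve_exponent n i I j * (\<Prod>j'\<in>{..<n} - {j}. (of_nat j - of_nat j') ^ curve_exponent n i I j')"
    using j by (subst prod.remove[of _ j]) auto
   then show ?thesis
    unfolding path_vector_def curve_vector_def diag_family_def if_P[OF True]
    unfolding I_def[symmetric] ex p by simp
  next
   case False
   then show ?thesis unfolding path_vector_def curve_vector_def diag_family_def if_not_P[OF False] by simp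
  qed
 next
  fix k assume "k \<in> {1..<n}"
  show "s k \<noteq> 0" by (auto simp: s_def)
 qed (rule curve_vector_hom, rule path_vector_hom(1)[OF node_chain[OF j]])
 from hom_class_eqI[OF this] show ?thesis .
qed

text \<open>The node lies over the divisor of the block at \<open>j\<close>, while the hypothesis
  speaks of the first \<open>i\<close> points only. Rotating the indices carries one into the other,
  and boundary components are stable under simultaneous permutation.\<close>

lemma node_in_component:
 assumes \<iota>: "torus_identification n \<iota>"
  and D: "boundary_component n D" "\<iota> ` delta n {..<i} \<subseteq> D"
  and j: "j < n"
 shows "hom_class n (curve_vector n i (of_nat j)) \<in> D"
proof -
 define sigma where "sigma = (\<lambda>l. if l < n then (l + n - j) mod n else l)"
 have sigma: "sigma permutes {..<n}"
 proof (rule bij_imp_permutes)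
  have inj: "inj_on sigma {..<n}"
   by (rule inj_on_cong[THEN iffD2, OF _ rotation_inj[OF j]]) (simp add: sigma_def)
  have "sigma ` {..<n} \<subseteq> {..<n}" using j by (auto simp: sigma_def)
  then show "bij_betw sigma {..<n} {..<n}"
   unfolding bij_betw_def using inj endo_inj_surj[OF finite_lessThan _ inj] by blast
 qed (simp add: sigma_def)
 \<comment> \<open>The chain of the node with its marked points relabelled by the rotation, so that
   its left component carries exactly the first \<open>i\<close> points.\<close>
 define C0 where "C0 = \<lparr>component = (\<lambda>l. if l \<in> {..<i} then 0 else 1),
  pos = (\<lambda>l. pos (node_chain j) (inv_into UNIV sigma l))\<rparr>"
 have C0: "C0 \<in> marked_chains n"
  unfolding C0_def using i node_pos_nonzero by (intro two_component_chain) auto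
 have "chain_class n C0 \<in> delta n {..<i}"
  unfolding delta_iff[OF C0] using i by (intro exI[of _ 1]) (auto simp: C0_def)
 then have "\<iota> (chain_class n C0) \<in> D" using D(2) by blast
 then have "hom_class n (path_vector n C0 0) \<in> D" unfolding torus_identification_class[OF \<iota> C0] .
 from component_permuted[OF D(1) sigma path_vector_hom[OF C0] this]
 have "hom_class n (permuted_vector sigma (path_vector n C0 0)) \<in> D" .
 moreover have "permuted_vector sigma (path_vector n C0 0) = path_vector n (node_chain j) 0"
 proof (rule path_vector_permuted[OF sigma])
  fix l assume l: "l < n"
  show "component (node_chain j) l = component C0 (sigma l)"
   using l by (simp add: node_chain_def C0_def sigma_def cyclic_block_def)
  show "pos (node_chain j) l = pos C0 (sigma l)"
   by (simp add: C0_def inv_into_f_f[OF permutes_inj[OF sigma] UNIV_I])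
 qed
 ultimately show ?thesis unfolding node_class[OF j] by simp
qed

text \<open>Some level works for the irreducible component; since \<open>D\<close> contains the node
  of the curve at 0, which has rank one on no other level, that level is
  \<open>n - i\<close>.\<close>

lemma component_subset_rank_one:
 assumes \<iota>: "torus_identification n \<iota>"
  and D: "boundary_component n D" "\<iota> ` delta n {..<i} \<subseteq> D"
 shows "D \<subseteq> rank_one_locus n (n - i)"
proof -
 have n: "n \<ge> 2" "0 < n" using i by auto
 obtain k where k: "k \<in> {1..<n}" "D \<subseteq> rank_one_locus n k"
  using boundary_component_rank_one[OF n(1) D(1)] by blast
 have "hom_class n (curve_vector n i (of_nat 0)) \<in> rank_one_locus n k"
  using node_in_component[OF \<iota> D n(2)] k(2) by blast
 then have "k = n - i" using curve_not_rank_one[OF k(1)] by blast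
 then show ?thesis using k(2) by simp
qed

end

section \<open>Weights and degrees\<close>

lemma sum_simple_root:
 assumes j: "j \<in> {1..<n}"
 shows "(\<Sum>k<n. v k * simple_root j k) = v (j - 1) - v j"
proof -
 have "(\<Sum>k<n. v k * simple_root j k) = (\<Sum>k<n. (if k = j - 1 then v k else 0) - (if k = j then v k else 0))"
  using j by (intro sum.cong refl) (auto simp: simple_root_def)
 also have "\<dots> = v (j - 1) - v j"
 proof -
  have "j - 1 < n" "j < n" using j by auto
  then show ?thesis by (simp add: sum_subtractf)
 qed
 finally show ?thesis .
qed

lemma coroot_pairing_simple:
 assumes j: "j \<in> {1..<n}"
 shows "coroot_pairing n v (simple_root j) = v (j - 1) - v j"
proof -
 have "simple_root j (j - 1) - simple_root j j = 2" using j by (auto simp: simple_root_def)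
 then show ?thesis unfolding coroot_pairing_def sum_simple_root[OF j] by simp
qed

lemma weight_lattice_iff:
 "v \<in> carrier (weight_lattice n) \<longleftrightarrow> v \<in> root_space n \<and> (\<forall>j\<in>{1..<n}. v (j - 1) - v j \<in> \<int>)"
 using coroot_pairing_simple[of _ n v] by (auto simp: weight_lattice_def)

lemma weight_add:
 assumes "v \<in> carrier (weight_lattice n)" "w \<in> carrier (weight_lattice n)"
 shows "(\<lambda>k. v k + w k) \<in> carrier (weight_lattice n)"
proof -
 have "(v (j - 1) - v j) + (w (j - 1) - w j) \<in> \<int>" if "j \<in> {1..<n}" for j
  using assms that unfolding weight_lattice_iff by (intro Ints_add) blast+
 then show ?thesis using assms unfolding weight_lattice_iff root_space_def
  by (simp add: sum.distrib algebra_simps)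
qed

lemma weight_uminus:
 assumes "v \<in> carrier (weight_lattice n)"
 shows "(\<lambda>k. - v k) \<in> carrier (weight_lattice n)"
proof -
 have "- (v (j - 1) - v j) \<in> \<int>" if "j \<in> {1..<n}" for j
  using assms that unfolding weight_lattice_iff by (intro Ints_minus) blast
 then show ?thesis using assms unfolding weight_lattice_iff root_space_def
  by (simp add: sum_negf)
qed

lemma simple_root_weight:
 assumes i: "i \<in> {1..<n}"
 shows "simple_root i \<in> carrier (weight_lattice n)"
proof -
 have "(\<Sum>k<n. simple_root i k) = 0" using sum_simple_root[OF i, of "\<lambda>_. 1"] by simp
 moreover have "\<forall>k\<ge>n. simple_root i k = 0" using i by (auto simp: simple_root_def)
 moreover have "simple_root i k \<in> \<int>" for k by (simp add: simple_root_def)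
 ultimately show ?thesis unfolding weight_lattice_iff root_space_def by (auto intro: Ints_diff)
qed

lemma root_space_zero:
 assumes w: "w \<in> root_space n" and z: "\<And>j. j \<in> {1..<n} ==> w (j - 1) = w j"
 shows "w k = 0"
proof -
 have c: "w k = w 0" if "k < n" for k
  using that by (induction k) (use z[of "Suc _"] in \<open>auto dest: Suc_lessD\<close>)
 have "(\<Sum>k<n. w k) = (\<Sum>k<n. w 0)" by (rule sum.cong[OF refl], rule c, simp)
 then have "real n * w 0 = 0" using w by (simp add: root_space_def)
 then show ?thesis using w c[of k] by (cases "k < n"; cases "n = 0") (simp_all add: root_space_def)
qed

lemma fundamental_weight_eqI:
 assumes v: "v \<in> root_space n" and p: "\<And>j. j \<in> {1..<n} ==> v (j - 1) - v j = (if j = a then 1 else 0)"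
 shows "fundamental_weight n a = v"
 unfolding fundamental_weight_def
proof (rule the_equality)
 show "v \<in> root_space n \<and> (\<forall>j\<in>{1..<n}. coroot_pairing n v (simple_root j) = (if j = a then 1 else 0))"
  using v p by (simp add: coroot_pairing_simple)
 fix u assume u: "u \<in> root_space n \<and> (\<forall>j\<in>{1..<n}. coroot_pairing n u (simple_root j) = (if j = a then 1 else 0))"
 define w where "w = (\<lambda>k. u k - v k)"
 have "w \<in> root_space n" using u v by (auto simp: w_def root_space_def sum_subtractf)
 moreover have "w (j - 1) = w j" if "j \<in> {1..<n}" for j
  using u p[OF that] coroot_pairing_simple[OF that, of u] that by (auto simp: w_def)
 ultimately have "w k = 0" for k by (rule root_space_zero)
 then show "u = v" by (auto simp: w_def fun_eq_iff)
qed

text \<open>Summation by parts: the coefficient of a simple root is the partial sum of coordinates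
  up to it, and the boundary term at \<open>n\<close> vanishes because the coordinates sum to
  0.\<close>

lemma weight_simple_roots:
 assumes v: "v \<in> root_space n"
 shows "v k = (\<Sum>j\<in>{1..<n}. (\<Sum>l<j. v l) * simple_root j k)"
proof (cases "k < n")
 case True
 have "(\<Sum>j\<in>{1..<n}. (\<Sum>l<j. v l) * simple_root j k) =
   (\<Sum>j\<in>{1..<n}. (if j = Suc k then \<Sum>l<j. v l else 0) - (if j = k then \<Sum>l<j. v l else 0))"
  by (intro sum.cong refl) (auto simp: simple_root_def)
 also have "\<dots> = (if Suc k \<in> {1..<n} then \<Sum>l<Suc k. v l else 0) - (if k \<in> {1..<n} then \<Sum>l<k. v l else 0)"
  by (simp add: sum_subtractf)
 also have "\<dots> = (\<Sum>l<Suc k. v l) - (\<Sum>l<k. v l)"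
 proof -
  have "(if k \<in> {1..<n} then \<Sum>l<k. v l else 0) = (\<Sum>l<k. v l)"
   using True by (cases "k = 0") auto
  moreover have "(if Suc k \<in> {1..<n} then \<Sum>l<Suc k. v l else 0) = (\<Sum>l<Suc k. v l)"
  proof (cases "Suc k = n")
   case True
   then show ?thesis using v by (simp only: root_space_def mem_Collect_eq) simp
  next
   case False
   then show ?thesis using \<open>k < n\<close> by simp
  qed
  ultimately show ?thesis by simp
 qed
 also have "\<dots> = v k" by simp
 finally show ?thesis by simp
next
 case False
 then have "simple_root j k = 0" if "j \<in> {1..<n}" for j using that by (auto simp: simple_root_def)
 then show ?thesis using v False by (simp add: root_space_def)
qed

text \<open>As the coordinates sum to 0, \<open>n\<close> times one of them is the sum of its
  differences to all others, and these are integers.\<close>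

lemma weight_multiple_integer:
 assumes v: "v \<in> carrier (weight_lattice n)" and k: "k < n"
 shows "real n * v k \<in> \<int>"
proof -
 have d: "\<forall>j\<in>{1..<n}. v (j - 1) - v j \<in> \<int>" and r: "(\<Sum>l<n. v l) = 0"
  using v by (auto simp: weight_lattice_iff root_space_def)
 have z: "v 0 - v l \<in> \<int>" if "l < n" for l
  using that
 proof (induction l)
  case (Suc l)
  have "v l - v (Suc l) \<in> \<int>" using d[rule_format, of "Suc l"] Suc.prems by simp
  with Suc show ?case using Ints_add[of "v 0 - v l" "v l - v (Suc l)"] by simp
 qed simp
 have kl: "v k - v l \<in> \<int>" if "l < n" for l
  using Ints_diff[OF z[OF that] z[OF k]] by simp
 have "(\<Sum>l<n. v k - v l) \<in> \<int>" by (rule Ints_sum) (use kl in auto)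
 then show ?thesis using r by (simp add: sum_subtractf)
qed

lemma weight_zero: "(\<lambda>_. 0) \<in> carrier (weight_lattice n)"
 by (simp add: weight_lattice_iff root_space_def)

section \<open>Homomorphisms from the weight lattice and degrees of weights\<close>

lemma weight_hom_add:
 assumes "\<Phi> \<in> hom (weight_lattice n) G" "v \<in> carrier (weight_lattice n)" "w \<in> carrier (weight_lattice n)"
 shows "\<Phi> (\<lambda>k. v k + w k) = \<Phi> v \<otimes>\<^bsub>G\<^esub> \<Phi> w"
 using hom_mult[OF assms] by (simp add: weight_lattice_def)

lemma weight_hom_zero:
 assumes "group G" "\<Phi> \<in> hom (weight_lattice n) G"
 shows "\<Phi> (\<lambda>_. 0) = \<one>\<^bsub>G\<^esub>"
proof -
 interpret group G by fact
 have c: "\<Phi> (\<lambda>_. 0) \<in> carrier G" by (rule hom_in_carrier[OF assms(2) weight_zero])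
 have "\<Phi> (\<lambda>_. 0) \<otimes>\<^bsub>G\<^esub> \<Phi> (\<lambda>_. 0) = \<Phi> (\<lambda>_. 0)"
  using weight_hom_add[OF assms(2) weight_zero weight_zero] by simp
 then show ?thesis using c l_cancel_one by simp
qed

lemma weight_hom_uminus:
 assumes "group G" "\<Phi> \<in> hom (weight_lattice n) G" "v \<in> carrier (weight_lattice n)"
 shows "\<Phi> (\<lambda>k. - v k) = inv\<^bsub>G\<^esub> \<Phi> v"
proof -
 interpret group G by fact
 note u = weight_uminus[OF assms(3)]
 have "\<Phi> (\<lambda>k. - v k) \<otimes>\<^bsub>G\<^esub> \<Phi> v = \<one>\<^bsub>G\<^esub>"
  using weight_hom_add[OF assms(2) u assms(3)] weight_hom_zero[OF assms(1,2)] by simp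
 from inv_equality[OF this hom_in_carrier[OF assms(2,3)] hom_in_carrier[OF assms(2) u]]
 show ?thesis by (rule sym)
qed

context cyclic_curve
begin

definition weight_degree :: "((nat => real) => collineation set cocycle set) => (nat => real) => int => bool" where
 "weight_degree \<Phi> v d \<longleftrightarrow> v \<in> carrier (weight_lattice n) \<and> class_degree (\<Phi> v) d"

lemma weight_degree_add:
 assumes "\<Phi> \<in> hom (weight_lattice n) (Pic (wonderful n))" "weight_degree \<Phi> v d" "weight_degree \<Phi> w e"
 shows "weight_degree \<Phi> (\<lambda>k. v k + w k) (d + e)"
 using assms unfolding weight_degree_def
 by (simp add: weight_add weight_hom_add class_degree_mult)

lemma weight_degree_uminus:
 assumes "\<Phi> \<in> hom (weight_lattice n) (Pic (wonderful n))" "weight_degree \<Phi> v d"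
 shows "weight_degree \<Phi> (\<lambda>k. - v k) (- d)"
proof -
 interpret Pic: comm_group "Pic (wonderful n)" by (rule Pic_comm_group)
 show ?thesis using assms unfolding weight_degree_def
  by (simp add: weight_uminus weight_hom_uminus[OF Pic.is_group] class_degree_inv)
qed

lemma weight_degree_zero:
 assumes "\<Phi> \<in> hom (weight_lattice n) (Pic (wonderful n))" "weight_degree \<Phi> v d"
 shows "weight_degree \<Phi> (\<lambda>_. 0) 0"
 using weight_degree_add[OF assms weight_degree_uminus[OF assms]] by simp

lemma weight_degree_multiple:
 assumes "\<Phi> \<in> hom (weight_lattice n) (Pic (wonderful n))" "weight_degree \<Phi> v d"
 shows "weight_degree \<Phi> (\<lambda>k. of_int m * v k) (m * d)"
proof -
 have nat: "weight_degree \<Phi> (\<lambda>k. real m * v k) (int m * d)" for m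
 proof (induction m)
  case 0
  then show ?case using weight_degree_zero[OF assms] by simp
 next
  case (Suc m)
  from weight_degree_add[OF assms(1) Suc assms(2)] show ?case by (simp add: algebra_simps)
 qed
 show ?thesis
 proof (cases "m \<ge> 0")
  case True
  then show ?thesis using nat[of "nat m"] by simp
 next
  case False
  then show ?thesis using weight_degree_uminus[OF assms(1) nat[of "nat (- m)"]] by simp
 qed
qed

lemma weight_degree_sum:
 assumes hom: "\<Phi> \<in> hom (weight_lattice n) (Pic (wonderful n))"
  and "finite A" "A \<noteq> {}" "\<And>j. j \<in> A ==> weight_degree \<Phi> (v j) (d j)"
 shows "weight_degree \<Phi> (\<lambda>k. \<Sum>j\<in>A. v j k) (\<Sum>j\<in>A. d j)"
 using assms(2-4)
proof (induction A rule: finite_ne_induct)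
 case (insert a A)
 have "weight_degree \<Phi> (v a) (d a)" "weight_degree \<Phi> (\<lambda>k. \<Sum>j\<in>A. v j k) (\<Sum>j\<in>A. d j)"
  using insert.prems insert.IH by blast+
 from weight_degree_add[OF hom this] show ?case using insert.hyps by simp
qed simp

text \<open>The multiple by \<open>n\<close> of a weight lies in the root lattice.\<close>

lemma weight_degree_partial_sum:
 assumes hom: "\<Phi> \<in> hom (weight_lattice n) (Pic (wonderful n))"
  and roots: "\<And>j. j \<in> {1..<n} ==> weight_degree \<Phi> (simple_root j) (if j = i then int n else 0)"
  and v: "weight_degree \<Phi> v d"
 shows "of_int d = real n * (\<Sum>l<i. v l)"
proof -
 have vc: "v \<in> carrier (weight_lattice n)" using v by (simp add: weight_degree_def)
 have vr: "v \<in> root_space n" using vc by (simp add: weight_lattice_iff)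
 have "\<exists>c. real n * (\<Sum>l<j. v l) = of_int c" if "j \<in> {1..<n}" for j
 proof -
  have "real n * (\<Sum>l<j. v l) = (\<Sum>l<j. real n * v l)" by (rule sum_distrib_left)
  moreover have "(\<Sum>l<j. real n * v l) \<in> \<int>"
   by (rule Ints_sum, rule weight_multiple_integer[OF vc]) (use that in auto)
  ultimately show ?thesis by (auto elim: Ints_cases)
 qed
 then have "\<exists>c. \<forall>j\<in>{1..<n}. real n * (\<Sum>l<j. v l) = of_int (c j)" by (intro bchoice ballI)
 then obtain c where c: "\<forall>j\<in>{1..<n}. real n * (\<Sum>l<j. v l) = of_int (c j)" by (elim exE)
 have "weight_degree \<Phi> (\<lambda>k. \<Sum>j\<in>{1..<n}. of_int (c j) * simple_root j k)
   (\<Sum>j\<in>{1..<n}. c j * (if j = i then int n else 0))"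
  by (rule weight_degree_sum[OF hom], simp, use i in force, rule weight_degree_multiple[OF hom roots])
 moreover have "(\<lambda>k. \<Sum>j\<in>{1..<n}. of_int (c j) * simple_root j k) = (\<lambda>k. of_int (int n) * v k)"
 proof
  fix k
  have "of_int (int n) * v k = real n * (\<Sum>j\<in>{1..<n}. (\<Sum>l<j. v l) * simple_root j k)"
   using weight_simple_roots[OF vr, of k] by simp
  also have "\<dots> = (\<Sum>j\<in>{1..<n}. real n * (\<Sum>l<j. v l) * simple_root j k)"
   by (subst sum_distrib_left) (simp only: mult.assoc)
  also have "\<dots> = (\<Sum>j\<in>{1..<n}. of_int (c j) * simple_root j k)"
   by (rule sum.cong[OF refl]) (simp only: c[rule_format])
  finally show "(\<Sum>j\<in>{1..<n}. of_int (c j) * simple_root j k) = of_int (int n) * v k" by simp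
 qed
 moreover have "(\<Sum>j\<in>{1..<n}. c j * (if j = i then int n else 0)) = c i * int n"
 proof -
  have "(\<Sum>j\<in>{1..<n}. c j * (if j = i then int n else 0)) = (\<Sum>j\<in>{1..<n}. if j = i then c j * int n else 0)"
   by (intro sum.cong refl) simp
  also have "\<dots> = c i * int n" using i by (subst sum.delta) auto
  finally show ?thesis .
 qed
 ultimately have "weight_degree \<Phi> (\<lambda>k. of_int (int n) * v k) (c i * int n)" by simp
 \<comment> \<open>Two computations of the degree of \<open>n\<close> times \<open>v\<close>: only
   the simple root of index \<open>i\<close> contributes to the first, with degree \<open>n\<close>
   and coefficient \<open>c i\<close>.\<close>
 then have "c i * int n = int n * d"
  using weight_degree_multiple[OF hom v, of "int n"] class_degree_unique unfolding weight_degree_def by blast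
 then have "c i = d" using i by simp
 then show ?thesis using c i by simp
qed

end

text \<open>The subtraction in \<open>curve_degree\<close> does not truncate: with
  \<open>a = n - k\<close> and \<open>b = n - j\<close> the difference is the product
  \<open>a b\<close> when \<open>k + j\<close> exceeds \<open>n\<close>.\<close>

lemma curve_degree_real:
 assumes "j \<le> n" "k \<le> n"
 shows "real (curve_degree n j k) = real k * real j - real n * real (k + j - n)"
proof -
 have "n * (k + j - n) \<le> k * j"
 proof (cases "k + j \<le> n")
  case False
  define a b where "a = n - k" and "b = n - j"
  have n: "k = n - a" "j = n - b" "a \<le> n" "b \<le> n" "a + b \<le> n" using assms False by (auto simp: a_def b_def)
  have "int n * (int n - int a - int b) \<le> (int n - int a) * (int n - int b)"
   by (simp add: algebra_simps)
  moreover have "int k = int n - int a" "int j = int n - int b" "int (k + j - n) = int n - int a - int b"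
   using n by auto
  ultimately have "int (n * (k + j - n)) \<le> int (k * j)" by simp
  then show ?thesis by linarith
 qed simp
 then show ?thesis by (simp add: curve_degree_def of_nat_diff)
qed

text \<open>Pairing with a simple coroot is minus the second difference of the partial sums. The
  linear part of the degree drops out, and the truncated term has its kink exactly at
  \<open>j = a\<close>, where it contributes 1 after division by \<open>n\<close>.\<close>

lemma fundamental_weight_degrees:
 assumes v: "v \<in> root_space n" and a: "a \<in> {1..<n}"
  and S: "\<And>j. j \<in> {1..<n} ==> real (curve_degree n j (n - a)) = real n * (\<Sum>l<j. v l)"
 shows "fundamental_weight n a = v"
proof (rule fundamental_weight_eqI[OF v])
 have k: "n - a \<le> n" "n > 0" using a by auto
 \<comment> \<open>Extended to \<open>j = 0\<close> and \<open>j = n\<close>, where both sides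
   vanish, so that second differences can be formed at the first and last simple root.\<close>
 have D: "real (n - a) * real j - real n * real (n - a + j - n) = real n * (\<Sum>l<j. v l)" if "j \<le> n" for j
 proof -
  consider "j = 0" | "j = n" | "j \<in> {1..<n}" using \<open>j \<le> n\<close> by fastforce
  then show ?thesis
  proof cases
   case 2
   then show ?thesis using v by (simp add: root_space_def)
  next
   case 3
   then show ?thesis using S[OF 3] curve_degree_real[OF that k(1)] by simp
  qed simp
 qed
 fix j assume j: "j \<in> {1..<n}"
 then obtain m where m: "j = Suc m" by (cases j) auto
 have "real n * (v m - v (Suc m)) = real n * (if j = a then 1 else 0)"
 proof -
  have "real n * (v m - v (Suc m)) = 2 * (real n * (\<Sum>l<Suc m. v l)) - real n * (\<Sum>l<m. v l) - real n * (\<Sum>l<Suc (Suc m). v l)"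
   by (simp add: algebra_simps)
  also have "\<dots> = real n * (real (n - a + m - n) + real (n - a + Suc (Suc m) - n) - 2 * real (n - a + Suc m - n))"
   using D[of m] D[of "Suc m"] D[of "Suc (Suc m)"] j m by (simp add: algebra_simps)
  also have "\<dots> = real n * (if j = a then 1 else 0)"
   using a m by (auto simp: of_nat_diff)
  finally show ?thesis .
 qed
 then show "v (j - 1) - v j = (if j = a then 1 else 0)" using k(2) m by simp
qed

theorem proposition4p14:
  fixes n :: nat
    and \<iota> :: "marked_chain set \<Rightarrow> collineation set"
    and D :: "nat \<Rightarrow> collineation set set"
    and \<Phi> :: "(nat \<Rightarrow> real) \<Rightarrow> collineation set cocycle set"
  assumes "n \<ge> 2"
    and "torus_identification n \<iota>"
    and "\<And>i. i \<in> {1..<n} \<Longrightarrow>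
      D i \<in> irreducible_components (vtop (wonderful n)) (wonderful_boundary n) \<and>
      \<iota> ` delta n {..<i} \<subseteq> D i"
    and "\<Phi> \<in> iso (weight_lattice n) (Pic (wonderful n))"
    and "\<And>i. i \<in> {1..<n} \<Longrightarrow> \<Phi> (simple_root i) = divisor_class (wonderful n) (D i)"
  shows "\<forall>a\<in>{1..<n}. pullback_class (LM n) \<iota> (\<Phi> (fundamental_weight n a)) = G_class n a"
proof
 interpret function_variety "wonderful n" by (rule function_variety_wonderful)
 fix a assume a: "a \<in> {1..<n}"
 define k where "k = n - a"
 have k: "k \<in> {1..<n}" using a by (auto simp: k_def)
 define c where "c = bundle_class (wonderful n) (level_bundle n k)"
 have hom: "\<Phi> \<in> hom (weight_lattice n) (Pic (wonderful n))"
  and bij: "bij_betw \<Phi> (carrier (weight_lattice n)) (carrier (Pic (wonderful n)))"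
  using assms(4) by (auto simp: iso_def)
 have "c \<in> carrier (Pic (wonderful n))" unfolding c_def by (rule Pic_carrierI[OF level_line_bundle[OF k]])
 \<comment> \<open>Surjectivity of \<Phi> names an unknown weight for the level bundle; the degrees
   along all the curves then force it to be the fundamental weight.\<close>
 then obtain v where v: "v \<in> carrier (weight_lattice n)" "c = \<Phi> v"
  using bij unfolding bij_betw_def by blast
 have "fundamental_weight n a = v"
 proof (rule fundamental_weight_degrees[OF _ a])
  show "v \<in> root_space n" using v(1) by (simp add: weight_lattice_iff)
  fix i assume i: "i \<in> {1..<n}"
  interpret curve: cyclic_curve n i by unfold_locales (rule i)
  have sub: "D j \<subseteq> rank_one_locus n (n - j)" if j: "j \<in> {1..<n}" for j
  proof -
   interpret C: cyclic_curve n j by unfold_locales (rule j)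
   show ?thesis using assms(3)[OF j] by (intro C.component_subset_rank_one[OF assms(2)]) blast+
  qed
  have roots: "curve.weight_degree \<Phi> (simple_root j) (if j = i then int n else 0)" if j: "j \<in> {1..<n}" for j
   unfolding curve.weight_degree_def
  proof (intro conjI simple_root_weight[OF j] curve.class_degreeI)
   show "\<Phi> (simple_root j) \<in> carrier (Pic (wonderful n))"
    by (rule hom_in_carrier[OF hom simple_root_weight[OF j]])
   fix L assume "L \<in> \<Phi> (simple_root j)"
   then have L: "L \<in> divisor_class (wonderful n) (D j)" using assms(5)[OF j] by simp
   show "curve.has_degree L (if j = i then int n else 0)"
   proof (cases "j = i")
    case True
    have "curve.has_degree L (int n)"
     using L sub[OF i] unfolding True
    proof (rule curve.degree_own_divisor)
     fix m assume "m < n"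
     then show "hom_class n (curve_vector n i (of_nat m)) \<in> D i"
      using assms(3)[OF i] by (intro curve.node_in_component[OF assms(2)]) blast+
    qed
    then show ?thesis using True by simp
   next
    case False
    have "n - j \<in> {1..<n}" "n - j \<noteq> n - i" using j i False by auto
    from curve.degree_other_divisor[OF L sub[OF j] this] show ?thesis using False by simp
   qed
  qed
  have "curve.weight_degree \<Phi> v (int (curve_degree n i k))"
   unfolding curve.weight_degree_def v(2)[symmetric] c_def
   using v(1) curve.class_degree_level_bundle[OF k] by blast
  from curve.weight_degree_partial_sum[OF hom roots this]
  show "real (curve_degree n i (n - a)) = real n * (\<Sum>l<i. v l)" by (simp add: k_def)
 qed
 then show "pullback_class (LM n) \<iota> (\<Phi> (fundamental_weight n a)) = G_class n a"
  using pullback_level_bundle[OF assms(2), of a] a v(2) by (simp add: c_def k_def)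
qed

end
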